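(* Let $k\ge1$, $\mathbf n=(n_1,\dots,n_k)$, $n=n_1+\dots+n_k\ge1$ and let $\delta=(\delta_{ij})$ be an $n\times k$ matrix of nonnegative integers. For all $i=1,\dots,n$, $$\sum_{j:n_j>0}\sqrt{\delta_{ij}}\cdot E(\mathbf n-\mathbf e_j,\delta^{-i})\;\ge\;E(\mathbf n,\delta)\;\ge\;\sqrt{\sum_{j:n_j>0}\delta_{ij}\cdot E(\mathbf n-\mathbf e_j,\delta^{-i})^2}.$$ Each of these inequalities holds with equality if and only if there is at most one $j$ with $n_j>0$, $\delta_{ij}>0$ and $E(\mathbf n-\mathbf e_j,\delta^{-i})>0$.
   Context: Setting. $k\ge1$ is an integer, $\mathbf n=(n_1,\dots,n_k)$ are nonnegative integers, $n=n_1+\dots+n_k$, and $\delta=(\delta_{ij})_{1\le i\le n,\,1\le j\le k}$ is a matrix of nonnegative integers. Variables are $\mathbf x=(\mathbf y_1,\dots,\mathbf y_k)$ with $\mathbf y_j=(y_{j0},y_{j1},\dots,y_{jn_j})$. For each $i$ let $\mathcal A_i=\mathcal A_{i1}\times\dots\times\mathcal A_{ik}$ where $\mathcal A_{ij}=\{\alpha\in\mathbb N^{n_j+1}:\alpha_0+\dots+\alpha_{n_j}=\delta_{ij}\}$ ($0\in\mathbb N$). A coefficient vector $f_i=(f_{ia})_{a\in\mathcal A_i}\in\mathbb R^{\mathcal A_i}$ is identified with the polynomial $f_i(\mathbf x)=\sum_{a\in\mathcal A_i}f_{ia}\mathbf x^a$, which is homogeneous of degree $\delta_{ij}$ in $\mathbf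 y_j$ for each $j$. For $a\in\mathcal A_i$, with components $a_{jh}$ ($1\le j\le k$, $0\le h\le n_j$), let $\eta(a)=\prod_{j=1}^k\frac{a_{j0}!\cdots a_{jn_j}!}{(a_{j0}+\dots+a_{jn_j})!}$. Random system: $\tilde f=(\tilde f_1,\dots,\tilde f_n)$, where all coefficients $\tilde f_{ia}$ are independent normal random variables with mean $0$ and variance $\eta(a)^{-1}$. Root space: $P=\mathbf P^{n_1}(\mathbb R)\times\dots\times\mathbf P^{n_k}(\mathbb R)$; the condition $f_i(\zeta)=0$ is well defined for $\zeta\in P$ by multihomogeneity. $E(\mathbf n,\delta)=\mathbb E\bigl(\#\{\zeta\in P:\tilde f(\zeta)=0\}\bigr)$. By convention $E((0,\dots,0),\delta_0)=1$, where $\delta_0$ is the $0\times k$ matrix. $\delta^{-i}$ is the $(n-1)\times k$ matrix obtained by removing row $i$ of $\delta$; $\mathbf e_j$ is the $j$-th standard unit basis vector of $\mathbb R^k$. *)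

theory Defs
  imports "HOL-Probability.Probability"
begin

text \<open>
  All families are indexed from 0: blocks of variables by \<open>j < k\<close>, equations by
  \<open>i < \<Sum>j<k. n j\<close>, and the variables in block \<open>j\<close> by \<open>h \<le> n j\<close>.
  Families are functions on \<^typ>\<open>nat\<close> whose values outside these ranges are irrelevant.
\<close>

text \<open>The exponents of multidegree \<open>d\<close>, where \<open>d j\<close> is the degree in block \<open>j\<close>.\<close>

definition exponents :: "nat \<Rightarrow> (nat \<Rightarrow> nat) \<Rightarrow> (nat \<Rightarrow> nat) \<Rightarrow> (nat \<Rightarrow> nat \<Rightarrow> nat) set" where
  "exponents k n d =
     (\<Pi>\<^sub>E j\<in>{..<k}. {\<alpha> \<in> {..n j} \<rightarrow>\<^sub>E (UNIV :: nat set). (\<Sum>h\<le>n j. \<alpha> h) = d j})"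

definition eta :: "nat \<Rightarrow> (nat \<Rightarrow> nat) \<Rightarrow> (nat \<Rightarrow> nat \<Rightarrow> nat) \<Rightarrow> real" where
  "eta k n a = (\<Prod>j<k. (\<Prod>h\<le>n j. fact (a j h)) / fact (\<Sum>h\<le>n j. a j h))"

text \<open>The multihomogeneous polynomial with coefficient vector \<open>c\<close>, as a function.\<close>

definition mh_eval ::
    "nat \<Rightarrow> (nat \<Rightarrow> nat) \<Rightarrow> (nat \<Rightarrow> nat) \<Rightarrow> ((nat \<Rightarrow> nat \<Rightarrow> nat) \<Rightarrow> real) \<Rightarrow> (nat \<Rightarrow> nat \<Rightarrow> real) \<Rightarrow> real" where
  "mh_eval k n d c x = (\<Sum>a\<in>exponents k n d. c a * (\<Prod>j<k. \<Prod>h\<le>n j. x j h ^ a j h))"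

text \<open>Real projective \<open>m\<close>-space: nonzero vectors in $R^{m+1}$ modulo nonzero scaling.\<close>

definition nonzero_vecs :: "nat \<Rightarrow> (nat \<Rightarrow> real) set" where
  "nonzero_vecs m = {v \<in> {..m} \<rightarrow>\<^sub>E UNIV. \<exists>h\<le>m. v h \<noteq> 0}"

definition proportional :: "nat \<Rightarrow> ((nat \<Rightarrow> real) \<times> (nat \<Rightarrow> real)) set" where
  "proportional m = {(v, w). v \<in> nonzero_vecs m \<and> w \<in> nonzero_vecs m \<and>
                      (\<exists>c. c \<noteq> 0 \<and> (\<forall>h\<le>m. w h = c * v h))}"

definition real_proj_space :: "nat \<Rightarrow> (nat \<Rightarrow> real) set set" where
  "real_proj_space m = nonzero_vecs m // proportional m"

definition root_space :: "nat \<Rightarrow> (nat \<Rightarrow> nat) \<Rightarrow> (nat \<Rightarrow> (nat \<Rightarrow> real) set) set" where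
  "root_space k n = (\<Pi>\<^sub>E j\<in>{..<k}. real_proj_space (n j))"

text \<open>
  A system is given by all its coefficients, indexed by pairs of an equation and an exponent.
  By multihomogeneity (see \<open>mh_eval_eq_0_representative\<close> below) the choice of the
  representative \<open>x\<close> of \<open>\<zeta>\<close> is immaterial.
\<close>

definition system_roots ::
    "nat \<Rightarrow> (nat \<Rightarrow> nat) \<Rightarrow> (nat \<Rightarrow> nat \<Rightarrow> nat) \<Rightarrow> (nat \<times> (nat \<Rightarrow> nat \<Rightarrow> nat) \<Rightarrow> real)
      \<Rightarrow> (nat \<Rightarrow> (nat \<Rightarrow> real) set) set" where
  "system_roots k n \<delta> f = {\<zeta> \<in> root_space k n.
     \<forall>i < (\<Sum>j<k. n j). \<forall>x \<in> (\<Pi>\<^sub>E j\<in>{..<k}. \<zeta> j). mh_eval k n (\<delta> i) (\<lambda>a. f (i, a)) x = 0}"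

text \<open>
  The law of the random system. Note that \<^const>\<open>normal_density\<close> takes the standard
  deviation, not the variance, as its second argument.
\<close>

definition random_system ::
    "nat \<Rightarrow> (nat \<Rightarrow> nat) \<Rightarrow> (nat \<Rightarrow> nat \<Rightarrow> nat) \<Rightarrow> (nat \<times> (nat \<Rightarrow> nat \<Rightarrow> nat) \<Rightarrow> real) measure" where
  "random_system k n \<delta> =
     (\<Pi>\<^sub>M (i, a) \<in> (SIGMA i:{..<(\<Sum>j<k. n j)}. exponents k n (\<delta> i)).
        density lborel (\<lambda>t. ennreal (normal_density 0 (sqrt (inverse (eta k n a))) t)))"

text \<open>
  The expected number of roots, as an extended nonnegative real; the counting measure gives
  infinite root sets the value \<open>\<infinity>\<close>.
\<close>

definition expected_roots :: "nat \<Rightarrow> (nat \<Rightarrow> nat) \<Rightarrow> (nat \<Rightarrow> nat \<Rightarrow> nat) \<Rightarrow> ennreal" where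
  "expected_roots k n \<delta> =
     (\<integral>\<^sup>+ f. emeasure (count_space UNIV) (system_roots k n \<delta> f) \<partial>random_system k n \<delta>)"

definition remove_row :: "nat \<Rightarrow> (nat \<Rightarrow> nat \<Rightarrow> nat) \<Rightarrow> (nat \<Rightarrow> nat \<Rightarrow> nat)" where
  "remove_row i \<delta> = (\<lambda>r. if r < i then \<delta> r else \<delta> (Suc r))"

definition ennsqrt :: "ennreal \<Rightarrow> ennreal" where
  "ennsqrt x = (if x = \<top> then \<top> else ennreal (sqrt (enn2real x)))"

lemma finite_exponents: "finite (exponents k n d)"
proof -
  have "finite {\<alpha> \<in> {..m} \<rightarrow>\<^sub>E (UNIV :: nat set). (\<Sum>h\<le>m. \<alpha> h) = e}" for m e :: nat
  proof (rule finite_subset)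
    show "{\<alpha> \<in> {..m} \<rightarrow>\<^sub>E (UNIV :: nat set). (\<Sum>h\<le>m. \<alpha> h) = e} \<subseteq> {..m} \<rightarrow>\<^sub>E {..e}"
    proof
      fix \<alpha> assume "\<alpha> \<in> {\<alpha> \<in> {..m} \<rightarrow>\<^sub>E (UNIV :: nat set). (\<Sum>h\<le>m. \<alpha> h) = e}"
      then have ext: "\<alpha> \<in> extensional {..m}" and sum: "(\<Sum>h\<le>m. \<alpha> h) = e"
        by (auto simp: PiE_iff)
      have "\<alpha> h \<le> e" if "h \<le> m" for h
        unfolding sum[symmetric] by (rule member_le_sum) (use that in auto)
      with ext show "\<alpha> \<in> {..m} \<rightarrow>\<^sub>E {..e}"
        by (simp add: PiE_iff)
    qed
    show "finite ({..m} \<rightarrow>\<^sub>E {..e})"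
      by (intro finite_PiE) auto
  qed
  then show ?thesis
    unfolding exponents_def by (intro finite_PiE) auto
qed

lemma eta_pos: "eta k n a > 0"
  unfolding eta_def by (intro prod_pos ballI divide_pos_pos) auto

lemma prob_space_random_system: "prob_space (random_system k n \<delta>)"
  unfolding random_system_def
  by (intro prob_space_PiM) (auto intro!: prob_space_normal_density simp: eta_pos)

lemma mh_eval_scale:
  assumes "\<And>j h. j < k \<Longrightarrow> h \<le> n j \<Longrightarrow> y j h = s j * x j h"
  shows "mh_eval k n d c y = (\<Prod>j<k. s j ^ d j) * mh_eval k n d c x"
proof -
  have "(\<Prod>j<k. \<Prod>h\<le>n j. y j h ^ a j h)
      = (\<Prod>j<k. s j ^ d j) * (\<Prod>j<k. \<Prod>h\<le>n j. x j h ^ a j h)"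
    if a: "a \<in> exponents k n d" for a
  proof -
    have "(\<Prod>h\<le>n j. y j h ^ a j h) = s j ^ d j * (\<Prod>h\<le>n j. x j h ^ a j h)" if j: "j < k" for j
    proof -
      have "(\<Sum>h\<le>n j. a j h) = d j"
        using a j by (auto simp: exponents_def PiE_iff)
      then show ?thesis
        using assms j by (simp add: power_mult_distrib prod.distrib power_sum[symmetric])
    qed
    then show ?thesis by (simp add: prod.distrib)
  qed
  then show ?thesis
    unfolding mh_eval_def by (simp add: sum_distrib_left mult_ac)
qed

lemma equiv_proportional: "equiv (nonzero_vecs m) (proportional m)"
proof (rule equivI)
  show "proportional m \<subseteq> nonzero_vecs m \<times> nonzero_vecs m"
    by (auto simp: proportional_def)
  show "refl_on (nonzero_vecs m) (proportional m)"
    by (auto simp: refl_on_def proportional_def intro!: exI[of _ 1])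
  show "sym (proportional m)"
  proof (rule symI)
    fix v w assume "(v, w) \<in> proportional m"
    then obtain c where "v \<in> nonzero_vecs m" "w \<in> nonzero_vecs m" "c \<noteq> 0" "\<forall>h\<le>m. w h = c * v h"
      by (auto simp: proportional_def)
    then show "(w, v) \<in> proportional m"
      by (auto simp: proportional_def intro!: exI[of _ "inverse c"])
  qed
  show "trans (proportional m)"
  proof (rule transI)
    fix u v w assume "(u, v) \<in> proportional m" "(v, w) \<in> proportional m"
    then obtain b c where "u \<in> nonzero_vecs m" "w \<in> nonzero_vecs m" "b \<noteq> 0" "c \<noteq> 0"
        "\<forall>h\<le>m. v h = b * u h" "\<forall>h\<le>m. w h = c * v h"
      by (auto simp: proportional_def)
    then show "(u, w) \<in> proportional m"
      by (auto simp: proportional_def intro!: exI[of _ "c * b"])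
  qed
qed

lemma mh_eval_eq_0_representative:
  assumes "\<zeta> \<in> root_space k n"
    and x: "x \<in> (\<Pi>\<^sub>E j\<in>{..<k}. \<zeta> j)" and y: "y \<in> (\<Pi>\<^sub>E j\<in>{..<k}. \<zeta> j)"
  shows "mh_eval k n d c x = 0 \<longleftrightarrow> mh_eval k n d c y = 0"
proof -
  have "\<exists>s. s \<noteq> 0 \<and> (\<forall>h\<le>n j. y j h = s * x j h)" if j: "j < k" for j
  proof -
    have "\<zeta> j \<in> nonzero_vecs (n j) // proportional (n j)"
      using assms(1) j by (auto simp: root_space_def real_proj_space_def PiE_iff)
    moreover have "x j \<in> \<zeta> j" "y j \<in> \<zeta> j"
      using x y j by (auto simp: PiE_iff)
    ultimately have "(x j, y j) \<in> proportional (n j)"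
      using quotient_eq_iff[OF equiv_proportional] by blast
    then show ?thesis by (auto simp: proportional_def)
  qed
  then obtain s where s: "\<And>j. j < k \<Longrightarrow> s j \<noteq> 0 \<and> (\<forall>h\<le>n j. y j h = s j * x j h)"
    by metis
  have "mh_eval k n d c y = (\<Prod>j<k. s j ^ d j) * mh_eval k n d c x"
    by (rule mh_eval_scale) (use s in auto)
  moreover have "(\<Prod>j<k. s j ^ d j) \<noteq> 0"
    using s by (simp add: prod_zero_iff)
  ultimately show ?thesis by (metis mult_eq_0_iff)
qed

lemma root_space_representative:
  assumes "\<zeta> \<in> root_space k n"
  shows "(\<Pi>\<^sub>E j\<in>{..<k}. \<zeta> j) \<noteq> {}"
  using assms in_quotient_imp_non_empty[OF equiv_proportional]
  by (auto simp: root_space_def real_proj_space_def PiE_eq_empty_iff PiE_iff)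

lemma real_proj_space_0: "\<exists>p. real_proj_space 0 = {p}"
proof -
  let ?v = "(\<lambda>h\<in>{..0}. 1) :: nat \<Rightarrow> real"
  have v: "?v \<in> nonzero_vecs 0"
    by (auto simp: nonzero_vecs_def)
  have "(?v, w) \<in> proportional 0" if "w \<in> nonzero_vecs 0" for w
    using that v by (auto simp: proportional_def nonzero_vecs_def intro!: exI[of _ "w 0"])
  then have "real_proj_space 0 = {proportional 0 `` {?v}}"
    using v equiv_class_eq[OF equiv_proportional]
    unfolding real_proj_space_def quotient_def by blast
  then show ?thesis by blast
qed

text \<open>The convention for the empty system is a consequence of the definitions.\<close>

lemma expected_roots_empty: "expected_roots k (\<lambda>_. 0) \<delta> = 1"
proof -
  obtain p where p: "real_proj_space 0 = {p}"
    using real_proj_space_0 by blast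
  have "system_roots k (\<lambda>_. 0) \<delta> f = {\<lambda>j\<in>{..<k}. p}" for f
    by (auto simp: system_roots_def root_space_def p PiE_singleton PiE_iff fun_eq_iff extensional_def)
  then show ?thesis
    using prob_space.emeasure_space_1[OF prob_space_random_system]
    by (simp add: expected_roots_def)
qed

end

theory Submission
  imports Defs "Jordan_Normal_Form.Determinant"
begin

text \<open>
  In the affine chart of the root space in which one coordinate of each block equals 1, the system
  reads \<open>c\<^sub>i + G\<^sub>i(t) = 0\<close>, where the coefficient \<open>c\<^sub>i\<close> is a standard normal variable independent of \<open>G\<^sub>i\<close>.
  For fixed \<open>G\<close> the area formula expresses the mean number of roots as the integral over \<open>t\<close> of
  \<open>\<Prod>\<^sub>i \<phi>(G\<^sub>i(t)) \<bar>det DG(t)\<bar>\<close>, \<open>\<phi>\<close> the normal density, and the roots at infinity are negligible by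
  Sard's theorem. The weights \<open>eta\<close> make the covariance kernel of equation \<open>i\<close> equal to
  \<open>\<Prod>\<^sub>j (1 + t\<^sub>j \<cdot> u\<^sub>j)\<close> with exponents \<open>\<delta>\<^sub>i\<^sub>j\<close>. Its 2-jet on the diagonal shows that, at each \<open>t\<close>, row \<open>i\<close> of
  \<open>DG(t)\<close> weighted by \<open>\<phi>(G\<^sub>i(t))\<close> may be replaced by a Gaussian row with independent entries of
  standard deviation \<open>sqrt \<delta>\<^sub>i\<^sub>j\<close> in block \<open>j\<close>, times a matrix depending on \<open>t\<close> only. Hence \<open>E(n,\<delta>)\<close> is a
  constant depending on \<open>n\<close> times the mean absolute value of the determinant of a matrix with
  independent Gaussian rows.

  Expanding that determinant along row \<open>i\<close> gives \<open>E(n,\<delta>) = K \<cdot> E sqrt(\<Sum>\<^sub>j \<delta>\<^sub>i\<^sub>j Y\<^sub>j\<^sup>2)\<close>, where \<open>Y\<^sub>j\<close> is the norm of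
  the vector of cofactors in block \<open>j\<close>; rotation invariance within the block gives
  \<open>E(n - e\<^sub>j, \<delta>\<^sup>-\<^sup>i) = K \<cdot> E Y\<^sub>j\<close>. The bounds are then the triangle inequality and the Cauchy-Schwarz
  inequality. If two blocks are active, equality in either would force \<open>Y\<^sub>j Y\<^sub>j\<^sub>' = 0\<close> or \<open>Y\<^sub>j\<close> proportional to \<open>Y\<^sub>j\<^sub>'\<close>
  identically, which setting a column to zero and the integrality of the polynomial ring exclude.
\<close>

text \<open>The number of variables is a value determined by \<open>n\<close>, not a type. Vectors
  are therefore extensional functions, and Sard's theorem and the change of variables are proved by
  induction on the dimension: one equation is solved for one variable, which replaces the Jacobian
  by the Schur complement of one entry. One constant K serves E(n, \<delta>) and all E(n - e_j, ...)
  because two dimension-dependent quantities cancel. Each expectation carries the factors vol(P^m) /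
  (2 pi)^(m/2), which are the numbers \<open>cc m\<close>; passing from one cofactor to the norm of
  a block of m + 1 cofactors costs the mean length of a standard Gaussian vector in m + 1
  dimensions, which is \<open>eL\<close>. The latter is exactly \<open>cc m / cc (m + 1)\<close>,
  and both are ratios of the Gamma values \<open>Mr\<close>. Expectations are extended nonnegative
  reals, so the discussion of equality also needs them to be finite; this comes from the Leibniz
  formula in \<open>Jd_finite\<close>.\<close>

section \<open>Determinants of matrices given as functions of two indices\<close>

definition dt :: "nat \<Rightarrow> (nat \<Rightarrow> nat \<Rightarrow> real) \<Rightarrow> real" where
  "dt m A = Determinant.det (Matrix.mat m m (\<lambda>(i, l). A i l))"

text \<open>The increasing enumeration of the indices other than \<open>i\<close>. It is the shift
  used in \<open>remove_row\<close>, so deleting row \<open>i\<close> here matches deleting equation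
  \<open>i\<close> there.\<close>

definition skip :: "nat \<Rightarrow> nat \<Rightarrow> nat" where
  "skip i r = (if r < i then r else Suc r)"

definition cof :: "nat \<Rightarrow> (nat \<Rightarrow> nat \<Rightarrow> real) \<Rightarrow> nat \<Rightarrow> nat \<Rightarrow> real" where
  "cof m A i l = (-1) ^ (i + l) * dt (m - 1) (\<lambda>r c. A (skip i r) (skip l c))"

lemma dt_leibniz:
  "dt m A = (\<Sum>p | p permutes {..<m}. of_int (sign p) * (\<Prod>i<m. A i (p i)))"
proof -
  have "dt m A = (\<Sum>p | p permutes {0..<m}. of_int (sign p) * (\<Prod>i=0..<m. Matrix.mat m m (\<lambda>(i, l). A i l) $$ (i, p i)))"
    unfolding dt_def by (subst det_def'[of _ m]) (auto simp: sign_def)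
  also have "\<dots> = (\<Sum>p | p permutes {0..<m}. of_int (sign p) * (\<Prod>i=0..<m. A i (p i)))"
    by (intro sum.cong refl arg_cong2[where f="(*)"] prod.cong)
       (auto dest: permutes_in_image)
  finally show ?thesis by (simp add: atLeast0LessThan)
qed

lemma dt_cong:
  assumes "\<And>i l. i < m \<Longrightarrow> l < m \<Longrightarrow> A i l = B i l"
  shows "dt m A = dt m B"
  unfolding dt_def using assms by (intro arg_cong[where f=Determinant.det] eq_matI) auto

lemma dt_0 [simp]: "dt 0 A = 1"
  by (simp add: dt_leibniz)

lemma dt_mult: "dt m (\<lambda>i l. \<Sum>r<m. A i r * B r l) = dt m A * dt m B"
proof -
  have "dt m (\<lambda>i l. \<Sum>r<m. A i r * B r l)
      = Determinant.det (Matrix.mat m m (\<lambda>(i, l). A i l) * Matrix.mat m m (\<lambda>(i, l). B i l))"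
    unfolding dt_def
    by (intro arg_cong[where f=Determinant.det] eq_matI)
       (auto simp: scalar_prod_def atLeast0LessThan)
  then show ?thesis
    unfolding dt_def by (subst (asm) det_mult[of _ m]) auto
qed

lemma dt_laplace_row:
  assumes "i < m"
  shows "dt m A = (\<Sum>l<m. A i l * cof m A i l)"
proof -
  have c: "Determinant.cofactor (Matrix.mat m m (\<lambda>(i, l). A i l)) i l = cof m A i l" if "l < m" for l
    unfolding Determinant.cofactor_def cof_def dt_def mat_delete_def skip_def
    using that assms by (intro arg_cong2[where f="(*)"] arg_cong[where f=Determinant.det] refl eq_matI) auto
  show ?thesis
    unfolding dt_def by (subst laplace_expansion_row[of _ m i]) (use assms c in auto)
qed

lemma dt_lower_triangular:
  assumes "\<And>i l. i < l \<Longrightarrow> l < m \<Longrightarrow> A i l = 0"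
  shows "dt m A = (\<Prod>i<m. A i i)"
proof -
  have "dt m A = prod_list (diag_mat (Matrix.mat m m (\<lambda>(i, l). A i l)))"
    unfolding dt_def by (rule det_lower_triangular[where n=m]) (use assms in auto)
  also have "diag_mat (Matrix.mat m m (\<lambda>(i, l). A i l)) = map (\<lambda>i. A i i) [0..<m]"
    unfolding diag_mat_def by auto
  also have "prod_list \<dots> = (\<Prod>i<m. A i i)"
    by (simp add: prod.distinct_set_conv_list[symmetric] atLeast0LessThan)
  finally show ?thesis .
qed

lemma dt_transpose: "dt m (\<lambda>i l. A l i) = dt m A"
proof -
  have "Matrix.mat m m (\<lambda>(i, l). A l i) = transpose_mat (Matrix.mat m m (\<lambda>(i, l). A i l))"
    by (intro eq_matI) auto
  then show ?thesis
    unfolding dt_def using det_transpose[of "Matrix.mat m m (\<lambda>(i, l). A i l)" m] by simp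
qed

lemma dt_upper_triangular:
  assumes "\<And>i l. l < i \<Longrightarrow> i < m \<Longrightarrow> A i l = 0"
  shows "dt m A = (\<Prod>i<m. A i i)"
  using dt_lower_triangular[of m "\<lambda>i l. A l i"] assms dt_transpose[of m A] by simp

lemma abs_dt_permute_cols:
  assumes "p permutes {..<m}"
  shows "\<bar>dt m (\<lambda>i l. A i (p l))\<bar> = \<bar>dt m A\<bar>"
proof -
  let ?B = "Matrix.mat m m (\<lambda>(i, l). A l i)"
  have p: "p permutes {0..<m}" using assms by (simp add: atLeast0LessThan)
  have pin: "p i < m" if "i < m" for i
    using permutes_in_image[OF assms, of i] that by simp
  have "dt m (\<lambda>i l. A i (p l)) = dt m (\<lambda>i l. A l (p i))"
    by (rule dt_transpose[symmetric])
  also have "\<dots> = Determinant.det (Matrix.mat m m (\<lambda>(i, l). ?B $$ (p i, l)))"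
    unfolding dt_def
    by (intro arg_cong[where f=Determinant.det] eq_matI) (auto simp: pin)
  also have "\<dots> = of_int (sign p) * Determinant.det ?B"
    by (subst det_permute_rows[OF _ p]) (auto simp: sign_def)
  also have "Determinant.det ?B = dt m (\<lambda>i l. A l i)"
    by (simp add: dt_def)
  finally show ?thesis
    by (simp add: abs_mult dt_transpose[of m A] sign_def)
qed

lemma dt_zero_col:
  assumes "l < m" "\<And>i. i < m \<Longrightarrow> A i l = 0"
  shows "dt m A = 0"
proof -
  have "dt m A = dt m (\<lambda>i l. A l i)" by (rule dt_transpose[symmetric])
  also have "\<dots> = 0" using assms by (subst dt_laplace_row[of l]) auto
  finally show ?thesis .
qed

text \<open>Subtracting multiples of the last column clears the last row outside the corner; the
  unipotent matrix \<open>E\<close> performs this without changing the determinant. What remains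
  beside the corner is its Schur complement.\<close>

lemma dt_pivot:
  assumes "A m m \<noteq> 0"
  shows "dt (Suc m) A = A m m * dt m (\<lambda>i l. A i l - A i m * A m l / A m m)"
proof -
  define E :: "nat \<Rightarrow> nat \<Rightarrow> real" where
    "E = (\<lambda>i l. if i = l then 1 else if i = m then - A m l / A m m else 0)"
  define P where "P = (\<lambda>i l. \<Sum>r<Suc m. A i r * E r l)"
  have P: "P i l = (if l = m then A i m else A i l - A i m * A m l / A m m)" if "l < Suc m" for i l
  proof (cases "l = m")
    case True
    then show ?thesis unfolding P_def E_def by simp
  next
    case False
    then have l: "l < m" using that by simp
    have "(\<Sum>r<m. A i r * E r l) = (\<Sum>r<m. if r = l then A i l else 0)"
      by (intro sum.cong) (auto simp: E_def)
    then show ?thesis unfolding P_def using l by (simp add: E_def)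
  qed
  have "dt (Suc m) E = 1"
    by (subst dt_lower_triangular) (auto simp: E_def)
  then have "dt (Suc m) A = dt (Suc m) P"
    unfolding P_def dt_mult by simp
  also have "\<dots> = (\<Sum>l<Suc m. P m l * cof (Suc m) P m l)"
    by (rule dt_laplace_row) simp
  also have "\<dots> = (\<Sum>l<Suc m. if l = m then A m m * cof (Suc m) P m m else 0)"
    using assms by (intro sum.cong) (auto simp: P)
  also have "\<dots> = A m m * cof (Suc m) P m m"
    by (subst sum.delta) auto
  also have "cof (Suc m) P m m = dt m (\<lambda>i l. A i l - A i m * A m l / A m m)"
    unfolding cof_def by (simp add: skip_def P mult_2[symmetric]) (rule dt_cong, simp add: P)
  finally show ?thesis .
qed

text \<open>The bordered matrix \<open>B\<close> with blocks I, -u, v, 1 is evaluated twice.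
  Eliminating the corner 1 leaves I + u v^T; clearing the last column instead leaves a lower
  triangular matrix with corner 1 + u . v.\<close>

lemma dt_rank_one:
  "dt m (\<lambda>i l. (if i = l then 1 else 0) + u i * v l) = 1 + (\<Sum>l<m. u l * v l)"
proof -
  define B :: "nat \<Rightarrow> nat \<Rightarrow> real" where
    "B = (\<lambda>i l. if i = m then (if l = m then 1 else v l)
                else if l = m then - u i else if i = l then 1 else 0)"
  define E :: "nat \<Rightarrow> nat \<Rightarrow> real" where
    "E = (\<lambda>i l. if i = l then 1 else if l = m then u i else 0)"
  have "dt (Suc m) B = dt m (\<lambda>i l. B i l - B i m * B m l)"
    by (subst dt_pivot) (auto simp: B_def)
  also have "\<dots> = dt m (\<lambda>i l. (if i = l then 1 else 0) + u i * v l)"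
    by (rule dt_cong) (auto simp: B_def)
  finally have 1: "dt (Suc m) B = \<dots>" .
  define P where "P = (\<lambda>i l. \<Sum>r<Suc m. B i r * E r l)"
  have P1: "P i m = 0" if "i < m" for i
  proof -
    have "(\<Sum>r<m. B i r * E r m) = (\<Sum>r<m. if r = i then u i else 0)"
      using that by (intro sum.cong) (auto simp: B_def E_def)
    also have "\<dots> = u i" using that by simp
    finally have "(\<Sum>r<m. B i r * E r m) = u i" .
    then show ?thesis using that by (simp add: P_def B_def E_def)
  qed
  have P2: "P i l = (if i = l then 1 else 0)" if "i < m" "l < m" for i l
  proof -
    have "(\<Sum>r<m. B i r * E r l) = (\<Sum>r<m. if r = i then (if i = l then 1 else 0) else 0)"
      using that by (intro sum.cong) (auto simp: B_def E_def)
    also have "\<dots> = (if i = l then 1 else 0)" using that by simp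
    finally show ?thesis using that by (simp add: P_def E_def)
  qed
  have P3: "P m m = 1 + (\<Sum>l<m. u l * v l)"
  proof -
    have "(\<Sum>r<m. B m r * E r m) = (\<Sum>l<m. u l * v l)"
      by (intro sum.cong) (auto simp: B_def E_def)
    then show ?thesis by (simp add: P_def B_def E_def)
  qed
  have "dt (Suc m) E = 1"
    by (subst dt_upper_triangular) (auto simp: E_def)
  then have "dt (Suc m) B = dt (Suc m) P"
    unfolding P_def dt_mult by simp
  also have "\<dots> = (\<Prod>i<Suc m. P i i)"
    by (rule dt_lower_triangular) (auto simp: less_Suc_eq P1 P2)
  also have "\<dots> = 1 + (\<Sum>l<m. u l * v l)"
    using P2 P3 by simp
  finally show ?thesis using 1 by simp
qed

lemma dt_scale_cols: "dt m (\<lambda>i l. A i l * s l) = dt m A * (\<Prod>l<m. s l)"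
proof -
  have "dt m (\<lambda>i l. A i l * s l) = dt m (\<lambda>i l. \<Sum>r<m. A i r * (if r = l then s l else 0))"
  proof (rule dt_cong)
    fix i l assume "i < m" "l < m"
    have "(\<Sum>r<m. A i r * (if r = l then s l else 0)) = (\<Sum>r<m. if r = l then A i l * s l else 0)"
      by (intro sum.cong) auto
    then show "A i l * s l = (\<Sum>r<m. A i r * (if r = l then s l else 0))"
      using \<open>l < m\<close> by simp
  qed
  also have "\<dots> = dt m A * dt m (\<lambda>r l. if r = l then s l else 0)"
    by (rule dt_mult)
  also have "dt m (\<lambda>r l. if r = l then s l else 0) = (\<Prod>l<m. s l)"
    by (subst dt_lower_triangular) auto
  finally show ?thesis .
qed

lemma dt_scale: "dt m (\<lambda>i l. s * A i l) = s ^ m * dt m A"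
  using dt_scale_cols[of m A "\<lambda>_. s"] by (simp add: mult.commute)

lemma cof_cong_row:
  assumes "\<And>r l. r \<noteq> i \<Longrightarrow> A r l = B r l"
  shows "cof m A i l = cof m B i l"
  unfolding cof_def by (intro arg_cong2[where f="(*)"] refl dt_cong) (auto simp: skip_def intro!: assms)

lemma dt_measurable:
  assumes "\<And>i l. i < m \<Longrightarrow> l < m \<Longrightarrow> (\<lambda>x. A x i l) \<in> borel_measurable M"
  shows "(\<lambda>x. dt m (A x)) \<in> borel_measurable M"
  unfolding dt_leibniz
  by (intro borel_measurable_sum borel_measurable_times borel_measurable_prod assms borel_measurable_const)
     (auto dest: permutes_in_image)

lemma tendsto_dt:
  assumes "\<And>i l. i < m \<Longrightarrow> l < m \<Longrightarrow> ((\<lambda>x. A x i l) \<longlongrightarrow> B i l) F"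
  shows "((\<lambda>x. dt m (A x)) \<longlongrightarrow> dt m B) F"
  unfolding dt_leibniz
  by (intro tendsto_sum tendsto_mult tendsto_prod assms tendsto_const)
     (auto dest: permutes_in_image)

lemma continuous_on_dt:
  assumes "\<And>i l. i < m \<Longrightarrow> l < m \<Longrightarrow> continuous_on S (\<lambda>x. A x i l)"
  shows "continuous_on S (\<lambda>x. dt m (A x))"
  unfolding dt_leibniz
  by (intro continuous_on_sum continuous_on_mult continuous_on_prod assms continuous_on_const)
     (auto dest: permutes_in_image)

section \<open>Extensional vectors as a model of m-dimensional space\<close>

text \<open>The underlying set of \<open>leb m\<close>, seen as a subset of all functions on the
  naturals. Continuity and compactness come from the product topology there, while the dimension
  stays a variable that an induction can decrease.\<close>

definition rsp :: "nat \<Rightarrow> (nat \<Rightarrow> real) set" where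
  "rsp m = (\<Pi>\<^sub>E i\<in>{..<m}. UNIV)"

abbreviation leb :: "nat \<Rightarrow> (nat \<Rightarrow> real) measure" where
  "leb m \<equiv> \<Pi>\<^sub>M i\<in>{..<m}. lborel"

interpretation lebp: product_sigma_finite "\<lambda>_::nat. lborel :: real measure"
  by standard

lemma space_leb: "space (leb m) = rsp m"
  by (simp add: space_PiM rsp_def)

lemma rsp_undefined: "x \<in> rsp m \<Longrightarrow> i \<ge> m \<Longrightarrow> x i = undefined"
  by (auto simp: rsp_def PiE_iff extensional_def)

lemma rspI: "(\<And>i. i \<ge> m \<Longrightarrow> x i = undefined) \<Longrightarrow> x \<in> rsp m"
  by (auto simp: rsp_def PiE_iff extensional_def)

lemma rsp_eqI: "x \<in> rsp m \<Longrightarrow> y \<in> rsp m \<Longrightarrow> (\<And>i. i < m \<Longrightarrow> x i = y i) \<Longrightarrow> x = y"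
  by (metis ext not_less rsp_undefined)

lemma rsp_upd: "x \<in> rsp m \<Longrightarrow> x(m := s) \<in> rsp (Suc m)"
  by (rule rspI) (auto simp: rsp_undefined)

lemma restrict_rsp: "restrict x {..<m} \<in> rsp m"
  by (rule rspI) auto

lemma restrict_upd: "y \<in> rsp (Suc m) \<Longrightarrow> (restrict y {..<m})(m := y m) = y"
  by (rule rsp_eqI[OF rsp_upd[OF restrict_rsp]]) (auto simp: less_Suc_eq)

lemma closed_rsp: "closed (rsp m)"
proof -
  have "closed {x :: nat \<Rightarrow> real. x i = undefined}" for i
    by (rule closed_Collect_eq) (rule continuous_on_product_coordinates continuous_on_const)+
  then have "closed (\<Inter>i\<in>{m..}. {x :: nat \<Rightarrow> real. x i = undefined})"
    by (intro closed_INT) simp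
  moreover have "rsp m = (\<Inter>i\<in>{m..}. {x. x i = undefined})"
    by (intro equalityI subsetI INT_I CollectI rspI) (simp_all add: rsp_undefined)
  ultimately show ?thesis by simp
qed

text \<open>Moves Borel sets of the product topology into the product sigma-algebra. Coordinates
  from \<open>m\<close> on are constantly \<open>undefined\<close> on \<open>rsp m\<close>, so only
  the first \<open>m\<close> matter.\<close>

lemma measurable_leb_borel: "(\<lambda>x. x) \<in> leb m \<rightarrow>\<^sub>M borel"
proof (rule measurable_coordinatewise_then_product)
  fix i
  show "(\<lambda>x. x i) \<in> borel_measurable (leb m)"
  proof (cases "i < m")
    case False
    then have "(\<lambda>x. x i) \<in> borel_measurable (leb m) \<longleftrightarrow> (\<lambda>x. undefined :: real) \<in> borel_measurable (leb m)"
      by (intro measurable_cong) (auto simp: space_leb rsp_undefined)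
    then show ?thesis by simp
  qed measurable
qed

lemma borel_leb: "C \<in> sets borel \<Longrightarrow> C \<subseteq> rsp m \<Longrightarrow> C \<in> sets (leb m)"
  using measurable_sets[OF measurable_leb_borel, of C m] by (simp add: space_leb Int_absorb2)

lemma compact_leb: "compact C \<Longrightarrow> C \<subseteq> rsp m \<Longrightarrow> C \<in> sets (leb m)"
  by (rule borel_leb) (auto intro: borel_compact)

lemma measurable_if_continuous_on:
  fixes f :: "(nat \<Rightarrow> real) \<Rightarrow> real"
  assumes "continuous_on K f" "K \<in> sets borel"
  shows "(\<lambda>x. if x \<in> K then f x else 0) \<in> borel_measurable (leb m)"
proof -
  have "(\<lambda>x. indicator K x *\<^sub>R f x) \<in> borel_measurable borel"
    using assms by (intro borel_measurable_continuous_on_indicator) auto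
  from measurable_compose[OF measurable_leb_borel this, of m]
  show ?thesis by (rule measurable_cong[THEN iffD1, rotated]) (auto simp: indicator_def)
qed

lemma measurable_if_continuous_on_rsp:
  assumes "continuous_on K f" "K \<in> sets borel" "\<And>x. x \<in> K \<Longrightarrow> f x \<in> rsp m'"
  shows "(\<lambda>x. if x \<in> K then f x else (\<lambda>i\<in>{..<m'}. 0)) \<in> leb m \<rightarrow>\<^sub>M leb m'"
proof -
  have "(\<lambda>x i. (if x \<in> K then f x else (\<lambda>i\<in>{..<m'}. 0)) i) \<in> leb m \<rightarrow>\<^sub>M leb m'"
  proof (rule measurable_PiM_single')
    fix i assume i: "i \<in> {..<m'}"
    have "(\<lambda>x. if x \<in> K then f x i else 0) \<in> borel_measurable (leb m)"
      by (rule measurable_if_continuous_on[OF continuous_on_product_then_coordinatewise[OF assms(1)] assms(2)])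
    then have "(\<lambda>x. (if x \<in> K then f x else (\<lambda>i\<in>{..<m'}. 0)) i) \<in> borel_measurable (leb m)"
      by (rule measurable_cong[THEN iffD1, rotated]) (use i in auto)
    then show "(\<lambda>x. (if x \<in> K then f x else (\<lambda>i\<in>{..<m'}. 0)) i) \<in> leb m \<rightarrow>\<^sub>M lborel" by simp
  next
    show "(\<lambda>\<omega> i. (if \<omega> \<in> K then f \<omega> else (\<lambda>i\<in>{..<m'}. 0)) i) \<in> space (leb m) \<rightarrow> (\<Pi>\<^sub>E i\<in>{..<m'}. space lborel)"
    proof
      fix x
      have "(if x \<in> K then f x else (\<lambda>i\<in>{..<m'}. 0)) \<in> rsp m'"
        using assms(3) restrict_rsp[of _ m'] by simp
      then show "(\<lambda>i. (if x \<in> K then f x else (\<lambda>i\<in>{..<m'}. 0)) i) \<in> (\<Pi>\<^sub>E i\<in>{..<m'}. space lborel)"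
        by (simp add: rsp_def)
    qed
  qed
  then show ?thesis by simp
qed

text \<open>The metric on functions weighs coordinates geometrically along an enumeration: twice the
  maximal distance over the first coordinates plus a tail (1/2)^N bounds it. Hence the choice of e/4
  for the coordinates and e/2 for the tail.\<close>

lemma dist_small_rsp:
  assumes "e > 0"
  obtains \<eta> where "\<eta> > 0" "\<And>x y. x \<in> rsp m \<Longrightarrow> y \<in> rsp m \<Longrightarrow> (\<And>l. l < m \<Longrightarrow> \<bar>x l - y l\<bar> \<le> \<eta>) \<Longrightarrow> dist x y < e"
proof -
  obtain N where N: "(1/2::real) ^ N < e / 2"
    using real_arch_pow_inv[of "e/2" "1/2"] assms by auto
  have "dist x y < e" if xy: "x \<in> rsp m" "y \<in> rsp m" and *: "\<And>l. l < m \<Longrightarrow> \<bar>x l - y l\<bar> \<le> e / 4" for x y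
  proof -
    let ?S = "{dist (x (from_nat n)) (y (from_nat n)) |n. n \<le> N}"
    have "?S = (\<lambda>n. dist (x (from_nat n)) (y (from_nat n))) ` {..N}" by auto
    then have fin: "finite ?S" and ne: "?S \<noteq> {}" by auto
    have "dist (x i) (y i) \<le> e / 4" for i
      using *[of i] rsp_undefined[OF xy(1), of i] rsp_undefined[OF xy(2), of i] assms
      by (cases "i < m") (auto simp: dist_real_def)
    then have "Max ?S \<le> e / 4" using fin ne by (subst Max_le_iff) auto
    then show ?thesis using dist_fun_le_dist_first_terms[of x y N] N by simp
  qed
  then show ?thesis using that[of "e/4"] assms by auto
qed

text \<open>Lindelof's theorem turns a local property into countably many closed pieces.
  \<open>P {}\<close> provides the pieces when \<open>U\<close> is empty.\<close>

lemma countable_closed_cover: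
  fixes U :: "'a::{metric_space, second_countable_topology} set"
  assumes "\<And>x. x \<in> U \<Longrightarrow> \<exists>e>0. P (cball x e)" "P {}"
  obtains C :: "nat \<Rightarrow> 'a set" where "\<And>i. closed (C i)" "\<And>i. P (C i)" "U \<subseteq> (\<Union>i. C i)"
proof -
  obtain e where e: "\<And>x. x \<in> U \<Longrightarrow> e x > 0 \<and> P (cball x (e x))" using assms(1) by metis
  obtain F' where F': "F' \<subseteq> (\<lambda>x. ball x (e x)) ` U" "countable F'" "\<Union>F' = \<Union>((\<lambda>x. ball x (e x)) ` U)"
    using Lindelof[of "(\<lambda>x. ball x (e x)) ` U"] by auto
  obtain V where V: "V \<subseteq> U" "countable V" "F' = (\<lambda>x. ball x (e x)) ` V"
    using F'(1,2) countable_subset_image[of F' "\<lambda>x. ball x (e x)" U] by blast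
  have U: "U \<subseteq> (\<Union>x\<in>V. cball x (e x))"
  proof
    fix x assume "x \<in> U"
    then have "x \<in> \<Union>F'" using F'(3) e by force
    then show "x \<in> (\<Union>x\<in>V. cball x (e x))" using V(3) by (force simp: less_imp_le)
  qed
  show ?thesis
  proof (cases "V = {}")
    case True
    then show ?thesis using that[of "\<lambda>_. {}"] assms(2) U by auto
  next
    case False
    define v where "v = from_nat_into V"
    have v: "range v = V" unfolding v_def by (rule range_from_nat_into[OF False V(2)])
    then have vU: "v i \<in> U" for i using V(1) by auto
    have "(\<Union>i. cball (v i) (e (v i))) = (\<Union>x\<in>range v. cball x (e x))" by simp
    then have "U \<subseteq> (\<Union>i. cball (v i) (e (v i)))" using U v by simp
    then show ?thesis
      using e[OF vU] by (intro that[of "\<lambda>i. cball (v i) (e (v i))"]) auto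
  qed
qed

section \<open>Difference quotients of systems of functions on compact sets\<close>

text \<open>
  Difference quotients \<open>A\<close> replace derivatives: they are preserved by solving an equation for
  one of the variables, and their restriction to the diagonal is the Jacobian matrix.
\<close>

definition dq :: "nat \<Rightarrow> (nat \<Rightarrow> real) set \<Rightarrow> (nat \<Rightarrow> (nat \<Rightarrow> real) \<Rightarrow> real) \<Rightarrow>
    (nat \<Rightarrow> nat \<Rightarrow> (nat \<Rightarrow> real) \<Rightarrow> (nat \<Rightarrow> real) \<Rightarrow> real) \<Rightarrow> bool" where
  "dq m K G A \<longleftrightarrow> compact K \<and> K \<subseteq> rsp m \<and>
     (\<forall>i<m. \<forall>x\<in>K. \<forall>y\<in>K. G i x - G i y = (\<Sum>l<m. A i l x y * (x l - y l))) \<and>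
     (\<forall>i<m. \<forall>l<m. continuous_on (K \<times> K) (\<lambda>(x, y). A i l x y))"

definition Gm :: "nat \<Rightarrow> (nat \<Rightarrow> (nat \<Rightarrow> real) \<Rightarrow> real) \<Rightarrow> (nat \<Rightarrow> real) \<Rightarrow> nat \<Rightarrow> real" where
  "Gm m G x = (\<lambda>i\<in>{..<m}. G i x)"

lemma Gm_rsp: "Gm m G x \<in> rsp m"
  by (simp add: Gm_def restrict_rsp)

lemma Gm_apply [simp]: "i < m \<Longrightarrow> Gm m G x i = G i x"
  by (simp add: Gm_def)

lemma dq_subset: "dq m K G A \<Longrightarrow> compact K' \<Longrightarrow> K' \<subseteq> K \<Longrightarrow> dq m K' G A"
  unfolding dq_def by (blast intro: continuous_on_subset Sigma_mono)

lemma dq_compact: "dq m K G A \<Longrightarrow> compact K"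
  and dq_rsp: "dq m K G A \<Longrightarrow> K \<subseteq> rsp m"
  and dq_diff: "dq m K G A \<Longrightarrow> i < m \<Longrightarrow> x \<in> K \<Longrightarrow> y \<in> K \<Longrightarrow>
    G i x - G i y = (\<Sum>l<m. A i l x y * (x l - y l))"
  and dq_cont: "dq m K G A \<Longrightarrow> i < m \<Longrightarrow> l < m \<Longrightarrow> continuous_on (K \<times> K) (\<lambda>z. A i l (fst z) (snd z))"
  unfolding dq_def by (auto simp: case_prod_beta')

lemma dq_cont_comp:
  assumes "dq m K G A" "i < m" "l < m" "continuous_on S f" "continuous_on S g" "f ` S \<subseteq> K" "g ` S \<subseteq> K"
  shows "continuous_on S (\<lambda>x. A i l (f x) (g x))"
  using continuous_on_compose2[OF dq_cont[OF assms(1-3)] continuous_on_Pair[OF assms(4,5)]] assms(6,7)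
  by auto

lemma dq_cont_diag: "dq m K G A \<Longrightarrow> i < m \<Longrightarrow> l < m \<Longrightarrow> continuous_on K (\<lambda>x. A i l x x)"
  by (rule dq_cont_comp) (auto intro: continuous_on_id)

lemma continuous_on_coord [continuous_intros]:
  fixes x :: "'a \<Rightarrow> 'b::topological_space"
  shows "continuous_on S (\<lambda>x. x i :: 'b)"
  by (rule continuous_on_subset[OF continuous_on_product_coordinates]) simp

lemma dq_cont_G:
  assumes "dq m K G A" "i < m"
  shows "continuous_on K (G i)"
proof (cases "K = {}")
  case False
  then obtain y where y: "y \<in> K" by auto
  have "continuous_on K (\<lambda>x. G i y + (\<Sum>l<m. A i l x y * (x l - y l)))"
    by (intro continuous_intros dq_cont_comp[OF assms(1,2)]) (use y in auto)
  then show ?thesis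
    by (rule continuous_on_eq) (use dq_diff[OF assms(1,2) _ y] in \<open>auto simp: algebra_simps\<close>)
qed simp

lemma dq_cont_Gm:
  assumes "dq m K G A"
  shows "continuous_on K (Gm m G)"
proof (rule continuous_on_coordinatewise_then_product)
  fix i show "continuous_on K (\<lambda>x. Gm m G x i)"
    by (cases "i < m") (auto simp: Gm_def intro: dq_cont_G[OF assms])
qed

lemma dq_compact_image: "dq m K G A \<Longrightarrow> compact (Gm m G ` K)"
  by (intro compact_continuous_image dq_cont_Gm dq_compact)

lemma dq_image_sets: "dq m K G A \<Longrightarrow> Gm m G ` K \<in> sets (leb m)"
  by (intro compact_leb dq_compact_image) (auto simp: Gm_rsp)

text \<open>Continuity on pairs upgrades nonvanishing at (x, x) to nonvanishing at all pairs of
  nearby points. This form, stronger than nonvanishing on the diagonal, gives injectivity on small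
  pieces.\<close>

lemma local_nonzero:
  fixes K :: "'a::metric_space set"
  assumes "x \<in> K" "continuous_on (K \<times> K) (\<lambda>z. f (fst z) (snd z) :: real)" "f x x \<noteq> 0"
  shows "\<exists>e>0. \<forall>u\<in>K \<inter> cball x e. \<forall>v\<in>K \<inter> cball x e. f u v \<noteq> 0"
proof -
  have "\<exists>d>0. \<forall>z\<in>K \<times> K. dist z (x, x) < d \<longrightarrow> dist (f (fst z) (snd z)) (f x x) < \<bar>f x x\<bar>"
    using assms(2)[unfolded continuous_on_iff, rule_format, of "(x,x)" "\<bar>f x x\<bar>"] assms(1,3) by auto
  then obtain d where d: "d > 0" "\<And>z. z \<in> K \<times> K \<Longrightarrow> dist z (x, x) < d \<Longrightarrow> dist (f (fst z) (snd z)) (f x x) < \<bar>f x x\<bar>"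
    by blast
  have "f u v \<noteq> 0" if "u \<in> K \<inter> cball x (d/3)" "v \<in> K \<inter> cball x (d/3)" for u v
  proof -
    have "dist (u, v) (x, x) \<le> dist u x + dist v x"
      unfolding dist_Pair_Pair by (rule sqrt_sum_squares_le_sum) auto
    also have "\<dots> < d" using that d(1) by (auto simp: dist_commute)
    finally have "dist (f u v) (f x x) < \<bar>f x x\<bar>" using d(2)[of "(u,v)"] that by auto
    then show ?thesis by (auto simp: dist_real_def)
  qed
  then show ?thesis using d(1) by (intro exI[of _ "d/3"]) auto
qed

subsection \<open>One-dimensional substitution\<close>

lemma nn_integral_substitution_compact:
  fixes g g' :: "real \<Rightarrow> real"
  assumes S: "compact S" and der: "\<And>x. x \<in> S \<Longrightarrow> (g has_field_derivative g' x) (at x within S)"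
    and cont': "continuous_on S g'" and inj: "inj_on g S" and [measurable]: "\<phi> \<in> borel_measurable borel"
  shows "(\<integral>\<^sup>+x. indicator S x * (\<phi> (g x) * ennreal \<bar>g' x\<bar>) \<partial>lborel) = (\<integral>\<^sup>+s. indicator (g ` S) s * \<phi> s \<partial>lborel)"
proof -
  have [measurable]: "S \<in> sets borel" using S by (rule borel_compact)
  have cont: "continuous_on S g"
    unfolding continuous_on_eq_continuous_within using der by (blast intro: DERIV_continuous)
  define h where "h = (\<lambda>x. if x \<in> S then g x else 0)"
  define h' where "h' = (\<lambda>x. if x \<in> S then g' x else 0)"
  have aux: "(\<lambda>x. if x \<in> S then f x else 0) \<in> borel_measurable borel" if "continuous_on S f" for f :: "real \<Rightarrow> real"
    using borel_measurable_continuous_on_indicator[OF _ that]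
    by (rule measurable_cong[THEN iffD1, rotated]) (auto simp: indicator_def)
  have [measurable]: "h \<in> borel_measurable borel" "h' \<in> borel_measurable borel"
    unfolding h_def h'_def using cont cont' by (auto intro: aux)
  have gS: "compact (g ` S)" using S cont by (rule compact_continuous_image[rotated])
  then have [measurable]: "g ` S \<in> sets borel" by (rule borel_compact)
  obtain B where B: "\<And>x. x \<in> S \<Longrightarrow> \<bar>g' x\<bar> \<le> B"
  proof -
    have "bounded (g' ` S)" by (intro compact_imp_bounded compact_continuous_image S cont')
    then show ?thesis using that by (auto simp: bounded_iff)
  qed
  have "distr (density lborel (\<lambda>x. indicator S x * ennreal \<bar>h' x\<bar>)) borel h = density lborel (indicator (g ` S))"
    (is "?L = ?R")
  proof (rule measure_eqI)
    show "sets ?L = sets ?R" by simp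
    fix T assume "T \<in> sets ?L"
    then have T[measurable]: "T \<in> sets borel" by simp
    define S' where "S' = S \<inter> h -` T"
    have "S' = {x \<in> space borel. x \<in> S \<and> h x \<in> T}" by (auto simp: S'_def)
    then have S'[measurable]: "S' \<in> sets borel" by simp
    have im: "g ` S' = g ` S \<inter> T" by (auto simp: S'_def h_def)
    then have [measurable]: "g ` S' \<in> sets borel" by simp
    have S'sub: "S' \<subseteq> S" by (auto simp: S'_def)
    have fin: "emeasure lborel S < \<infinity>" "emeasure lborel (g ` S) < \<infinity>"
      using emeasure_bounded_finite[OF compact_imp_bounded] S gS by blast+
    have fin': "emeasure lborel (g ` S') < \<infinity>" using fin(2)
      by (rule le_less_trans[rotated]) (auto intro!: emeasure_mono simp: im)
    have int: "integrable lborel (\<lambda>x. indicator S' x * \<bar>h' x\<bar>)"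
    proof (rule Bochner_Integration.integrable_bound[of _ "\<lambda>x. B * indicator S x"])
      show "integrable lborel (\<lambda>x. B * indicator S x)" using fin(1) by simp
      show "AE x in lborel. norm (indicator S' x * \<bar>h' x\<bar>) \<le> norm (B * indicator S x)"
        using B S'sub by (intro AE_I2) (auto simp: indicator_def h'_def intro: order.trans[OF _ abs_ge_self])
    qed measurable
    have absint: "(\<lambda>x. \<bar>g' x\<bar> * 1) absolutely_integrable_on S'"
    proof -
      have "set_integrable lborel S' (\<lambda>x. \<bar>h' x\<bar>)" using int by (simp add: set_integrable_def)
      then have "set_integrable lebesgue S' (\<lambda>x. \<bar>h' x\<bar>)"
        unfolding set_integrable_def by (subst integrable_completion) auto
      then show ?thesis
        by (rule set_integrable_cong[THEN iffD1, rotated 3]) (use S'sub in \<open>auto simp: h'_def\<close>)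
    qed
    have "(\<lambda>x. 1 :: real) absolutely_integrable_on (g ` S') \<and>
        integral (g ` S') (\<lambda>x. 1) = integral S' (\<lambda>x. \<bar>g' x\<bar> * 1)"
      by (rule has_absolute_integral_change_of_variables_1'[THEN iffD1, of S' g g'])
         (use absint S'sub inj in \<open>auto intro: DERIV_subset[OF der] inj_on_subset\<close>)
    then have eq: "integral (g ` S') (\<lambda>x. 1 :: real) = integral S' (\<lambda>x. \<bar>g' x\<bar> * 1)" by blast
    have "emeasure ?R T = emeasure lborel (g ` S')"
      by (subst emeasure_density) (auto simp: im indicator_inter_arith[symmetric])
    also have "\<dots> = ennreal (integral (g ` S') (\<lambda>x. 1 :: real))"
    proof -
      have "g ` S' \<in> lmeasurable" using fin' by (auto simp: fmeasurable_def)
      then have "integral (g ` S') (\<lambda>x. 1 :: real) = measure lebesgue (g ` S')"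
        by (rule lmeasure_integral[symmetric])
      also have "\<dots> = measure lborel (g ` S')" by (rule measure_completion) simp
      finally show ?thesis using fin' by (simp add: emeasure_eq_ennreal_measure)
    qed
    also have "integral (g ` S') (\<lambda>x. 1 :: real) = (LINT x|lborel. indicator S' x * \<bar>h' x\<bar>)"
    proof -
      have "integral S' (\<lambda>x. \<bar>g' x\<bar> * 1) = integral S' (\<lambda>x. \<bar>h' x\<bar>)"
        by (rule integral_cong) (use S'sub in \<open>auto simp: h'_def\<close>)
      also have "\<dots> = (LINT x:S'|lborel. \<bar>h' x\<bar>)"
        by (rule set_borel_integral_eq_integral(2)[symmetric]) (use int in \<open>simp add: set_integrable_def\<close>)
      finally show ?thesis using eq by (simp add: set_lebesgue_integral_def)
    qed
    also have "ennreal (LINT x|lborel. indicator S' x * \<bar>h' x\<bar>) = (\<integral>\<^sup>+x. ennreal (indicator S' x * \<bar>h' x\<bar>) \<partial>lborel)"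
      by (rule nn_integral_eq_integral[symmetric]) (use int in auto)
    also have "\<dots> = (\<integral>\<^sup>+x. indicator S x * ennreal \<bar>h' x\<bar> * indicator (h -` T) x \<partial>lborel)"
      by (auto intro!: nn_integral_cong simp: S'_def indicator_def)
    also have "\<dots> = emeasure ?L T"
      using measurable_sets[of h borel borel T]
      by (subst emeasure_distr, simp, simp, subst emeasure_density) auto
    finally show "emeasure ?L T = emeasure ?R T" ..
  qed
  then have "(\<integral>\<^sup>+s. \<phi> s \<partial>?L) = (\<integral>\<^sup>+s. \<phi> s \<partial>?R)" by simp
  also have "(\<integral>\<^sup>+s. \<phi> s \<partial>?L) = (\<integral>\<^sup>+x. (indicator S x * ennreal \<bar>h' x\<bar>) * \<phi> (h x) \<partial>lborel)"
    by (subst nn_integral_distr, simp, simp, subst nn_integral_density) auto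
  also have "\<dots> = (\<integral>\<^sup>+x. indicator S x * (\<phi> (g x) * ennreal \<bar>g' x\<bar>) \<partial>lborel)"
    by (intro nn_integral_cong) (auto simp: h_def h'_def indicator_def mult_ac)
  also have "(\<integral>\<^sup>+s. \<phi> s \<partial>?R) = (\<integral>\<^sup>+s. indicator (g ` S) s * \<phi> s \<partial>lborel)"
    by (subst nn_integral_density) auto
  finally show ?thesis .
qed

subsection \<open>Solving the last equation for the last variable\<close>

text \<open>Nonvanishing of the corner quotient at all pairs of points plays the role of the
  implicit function theorem: it makes \<open>psi\<close> injective, and compactness makes the
  inverse \<open>T\<close> continuous. The level set where the last function equals \<open>s\<close>
  then carries the m-dimensional system \<open>H s\<close> with quotients
  \<open>B s\<close>.\<close>

locale pivot =
  fixes m K G A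
  assumes dq: "dq (Suc m) K G A" and pv: "\<And>x y. x \<in> K \<Longrightarrow> y \<in> K \<Longrightarrow> A m m x y \<noteq> 0"
begin

definition "psi x = x(m := G m x)" for x :: "nat \<Rightarrow> real"
definition "L = psi ` K"
definition "T = the_inv_into K psi"
definition "Ls s = {t \<in> rsp m. t(m := s) \<in> L}" for s :: real
definition "H s i t = G i (T (t(m := s)))" for s :: real and t :: "nat \<Rightarrow> real" and i :: nat
definition "Sch i l u v = A i l u v - A i m u v * A m l u v / A m m u v" for i l u v
definition "B s i l x y = Sch i l (T (x(m := s))) (T (y(m := s)))" for s :: real and i l :: nat and x y :: "nat \<Rightarrow> real"

lemma K_rsp: "x \<in> K \<Longrightarrow> x \<in> rsp (Suc m)" using dq_rsp[OF dq] by auto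

lemma psi_rsp: "x \<in> K \<Longrightarrow> psi x \<in> rsp (Suc m)"
  unfolding psi_def by (rule rspI) (simp add: rsp_undefined[OF K_rsp])

lemma inj_psi: "inj_on psi K"
proof (rule inj_onI)
  fix x y assume x: "x \<in> K" and y: "y \<in> K" and eq: "psi x = psi y"
  have l: "x l = y l" if "l < m" for l using fun_cong[OF eq, of l] that by (simp add: psi_def)
  have "G m x = G m y" using fun_cong[OF eq, of m] by (simp add: psi_def)
  then have "0 = A m m x y * (x m - y m)" using dq_diff[OF dq, of m x y] x y l by simp
  then have "x m = y m" using pv x y by simp
  show "x = y"
  proof (rule rsp_eqI[OF K_rsp[OF x] K_rsp[OF y]])
    fix i assume "i < Suc m"
    then show "x i = y i" using l \<open>x m = y m\<close> by (cases "i = m") auto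
  qed
qed

lemma T_psi: "x \<in> K \<Longrightarrow> T (psi x) = x" by (simp add: T_def the_inv_into_f_f inj_psi)

lemma T_in: "y \<in> L \<Longrightarrow> T y \<in> K" by (auto simp: L_def T_psi)

lemma psi_T: "y \<in> L \<Longrightarrow> psi (T y) = y" by (auto simp: L_def T_psi)

lemma T_low: "y \<in> L \<Longrightarrow> l \<noteq> m \<Longrightarrow> T y l = y l"
  using fun_cong[OF psi_T, of y l] by (simp add: psi_def)

lemma G_T: "y \<in> L \<Longrightarrow> G m (T y) = y m"
  using fun_cong[OF psi_T, of y m] by (simp add: psi_def)

lemma cont_psi: "continuous_on K psi"
proof (rule continuous_on_coordinatewise_then_product)
  fix i show "continuous_on K (\<lambda>x. psi x i)"
    using dq_cont_G[OF dq, of m] by (cases "i = m") (auto simp: psi_def intro: continuous_on_coord)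
qed

lemma compact_L: "compact L"
  unfolding L_def by (intro compact_continuous_image cont_psi dq_compact[OF dq])

lemma L_rsp: "y \<in> L \<Longrightarrow> y \<in> rsp (Suc m)"
  by (auto simp: L_def psi_rsp)

lemma cont_T: "continuous_on L T"
  unfolding L_def T_def by (rule continuous_on_inv_into[OF cont_psi dq_compact[OF dq] inj_psi])

lemma compact_Ls: "compact (Ls s)"
proof -
  have "Ls s = (\<lambda>y. restrict y {..<m}) ` (L \<inter> {y. y m = s})" (is "_ = ?R")
  proof (intro equalityI subsetI)
    fix t assume "t \<in> Ls s"
    then have t: "t \<in> rsp m" "t(m := s) \<in> L" by (auto simp: Ls_def)
    have "t = restrict (t(m := s)) {..<m}"
      by (rule rsp_eqI[OF t(1) restrict_rsp]) simp
    then show "t \<in> ?R" using t(2) by (auto intro!: image_eqI[where x="t(m := s)"])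
  next
    fix t assume "t \<in> ?R"
    then obtain y where "y \<in> L" "y m = s" "t = restrict y {..<m}" by auto
    then show "t \<in> Ls s" using restrict_upd[OF L_rsp, of y] by (auto simp: Ls_def restrict_rsp)
  qed
  also have "compact \<dots>"
  proof (rule compact_continuous_image)
    have "closed {y :: nat \<Rightarrow> real. y m = s}"
      by (rule closed_Collect_eq) (rule continuous_on_product_coordinates continuous_on_const)+
    then show "compact (L \<inter> {y. y m = s})" by (intro compact_Int_closed compact_L)
    show "continuous_on (L \<inter> {y. y m = s}) (\<lambda>y. restrict y {..<m})"
    proof (rule continuous_on_coordinatewise_then_product)
      fix i show "continuous_on (L \<inter> {y. y m = s}) (\<lambda>y. restrict y {..<m} i)"
        by (cases "i < m") (auto intro: continuous_on_coord)
    qed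
  qed
  finally show ?thesis .
qed

lemma cont_upd: "continuous_on S (\<lambda>t :: nat \<Rightarrow> real. t(m := s))"
proof (rule continuous_on_coordinatewise_then_product)
  fix i show "continuous_on S (\<lambda>t. (t(m := s)) i)"
    by (cases "i = m") (auto intro: continuous_on_coord)
qed

lemma cont_T_upd: "continuous_on (Ls s) (\<lambda>t. T (t(m := s)))"
  by (rule continuous_on_compose2[OF cont_T cont_upd]) (auto simp: Ls_def)

lemma cont_Sch:
  assumes "continuous_on S f" "continuous_on S g" "f ` S \<subseteq> K" "g ` S \<subseteq> K" "i < m" "l < m"
  shows "continuous_on S (\<lambda>x. Sch i l (f x) (g x))"
  unfolding Sch_def
  by (intro continuous_intros dq_cont_comp[OF dq _ _ assms(1-4)]) (use assms pv in auto)

text \<open>On a slice the last function is constant, so its quotient identity can be solved for the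
  increment of the last variable. Substituting this increment into the other identities produces the
  Schur complement \<open>Sch\<close> as their quotient matrix.\<close>

lemma dq_slice: "dq m (Ls s) (H s) (B s)"
  unfolding dq_def
proof (intro conjI allI impI ballI compact_Ls)
  show "Ls s \<subseteq> rsp m" by (auto simp: Ls_def)
  fix i assume i: "i < m"
  fix x y assume xy: "x \<in> Ls s" "y \<in> Ls s"
  define u v where "u = T (x(m := s))" and "v = T (y(m := s))"
  have L: "x(m := s) \<in> L" "y(m := s) \<in> L" using xy by (auto simp: Ls_def)
  have K: "u \<in> K" "v \<in> K" using L by (auto simp: u_def v_def T_in)
  have low: "u l - v l = x l - y l" if "l < m" for l
    using that L by (simp add: u_def v_def T_low)
  have "G m u - G m v = 0" using L by (simp add: u_def v_def G_T)
  then have 0: "(\<Sum>l<m. A m l u v * (x l - y l)) + A m m u v * (u m - v m) = 0"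
    using dq_diff[OF dq, of m u v] K low by simp
  then have um: "u m - v m = - (\<Sum>l<m. A m l u v * (x l - y l)) / A m m u v"
    using pv[OF K] by (simp add: field_simps)
  have "H s i x - H s i y = (\<Sum>l<m. A i l u v * (x l - y l)) + A i m u v * (u m - v m)"
    using dq_diff[OF dq, of i u v] K low i by (simp add: H_def u_def v_def)
  also have "\<dots> = (\<Sum>l<m. A i l u v * (x l - y l)) - (\<Sum>l<m. A i m u v * A m l u v / A m m u v * (x l - y l))"
    unfolding um by (simp add: sum_distrib_left sum_divide_distrib mult_ac)
  also have "\<dots> = (\<Sum>l<m. B s i l x y * (x l - y l))"
    by (simp add: B_def Sch_def u_def v_def sum_subtractf[symmetric] left_diff_distrib)
  finally show "H s i x - H s i y = (\<Sum>l<m. B s i l x y * (x l - y l))" .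
next
  fix i l assume il: "i < m" "l < m"
  have "continuous_on (Ls s \<times> Ls s) (\<lambda>z. Sch i l (T ((fst z)(m := s))) (T ((snd z)(m := s))))"
    by (rule cont_Sch[OF continuous_on_compose2[OF cont_T_upd[of s] continuous_on_fst[OF continuous_on_id]]
            continuous_on_compose2[OF cont_T_upd[of s] continuous_on_snd[OF continuous_on_id]]])
       (use il in \<open>auto simp: Ls_def T_in\<close>)
  then show "continuous_on (Ls s \<times> Ls s) (\<lambda>(x, y). B s i l x y)"
    by (simp add: B_def case_prod_beta')
qed

lemma dt_Schur: "x \<in> K \<Longrightarrow> y \<in> K \<Longrightarrow>
    dt (Suc m) (\<lambda>i l. A i l x y) = A m m x y * dt m (\<lambda>i l. Sch i l x y)"
  unfolding Sch_def by (rule dt_pivot) (rule pv)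

lemma Gm_slice: "t \<in> Ls s \<Longrightarrow> (Gm m (H s) t)(m := s) = Gm (Suc m) G (T (t(m := s)))"
proof (rule rsp_eqI[of _ "Suc m"])
  fix i assume t: "t \<in> Ls s" and "i < Suc m"
  then show "((Gm m (H s) t)(m := s)) i = Gm (Suc m) G (T (t(m := s))) i"
    using G_T[of "t(m := s)"] by (cases "i = m") (auto simp: H_def Ls_def)
qed (auto simp: Gm_rsp intro: rsp_upd)

lemma image_slice:
  assumes "c \<in> rsp m"
  shows "c(m := s) \<in> Gm (Suc m) G ` K \<longleftrightarrow> c \<in> Gm m (H s) ` Ls s"
proof
  assume "c(m := s) \<in> Gm (Suc m) G ` K"
  then obtain x where x: "x \<in> K" "c(m := s) = Gm (Suc m) G x" by auto
  have s: "G m x = s" using fun_cong[OF x(2), of m] by simp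
  define t where "t = restrict x {..<m}"
  have tm: "t(m := s) = psi x"
    by (rule rsp_eqI[OF rsp_upd psi_rsp[OF x(1)]]) (auto simp: t_def restrict_rsp psi_def s less_Suc_eq)
  have t: "t \<in> Ls s" using x(1) by (auto simp: Ls_def tm L_def) (auto simp: t_def restrict_rsp)
  have "c = Gm m (H s) t"
  proof (rule rsp_eqI[OF assms Gm_rsp])
    fix i assume "i < m"
    then show "c i = Gm m (H s) t i"
      using fun_cong[OF x(2), of i] by (simp add: H_def tm T_psi x(1))
  qed
  then show "c \<in> Gm m (H s) ` Ls s" using t by auto
next
  assume "c \<in> Gm m (H s) ` Ls s"
  then obtain t where "t \<in> Ls s" "c = Gm m (H s) t" by auto
  then show "c(m := s) \<in> Gm (Suc m) G ` K"
    using Gm_slice[of t s] T_in[of "t(m := s)"] by (auto simp: Ls_def)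
qed

end

subsection \<open>Sard's theorem\<close>

lemma emeasure_leb_box:
  assumes "\<And>i. i < m \<Longrightarrow> a i \<le> b i"
  shows "emeasure (leb m) (\<Pi>\<^sub>E i\<in>{..<m}. {a i..b i}) = ennreal (\<Prod>i<m. b i - a i)"
proof -
  have "emeasure (leb m) (\<Pi>\<^sub>E i\<in>{..<m}. {a i..b i}) = (\<Prod>i<m. emeasure lborel {a i..b i})"
    by (rule lebp.emeasure_PiM) auto
  also have "\<dots> = (\<Prod>i<m. ennreal (b i - a i))" using assms by (intro prod.cong) auto
  also have "\<dots> = ennreal (\<Prod>i<m. b i - a i)" using assms by (intro prod_ennreal) auto
  finally show ?thesis .
qed

text \<open>Cut [-R, R]^(m+1) into p^(m+1) cubes of side h = 2R/p, so fine that the last row of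
  quotients is at most \<open>e\<close> within a cube. The image of a cube lies in a box with m
  sides of order h and one of order e h. Summed over all cubes, the powers of h combine with those
  of p to (2R)^(m+1), so the total is a constant times \<open>e\<close>.\<close>

lemma sard_flat_bound:
  assumes dq: "dq (Suc m) K G A" and flat: "\<And>x l. x \<in> K \<Longrightarrow> l < Suc m \<Longrightarrow> A m l x x = 0"
  shows "\<exists>C. \<forall>e. 0 < e \<longrightarrow> e \<le> 1 \<longrightarrow> emeasure (leb (Suc m)) (Gm (Suc m) G ` K) \<le> ennreal (C * e)"
proof -
  note cK = dq_compact[OF dq]
  have K_rsp: "x \<in> rsp (Suc m)" if "x \<in> K" for x using dq_rsp[OF dq] that by auto
  have "\<exists>b. \<forall>z\<in>K \<times> K. \<bar>A i l (fst z) (snd z)\<bar> \<le> b" if "i < Suc m" "l < Suc m" for i l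
  proof -
    have "bounded ((\<lambda>z. A i l (fst z) (snd z)) ` (K \<times> K))"
      using that by (intro compact_imp_bounded compact_continuous_image dq_cont[OF dq] compact_Times cK)
    then show ?thesis by (auto simp: bounded_iff)
  qed
  then obtain b where b: "\<And>i l z. i < Suc m \<Longrightarrow> l < Suc m \<Longrightarrow> z \<in> K \<times> K \<Longrightarrow> \<bar>A i l (fst z) (snd z)\<bar> \<le> b i l"
    by metis
  define D where "D = 1 + (\<Sum>i<Suc m. \<Sum>l<Suc m. \<bar>b i l\<bar>)"
  have D0: "D \<ge> 0" unfolding D_def by (intro add_nonneg_nonneg sum_nonneg) auto
  have D: "\<bar>A i l x y\<bar> \<le> D" if "i < Suc m" "l < Suc m" "x \<in> K" "y \<in> K" for i l x y
  proof -
    have "\<bar>A i l x y\<bar> \<le> \<bar>b i l\<bar>" using b[of i l "(x, y)"] that by auto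
    also have "\<dots> \<le> (\<Sum>l<Suc m. \<bar>b i l\<bar>)" using that by (intro member_le_sum) auto
    also have "\<dots> \<le> (\<Sum>i<Suc m. \<Sum>l<Suc m. \<bar>b i l\<bar>)"
      using that by (intro member_le_sum[of i "{..<Suc m}" "\<lambda>i. \<Sum>l<Suc m. \<bar>b i l\<bar>"]) (auto intro: sum_nonneg)
    finally show ?thesis by (simp add: D_def)
  qed
  have "\<exists>r. \<forall>x\<in>K. \<bar>x l\<bar> \<le> r" for l
  proof -
    have "bounded ((\<lambda>x. x l) ` K)"
      by (intro compact_imp_bounded compact_continuous_image continuous_on_coord cK)
    then show ?thesis by (auto simp: bounded_iff)
  qed
  then obtain r where r: "\<And>l x. x \<in> K \<Longrightarrow> \<bar>x l\<bar> \<le> r l" by metis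
  define R where "R = 1 + (\<Sum>l<Suc m. \<bar>r l\<bar>)"
  have R0: "R > 0" unfolding R_def by (intro add_pos_nonneg sum_nonneg) auto
  have R: "\<bar>x l\<bar> < R" if "l < Suc m" "x \<in> K" for l x
  proof -
    have "\<bar>x l\<bar> \<le> \<bar>r l\<bar>" using r[of x l] that by auto
    also have "\<dots> \<le> (\<Sum>l<Suc m. \<bar>r l\<bar>)" using that by (intro member_le_sum) auto
    finally show ?thesis by (simp add: R_def)
  qed
  let ?M = "real (Suc m)"
  define C where "C = (2 * R) ^ Suc m * (2 * ?M) ^ Suc m * D ^ m"
  have "emeasure (leb (Suc m)) (Gm (Suc m) G ` K) \<le> ennreal (C * e)" if e: "0 < e" "e \<le> 1" for e
  proof -
    have "\<exists>\<eta>>0. \<forall>x\<in>K. \<forall>y\<in>K. (\<forall>l<Suc m. \<bar>x l - y l\<bar> \<le> \<eta>) \<longrightarrow> \<bar>A m l x y\<bar> \<le> e" if l: "l < Suc m" for l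
    proof -
      have "uniformly_continuous_on (K \<times> K) (\<lambda>z. A m l (fst z) (snd z))"
        by (rule compact_uniformly_continuous[OF dq_cont[OF dq _ l] compact_Times[OF cK cK]]) simp
      then obtain d where d: "d > 0" "\<And>z z'. z \<in> K \<times> K \<Longrightarrow> z' \<in> K \<times> K \<Longrightarrow> dist z' z < d \<Longrightarrow>
          dist (A m l (fst z') (snd z')) (A m l (fst z) (snd z)) < e"
        unfolding uniformly_continuous_on_def using e(1) by metis
      obtain \<eta> where \<eta>: "\<eta> > 0" "\<And>x y. x \<in> rsp (Suc m) \<Longrightarrow> y \<in> rsp (Suc m) \<Longrightarrow> (\<And>l. l < Suc m \<Longrightarrow> \<bar>x l - y l\<bar> \<le> \<eta>) \<Longrightarrow> dist x y < d"
        using dist_small_rsp[OF d(1)] by blast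
      have "\<bar>A m l x y\<bar> \<le> e" if "x \<in> K" "y \<in> K" "\<forall>l<Suc m. \<bar>x l - y l\<bar> \<le> \<eta>" for x y
        using d(2)[of "(x, x)" "(x, y)"] \<eta>(2)[of x y] that K_rsp flat[OF _ l]
        by (auto simp: dist_Pair_Pair dist_commute dist_real_def)
      then show ?thesis using \<eta>(1) by blast
    qed
    then obtain \<eta>' where \<eta>': "\<And>l. l < Suc m \<Longrightarrow> \<eta>' l > 0"
        "\<And>l x y. l < Suc m \<Longrightarrow> x \<in> K \<Longrightarrow> y \<in> K \<Longrightarrow> (\<forall>j<Suc m. \<bar>x j - y j\<bar> \<le> \<eta>' l) \<Longrightarrow> \<bar>A m l x y\<bar> \<le> e"
      by metis
    define \<eta> where "\<eta> = Min (\<eta>' ` {..<Suc m})"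
    have \<eta>0: "\<eta> > 0" unfolding \<eta>_def by (subst Min_gr_iff) (use \<eta>'(1) in auto)
    have \<eta>_le: "\<eta> \<le> \<eta>' l" if "l < Suc m" for l unfolding \<eta>_def by (rule Min_le) (use that in auto)
    have \<eta>: "\<bar>A m l x y\<bar> \<le> e" if "l < Suc m" "x \<in> K" "y \<in> K" "\<And>j. j < Suc m \<Longrightarrow> \<bar>x j - y j\<bar> \<le> \<eta>" for l x y
      using \<eta>'(2)[of l x y] that \<eta>_le[of l] by force
    obtain p :: nat where p: "2 * R / \<eta> < real p" using reals_Archimedean2 by blast
    then have p0: "p > 0" using R0 \<eta>0 by (metis divide_pos_pos gr0I less_trans mult_pos_pos not_less_iff_gr_or_eq of_nat_0 zero_less_numeral)
    define h where "h = 2 * R / real p"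
    have h0: "h > 0" using R0 p0 by (simp add: h_def)
    have h\<eta>: "h \<le> \<eta>" using p \<eta>0 p0 by (simp add: h_def field_simps)
    define I where "I = (\<Pi>\<^sub>E i\<in>{..<Suc m}. {..<p})"
    have finI: "finite I" unfolding I_def by (intro finite_PiE) auto
    define Q where "Q = (\<lambda>a. {x \<in> K. \<forall>l<Suc m. - R + real (a l) * h \<le> x l \<and> x l \<le> - R + real (a l) * h + h})"
    have cov: "K \<subseteq> (\<Union>a\<in>I. Q a)"
    proof
      fix x assume x: "x \<in> K"
      define a where "a = (\<lambda>l\<in>{..<Suc m}. nat \<lfloor>(x l + R) / h\<rfloor>)"
      have al: "real (a l) \<le> (x l + R) / h \<and> (x l + R) / h < real (a l) + 1 \<and> a l < p" if l: "l < Suc m" for l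
      proof -
        have pos: "(x l + R) / h \<ge> 0" using R[OF l x] h0 by (auto simp: abs_less_iff)
        have "(x l + R) / h < 2 * R / h" using R[OF l x] h0 by (intro divide_strict_right_mono) auto
        also have "2 * R / h = real p" using R0 p0 by (simp add: h_def)
        finally have "\<lfloor>(x l + R) / h\<rfloor> < int p" by (simp add: floor_less_iff)
        moreover have "real (nat \<lfloor>(x l + R) / h\<rfloor>) = of_int \<lfloor>(x l + R) / h\<rfloor>" using pos by simp
        ultimately show ?thesis using l pos by (simp add: a_def) linarith
      qed
      have "a \<in> I" unfolding I_def PiE_iff using al by (auto simp: a_def)
      moreover have "x \<in> Q a"
        unfolding Q_def
      proof (intro CollectI conjI x allI impI)
        fix l assume l: "l < Suc m"
        have "real (a l) * h \<le> x l + R" "x l + R < (real (a l) + 1) * h"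
          using al[OF l] h0 by (auto simp: field_simps)
        then show "- R + real (a l) * h \<le> x l" "x l \<le> - R + real (a l) * h + h"
          by (auto simp: algebra_simps)
      qed
      ultimately show "x \<in> (\<Union>a\<in>I. Q a)" by blast
    qed
    define w where "w i = (if i < m then ?M * (D * h) else ?M * (e * h))" for i
    have w0: "w i \<ge> 0" for i using D0 h0 e by (simp add: w_def)
    have "\<exists>X \<in> sets (leb (Suc m)). Gm (Suc m) G ` Q a \<subseteq> X \<and> emeasure (leb (Suc m)) X \<le> ennreal (\<Prod>i<Suc m. 2 * w i)" for a
    proof (cases "Q a = {}")
      case True
      then show ?thesis by (intro bexI[of _ "{}"]) auto
    next
      case False
      then obtain z where z: "z \<in> Q a" by auto
      define X where "X = (\<Pi>\<^sub>E i\<in>{..<Suc m}. {G i z - w i..G i z + w i})"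
      have zK: "z \<in> K" using z by (simp add: Q_def)
      have "Gm (Suc m) G x \<in> X" if x: "x \<in> Q a" for x
      proof -
        have xK: "x \<in> K" using x by (simp add: Q_def)
        have close: "\<bar>x l - z l\<bar> \<le> h" if "l < Suc m" for l
          using x z that unfolding Q_def by (smt (verit, ccfv_SIG) mem_Collect_eq)
        have "\<bar>G i x - G i z\<bar> \<le> w i" if i: "i < Suc m" for i
        proof -
          have "\<bar>G i x - G i z\<bar> \<le> (\<Sum>l<Suc m. \<bar>A i l x z * (x l - z l)\<bar>)"
            unfolding dq_diff[OF dq i xK zK] by (rule sum_abs)
          also have "\<dots> \<le> (\<Sum>l<Suc m. (if i < m then D else e) * h)"
          proof (rule sum_mono)
            fix l assume "l \<in> {..<Suc m}"
            then have l: "l < Suc m" by simp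
            have "\<bar>A i l x z\<bar> \<le> (if i < m then D else e)"
            proof (cases "i < m")
              case False
              then have "i = m" using i by simp
              then show ?thesis using \<eta>[OF l xK zK] close h\<eta> by (force intro: order.trans)
            qed (use D[OF i l xK zK] in simp)
            then show "\<bar>A i l x z * (x l - z l)\<bar> \<le> (if i < m then D else e) * h"
              unfolding abs_mult using close[OF l] D0 e by (intro mult_mono) auto
          qed
          also have "\<dots> = w i" by (simp add: w_def)
          finally show ?thesis .
        qed
        then show ?thesis unfolding X_def PiE_iff Gm_def by (force simp: abs_le_iff algebra_simps)
      qed
      moreover have "X \<in> sets (leb (Suc m))" unfolding X_def by (rule sets_PiM_I_finite) auto
      moreover have "emeasure (leb (Suc m)) X = ennreal (\<Prod>i<Suc m. (G i z + w i) - (G i z - w i))"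
        unfolding X_def by (rule emeasure_leb_box) (use w0 in \<open>auto simp: algebra_simps\<close>)
      ultimately show ?thesis by (intro bexI[of _ X]) auto
    qed
    then obtain X where X: "\<And>a. X a \<in> sets (leb (Suc m))" "\<And>a. Gm (Suc m) G ` Q a \<subseteq> X a"
        "\<And>a. emeasure (leb (Suc m)) (X a) \<le> ennreal (\<Prod>i<Suc m. 2 * w i)" by metis
    have "emeasure (leb (Suc m)) (Gm (Suc m) G ` K) \<le> emeasure (leb (Suc m)) (\<Union>a\<in>I. X a)"
      by (rule emeasure_mono) (use cov X(2) X(1) finI in \<open>blast\<close>)+
    also have "\<dots> \<le> (\<Sum>a\<in>I. emeasure (leb (Suc m)) (X a))"
      using X(1) by (intro emeasure_subadditive_finite finI) auto
    also have "\<dots> \<le> (\<Sum>a\<in>I. ennreal (\<Prod>i<Suc m. 2 * w i))" by (intro sum_mono X(3))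
    also have "\<dots> = ennreal (real (card I) * (\<Prod>i<Suc m. 2 * w i))"
      using w0 by (simp add: ennreal_mult' prod_nonneg ennreal_of_nat_eq_real_of_nat)
    also have "card I = p ^ Suc m" unfolding I_def by (simp add: card_PiE)
    also have "(\<Prod>i<Suc m. 2 * w i) = (2 * ?M * h) ^ Suc m * D ^ m * e"
      by (simp add: w_def power_mult_distrib mult_ac)
    also have "real (p ^ Suc m) * ((2 * ?M * h) ^ Suc m * D ^ m * e) = (real p * h) ^ Suc m * (2 * ?M) ^ Suc m * D ^ m * e"
      by (simp add: power_mult_distrib mult_ac)
    also have "real p * h = 2 * R" using p0 by (simp add: h_def)
    finally show ?thesis by (simp only: C_def)
  qed
  then show ?thesis by blast
qed

lemma sard_flat:
  assumes dq: "dq (Suc m) K G A" and flat: "\<And>x l. x \<in> K \<Longrightarrow> l < Suc m \<Longrightarrow> A m l x x = 0"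
  shows "emeasure (leb (Suc m)) (Gm (Suc m) G ` K) = 0"
proof -
  obtain C where C: "\<And>e. 0 < e \<Longrightarrow> e \<le> 1 \<Longrightarrow> emeasure (leb (Suc m)) (Gm (Suc m) G ` K) \<le> ennreal (C * e)"
    using sard_flat_bound[OF assms] by blast
  have *: "emeasure (leb (Suc m)) (Gm (Suc m) G ` K) \<le> 0 + ennreal d" if d: "d > 0" for d
  proof -
    define e where "e = min 1 (d / (\<bar>C\<bar> + 1))"
    have "e \<le> d / (\<bar>C\<bar> + 1)" by (simp add: e_def)
    then have "(\<bar>C\<bar> + 1) * e \<le> d" by (simp add: field_simps)
    moreover have e: "0 < e" "e \<le> 1" using d by (auto simp: e_def)
    moreover have "C * e \<le> (\<bar>C\<bar> + 1) * e" using e by (intro mult_right_mono) auto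
    ultimately have "C * e \<le> d" by linarith
    then have "ennreal (C * e) \<le> ennreal d" by (rule ennreal_leI)
    then show ?thesis using C[OF e] by simp
  qed
  have "emeasure (leb (Suc m)) (Gm (Suc m) G ` K) \<le> 0"
    by (rule ennreal_le_epsilon) (rule *)
  then show ?thesis by simp
qed

context pivot begin

text \<open>Fubini over the value \<open>s\<close> of the last function: by
  \<open>image_slice\<close> the section of the image at height \<open>s\<close> is the image of the
  system \<open>H s\<close>.\<close>

lemma sard_pivot:
  assumes "\<And>s. emeasure (leb m) (Gm m (H s) ` Ls s) = 0"
  shows "emeasure (leb (Suc m)) (Gm (Suc m) G ` K) = 0"
proof -
  let ?X = "Gm (Suc m) G ` K"
  have X[measurable]: "?X \<in> sets (leb (Suc m))" by (rule dq_image_sets[OF dq])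
  have Xm: "indicator ?X \<in> borel_measurable (leb (Suc m))" by simp
  have "emeasure (leb (Suc m)) ?X = (\<integral>\<^sup>+c. indicator ?X c \<partial>leb (Suc m))" by simp
  also have "\<dots> = (\<integral>\<^sup>+s. (\<integral>\<^sup>+c. indicator ?X (c(m := s)) \<partial>leb m) \<partial>lborel)"
    unfolding lessThan_Suc
    by (rule lebp.product_nn_integral_insert_rev) (use Xm in \<open>auto simp: lessThan_Suc\<close>)
  also have "\<dots> = (\<integral>\<^sup>+s. emeasure (leb m) (Gm m (H s) ` Ls s) \<partial>(lborel :: real measure))"
  proof (rule nn_integral_cong)
    fix s :: real
    have "(\<integral>\<^sup>+c. indicator ?X (c(m := s)) \<partial>leb m) = (\<integral>\<^sup>+c. indicator (Gm m (H s) ` Ls s) c \<partial>leb m)"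
      by (rule nn_integral_cong) (simp add: space_leb image_slice indicator_def)
    then show "(\<integral>\<^sup>+c. indicator ?X (c(m := s)) \<partial>leb m) = emeasure (leb m) (Gm m (H s) ` Ls s)"
      using dq_image_sets[OF dq_slice] by simp
  qed
  finally show ?thesis by (simp add: assms)
qed

end

text \<open>Brings a nonvanishing quotient from column \<open>l\<close> into the corner, where
  \<open>pivot\<close> expects it.\<close>

lemma dq_swap:
  assumes dq: "dq (Suc m) K G A" and l: "l \<le> m" and \<sigma>: "\<sigma> = Transposition.transpose l m"
  shows "dq (Suc m) ((\<lambda>x. x \<circ> \<sigma>) ` K) (\<lambda>i x. G i (x \<circ> \<sigma>)) (\<lambda>i j x y. A i (\<sigma> j) (x \<circ> \<sigma>) (y \<circ> \<sigma>))"
    and "x \<circ> \<sigma> \<circ> \<sigma> = x"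
    and "\<sigma> permutes {..<Suc m}"
    and "x \<in> rsp (Suc m) \<Longrightarrow> x \<circ> \<sigma> \<in> rsp (Suc m)"
    and "continuous_on S (\<lambda>x :: nat \<Rightarrow> real. x \<circ> \<sigma>)"
proof -
  show inv: "x \<circ> \<sigma> \<circ> \<sigma> = x" for x :: "nat \<Rightarrow> real" by (simp add: \<sigma> fun_eq_iff)
  show p: "\<sigma> permutes {..<Suc m}" unfolding \<sigma> using l by (intro permutes_swap_id) auto
  show rsp: "x \<circ> \<sigma> \<in> rsp (Suc m)" if "x \<in> rsp (Suc m)" for x
    using that permutes_not_in[OF p] by (intro rspI) (auto simp: rsp_undefined)
  show cont: "continuous_on S (\<lambda>x :: nat \<Rightarrow> real. x \<circ> \<sigma>)" for S
    unfolding comp_def by (rule continuous_on_coordinatewise_then_product) (rule continuous_on_coord)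
  show "dq (Suc m) ((\<lambda>x. x \<circ> \<sigma>) ` K) (\<lambda>i x. G i (x \<circ> \<sigma>)) (\<lambda>i j x y. A i (\<sigma> j) (x \<circ> \<sigma>) (y \<circ> \<sigma>))"
    unfolding dq_def
  proof (intro conjI allI impI ballI)
    show "compact ((\<lambda>x. x \<circ> \<sigma>) ` K)" by (intro compact_continuous_image cont dq_compact[OF dq])
    show "(\<lambda>x. x \<circ> \<sigma>) ` K \<subseteq> rsp (Suc m)" using dq_rsp[OF dq] rsp by auto
    fix i assume i: "i < Suc m"
    fix x y assume xy: "x \<in> (\<lambda>x. x \<circ> \<sigma>) ` K" "y \<in> (\<lambda>x. x \<circ> \<sigma>) ` K"
    then have "x \<circ> \<sigma> \<in> K" "y \<circ> \<sigma> \<in> K" using inv by auto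
    then have "G i (x \<circ> \<sigma>) - G i (y \<circ> \<sigma>) = (\<Sum>j<Suc m. A i j (x \<circ> \<sigma>) (y \<circ> \<sigma>) * ((x \<circ> \<sigma>) j - (y \<circ> \<sigma>) j))"
      by (rule dq_diff[OF dq i])
    also have "\<dots> = (\<Sum>j<Suc m. A i (\<sigma> j) (x \<circ> \<sigma>) (y \<circ> \<sigma>) * ((x \<circ> \<sigma>) (\<sigma> j) - (y \<circ> \<sigma>) (\<sigma> j)))"
      by (rule sum.permute[OF p, unfolded comp_def, of "\<lambda>j. A i j (x \<circ> \<sigma>) (y \<circ> \<sigma>) * ((x \<circ> \<sigma>) j - (y \<circ> \<sigma>) j)", unfolded comp_def[symmetric]])
    also have "\<dots> = (\<Sum>j<Suc m. A i (\<sigma> j) (x \<circ> \<sigma>) (y \<circ> \<sigma>) * (x j - y j))"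
      by (simp add: \<sigma>)
    finally show "G i (x \<circ> \<sigma>) - G i (y \<circ> \<sigma>) = (\<Sum>j<Suc m. A i (\<sigma> j) (x \<circ> \<sigma>) (y \<circ> \<sigma>) * (x j - y j))" .
  next
    fix i j assume "i < Suc m" "j < Suc m"
    then have j: "\<sigma> j < Suc m" using permutes_in_image[OF p, of j] by simp
    have "continuous_on (((\<lambda>x. x \<circ> \<sigma>) ` K) \<times> ((\<lambda>x. x \<circ> \<sigma>) ` K)) (\<lambda>z. A i (\<sigma> j) (fst z \<circ> \<sigma>) (snd z \<circ> \<sigma>))"
      by (rule dq_cont_comp[OF dq \<open>i < Suc m\<close> j continuous_on_compose2[OF cont[of UNIV] continuous_on_fst[OF continuous_on_id]]
            continuous_on_compose2[OF cont[of UNIV] continuous_on_snd[OF continuous_on_id]]])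
         (auto simp: inv)
    then show "continuous_on (((\<lambda>x. x \<circ> \<sigma>) ` K) \<times> ((\<lambda>x. x \<circ> \<sigma>) ` K)) (\<lambda>(x, y). A i (\<sigma> j) (x \<circ> \<sigma>) (y \<circ> \<sigma>))"
      by (simp add: case_prod_beta')
  qed
qed

text \<open>The column of the nonzero entry varies with the point; by \<open>local_nonzero\<close>
  one column serves a whole closed piece, and countably many pieces suffice.\<close>

lemma dq_pivot_cover:
  assumes dq: "dq (Suc m) K G A" and U: "U \<subseteq> K" "\<And>x. x \<in> U \<Longrightarrow> \<exists>l<Suc m. A m l x x \<noteq> 0"
  obtains C l where "\<And>i. closed (C i)" "U \<subseteq> (\<Union>i::nat. C i)" "\<And>i. l i < Suc m"
    "\<And>i x y. x \<in> K \<inter> C i \<Longrightarrow> y \<in> K \<inter> C i \<Longrightarrow> A m (l i) x y \<noteq> 0"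
proof -
  define P where "P C \<longleftrightarrow> (\<exists>l<Suc m. \<forall>x\<in>K \<inter> C. \<forall>y\<in>K \<inter> C. A m l x y \<noteq> 0)" for C
  have "\<exists>e>0. P (cball x e)" if x: "x \<in> U" for x
  proof -
    obtain l where l: "l < Suc m" "A m l x x \<noteq> 0" using U(2)[OF x] by blast
    have "\<exists>e>0. \<forall>u\<in>K \<inter> cball x e. \<forall>v\<in>K \<inter> cball x e. A m l u v \<noteq> 0"
      by (rule local_nonzero) (use x U(1) l dq_cont[OF dq] in auto)
    then show ?thesis unfolding P_def using l(1) by blast
  qed
  then obtain C :: "nat \<Rightarrow> (nat \<Rightarrow> real) set" where C: "\<And>i. closed (C i)" "\<And>i. P (C i)" "U \<subseteq> (\<Union>i. C i)"
    by (rule countable_closed_cover[of U P]) (auto simp: P_def)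
  obtain l where "\<And>i. l i < Suc m \<and> (\<forall>x\<in>K \<inter> C i. \<forall>y\<in>K \<inter> C i. A m (l i) x y \<noteq> 0)"
    using C(2) unfolding P_def by metis
  then show ?thesis using that[of C l] C by blast
qed

text \<open>The critical set is split by the last row of the Jacobian. Where that row vanishes,
  \<open>sard_flat\<close> applies. Elsewhere one of its entries is locally a pivot, and after
  elimination the Schur complement has determinant 0 too, since its product with the pivot is the
  vanishing determinant; the induction hypothesis then handles every slice.\<close>

theorem sard:
  assumes "dq m K G A" "\<And>x. x \<in> K \<Longrightarrow> dt m (\<lambda>i l. A i l x x) = 0"
  shows "emeasure (leb m) (Gm m G ` K) = 0"
  using assms
proof (induction m arbitrary: K G A)
  case 0
  \<comment> \<open>The determinant of size 0 is 1, so there are no critical points in dimension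
    0.\<close>
  then have "K = {}" by (auto simp: dt_0)
  then show ?case by simp
next
  case (Suc m)
  note dq = Suc.prems(1)
  define K0 where "K0 = {x \<in> K. \<forall>l<Suc m. A m l x x = 0}"
  have K0: "compact K0"
  proof -
    have "closed {x \<in> K. A m l x x = 0}" if "l < Suc m" for l
      using continuous_closed_preimage_constant[OF dq_cont_diag[OF dq _ that, of m] compact_imp_closed[OF dq_compact[OF dq]]] by simp
    then have "closed (\<Inter>l\<in>{..<Suc m}. {x \<in> K. A m l x x = 0})" by (intro closed_INT) auto
    moreover have "K0 = K \<inter> (\<Inter>l\<in>{..<Suc m}. {x \<in> K. A m l x x = 0})" by (auto simp: K0_def)
    ultimately show ?thesis using compact_Int_closed[OF dq_compact[OF dq]] by simp
  qed
  have dq0: "dq (Suc m) K0 G A" by (rule dq_subset[OF dq K0]) (auto simp: K0_def)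
  have null0: "emeasure (leb (Suc m)) (Gm (Suc m) G ` K0) = 0"
    by (rule sard_flat[OF dq0]) (auto simp: K0_def)
  obtain C l where C: "\<And>i. closed (C i)" "K - K0 \<subseteq> (\<Union>i::nat. C i)" "\<And>i. l i < Suc m"
    "\<And>i x y. x \<in> K \<inter> C i \<Longrightarrow> y \<in> K \<inter> C i \<Longrightarrow> A m (l i) x y \<noteq> 0"
    by (rule dq_pivot_cover[OF dq, of "K - K0"]) (auto simp: K0_def)
  have dqC: "dq (Suc m) (K \<inter> C i) G A" for i
    by (rule dq_subset[OF dq]) (use C(1) dq_compact[OF dq] in auto)
  have null: "emeasure (leb (Suc m)) (Gm (Suc m) G ` (K \<inter> C i)) = 0" for i
  proof -
    define \<sigma> where "\<sigma> = Transposition.transpose (l i) m"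
    have li: "l i \<le> m" using C(3)[of i] by simp
    note sw = dq_swap[OF dqC li \<sigma>_def]
    have \<sigma>m: "\<sigma> m = l i" by (simp add: \<sigma>_def)
    define K' where "K' = (\<lambda>x. x \<circ> \<sigma>) ` (K \<inter> C i)"
    define G' where "G' = (\<lambda>i x. G i (x \<circ> \<sigma>))"
    define A' where "A' = (\<lambda>i j x y. A i (\<sigma> j) (x \<circ> \<sigma>) (y \<circ> \<sigma>))"
    have K': "x \<in> K' \<Longrightarrow> x \<circ> \<sigma> \<in> K \<inter> C i" for x using sw(2) by (auto simp: K'_def)
    interpret pivot m K' G' A'
    proof
      show "dq (Suc m) K' G' A'" unfolding K'_def G'_def A'_def by (rule sw(1))
      show "A' m m x y \<noteq> 0" if "x \<in> K'" "y \<in> K'" for x y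
        using C(4)[OF K' K', OF that] by (simp add: A'_def \<sigma>m)
    qed
    have det0: "dt (Suc m) (\<lambda>i j. A' i j x x) = 0" if "x \<in> K'" for x
      using abs_dt_permute_cols[OF sw(3), of "\<lambda>i j. A i j (x \<circ> \<sigma>) (x \<circ> \<sigma>)"] Suc.prems(2)[of "x \<circ> \<sigma>"] K'[OF that]
      by (simp add: A'_def comp_def)
    have "emeasure (leb (Suc m)) (Gm (Suc m) G' ` K') = 0"
    proof (rule sard_pivot, rule Suc.IH[OF dq_slice])
      fix s x assume "x \<in> Ls s"
      then have "T (x(m := s)) \<in> K'" by (auto simp: Ls_def T_in)
      then show "dt m (\<lambda>i l. B s i l x x) = 0"
        unfolding B_def using dt_Schur[of "T (x(m := s))" "T (x(m := s))"] det0 pv by simp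
    qed
    moreover have "Gm (Suc m) G' ` K' = Gm (Suc m) G ` (K \<inter> C i)"
      unfolding K'_def image_image by (rule image_cong) (auto simp: G'_def Gm_def sw(2))
    ultimately show ?thesis by simp
  qed
  have "Gm (Suc m) G ` K \<subseteq> Gm (Suc m) G ` K0 \<union> (\<Union>i. Gm (Suc m) G ` (K \<inter> C i))"
    using C(2) by (auto 4 3)
  moreover have "Gm (Suc m) G ` K0 \<union> (\<Union>i. Gm (Suc m) G ` (K \<inter> C i)) \<in> null_sets (leb (Suc m))"
    using null null0 dq_image_sets[OF dqC] dq_image_sets[OF dq0]
    by (intro null_sets.Un null_sets_UN) (auto intro: null_setsI)
  ultimately have "Gm (Suc m) G ` K \<in> null_sets (leb (Suc m))"
    using dq_image_sets[OF dq] null_sets_subset by blast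
  then show ?case by auto
qed

subsection \<open>Change of variables\<close>

text \<open>Cramer's rule: \<open>E\<close> is the identity with column \<open>l0\<close> replaced
  by \<open>v\<close>, so its determinant is \<open>v l0\<close>, while the product of
  \<open>A\<close> and \<open>E\<close> has a zero column.\<close>

lemma dt_inj:
  assumes "dt m A \<noteq> 0" "\<And>i. i < m \<Longrightarrow> (\<Sum>l<m. A i l * v l) = 0" "l0 < m"
  shows "v l0 = 0"
proof -
  define E where "E i l = (if i = l then 1 else 0) + (v i - (if i = l0 then 1 else 0)) * (if l = l0 then 1 else 0)" for i l
  have "dt m E = 1 + (\<Sum>l<m. (v l - (if l = l0 then 1 else 0)) * (if l = l0 then 1 else 0))"
    unfolding E_def by (rule dt_rank_one)
  also have "(\<Sum>l<m. (v l - (if l = l0 then 1 else 0)) * (if l = l0 then 1 else 0)) = (\<Sum>l<m. if l = l0 then v l0 - 1 else 0)"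
    by (intro sum.cong) auto
  finally have E: "dt m E = v l0" using assms(3) by simp
  have col: "E r l0 = v r" for r by (simp add: E_def)
  have "dt m A * dt m E = dt m (\<lambda>i l. \<Sum>r<m. A i r * E r l)" by (rule dt_mult[symmetric])
  also have "\<dots> = 0"
    by (rule dt_zero_col[OF assms(3)]) (simp add: col assms(2))
  finally show ?thesis using assms(1) E by simp
qed

lemma dq_inj:
  assumes dq: "dq m K G A" and nz: "\<And>x y. x \<in> K \<Longrightarrow> y \<in> K \<Longrightarrow> dt m (\<lambda>i l. A i l x y) \<noteq> 0"
  shows "inj_on (Gm m G) K"
proof (rule inj_onI)
  fix x y assume x: "x \<in> K" and y: "y \<in> K" and eq: "Gm m G x = Gm m G y"
  have xr: "x \<in> rsp m" "y \<in> rsp m" using dq_rsp[OF dq] x y by auto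
  show "x = y"
  proof (rule rsp_eqI[OF xr])
    fix l assume l: "l < m"
    have "x l - y l = 0"
    proof (rule dt_inj[OF nz[OF x y] _ l])
      fix i assume i: "i < m"
      then have "G i x = G i y" using fun_cong[OF eq, of i] by simp
      then show "(\<Sum>l<m. A i l x y * (x l - y l)) = 0" using dq_diff[OF dq i x y] by simp
    qed
    then show "x l = y l" by simp
  qed
qed

lemma leb_permute:
  assumes p: "p permutes {..<m}" and [measurable]: "f \<in> borel_measurable (leb m)"
  shows "(\<integral>\<^sup>+x. f (x \<circ> p) \<partial>leb m) = (\<integral>\<^sup>+x. f x \<partial>leb m)"
proof -
  define P where "P x = (\<lambda>i\<in>{..<m}. x (p i))" for x :: "nat \<Rightarrow> real"
  have pin: "p i < m \<longleftrightarrow> i < m" for i using permutes_in_image[OF p, of i] by simp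
  have P[measurable]: "P \<in> leb m \<rightarrow>\<^sub>M leb m"
    unfolding P_def by (rule measurable_restrict) (use pin in \<open>simp add: measurable_component_singleton\<close>)
  have pge: "p i = i" if "m \<le> i" for i using permutes_not_in[OF p, of i] that by simp
  have eq: "x \<circ> p = P x" if "x \<in> rsp m" for x
    by (rule rsp_eqI[of _ m]) (use that in \<open>auto simp: P_def pin pge rsp_undefined restrict_rsp intro!: rspI\<close>)
  have "distr (leb m) (leb m) P = leb m"
  proof (rule lebp.PiM_eqI)
    fix A :: "nat \<Rightarrow> real set" assume A: "\<And>i. i \<in> {..<m} \<Longrightarrow> A i \<in> sets lborel"
    have invin: "Hilbert_Choice.inv p i < m \<longleftrightarrow> i < m" for i using permutes_in_image[OF permutes_inv[OF p], of i] by simp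
    have "P -` (Pi\<^sub>E {..<m} A) \<inter> space (leb m) = Pi\<^sub>E {..<m} (\<lambda>i. A (Hilbert_Choice.inv p i))"
    proof (intro equalityI subsetI)
      fix x assume "x \<in> P -` (Pi\<^sub>E {..<m} A) \<inter> space (leb m)"
      then have x: "\<And>i. i < m \<Longrightarrow> x (p i) \<in> A i" "x \<in> rsp m" by (auto simp: P_def space_leb PiE_iff)
      have "x i \<in> A (Hilbert_Choice.inv p i)" if "i < m" for i
        using x(1)[of "Hilbert_Choice.inv p i"] that invin permutes_inverses(1)[OF p] by simp
      then show "x \<in> Pi\<^sub>E {..<m} (\<lambda>i. A (Hilbert_Choice.inv p i))" using x(2) by (auto simp: rsp_def PiE_iff)
    next
      fix x assume x: "x \<in> Pi\<^sub>E {..<m} (\<lambda>i. A (Hilbert_Choice.inv p i))"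
      then have "x (p i) \<in> A i" if "i < m" for i
        using PiE_mem[OF x, of "p i"] that pin permutes_inverses(2)[OF p] by simp
      then show "x \<in> P -` (Pi\<^sub>E {..<m} A) \<inter> space (leb m)" using x
        by (auto simp: P_def space_leb rsp_def PiE_iff)
    qed
    then have "emeasure (distr (leb m) (leb m) P) (Pi\<^sub>E {..<m} A) = emeasure (leb m) (Pi\<^sub>E {..<m} (\<lambda>i. A (Hilbert_Choice.inv p i)))"
      using A by (subst emeasure_distr) (auto intro: sets_PiM_I_finite)
    also have "\<dots> = (\<Prod>i<m. emeasure lborel (A (Hilbert_Choice.inv p i)))"
      by (rule lebp.emeasure_PiM) (use A invin in auto)
    also have "\<dots> = (\<Prod>i<m. emeasure lborel (A i))"
      using prod.permute[OF permutes_inv[OF p], of "\<lambda>i. emeasure lborel (A i)"] by (simp add: comp_def)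
    finally show "emeasure (distr (leb m) (leb m) P) (Pi\<^sub>E {..<m} A) = (\<Prod>i\<in>{..<m}. emeasure lborel (A i))" .
  qed auto
  then have "(\<integral>\<^sup>+x. f x \<partial>leb m) = (\<integral>\<^sup>+x. f x \<partial>distr (leb m) (leb m) P)" by simp
  also have "\<dots> = (\<integral>\<^sup>+x. f (P x) \<partial>leb m)" by (rule nn_integral_distr) auto
  also have "\<dots> = (\<integral>\<^sup>+x. f (x \<circ> p) \<partial>leb m)" by (rule nn_integral_cong) (simp add: eq space_leb)
  finally show ?thesis by simp
qed

lemma measurable_on_K:
  assumes "dq m K G A" and [measurable]: "\<phi> \<in> borel_measurable (leb m)"
    and "continuous_on K J"
  shows "(\<lambda>x. indicator K x * (\<phi> (Gm m G x) * ennreal \<bar>J x\<bar>)) \<in> borel_measurable (leb m)"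
proof -
  have K: "K \<in> sets borel" using dq_compact[OF assms(1)] by (rule borel_compact)
  then have [measurable]: "K \<in> sets (leb m)" using dq_rsp[OF assms(1)] by (rule borel_leb)
  have [measurable]: "(\<lambda>x. if x \<in> K then Gm m G x else (\<lambda>i\<in>{..<m}. 0)) \<in> leb m \<rightarrow>\<^sub>M leb m"
    by (rule measurable_if_continuous_on_rsp[OF dq_cont_Gm[OF assms(1)] K]) (rule Gm_rsp)
  have [measurable]: "(\<lambda>x. if x \<in> K then J x else 0) \<in> borel_measurable (leb m)"
    by (rule measurable_if_continuous_on[OF assms(3) K])
  have "(\<lambda>x. indicator K x * (\<phi> (if x \<in> K then Gm m G x else (\<lambda>i\<in>{..<m}. 0)) * ennreal \<bar>if x \<in> K then J x else 0\<bar>))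
      \<in> borel_measurable (leb m)" by measurable
  then show ?thesis by (rule measurable_cong[THEN iffD1, rotated]) (auto simp: indicator_def)
qed

context pivot begin

text \<open>The determinant factors into pivot times Schur determinant. For fixed first coordinates
  the pivot factor is absorbed by a one-dimensional substitution that replaces the last variable by
  the value of the last function; after exchanging the integrations, the Schur factor is handled on
  each slice by the induction hypothesis.\<close>

lemma cov_pivot:
  assumes IH: "\<And>s \<phi>. \<phi> \<in> borel_measurable (leb m) \<Longrightarrow>
      (\<integral>\<^sup>+t. indicator (Ls s) t * (\<phi> (Gm m (H s) t) * ennreal \<bar>dt m (\<lambda>i l. B s i l t t)\<bar>) \<partial>leb m)
      = (\<integral>\<^sup>+c. indicator (Gm m (H s) ` Ls s) c * \<phi> c \<partial>leb m)"
    and \<phi>: "\<phi> \<in> borel_measurable (leb (Suc m))"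
  shows "(\<integral>\<^sup>+x. indicator K x * (\<phi> (Gm (Suc m) G x) * ennreal \<bar>dt (Suc m) (\<lambda>i l. A i l x x)\<bar>) \<partial>leb (Suc m))
      = (\<integral>\<^sup>+c. indicator (Gm (Suc m) G ` K) c * \<phi> c \<partial>leb (Suc m))"
    (is "(\<integral>\<^sup>+x. ?F x \<partial>_) = (\<integral>\<^sup>+c. ?R c \<partial>_)")
proof -
  define F where "F = ?F"
  define J where "J y = dt m (\<lambda>i l. Sch i l (T y) (T y))" for y
  \<comment> \<open>The integrand in the coordinates \<open>psi x\<close>, without the pivot
    factor.\<close>
  define Fh where "Fh y = indicator L y * (\<phi> (Gm (Suc m) G (T y)) * ennreal \<bar>J y\<bar>)" for y
  have ins: "{..<Suc m} = insert m {..<m}" by (rule lessThan_Suc)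
  have L: "L \<in> sets borel" by (rule borel_compact[OF compact_L])
  then have [measurable]: "L \<in> sets (leb (Suc m))" by (rule borel_leb) (auto simp: L_rsp)
  have F_meas: "F \<in> borel_measurable (leb (Suc m))"
    unfolding F_def by (rule measurable_on_K[OF dq \<phi> continuous_on_dt]) (rule dq_cont_diag[OF dq])
  have contJ: "continuous_on L J"
    unfolding J_def by (rule continuous_on_dt, rule cont_Sch[OF cont_T cont_T]) (auto simp: T_in)
  have contGT: "continuous_on L (\<lambda>y. Gm (Suc m) G (T y))"
    by (rule continuous_on_compose2[OF dq_cont_Gm[OF dq] cont_T]) (auto simp: T_in)
  have Fh_meas: "Fh \<in> borel_measurable (leb (Suc m))"
  proof -
    note \<phi>[measurable]
    have [measurable]: "(\<lambda>x. if x \<in> L then Gm (Suc m) G (T x) else (\<lambda>i\<in>{..<Suc m}. 0)) \<in> leb (Suc m) \<rightarrow>\<^sub>M leb (Suc m)"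
      by (rule measurable_if_continuous_on_rsp[OF contGT L]) (rule Gm_rsp)
    have [measurable]: "(\<lambda>x. if x \<in> L then J x else 0) \<in> borel_measurable (leb (Suc m))"
      by (rule measurable_if_continuous_on[OF contJ L])
    have "(\<lambda>x. indicator L x * (\<phi> (if x \<in> L then Gm (Suc m) G (T x) else (\<lambda>i\<in>{..<Suc m}. 0)) * ennreal \<bar>if x \<in> L then J x else 0\<bar>))
      \<in> borel_measurable (leb (Suc m))" by measurable
    then show ?thesis unfolding Fh_def by (rule measurable_cong[THEN iffD1, rotated]) (auto simp: indicator_def)
  qed
  have R_meas: "?R \<in> borel_measurable (leb (Suc m))"
    using \<phi> dq_image_sets[OF dq] by simp
  have upd_meas: "(\<lambda>u. t(m := u)) \<in> lborel \<rightarrow>\<^sub>M leb (Suc m)" if "t \<in> rsp m" for t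
    unfolding ins by (rule measurable_component_update) (use that in \<open>auto simp: space_leb\<close>)
  have upd_meas': "(\<lambda>c. c(m := s)) \<in> leb m \<rightarrow>\<^sub>M leb (Suc m)" for s
    unfolding ins by (rule measurable_fun_upd[where J="{..<m}"]) auto
  have inner: "(\<integral>\<^sup>+u. F (t(m := u)) \<partial>lborel) = (\<integral>\<^sup>+s. Fh (t(m := s)) \<partial>lborel)" if t: "t \<in> rsp m" for t
  proof -
    define S where "S = {u. t(m := u) \<in> K}"
    define g where "g u = G m (t(m := u))" for u
    define g' where "g' u = A m m (t(m := u)) (t(m := u))" for u
    have upd: "continuous_on X (\<lambda>u. t(m := u))" for X
    proof (rule continuous_on_coordinatewise_then_product)
      fix i show "continuous_on X (\<lambda>u. (t(m := u)) i)"
        by (cases "i = m") (auto intro: continuous_on_id)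
    qed
    have S: "compact S"
    proof -
      have "S = (\<lambda>x. x m) ` (K \<inter> {x. \<forall>i\<in>{..<m}. x i = t i})" (is "_ = _ ` (K \<inter> ?E)")
      proof (intro equalityI subsetI)
        fix u assume "u \<in> S"
        then show "u \<in> (\<lambda>x. x m) ` (K \<inter> ?E)" by (auto simp: S_def intro!: image_eqI[where x="t(m := u)"])
      next
        fix u assume "u \<in> (\<lambda>x. x m) ` (K \<inter> ?E)"
        then obtain x where x: "x \<in> K" "\<forall>i<m. x i = t i" "u = x m" by auto
        have "t(m := u) = x"
          by (rule rsp_eqI[OF rsp_upd[OF t] K_rsp[OF x(1)]]) (use x in \<open>auto simp: less_Suc_eq\<close>)
        then show "u \<in> S" using x(1) by (simp add: S_def)
      qed
      also have "compact \<dots>"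
      proof (intro compact_continuous_image continuous_on_coord compact_Int_closed dq_compact[OF dq])
        have "closed {x :: nat \<Rightarrow> real. x i = t i}" for i
          by (rule closed_Collect_eq) (rule continuous_on_product_coordinates continuous_on_const)+
        then have "closed (\<Inter>i\<in>{..<m}. {x :: nat \<Rightarrow> real. x i = t i})" by (intro closed_INT) simp
        also have "(\<Inter>i\<in>{..<m}. {x :: nat \<Rightarrow> real. x i = t i}) = ?E" by auto
        finally show "closed ?E" .
      qed
      finally show ?thesis .
    qed
    have psi_u: "psi (t(m := u)) = t(m := g u)" for u
      by (simp add: psi_def g_def)
    have der: "(g has_field_derivative g' u) (at u within S)" if u: "u \<in> S" for u
      unfolding has_field_derivative_iff
    proof (rule Lim_transform_eventually)
      have "continuous_on S (\<lambda>v. A m m (t(m := v)) (t(m := u)))"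
        by (rule dq_cont_comp[OF dq _ _ upd continuous_on_const]) (use u in \<open>auto simp: S_def\<close>)
      then show "((\<lambda>v. A m m (t(m := v)) (t(m := u))) \<longlongrightarrow> g' u) (at u within S)"
        using u by (simp add: continuous_on_def g'_def)
      have "A m m (t(m := v)) (t(m := u)) = (g v - g u) / (v - u)" if "v \<in> S" "v \<noteq> u" for v
        using dq_diff[OF dq, of m "t(m := v)" "t(m := u)"] that u by (simp add: S_def g_def)
      then show "\<forall>\<^sub>F v in at u within S. A m m (t(m := v)) (t(m := u)) = (g v - g u) / (v - u)"
        by (auto simp: eventually_at_filter)
    qed
    have cont': "continuous_on S g'"
      unfolding g'_def by (rule dq_cont_comp[OF dq _ _ upd upd]) (auto simp: S_def)
    have inj: "inj_on g S"
    proof (rule inj_onI)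
      fix u v assume "u \<in> S" "v \<in> S" "g u = g v"
      then have "t(m := u) = t(m := v)"
        using inj_onD[OF inj_psi, of "t(m := u)" "t(m := v)"] by (simp add: psi_u S_def)
      then show "u = v" by (metis fun_upd_same)
    qed
    have mem: "t(m := s) \<in> L \<longleftrightarrow> s \<in> g ` S" for s
    proof
      assume "t(m := s) \<in> L"
      then obtain x where x: "x \<in> K" "t(m := s) = psi x" by (auto simp: L_def)
      have "x i = t i" if "i < m" for i using fun_cong[OF x(2), of i] that by (simp add: psi_def)
      then have "t(m := x m) = x"
        by (intro rsp_eqI[OF rsp_upd[OF t] K_rsp[OF x(1)]]) (auto simp: less_Suc_eq)
      moreover have "s = G m x" using fun_cong[OF x(2), of m] by (simp add: psi_def)
      ultimately show "s \<in> g ` S" using x(1) by (auto simp: S_def g_def intro!: image_eqI[of _ _ "x m"])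
    next
      assume "s \<in> g ` S"
      then show "t(m := s) \<in> L" by (auto simp: L_def S_def psi_u[symmetric])
    qed
    have "(\<integral>\<^sup>+u. F (t(m := u)) \<partial>lborel) = (\<integral>\<^sup>+u. indicator S u * (Fh (t(m := g u)) * ennreal \<bar>g' u\<bar>) \<partial>lborel)"
    proof (rule nn_integral_cong)
      fix u
      show "F (t(m := u)) = indicator S u * (Fh (t(m := g u)) * ennreal \<bar>g' u\<bar>)"
      proof (cases "u \<in> S")
        case True
        then have K: "t(m := u) \<in> K" by (simp add: S_def)
        have "T (t(m := g u)) = t(m := u)" using T_psi[OF K] by (simp add: psi_u)
        moreover have "t(m := g u) \<in> L" using True mem by blast
        ultimately show ?thesis using True K dt_Schur[OF K K]
          by (simp add: F_def Fh_def J_def g'_def abs_mult ennreal_mult mult_ac)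
      qed (simp add: F_def S_def)
    qed
    also have "\<dots> = (\<integral>\<^sup>+s. indicator (g ` S) s * Fh (t(m := s)) \<partial>lborel)"
      by (rule nn_integral_substitution_compact[OF S der cont' inj])
         (use measurable_compose[OF upd_meas[OF t] Fh_meas] in auto)
    also have "\<dots> = (\<integral>\<^sup>+s. Fh (t(m := s)) \<partial>lborel)"
      by (rule nn_integral_cong) (simp add: Fh_def mem indicator_def)
    finally show ?thesis .
  qed
  have "(\<integral>\<^sup>+x. ?F x \<partial>leb (Suc m)) = (\<integral>\<^sup>+t. (\<integral>\<^sup>+u. F (t(m := u)) \<partial>lborel) \<partial>leb m)"
    unfolding F_def[symmetric] unfolding ins
    by (rule lebp.product_nn_integral_insert) (use F_meas in \<open>auto simp: ins\<close>)
  also have "\<dots> = (\<integral>\<^sup>+t. (\<integral>\<^sup>+s. Fh (t(m := s)) \<partial>lborel) \<partial>leb m)"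
    by (rule nn_integral_cong) (simp add: inner space_leb)
  also have "\<dots> = (\<integral>\<^sup>+y. Fh y \<partial>leb (Suc m))"
    unfolding ins by (rule lebp.product_nn_integral_insert[symmetric]) (use Fh_meas in \<open>auto simp: ins\<close>)
  also have "\<dots> = (\<integral>\<^sup>+s. (\<integral>\<^sup>+t. Fh (t(m := s)) \<partial>leb m) \<partial>lborel)"
    unfolding ins by (rule lebp.product_nn_integral_insert_rev) (use Fh_meas in \<open>auto simp: ins\<close>)
  also have "\<dots> = (\<integral>\<^sup>+s. (\<integral>\<^sup>+c. ?R (c(m := s)) \<partial>leb m) \<partial>lborel)"
  proof (rule nn_integral_cong)
    fix s :: real
    have "(\<integral>\<^sup>+t. Fh (t(m := s)) \<partial>leb m)
        = (\<integral>\<^sup>+t. indicator (Ls s) t * (\<phi> ((Gm m (H s) t)(m := s)) * ennreal \<bar>dt m (\<lambda>i l. B s i l t t)\<bar>) \<partial>leb m)"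
    proof (rule nn_integral_cong)
      fix t assume "t \<in> space (leb m)"
      then have t: "t \<in> rsp m" by (simp add: space_leb)
      show "Fh (t(m := s)) = indicator (Ls s) t * (\<phi> ((Gm m (H s) t)(m := s)) * ennreal \<bar>dt m (\<lambda>i l. B s i l t t)\<bar>)"
        using Gm_slice[of t s] t by (cases "t \<in> Ls s") (auto simp: Fh_def J_def B_def Ls_def)
    qed
    also have "\<dots> = (\<integral>\<^sup>+c. indicator (Gm m (H s) ` Ls s) c * \<phi> (c(m := s)) \<partial>leb m)"
      by (rule IH) (rule measurable_compose[OF upd_meas' \<phi>])
    also have "\<dots> = (\<integral>\<^sup>+c. ?R (c(m := s)) \<partial>leb m)"
      by (rule nn_integral_cong) (simp add: space_leb image_slice indicator_def)
    finally show "(\<integral>\<^sup>+t. Fh (t(m := s)) \<partial>leb m) = (\<integral>\<^sup>+c. ?R (c(m := s)) \<partial>leb m)" .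
  qed
  also have "\<dots> = (\<integral>\<^sup>+c. ?R c \<partial>leb (Suc m))"
    unfolding ins by (rule lebp.product_nn_integral_insert_rev[symmetric]) (use R_meas in \<open>auto simp: ins\<close>)
  finally show ?thesis .
qed

end

text \<open>
  A countable closed cover of \<open>K\<close> suffices: on disjoint pieces the pulled-back indicator of the
  image of a piece is the indicator of the piece, by injectivity.
\<close>

lemma cov_cover:
  assumes dq: "dq m K G A" and inj: "inj_on (Gm m G) K"
    and C: "\<And>i. closed (C i)" "K \<subseteq> (\<Union>i::nat. C i)" and \<phi>[measurable]: "\<phi> \<in> borel_measurable (leb m)"
    and piece: "\<And>i \<psi>. \<psi> \<in> borel_measurable (leb m) \<Longrightarrow>
      (\<integral>\<^sup>+x. indicator (K \<inter> C i) x * (\<psi> (Gm m G x) * ennreal \<bar>dt m (\<lambda>i l. A i l x x)\<bar>) \<partial>leb m)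
      = (\<integral>\<^sup>+c. indicator (Gm m G ` (K \<inter> C i)) c * \<psi> c \<partial>leb m)"
  shows "(\<integral>\<^sup>+x. indicator K x * (\<phi> (Gm m G x) * ennreal \<bar>dt m (\<lambda>i l. A i l x x)\<bar>) \<partial>leb m)
      = (\<integral>\<^sup>+c. indicator (Gm m G ` K) c * \<phi> c \<partial>leb m)"
proof -
  define D where "D i = K \<inter> disjointed C i" for i
  define V where "V i = Gm m G ` D i" for i
  let ?J = "\<lambda>x. dt m (\<lambda>i l. A i l x x)"
  have dqC: "dq m (K \<inter> C i) G A" for i
    by (rule dq_subset[OF dq]) (use C(1) dq_compact[OF dq] in auto)
  have Deq: "D i = (K \<inter> C i) - (\<Union>j<i. K \<inter> C j)" for i
    by (auto simp: D_def disjointed_def)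
  have DK: "D i \<subseteq> K" for i by (auto simp: D_def)
  have UD: "(\<Union>i. D i) = K" using C(2) by (auto simp: D_def UN_disjointed_eq Int_UN_distrib[symmetric] simp del: Int_UN_distrib)
  have disj: "disjoint_family D"
    using disjoint_family_disjointed[of C] by (auto simp: D_def disjoint_family_on_def)
  have Veq: "V i = Gm m G ` (K \<inter> C i) - (\<Union>j<i. Gm m G ` (K \<inter> C j))" for i
    unfolding V_def Deq image_UN[symmetric] by (rule inj_on_image_set_diff[OF inj]) auto
  have V[measurable]: "V i \<in> sets (leb m)" for i
    unfolding Veq using dq_image_sets[OF dqC] by (intro sets.Diff sets.finite_UN) auto
  have memV: "Gm m G x \<in> V i \<longleftrightarrow> x \<in> D i" if "x \<in> K" for x i
    using inj_on_image_mem_iff[OF inj that DK[of i]] by (simp add: V_def)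
  have contJ: "continuous_on K ?J" by (rule continuous_on_dt) (rule dq_cont_diag[OF dq])
  have VK: "(\<Union>i. V i) = Gm m G ` K" using UD by (auto simp: V_def)
  have disjV: "disjoint_family V"
    using disj inj_on_image_Int[OF inj DK DK] unfolding V_def disjoint_family_on_def by (metis image_empty)
  have ind: "indicator (\<Union>i. X i) x = (\<Sum>i. indicator (X i) x :: ennreal)" if "disjoint_family X" for X :: "nat \<Rightarrow> (nat \<Rightarrow> real) set" and x
    using suminf_indicator[OF that, of x] by simp
  have "(\<integral>\<^sup>+x. indicator K x * (\<phi> (Gm m G x) * ennreal \<bar>?J x\<bar>) \<partial>leb m)
      = (\<integral>\<^sup>+x. (\<Sum>i. indicator K x * (indicator (V i) (Gm m G x) * \<phi> (Gm m G x) * ennreal \<bar>?J x\<bar>)) \<partial>leb m)"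
  proof (rule nn_integral_cong)
    fix x
    show "indicator K x * (\<phi> (Gm m G x) * ennreal \<bar>?J x\<bar>)
        = (\<Sum>i. indicator K x * (indicator (V i) (Gm m G x) * \<phi> (Gm m G x) * ennreal \<bar>?J x\<bar>))"
    proof (cases "x \<in> K")
      case True
      have "(\<Sum>i. indicator (V i) (Gm m G x) * (\<phi> (Gm m G x) * ennreal \<bar>?J x\<bar>))
          = indicator (Gm m G ` K) (Gm m G x) * (\<phi> (Gm m G x) * ennreal \<bar>?J x\<bar>)"
        unfolding ennreal_suminf_multc ind[OF disjV, symmetric] VK ..
      then show ?thesis using True by (simp add: mult_ac)
    qed simp
  qed
  also have "\<dots> = (\<Sum>i. \<integral>\<^sup>+x. indicator K x * (indicator (V i) (Gm m G x) * \<phi> (Gm m G x) * ennreal \<bar>?J x\<bar>) \<partial>leb m)"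
    by (intro nn_integral_suminf measurable_on_K[OF dq _ contJ, where \<phi>="\<lambda>c. indicator (V i) c * \<phi> c" for i]) auto
  also have "\<dots> = (\<Sum>i. \<integral>\<^sup>+c. indicator (V i) c * \<phi> c \<partial>leb m)"
  proof (rule suminf_cong)
    fix i
    have "(\<integral>\<^sup>+x. indicator K x * (indicator (V i) (Gm m G x) * \<phi> (Gm m G x) * ennreal \<bar>?J x\<bar>) \<partial>leb m)
        = (\<integral>\<^sup>+x. indicator (K \<inter> C i) x * ((indicator (V i) (Gm m G x) * \<phi> (Gm m G x)) * ennreal \<bar>?J x\<bar>) \<partial>leb m)"
    proof (rule nn_integral_cong)
      fix x
      show "indicator K x * (indicator (V i) (Gm m G x) * \<phi> (Gm m G x) * ennreal \<bar>?J x\<bar>)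
          = indicator (K \<inter> C i) x * ((indicator (V i) (Gm m G x) * \<phi> (Gm m G x)) * ennreal \<bar>?J x\<bar>)"
        using memV[of x i] by (cases "x \<in> K"; cases "x \<in> D i") (auto simp: Deq)
    qed
    also have "\<dots> = (\<integral>\<^sup>+c. indicator (Gm m G ` (K \<inter> C i)) c * (indicator (V i) c * \<phi> c) \<partial>leb m)"
      by (rule piece) simp
    also have "\<dots> = (\<integral>\<^sup>+c. indicator (V i) c * \<phi> c \<partial>leb m)"
      by (rule nn_integral_cong) (auto simp: Veq indicator_def)
    finally show "(\<integral>\<^sup>+x. indicator K x * (indicator (V i) (Gm m G x) * \<phi> (Gm m G x) * ennreal \<bar>?J x\<bar>) \<partial>leb m)
        = (\<integral>\<^sup>+c. indicator (V i) c * \<phi> c \<partial>leb m)" .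
  qed
  also have "\<dots> = (\<integral>\<^sup>+c. (\<Sum>i. indicator (V i) c * \<phi> c) \<partial>leb m)"
    by (intro nn_integral_suminf[symmetric]) simp
  also have "\<dots> = (\<integral>\<^sup>+c. indicator (Gm m G ` K) c * \<phi> c \<partial>leb m)"
    unfolding ennreal_suminf_multc ind[OF disjV, symmetric] VK ..
  finally show ?thesis .
qed

text \<open>The determinant is assumed nonzero at all pairs of points: this gives injectivity by
  \<open>dq_inj\<close> and passes to the slices by \<open>dt_Schur\<close>, which keeps the
  induction going. Laplace expansion along the last row shows that each point has a usable pivot,
  and \<open>cov_cover\<close> glues the pieces.\<close>

theorem change_of_variables:
  assumes "dq m K G A" "\<And>x y. x \<in> K \<Longrightarrow> y \<in> K \<Longrightarrow> dt m (\<lambda>i l. A i l x y) \<noteq> 0"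
    "\<phi> \<in> borel_measurable (leb m)"
  shows "(\<integral>\<^sup>+x. indicator K x * (\<phi> (Gm m G x) * ennreal \<bar>dt m (\<lambda>i l. A i l x x)\<bar>) \<partial>leb m)
      = (\<integral>\<^sup>+c. indicator (Gm m G ` K) c * \<phi> c \<partial>leb m)"
  using assms
proof (induction m arbitrary: K G A \<phi>)
  case 0
  have "K \<subseteq> {\<lambda>_. undefined}" using dq_rsp[OF 0(1)] by (simp add: rsp_def)
  moreover have "Gm 0 G x = (\<lambda>_. undefined)" for x by (simp add: Gm_def restrict_def)
  moreover have "x = (\<lambda>_. undefined)" if "x \<in> space (leb 0)" for x
    using that by (simp add: space_PiM)
  ultimately show ?case
    by (intro nn_integral_cong) (auto simp: indicator_def image_iff Bex_def dest!: subsetD)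
next
  case (Suc m)
  note dq = Suc.prems(1) and \<phi> = Suc.prems(3)
  have "\<exists>l<Suc m. A m l x x \<noteq> 0" if "x \<in> K" for x
  proof (rule ccontr)
    assume "\<not> ?thesis"
    then have "dt (Suc m) (\<lambda>i l. A i l x x) = 0" by (subst dt_laplace_row[of m]) auto
    then show False using Suc.prems(2) that by blast
  qed
  then obtain C l where C: "\<And>i. closed (C i)" "K \<subseteq> (\<Union>i::nat. C i)" "\<And>i. l i < Suc m"
    "\<And>i x y. x \<in> K \<inter> C i \<Longrightarrow> y \<in> K \<inter> C i \<Longrightarrow> A m (l i) x y \<noteq> 0"
    by (rule dq_pivot_cover[OF dq subset_refl]) auto
  have dqC: "dq (Suc m) (K \<inter> C i) G A" for i
    by (rule dq_subset[OF dq]) (use C(1) dq_compact[OF dq] in auto)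
  show ?case
  proof (rule cov_cover[OF dq dq_inj[OF dq Suc.prems(2)] C(1,2) \<phi>])
    fix i :: nat and \<psi> :: "(nat \<Rightarrow> real) \<Rightarrow> ennreal" assume \<psi>: "\<psi> \<in> borel_measurable (leb (Suc m))"
    define \<sigma> where "\<sigma> = Transposition.transpose (l i) m"
    have li: "l i \<le> m" using C(3)[of i] by simp
    note sw = dq_swap[OF dqC li \<sigma>_def]
    have \<sigma>m: "\<sigma> m = l i" by (simp add: \<sigma>_def)
    define K' where "K' = (\<lambda>x. x \<circ> \<sigma>) ` (K \<inter> C i)"
    define G' where "G' = (\<lambda>i x. G i (x \<circ> \<sigma>))"
    define A' where "A' = (\<lambda>i j x y. A i (\<sigma> j) (x \<circ> \<sigma>) (y \<circ> \<sigma>))"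
    have K': "x \<in> K' \<longleftrightarrow> x \<circ> \<sigma> \<in> K \<inter> C i" for x
      using sw(2) unfolding K'_def by (metis (no_types, lifting) imageE image_eqI)
    interpret pivot m K' G' A'
    proof
      show "dq (Suc m) K' G' A'" unfolding K'_def G'_def A'_def by (rule sw(1))
      show "A' m m x y \<noteq> 0" if "x \<in> K'" "y \<in> K'" for x y
        using C(4)[of "x \<circ> \<sigma>" i "y \<circ> \<sigma>"] that by (simp add: A'_def \<sigma>m K')
    qed
    have det: "\<bar>dt (Suc m) (\<lambda>i j. A' i j x y)\<bar> = \<bar>dt (Suc m) (\<lambda>i j. A i j (x \<circ> \<sigma>) (y \<circ> \<sigma>))\<bar>" for x y
      unfolding A'_def by (rule abs_dt_permute_cols[OF sw(3)])
    have Gm': "Gm (Suc m) G' x = Gm (Suc m) G (x \<circ> \<sigma>)" for x by (simp add: G'_def Gm_def)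
    have im: "Gm (Suc m) G' ` K' = Gm (Suc m) G ` (K \<inter> C i)"
      unfolding K'_def image_image Gm' by (rule image_cong) (auto simp: sw(2))
    let ?f = "\<lambda>x. indicator (K \<inter> C i) x * (\<psi> (Gm (Suc m) G x) * ennreal \<bar>dt (Suc m) (\<lambda>i j. A i j x x)\<bar>)"
    have f: "?f \<in> borel_measurable (leb (Suc m))"
      by (rule measurable_on_K[OF dqC \<psi> continuous_on_dt]) (rule dq_cont_diag[OF dqC])
    have "(\<integral>\<^sup>+x. ?f x \<partial>leb (Suc m)) = (\<integral>\<^sup>+x. ?f (x \<circ> \<sigma>) \<partial>leb (Suc m))"
      by (rule leb_permute[OF sw(3) f, symmetric])
    also have "\<dots> = (\<integral>\<^sup>+x. indicator K' x * (\<psi> (Gm (Suc m) G' x) * ennreal \<bar>dt (Suc m) (\<lambda>i j. A' i j x x)\<bar>) \<partial>leb (Suc m))"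
      unfolding det Gm' by (rule nn_integral_cong) (simp add: indicator_def K')
    also have "\<dots> = (\<integral>\<^sup>+c. indicator (Gm (Suc m) G' ` K') c * \<psi> c \<partial>leb (Suc m))"
    proof (rule cov_pivot[OF Suc.IH[OF dq_slice] \<psi>])
      fix s x y assume "x \<in> Ls s" "y \<in> Ls s"
      then have xy: "T (x(m := s)) \<in> K'" "T (y(m := s)) \<in> K'" by (auto simp: Ls_def T_in)
      then have "dt (Suc m) (\<lambda>i l. A i l (T (x(m := s)) \<circ> \<sigma>) (T (y(m := s)) \<circ> \<sigma>)) \<noteq> 0"
        by (intro Suc.prems(2)) (blast dest: K'[THEN iffD1])+
      then have "dt (Suc m) (\<lambda>i l. A' i l (T (x(m := s))) (T (y(m := s)))) \<noteq> 0"
        using det[of "T (x(m := s))" "T (y(m := s))"] by (metis abs_eq_0)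
      then show "dt m (\<lambda>i l. B s i l x y) \<noteq> 0"
        unfolding B_def using dt_Schur[OF xy] by auto
    qed
    finally show "(\<integral>\<^sup>+x. ?f x \<partial>leb (Suc m)) = (\<integral>\<^sup>+c. indicator (Gm (Suc m) G ` (K \<inter> C i)) c * \<psi> c \<partial>leb (Suc m))"
      unfolding im .
  qed
qed

subsection \<open>The area formula\<close>

text \<open>The version for a single function on the whole space. It is closed under products and
  linear combinations, so polynomials have such quotients. They are not unique off the
  diagonal.\<close>

definition dqf :: "nat \<Rightarrow> ((nat \<Rightarrow> real) \<Rightarrow> real) \<Rightarrow> (nat \<Rightarrow> (nat \<Rightarrow> real) \<Rightarrow> (nat \<Rightarrow> real) \<Rightarrow> real) \<Rightarrow> bool" where
  "dqf m f A \<longleftrightarrow> (\<forall>x\<in>rsp m. \<forall>y\<in>rsp m. f x - f y = (\<Sum>l<m. A l x y * (x l - y l))) \<and>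
     (\<forall>l<m. continuous_on (rsp m \<times> rsp m) (\<lambda>z. A l (fst z) (snd z)))"

lemma dqfD: "dqf m f A \<Longrightarrow> x \<in> rsp m \<Longrightarrow> y \<in> rsp m \<Longrightarrow> f x - f y = (\<Sum>l<m. A l x y * (x l - y l))"
  and dqf_cont: "dqf m f A \<Longrightarrow> l < m \<Longrightarrow> continuous_on (rsp m \<times> rsp m) (\<lambda>z. A l (fst z) (snd z))"
  by (auto simp: dqf_def)

lemma dqf_cont_comp:
  assumes "dqf m f A" "l < m" "continuous_on S g" "continuous_on S h" "g ` S \<subseteq> rsp m" "h ` S \<subseteq> rsp m"
  shows "continuous_on S (\<lambda>x. A l (g x) (h x))"
  using continuous_on_compose2[OF dqf_cont[OF assms(1,2)] continuous_on_Pair[OF assms(3,4)]] assms(5,6)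
  by auto

lemma dqf_cont_self:
  assumes "dqf m f A"
  shows "continuous_on (rsp m) f"
proof -
  have y: "(\<lambda>i\<in>{..<m}. 0) \<in> rsp m" by (rule restrict_rsp)
  have "continuous_on (rsp m) (\<lambda>x. f (\<lambda>i\<in>{..<m}. 0) + (\<Sum>l<m. A l x (\<lambda>i\<in>{..<m}. 0) * (x l - (\<lambda>i\<in>{..<m}. 0) l)))"
    by (intro continuous_on_add continuous_on_sum continuous_on_mult continuous_on_diff continuous_on_const
        continuous_on_coord dqf_cont_comp[OF assms] continuous_on_id) (use y in auto)
  then show ?thesis
    by (rule continuous_on_eq) (use dqfD[OF assms _ y] in \<open>simp add: algebra_simps\<close>)
qed

lemma dqf_const: "dqf m (\<lambda>x. c) (\<lambda>l x y. 0)"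
  by (simp add: dqf_def)

lemma dqf_coord: "j < m \<Longrightarrow> dqf m (\<lambda>x. x j) (\<lambda>l x y. if l = j then 1 else 0)"
proof -
  assume j: "j < m"
  have "x j - y j = (\<Sum>l<m. (if l = j then 1 else 0) * (x l - y l))" for x y :: "nat \<Rightarrow> real"
  proof -
    have "(\<Sum>l<m. (if l = j then 1 else 0) * (x l - y l)) = (\<Sum>l<m. if l = j then x j - y j else 0)"
      by (intro sum.cong) auto
    then show ?thesis using j by simp
  qed
  then show ?thesis by (simp add: dqf_def)
qed

lemma dqf_mult:
  assumes "dqf m f A" "dqf m g B"
  shows "dqf m (\<lambda>x. f x * g x) (\<lambda>l x y. f x * B l x y + A l x y * g y)"
  unfolding dqf_def
proof (intro conjI allI impI ballI)
  fix x y assume xy: "x \<in> rsp m" "y \<in> rsp m"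
  have "f x * g x - f y * g y = f x * (g x - g y) + (f x - f y) * g y" by (simp add: algebra_simps)
  also have "\<dots> = (\<Sum>l<m. (f x * B l x y + A l x y * g y) * (x l - y l))"
    unfolding dqfD[OF assms(1) xy] dqfD[OF assms(2) xy]
    by (simp add: sum_distrib_left sum_distrib_right sum.distrib[symmetric] algebra_simps)
  finally show "f x * g x - f y * g y = (\<Sum>l<m. (f x * B l x y + A l x y * g y) * (x l - y l))" .
next
  fix l assume l: "l < m"
  have "continuous_on (rsp m \<times> rsp m) (\<lambda>z. f (fst z))" "continuous_on (rsp m \<times> rsp m) (\<lambda>z. g (snd z))"
    by (rule continuous_on_compose2[OF dqf_cont_self[OF assms(1)] continuous_on_fst[OF continuous_on_id]]
             continuous_on_compose2[OF dqf_cont_self[OF assms(2)] continuous_on_snd[OF continuous_on_id]]; auto)+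
  then show "continuous_on (rsp m \<times> rsp m) (\<lambda>z. f (fst z) * B l (fst z) (snd z) + A l (fst z) (snd z) * g (snd z))"
    by (intro continuous_on_add continuous_on_mult dqf_cont[OF assms(1) l] dqf_cont[OF assms(2) l])
qed

lemma dqf_prod:
  assumes "finite S" "\<And>a. a \<in> S \<Longrightarrow> \<exists>A. dqf m (f a) A"
  shows "\<exists>A. dqf m (\<lambda>x. \<Prod>a\<in>S. f a x) A"
  using assms
proof (induction S)
  case empty
  then show ?case using dqf_const[of m 1] by auto
next
  case (insert a S)
  then obtain A B where "dqf m (f a) A" "dqf m (\<lambda>x. \<Prod>a\<in>S. f a x) B" by blast
  from dqf_mult[OF this] show ?case using insert.hyps by auto
qed

lemma dqf_power: "dqf m f A \<Longrightarrow> \<exists>B. dqf m (\<lambda>x. f x ^ n) B"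
  using dqf_prod[of "{..<n}" m "\<lambda>_. f"] by auto

lemma dqf_lincomb:
  assumes "\<And>a. a \<in> S \<Longrightarrow> dqf m (p a) (A a)"
  shows "dqf m (\<lambda>x. \<Sum>a\<in>S. c a * p a x) (\<lambda>l x y. \<Sum>a\<in>S. c a * A a l x y)"
  unfolding dqf_def
proof (intro conjI allI impI ballI)
  fix x y assume xy: "x \<in> rsp m" "y \<in> rsp m"
  have "(\<Sum>a\<in>S. c a * p a x) - (\<Sum>a\<in>S. c a * p a y) = (\<Sum>a\<in>S. c a * (p a x - p a y))"
    by (simp add: sum_subtractf right_diff_distrib)
  also have "\<dots> = (\<Sum>a\<in>S. \<Sum>l<m. c a * A a l x y * (x l - y l))"
    using dqfD[OF assms xy] by (simp add: sum_distrib_left mult_ac)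
  also have "\<dots> = (\<Sum>l<m. (\<Sum>a\<in>S. c a * A a l x y) * (x l - y l))"
    by (subst sum.swap) (simp add: sum_distrib_right)
  finally show "(\<Sum>a\<in>S. c a * p a x) - (\<Sum>a\<in>S. c a * p a y) = (\<Sum>l<m. (\<Sum>a\<in>S. c a * A a l x y) * (x l - y l))" .
qed (intro continuous_on_sum continuous_on_mult continuous_on_const dqf_cont[OF assms])

text \<open>Ties arbitrary difference quotients to calculus: on the diagonal they are the partial
  derivatives, whichever quotients were chosen.\<close>

lemma dqf_deriv:
  assumes f: "dqf m f A" and t: "t \<in> rsp m"
  shows "((\<lambda>s. f (\<lambda>l\<in>{..<m}. t l + s * C l)) has_field_derivative (\<Sum>l<m. A l t t * C l)) (at 0)"
  unfolding has_field_derivative_iff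
proof (rule Lim_transform_eventually)
  define g where "g s = (\<lambda>l\<in>{..<m}. t l + s * C l)" for s :: real
  have g0: "g 0 = t" by (rule rsp_eqI[OF _ t]) (auto simp: g_def restrict_rsp)
  have g: "g s \<in> rsp m" for s by (simp add: g_def restrict_rsp)
  have contg: "continuous_on UNIV g"
  proof (rule continuous_on_coordinatewise_then_product)
    fix i show "continuous_on UNIV (\<lambda>s. g s i)"
      by (cases "i < m") (auto simp: g_def intro!: continuous_intros)
  qed
  have "continuous_on UNIV (\<lambda>s. \<Sum>l<m. A l (g s) t * C l)"
    by (intro continuous_on_sum continuous_on_mult continuous_on_const dqf_cont_comp[OF f] contg) (use g t in auto)
  then show "((\<lambda>s. \<Sum>l<m. A l (g s) t * C l) \<longlongrightarrow> (\<Sum>l<m. A l t t * C l)) (at 0)"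
    using continuous_on_eq_continuous_at[OF open_UNIV] unfolding isCont_def g0[symmetric] by blast
  have "(\<Sum>l<m. A l (g s) t * C l) = (f (g s) - f (g 0)) / (s - 0)" if "s \<noteq> 0" for s
  proof -
    have "f (g s) - f t = (\<Sum>l<m. A l (g s) t * (g s l - t l))" by (rule dqfD[OF f g t])
    also have "\<dots> = s * (\<Sum>l<m. A l (g s) t * C l)" by (simp add: g_def sum_distrib_left mult_ac)
    finally show ?thesis using that by (simp add: g0)
  qed
  then show "\<forall>\<^sub>F s in at 0. (\<Sum>l<m. A l (g s) t * C l) =
      (f (\<lambda>l\<in>{..<m}. t l + s * C l) - f (\<lambda>l\<in>{..<m}. t l + 0 * C l)) / (s - 0)"
    unfolding g_def[symmetric] by (auto simp: eventually_at_filter)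
qed

definition rbox :: "nat \<Rightarrow> real \<Rightarrow> (nat \<Rightarrow> real) set" where
  "rbox m r = (\<Pi>\<^sub>E i\<in>{..<m}. {- r..r})"

lemma rbox_rsp: "rbox m r \<subseteq> rsp m"
  unfolding rbox_def rsp_def by (rule PiE_mono) simp

lemma rbox_iff: "x \<in> rsp m \<Longrightarrow> x \<in> rbox m r \<longleftrightarrow> (\<forall>i<m. \<bar>x i\<bar> \<le> r)"
  by (simp add: rbox_def rsp_def PiE_iff abs_le_iff minus_le_iff) blast

lemma compact_rbox: "compact (rbox m r)"
proof -
  \<comment> \<open>Tychonoff's theorem applies to a product over all naturals, hence the factors
    {0} beyond \<open>m\<close>; restriction then turns those coordinates into
    \<open>undefined\<close>.\<close>
  let ?B = "\<Pi>\<^sub>E i\<in>UNIV. if i < m then {- r..r} else {0 :: real}"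
  have "rbox m r = (\<lambda>x. restrict x {..<m}) ` ?B"
  proof (intro equalityI subsetI)
    fix x assume x: "x \<in> rbox m r"
    have "x = restrict (\<lambda>i. if i < m then x i else 0) {..<m}"
      using x rbox_rsp by (intro rsp_eqI[OF _ restrict_rsp]) auto
    moreover have "(\<lambda>i. if i < m then x i else 0) \<in> ?B"
      using PiE_mem[OF x[unfolded rbox_def]] by (simp add: PiE_iff)
    ultimately show "x \<in> (\<lambda>x. restrict x {..<m}) ` ?B" by blast
  next
    fix x assume "x \<in> (\<lambda>x. restrict x {..<m}) ` ?B"
    then obtain y where y: "y \<in> ?B" "x = restrict y {..<m}" by blast
    have "y i \<in> {- r..r}" if "i < m" for i using PiE_mem[OF y(1), of i] that by simp
    then show "x \<in> rbox m r" unfolding y(2) rbox_def by simp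
  qed
  also have "compact \<dots>"
  proof (rule compact_continuous_image)
    show "continuous_on ?B (\<lambda>x. restrict x {..<m})"
    proof (rule continuous_on_coordinatewise_then_product)
      fix i show "continuous_on ?B (\<lambda>y. restrict y {..<m} i)"
        by (cases "i < m") (auto intro: continuous_on_coord)
    qed
    have "compactin (product_topology (\<lambda>i. euclidean) UNIV) ?B"
      by (subst compactin_PiE) auto
    then show "compact ?B" by (simp add: euclidean_product_topology)
  qed
  finally show ?thesis .
qed

lemma rsp_eq_UN_rbox: "rsp m = (\<Union>r::nat. rbox m (real r))"
proof (intro equalityI subsetI)
  fix x assume x: "x \<in> rsp m"
  obtain r :: nat where r: "(\<Sum>i<m. \<bar>x i\<bar>) \<le> real r" using real_arch_simple by blast
  have "\<bar>x i\<bar> \<le> real r" if "i < m" for i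
    using member_le_sum[of i "{..<m}" "\<lambda>i. \<bar>x i\<bar>"] that r by auto
  then have "x \<in> rbox m (real r)" using x by (simp add: rbox_iff)
  then show "x \<in> (\<Union>r::nat. rbox m (real r))" by blast
qed (use rbox_rsp in blast)

lemma dq_of_dqf:
  assumes "\<And>i. i < m \<Longrightarrow> dqf m (G i) (A i)" "compact K" "K \<subseteq> rsp m"
  shows "dq m K G A"
  unfolding dq_def case_prod_beta'
proof (intro conjI allI impI ballI assms(2,3))
  fix i l assume "i < m" "l < m"
  then show "continuous_on (K \<times> K) (\<lambda>z. A i l (fst z) (snd z))"
    using dqf_cont[OF assms(1), of i l] assms(3) by (rule_tac continuous_on_subset) auto
qed (use dqfD[OF assms(1)] assms(3) in blast)

lemma dqf_measurable_Gm:
  assumes "\<And>i. i < m \<Longrightarrow> dqf m (G i) (A i)"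
  shows "Gm m G \<in> leb m \<rightarrow>\<^sub>M leb m"
proof -
  have "continuous_on (rsp m) (Gm m G)"
  proof (rule continuous_on_coordinatewise_then_product)
    fix i show "continuous_on (rsp m) (\<lambda>x. Gm m G x i)"
      by (cases "i < m") (auto simp: Gm_def intro: dqf_cont_self[OF assms])
  qed
  from measurable_if_continuous_on_rsp[OF this _ Gm_rsp, of m]
  show ?thesis by (rule measurable_cong[THEN iffD1, rotated]) (auto simp: space_leb closed_rsp)
qed

lemma dqf_sard:
  assumes "\<And>i. i < m \<Longrightarrow> dqf m (G i) (A i)" "closed Z" "Z \<subseteq> rsp m"
    "\<And>x. x \<in> Z \<Longrightarrow> dt m (\<lambda>i l. A i l x x) = 0"
  shows "Gm m G ` Z \<in> null_sets (leb m)"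
proof -
  have cZ: "compact (Z \<inter> rbox m r)" for r
    using compact_Int_closed[OF compact_rbox assms(2)] by (simp add: Int_commute)
  have dq: "dq m (Z \<inter> rbox m r) G A" for r
    by (rule dq_of_dqf[OF assms(1) cZ]) (use assms(3) in auto)
  have "Gm m G ` (Z \<inter> rbox m r) \<in> null_sets (leb m)" for r
    using sard[OF dq, of r] assms(4) dq_image_sets[OF dq, of r] by (auto intro!: null_setsI)
  then have "(\<Union>r::nat. Gm m G ` (Z \<inter> rbox m (real r))) \<in> null_sets (leb m)"
    by (intro null_sets_UN) auto
  also have "(\<Union>r::nat. Gm m G ` (Z \<inter> rbox m (real r))) = Gm m G ` Z"
    using assms(3) rsp_eq_UN_rbox[of m] by blast
  finally show ?thesis .
qed

text \<open>Freezing coordinate \<open>j\<close> at 0 leaves the map unchanged on the hyperplane but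
  makes column \<open>j\<close> of the Jacobian zero. Every point becomes critical and Sard's
  theorem applies.\<close>

lemma dqf_hyperplane_null:
  assumes dqf: "\<And>i. i < m \<Longrightarrow> dqf m (G i) (A i)" and j: "j < m"
  shows "Gm m G ` {x \<in> rsp m. x j = 0} \<in> null_sets (leb m)"
proof -
  define P :: "(nat \<Rightarrow> real) \<Rightarrow> nat \<Rightarrow> real" where "P x = x(j := 0)" for x
  define G' where "G' i x = G i (P x)" for i x
  define A' where "A' i l x y = (if l = j then 0 else A i l (P x) (P y))" for i l x y
  have P: "P x \<in> rsp m" if "x \<in> rsp m" for x
    using j by (intro rspI) (auto simp: P_def rsp_undefined[OF that])
  have contP: "continuous_on S P" for S
  proof (rule continuous_on_coordinatewise_then_product)
    fix i show "continuous_on S (\<lambda>x. P x i)" by (cases "i = j") (auto simp: P_def intro: continuous_on_coord)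
  qed
  have dqf': "dqf m (G' i) (A' i)" if i: "i < m" for i
    unfolding dqf_def
  proof (intro conjI ballI allI impI)
    fix x y assume xy: "x \<in> rsp m" "y \<in> rsp m"
    show "G' i x - G' i y = (\<Sum>l<m. A' i l x y * (x l - y l))"
      unfolding G'_def dqfD[OF dqf[OF i] P[OF xy(1)] P[OF xy(2)]]
      by (rule sum.cong) (auto simp: A'_def P_def)
  next
    fix l assume l: "l < m"
    have "continuous_on (rsp m \<times> rsp m) (\<lambda>z. A i l (P (fst z)) (P (snd z)))"
      by (rule dqf_cont_comp[OF dqf[OF i] l continuous_on_compose2[OF contP[of UNIV] continuous_on_fst[OF continuous_on_id]]
            continuous_on_compose2[OF contP[of UNIV] continuous_on_snd[OF continuous_on_id]]]) (auto simp: P)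
    then show "continuous_on (rsp m \<times> rsp m) (\<lambda>z. A' i l (fst z) (snd z))"
      by (cases "l = j") (auto simp: A'_def)
  qed
  have cl: "closed {x :: nat \<Rightarrow> real. x j = 0}"
    by (rule closed_Collect_eq) (rule continuous_on_product_coordinates continuous_on_const)+
  have "Gm m G' ` (rsp m \<inter> {x. x j = 0}) \<in> null_sets (leb m)"
    by (rule dqf_sard[OF dqf' closed_Int[OF closed_rsp cl]]) (auto intro!: dt_zero_col[OF j] simp: A'_def)
  also have "Gm m G' ` (rsp m \<inter> {x. x j = 0}) = Gm m G ` {x \<in> rsp m. x j = 0}"
    by (intro image_cong) (auto simp: G'_def Gm_def P_def fun_upd_idem)
  finally show ?thesis .
qed

text \<open>Outside the critical set, countably many compact pieces on which the map is injective
  are made disjoint; the number of preimages of \<open>c\<close> is then the number of pieces whose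
  image contains \<open>c\<close>, and \<open>change_of_variables\<close> applies to each. Critical
  points drop out on both sides: their values form a null set, and the determinant vanishes at
  them.\<close>

theorem area_formula:
  assumes dqf: "\<And>i. i < m \<Longrightarrow> dqf m (G i) (A i)" and \<phi>[measurable]: "\<phi> \<in> borel_measurable (leb m)"
  shows "(\<integral>\<^sup>+c. \<phi> c * emeasure (count_space UNIV) {x \<in> rsp m. Gm m G x = c} \<partial>leb m)
      = (\<integral>\<^sup>+x. \<phi> (Gm m G x) * ennreal \<bar>dt m (\<lambda>i l. A i l x x)\<bar> \<partial>leb m)"
proof -
  let ?J = "\<lambda>x. dt m (\<lambda>i l. A i l x x)"
  define Z where "Z = {x \<in> rsp m. ?J x = 0}"
  have contJ: "continuous_on (rsp m) ?J"
    by (intro continuous_on_dt dqf_cont_comp[OF dqf] continuous_on_id) auto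
  have contJ2: "continuous_on (rsp m \<times> rsp m) (\<lambda>z. dt m (\<lambda>i l. A i l (fst z) (snd z)))"
    by (intro continuous_on_dt dqf_cont[OF dqf])
  have Z: "closed Z" unfolding Z_def
    by (rule continuous_closed_preimage_constant[OF contJ closed_rsp])
  have nullZ: "Gm m G ` Z \<in> null_sets (leb m)"
    by (rule dqf_sard[OF dqf Z]) (auto simp: Z_def)
  \<comment> \<open>Boundedness makes the pieces compact, and the determinant condition at all pairs
    makes the map injective on them.\<close>
  define P where "P C \<longleftrightarrow> (\<exists>r. rsp m \<inter> C \<subseteq> rbox m r) \<and> (\<forall>x\<in>rsp m \<inter> C. \<forall>y\<in>rsp m \<inter> C. dt m (\<lambda>i l. A i l x y) \<noteq> 0)" for C
  have "\<exists>e>0. P (cball x e)" if x: "x \<in> rsp m - Z" for x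
  proof -
    obtain e where e: "e > 0" "\<forall>u\<in>rsp m \<inter> cball x e. \<forall>v\<in>rsp m \<inter> cball x e. dt m (\<lambda>i l. A i l u v) \<noteq> 0"
      using local_nonzero[OF _ contJ2, of x] x by (auto simp: Z_def)
    obtain r :: nat where r: "x \<in> rbox m (real r)" using x rsp_eq_UN_rbox[of m] by auto
    let ?V = "\<Inter>i\<in>{..<m}. {y :: nat \<Rightarrow> real. \<bar>y i\<bar> < real r + 1}"
    have "open {y :: nat \<Rightarrow> real. \<bar>y i\<bar> < real r + 1}" for i
      by (rule open_Collect_less) (intro continuous_on_rabs continuous_on_coord, rule continuous_on_const)
    then have "open ?V" by (intro open_INT) auto
    moreover have "x \<in> ?V" using r rbox_iff[of x m "real r"] x by (auto intro: le_less_trans)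
    ultimately obtain e' where e': "e' > 0" "cball x e' \<subseteq> ?V" unfolding open_contains_cball by blast
    have "rsp m \<inter> cball x e' \<subseteq> rbox m (real r + 1)"
    proof
      fix y assume y: "y \<in> rsp m \<inter> cball x e'"
      then have "\<bar>y i\<bar> < real r + 1" if "i < m" for i using e'(2) that by blast
      then show "y \<in> rbox m (real r + 1)" using y by (simp add: rbox_iff less_imp_le)
    qed
    then have "P (cball x (min e e'))" unfolding P_def using e(2) by (intro conjI exI[of _ "real r + 1"]) auto
    then show ?thesis using e(1) e'(1) by (intro exI[of _ "min e e'"]) auto
  qed
  moreover have "P {}" by (auto simp: P_def)
  ultimately obtain C :: "nat \<Rightarrow> (nat \<Rightarrow> real) set"
    where C: "\<And>i. closed (C i)" "\<And>i. P (C i)" "rsp m - Z \<subseteq> (\<Union>i. C i)"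
    using countable_closed_cover[of "rsp m - Z" P] by blast
  define K where "K i = rsp m \<inter> C i" for i
  have Kc: "compact (K i)" for i
  proof -
    obtain r where "K i \<subseteq> rbox m r" using C(2)[of i] by (auto simp: P_def K_def)
    then have "K i = rbox m r \<inter> (rsp m \<inter> C i)" by (auto simp: K_def)
    then show ?thesis using compact_Int_closed[OF compact_rbox closed_Int[OF closed_rsp C(1)]] by metis
  qed
  have nz: "dt m (\<lambda>i l. A i l x y) \<noteq> 0" if "x \<in> K i" "y \<in> K i" for x y i
    using C(2)[of i] that by (auto simp: P_def K_def)
  have Krsp: "K i \<subseteq> rsp m" for i by (auto simp: K_def)
  have dq: "dq m (K i) G A" for i by (rule dq_of_dqf[OF dqf Kc Krsp])
  have inj: "inj_on (Gm m G) (K i)" for i by (rule dq_inj[OF dq nz])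
  define D where "D i = K i - (\<Union>j<i. K j)" for i
  define V where "V i = Gm m G ` D i" for i
  have DK: "D i \<subseteq> K i" for i by (auto simp: D_def)
  have UD: "(\<Union>i. D i) = rsp m - Z"
  proof -
    have "(\<Union>i. D i) = (\<Union>i. K i)" using UN_disjointed_eq[of K] by (simp add: D_def disjointed_def atLeast0LessThan)
    also have "\<dots> = rsp m - Z" using C(3) nz by (auto simp: K_def Z_def)
    finally show ?thesis .
  qed
  have disj: "disjoint_family D"
  proof -
    have "D = disjointed K" by (rule ext) (simp add: D_def disjointed_def atLeast0LessThan)
    then show ?thesis using disjoint_family_disjointed[of K] by simp
  qed
  have Dm[measurable]: "D i \<in> sets (leb m)" for i
    unfolding D_def using compact_leb[OF Kc Krsp] by (intro sets.Diff sets.finite_UN) auto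
  have V[measurable]: "V i \<in> sets (leb m)" for i
  proof -
    have "V i = Gm m G ` K i - Gm m G ` (K i \<inter> (\<Union>j<i. K j))"
      unfolding V_def D_def by (subst inj_on_image_set_diff[OF inj[of i], symmetric]) (auto simp: Diff_Int)
    moreover have "dq m (K i \<inter> (\<Union>j<i. K j)) G A"
      by (rule dq_subset[OF dq]) (intro compact_Int Kc compact_UN, auto intro: Kc)
    ultimately show ?thesis using dq_image_sets[OF dq, of i] dq_image_sets by auto
  qed
  have memV: "Gm m G x \<in> V i \<longleftrightarrow> x \<in> D i" if "x \<in> K i" for x i
    using inj_on_image_mem_iff[OF inj that DK] by (simp add: V_def)
  have Gm_meas[measurable]: "Gm m G \<in> leb m \<rightarrow>\<^sub>M leb m" by (rule dqf_measurable_Gm[OF dqf])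
  have J_meas[measurable]: "?J \<in> borel_measurable (leb m)"
    using measurable_if_continuous_on[OF contJ, of m]
    by (rule measurable_cong[THEN iffD1, rotated]) (auto simp: space_leb closed_rsp)
  have count: "emeasure (count_space UNIV) {x \<in> rsp m. Gm m G x = c} = (\<Sum>i. indicator (V i) c)"
    if c: "c \<notin> Gm m G ` Z" for c
  proof -
    let ?X = "\<lambda>i. {x \<in> D i. Gm m G x = c}"
    have "{x \<in> rsp m. Gm m G x = c} = {x \<in> rsp m - Z. Gm m G x = c}" using c by auto
    also have "\<dots> = (\<Union>i. ?X i)" unfolding UD[symmetric] by auto
    also have "emeasure (count_space UNIV) \<dots> = (\<Sum>i. emeasure (count_space UNIV) (?X i))"
      by (rule suminf_emeasure[symmetric]) (use disj in \<open>auto simp: disjoint_family_on_def\<close>)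
    also have "\<dots> = (\<Sum>i. indicator (V i) c)"
    proof (rule suminf_cong)
      fix i
      show "emeasure (count_space UNIV) (?X i) = indicator (V i) c"
      proof (cases "c \<in> V i")
        case True
        then obtain x where x: "x \<in> D i" "c = Gm m G x" by (auto simp: V_def)
        then have "?X i = {x}" using inj_onD[OF inj[of i]] DK[of i] by blast
        then show ?thesis using True by simp
      next
        case False
        then have "?X i = {}" by (auto simp: V_def)
        then show ?thesis using False by (metis emeasure_empty indicator_simps(2))
      qed
    qed
    finally show ?thesis .
  qed
  have piece: "(\<integral>\<^sup>+x. indicator (D i) x * (\<phi> (Gm m G x) * ennreal \<bar>?J x\<bar>) \<partial>leb m) = (\<integral>\<^sup>+c. indicator (V i) c * \<phi> c \<partial>leb m)" for i
  proof -
    have "(\<integral>\<^sup>+x. indicator (D i) x * (\<phi> (Gm m G x) * ennreal \<bar>?J x\<bar>) \<partial>leb m)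
        = (\<integral>\<^sup>+x. indicator (K i) x * ((indicator (V i) (Gm m G x) * \<phi> (Gm m G x)) * ennreal \<bar>?J x\<bar>) \<partial>leb m)"
    proof (rule nn_integral_cong)
      fix x
      show "indicator (D i) x * (\<phi> (Gm m G x) * ennreal \<bar>?J x\<bar>)
          = indicator (K i) x * ((indicator (V i) (Gm m G x) * \<phi> (Gm m G x)) * ennreal \<bar>?J x\<bar>)"
        using memV[of x i] DK[of i] by (cases "x \<in> K i"; cases "x \<in> D i") auto
    qed
    also have "\<dots> = (\<integral>\<^sup>+c. indicator (Gm m G ` K i) c * (indicator (V i) c * \<phi> c) \<partial>leb m)"
      by (rule change_of_variables[OF dq nz]) auto
    also have "\<dots> = (\<integral>\<^sup>+c. indicator (V i) c * \<phi> c \<partial>leb m)"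
      using DK[of i] by (intro nn_integral_cong) (auto simp: V_def indicator_def)
    finally show ?thesis .
  qed
  have "(\<integral>\<^sup>+c. \<phi> c * emeasure (count_space UNIV) {x \<in> rsp m. Gm m G x = c} \<partial>leb m)
      = (\<integral>\<^sup>+c. (\<Sum>i. indicator (V i) c * \<phi> c) \<partial>leb m)"
  proof (rule nn_integral_cong_AE)
    show "AE c in leb m. \<phi> c * emeasure (count_space UNIV) {x \<in> rsp m. Gm m G x = c} = (\<Sum>i. indicator (V i) c * \<phi> c)"
      using AE_not_in[OF nullZ] by eventually_elim (simp add: count ennreal_suminf_multc mult.commute)
  qed
  also have "\<dots> = (\<Sum>i. \<integral>\<^sup>+c. indicator (V i) c * \<phi> c \<partial>leb m)" by (rule nn_integral_suminf) simp
  also have "\<dots> = (\<Sum>i. \<integral>\<^sup>+x. indicator (D i) x * (\<phi> (Gm m G x) * ennreal \<bar>?J x\<bar>) \<partial>leb m)"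
    by (simp add: piece)
  also have "\<dots> = (\<integral>\<^sup>+x. (\<Sum>i. indicator (D i) x * (\<phi> (Gm m G x) * ennreal \<bar>?J x\<bar>)) \<partial>leb m)"
    by (rule nn_integral_suminf[symmetric]) measurable
  also have "\<dots> = (\<integral>\<^sup>+x. \<phi> (Gm m G x) * ennreal \<bar>?J x\<bar> \<partial>leb m)"
  proof (rule nn_integral_cong)
    fix x assume "x \<in> space (leb m)"
    then have x: "x \<in> rsp m" by (simp add: space_leb)
    have "(\<Sum>i. indicator (D i) x * (\<phi> (Gm m G x) * ennreal \<bar>?J x\<bar>)) = indicator (rsp m - Z) x * (\<phi> (Gm m G x) * ennreal \<bar>?J x\<bar>)"
      unfolding ennreal_suminf_multc UD[symmetric] using suminf_indicator[OF disj, of x] by simp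
    also have "\<dots> = \<phi> (Gm m G x) * ennreal \<bar>?J x\<bar>" using x by (auto simp: Z_def indicator_def)
    finally show "(\<Sum>i. indicator (D i) x * (\<phi> (Gm m G x) * ennreal \<bar>?J x\<bar>)) = \<phi> (Gm m G x) * ennreal \<bar>?J x\<bar>" .
  qed
  finally show ?thesis .
qed

subsection \<open>Gaussian integrals\<close>

abbreviation nrm :: "real \<Rightarrow> real measure" where
  "nrm \<sigma> \<equiv> density lborel (\<lambda>t. ennreal (normal_density 0 \<sigma> t))"

lemma prob_space_nrm: "\<sigma> > 0 \<Longrightarrow> prob_space (nrm \<sigma>)"
  by (rule prob_space_normal_density)

lemma nn_integral_normal_density:
  assumes "\<sigma> > 0" and [measurable]: "h \<in> borel_measurable borel"
  shows "(\<integral>\<^sup>+x. ennreal (normal_density \<mu> \<sigma> x) * h x \<partial>lborel) = (\<integral>\<^sup>+x. h (\<mu> + \<sigma> * x) \<partial>nrm 1)"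
proof -
  have "(\<integral>\<^sup>+x. ennreal (normal_density \<mu> \<sigma> x) * h x \<partial>lborel)
      = ennreal \<bar>\<sigma>\<bar> * (\<integral>\<^sup>+x. ennreal (normal_density \<mu> \<sigma> (\<mu> + \<sigma> * x)) * h (\<mu> + \<sigma> * x) \<partial>lborel)"
    by (rule nn_integral_real_affine) (use assms(1) in auto)
  also have "\<dots> = (\<integral>\<^sup>+x. ennreal (normal_density 0 1 x) * h (\<mu> + \<sigma> * x) \<partial>lborel)"
  proof (subst nn_integral_cmult[symmetric], measurable, rule nn_integral_cong)
    fix x
    have "\<bar>\<sigma>\<bar> * normal_density \<mu> \<sigma> (\<mu> + \<sigma> * x) = normal_density 0 1 x"
      using assms(1) by (simp add: normal_density_def real_sqrt_mult power_mult_distrib)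
    then show "ennreal \<bar>\<sigma>\<bar> * (ennreal (normal_density \<mu> \<sigma> (\<mu> + \<sigma> * x)) * h (\<mu> + \<sigma> * x))
        = ennreal (normal_density 0 1 x) * h (\<mu> + \<sigma> * x)"
      by (simp add: mult.assoc[symmetric] ennreal_mult'[symmetric] del: mult.assoc)
  qed
  also have "\<dots> = (\<integral>\<^sup>+x. h (\<mu> + \<sigma> * x) \<partial>nrm 1)"
    by (rule nn_integral_density[symmetric]) auto
  finally show ?thesis .
qed

lemma nn_integral_nrm:
  assumes "\<sigma> > 0" and [measurable]: "h \<in> borel_measurable borel"
  shows "(\<integral>\<^sup>+x. h x \<partial>nrm \<sigma>) = (\<integral>\<^sup>+x. h (\<sigma> * x) \<partial>nrm 1)"
  using nn_integral_normal_density[OF assms, of 0] by (subst nn_integral_density) auto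

lemma nn_integral_nrm_minus:
  assumes [measurable]: "h \<in> borel_measurable borel"
  shows "(\<integral>\<^sup>+x. h (- x) \<partial>nrm 1) = (\<integral>\<^sup>+x. h x \<partial>nrm 1)"
proof -
  have "(\<integral>\<^sup>+x. h x \<partial>nrm 1) = (\<integral>\<^sup>+x. ennreal (normal_density 0 1 x) * h x \<partial>lborel)"
    by (rule nn_integral_density) auto
  also have "\<dots> = (\<integral>\<^sup>+x. ennreal (normal_density 0 1 (- x)) * h (- x) \<partial>lborel)"
    using nn_integral_real_affine[of "\<lambda>x. ennreal (normal_density 0 1 x) * h x" "-1" 0] by simp
  also have "\<dots> = (\<integral>\<^sup>+x. ennreal (normal_density 0 1 x) * h (- x) \<partial>lborel)"
    by (simp add: normal_density_def)
  also have "\<dots> = (\<integral>\<^sup>+x. h (- x) \<partial>nrm 1)"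
    by (rule nn_integral_density[symmetric]) auto
  finally show ?thesis ..
qed

lemma nn_integral_nrm_abs:
  assumes [measurable]: "h \<in> borel_measurable borel"
  shows "(\<integral>\<^sup>+x. h (\<bar>b\<bar> * x) \<partial>nrm 1) = (\<integral>\<^sup>+x. h (b * x) \<partial>nrm 1)"
  using nn_integral_nrm_minus[of "\<lambda>x. h (b * x)"] by (cases "b \<ge> 0") auto

text \<open>Convolution of two centred normal laws. The cases with a zero coefficient are separate
  because a normal density needs a positive standard deviation.\<close>

lemma nn_integral_nrm_add:
  assumes h[measurable]: "h \<in> borel_measurable borel"
  shows "(\<integral>\<^sup>+x. (\<integral>\<^sup>+y. h (a * x + b * y) \<partial>nrm 1) \<partial>nrm 1) = (\<integral>\<^sup>+z. h (sqrt (a\<^sup>2 + b\<^sup>2) * z) \<partial>nrm 1)"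
proof -
  interpret prob_space "nrm 1" by (rule prob_space_nrm) simp
  consider "a = 0" | "b = 0" | "a \<noteq> 0" "b \<noteq> 0" by blast
  then show ?thesis
  proof cases
    case 1
    then show ?thesis using nn_integral_nrm_abs[OF h, of b] emeasure_space_1 by simp
  next
    case 2
    then show ?thesis using nn_integral_nrm_abs[OF h, of a] emeasure_space_1 by simp
  next
    case 3
    have pos: "\<bar>a\<bar> > 0" "\<bar>b\<bar> > 0" "sqrt (a\<^sup>2 + b\<^sup>2) > 0" using 3 by (auto simp: sum_power2_gt_zero_iff)
    interpret b: prob_space "nrm \<bar>b\<bar>" by (rule prob_space_nrm) (rule pos(2))
    have conv: "(\<integral>\<^sup>+y. ennreal (normal_density 0 \<bar>a\<bar> (x - y) * normal_density 0 \<bar>b\<bar> y) \<partial>lborel)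
        = ennreal (normal_density 0 (sqrt (a\<^sup>2 + b\<^sup>2)) x)" for x
      using fun_cong[OF conv_normal_density_zero_mean[OF pos(1,2)], of x] by simp
    have "(\<integral>\<^sup>+x. (\<integral>\<^sup>+y. h (a * x + b * y) \<partial>nrm 1) \<partial>nrm 1)
        = (\<integral>\<^sup>+x. (\<integral>\<^sup>+y. h (a * x + \<bar>b\<bar> * y) \<partial>nrm 1) \<partial>nrm 1)"
      by (intro nn_integral_cong nn_integral_nrm_abs[of "\<lambda>u. h (a * x + u)" for x, symmetric]) measurable
    also have "\<dots> = (\<integral>\<^sup>+x. (\<integral>\<^sup>+y. h (\<bar>a\<bar> * x + \<bar>b\<bar> * y) \<partial>nrm 1) \<partial>nrm 1)"
      by (rule nn_integral_nrm_abs[of "\<lambda>u. \<integral>\<^sup>+y. h (u + \<bar>b\<bar> * y) \<partial>nrm 1", symmetric]) measurable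
    also have "\<dots> = (\<integral>\<^sup>+x. (\<integral>\<^sup>+y. h (x + \<bar>b\<bar> * y) \<partial>nrm 1) \<partial>nrm \<bar>a\<bar>)"
      by (rule nn_integral_nrm[OF pos(1), symmetric]) measurable
    also have "\<dots> = (\<integral>\<^sup>+x. (\<integral>\<^sup>+y. h (x + y) \<partial>nrm \<bar>b\<bar>) \<partial>nrm \<bar>a\<bar>)"
      by (intro nn_integral_cong nn_integral_nrm[OF pos(2), of "\<lambda>u. h (x + u)" for x, symmetric]) measurable
    also have "\<dots> = (\<integral>\<^sup>+x. ennreal (normal_density 0 \<bar>a\<bar> x) * (\<integral>\<^sup>+y. ennreal (normal_density 0 \<bar>b\<bar> y) * h (x + y) \<partial>lborel) \<partial>lborel)"
      by (subst nn_integral_density, measurable) (intro nn_integral_cong, subst nn_integral_density, auto)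
    also have "\<dots> = (\<integral>\<^sup>+x. (\<integral>\<^sup>+y. ennreal (normal_density 0 \<bar>a\<bar> x * normal_density 0 \<bar>b\<bar> y) * h (x + y) \<partial>lborel) \<partial>lborel)"
      by (intro nn_integral_cong, subst nn_integral_cmult[symmetric]) (auto simp: ennreal_mult mult_ac)
    also have "\<dots> = (\<integral>\<^sup>+y. (\<integral>\<^sup>+x. ennreal (normal_density 0 \<bar>a\<bar> x * normal_density 0 \<bar>b\<bar> y) * h (x + y) \<partial>lborel) \<partial>lborel)"
      by (rule lborel_pair.Fubini'[symmetric]) measurable
    also have "\<dots> = (\<integral>\<^sup>+y. (\<integral>\<^sup>+z. ennreal (normal_density 0 \<bar>a\<bar> (z - y) * normal_density 0 \<bar>b\<bar> y) * h z \<partial>lborel) \<partial>lborel)"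
    proof (rule nn_integral_cong)
      fix y
      show "(\<integral>\<^sup>+x. ennreal (normal_density 0 \<bar>a\<bar> x * normal_density 0 \<bar>b\<bar> y) * h (x + y) \<partial>lborel)
          = (\<integral>\<^sup>+z. ennreal (normal_density 0 \<bar>a\<bar> (z - y) * normal_density 0 \<bar>b\<bar> y) * h z \<partial>lborel)"
        using nn_integral_real_affine[of "\<lambda>x. ennreal (normal_density 0 \<bar>a\<bar> x * normal_density 0 \<bar>b\<bar> y) * h (x + y)" 1 "-y"]
        by (simp add: algebra_simps)
    qed
    also have "\<dots> = (\<integral>\<^sup>+z. (\<integral>\<^sup>+y. ennreal (normal_density 0 \<bar>a\<bar> (z - y) * normal_density 0 \<bar>b\<bar> y) * h z \<partial>lborel) \<partial>lborel)"
      by (rule lborel_pair.Fubini') measurable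
    also have "\<dots> = (\<integral>\<^sup>+z. ennreal (normal_density 0 (sqrt (a\<^sup>2 + b\<^sup>2)) z) * h z \<partial>lborel)"
      by (intro nn_integral_cong, subst nn_integral_multc) (auto simp: conv)
    also have "\<dots> = (\<integral>\<^sup>+z. h (sqrt (a\<^sup>2 + b\<^sup>2) * z) \<partial>nrm 1)"
      using nn_integral_normal_density[OF pos(3) h, of 0] by simp
    finally show ?thesis .
  qed
qed

text \<open>Completing the square in \<open>x\<close>. In terms of conditioning, the first factor on
  the right is the marginal density at \<open>p\<close>, with variance \<kappa>^2 + \<sigma>^2 v^2,
  and the second is the conditional density of \<open>x\<close>.\<close>

lemma normal_density_product:
  fixes v p x :: real
  assumes \<kappa>: "\<kappa> > 0" and \<sigma>: "\<sigma> > 0"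
  defines "K \<equiv> sqrt (\<kappa>\<^sup>2 + \<sigma>\<^sup>2 * v\<^sup>2)"
  shows "normal_density 0 \<kappa> (p + v * x) * normal_density 0 \<sigma> x
    = normal_density 0 K p * normal_density (- p * v * \<sigma>\<^sup>2 / K\<^sup>2) (\<sigma> * \<kappa> / K) x"
proof -
  have K2: "K\<^sup>2 = \<kappa>\<^sup>2 + \<sigma>\<^sup>2 * v\<^sup>2" unfolding K_def by (rule real_sqrt_pow2) (simp add: sum_nonneg)
  have K: "K > 0" unfolding K_def using \<kappa> by (simp add: add_pos_nonneg)
  define k2 s2 where "k2 = \<kappa>\<^sup>2" and "s2 = \<sigma>\<^sup>2"
  have pos: "k2 > 0" "s2 > 0" "k2 + s2 * v\<^sup>2 > 0"
    using \<kappa> \<sigma> K K2 by (auto simp: k2_def s2_def add_pos_nonneg)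
  have "(p + v * x)\<^sup>2 / k2 + x\<^sup>2 / s2 = p\<^sup>2 / (k2 + s2 * v\<^sup>2) + (x + p * v * s2 / (k2 + s2 * v\<^sup>2))\<^sup>2 / (s2 * k2 / (k2 + s2 * v\<^sup>2))"
    using pos by (simp add: divide_simps) (simp add: power2_eq_square algebra_simps)
  then have ex: "(p + v * x)\<^sup>2 / \<kappa>\<^sup>2 + x\<^sup>2 / \<sigma>\<^sup>2 = p\<^sup>2 / K\<^sup>2 + (x - - p * v * \<sigma>\<^sup>2 / K\<^sup>2)\<^sup>2 / (\<sigma> * \<kappa> / K)\<^sup>2"
    unfolding power_divide power_mult_distrib K2 k2_def[symmetric] s2_def[symmetric] by simp
  have c: "sqrt (2 * pi * \<kappa>\<^sup>2) * sqrt (2 * pi * \<sigma>\<^sup>2) = sqrt (2 * pi * K\<^sup>2) * sqrt (2 * pi * (\<sigma> * \<kappa> / K)\<^sup>2)"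
    using K \<kappa> \<sigma> by (simp add: real_sqrt_mult power_divide real_sqrt_divide power_mult_distrib)
  have "normal_density 0 \<kappa> (p + v * x) * normal_density 0 \<sigma> x
      = 1 / (sqrt (2 * pi * \<kappa>\<^sup>2) * sqrt (2 * pi * \<sigma>\<^sup>2)) * exp (- ((p + v * x)\<^sup>2 / \<kappa>\<^sup>2 + x\<^sup>2 / \<sigma>\<^sup>2) / 2)"
    by (simp add: normal_density_def exp_add[symmetric] add_divide_distrib diff_divide_distrib)
  also have "\<dots> = normal_density 0 K p * normal_density (- p * v * \<sigma>\<^sup>2 / K\<^sup>2) (\<sigma> * \<kappa> / K) x"
    unfolding c ex by (simp add: normal_density_def exp_add[symmetric] add_divide_distrib diff_divide_distrib)
  finally show ?thesis .
qed

text \<open>Integrate one variable at a time, completing the square.\<close>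

lemma gauss_two_forms:
  fixes v w \<sigma> :: "'i \<Rightarrow> real"
  assumes "finite S" and \<sigma>: "\<And>a. \<sigma> a > 0" and \<kappa>: "\<kappa> > 0" and h[measurable]: "h \<in> borel_measurable borel"
  defines "V \<equiv> \<Sum>a\<in>S. (\<sigma> a)\<^sup>2 * (v a)\<^sup>2" and "B \<equiv> \<Sum>a\<in>S. (\<sigma> a)\<^sup>2 * (v a * w a)" and "W \<equiv> \<Sum>a\<in>S. (\<sigma> a)\<^sup>2 * (w a)\<^sup>2"
  shows "(\<integral>\<^sup>+X. ennreal (normal_density 0 \<kappa> (p + (\<Sum>a\<in>S. v a * X a))) * h (q + (\<Sum>a\<in>S. w a * X a)) \<partial>(\<Pi>\<^sub>M a\<in>S. nrm (\<sigma> a)))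
    = ennreal (normal_density 0 (sqrt (\<kappa>\<^sup>2 + V)) p) * (\<integral>\<^sup>+z. h (q - B / (\<kappa>\<^sup>2 + V) * p + sqrt (W - B\<^sup>2 / (\<kappa>\<^sup>2 + V)) * z) \<partial>nrm 1)"
  unfolding V_def B_def W_def
  using \<open>finite S\<close>
proof (induction S arbitrary: p q rule: finite_induct)
  case empty
  have "prob_space (nrm 1)" by (rule prob_space_nrm) simp
  moreover have "(\<Pi>\<^sub>M a\<in>{}. nrm (\<sigma> a)) = count_space {\<lambda>_. undefined}" by (rule PiM_empty)
  ultimately show ?case using \<kappa> prob_space.emeasure_space_1[of "nrm 1"] by (simp add: nn_integral_count_space_finite)
next
  case (insert a S)
  interpret product_sigma_finite "\<lambda>a. nrm (\<sigma> a)"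
    using prob_space_nrm[OF \<sigma>] by (intro product_sigma_finite.intro prob_space_imp_sigma_finite)
  interpret nrm1: prob_space "nrm 1" by (rule prob_space_nrm) simp
  define V B W where "V = (\<Sum>a\<in>S. (\<sigma> a)\<^sup>2 * (v a)\<^sup>2)" and "B = (\<Sum>a\<in>S. (\<sigma> a)\<^sup>2 * (v a * w a))" and "W = (\<Sum>a\<in>S. (\<sigma> a)\<^sup>2 * (w a)\<^sup>2)"
  define K2 where "K2 = \<kappa>\<^sup>2 + V"
  define s where "s = sqrt (W - B\<^sup>2 / K2)"
  have V0: "V \<ge> 0" and W0: "W \<ge> 0" by (auto simp: V_def W_def intro!: sum_nonneg)
  have K2: "K2 > 0" using \<kappa> V0 by (simp add: K2_def add_pos_nonneg)
  \<comment> \<open>Cauchy-Schwarz makes the number under the root in \<open>s\<close> nonnegative,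
    so \<open>s\<close> is the conditional standard deviation of the second form.\<close>
  have "B\<^sup>2 \<le> V * W"
    using Cauchy_Schwarz_ineq_sum[of "\<lambda>a. \<sigma> a * v a" "\<lambda>a. \<sigma> a * w a" S]
    by (simp add: V_def B_def W_def power_mult_distrib power2_eq_square mult_ac)
  also have "\<dots> \<le> K2 * W" using W0 \<kappa> by (intro mult_right_mono) (auto simp: K2_def)
  finally have s2: "s\<^sup>2 = W - B\<^sup>2 / K2" unfolding s_def using K2 by (subst real_sqrt_pow2) (auto simp: field_simps)
  define k where "k = sqrt K2"
  have k: "k > 0" "k\<^sup>2 = K2" using K2 by (auto simp: k_def)
  let ?\<sigma> = "\<sigma> a" and ?v = "v a" and ?w = "w a"
  define L2 where "L2 = K2 + ?\<sigma>\<^sup>2 * ?v\<^sup>2"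
  have L2: "L2 > 0" using K2 by (simp add: L2_def add_pos_nonneg)
  have pr: "normal_density 0 k (p + ?v * x) * normal_density 0 ?\<sigma> x
      = normal_density 0 (sqrt L2) p * normal_density (- p * ?v * ?\<sigma>\<^sup>2 / L2) (?\<sigma> * k / sqrt L2) x" for x
    using normal_density_product[OF k(1) \<sigma>[of a], of p ?v x] L2 by (simp add: k(2) L2_def)
  \<comment> \<open>Minus the regression coefficient of the second form on the first form with added
    noise of variance \<kappa>^2.\<close>
  define b where "b = - B / K2"
  define \<mu> \<tau> where "\<mu> = - p * ?v * ?\<sigma>\<^sup>2 / L2" and "\<tau> = ?\<sigma> * k / sqrt L2"
  have \<tau>: "\<tau> > 0" using \<sigma>[of a] k(1) L2 by (simp add: \<tau>_def)
  let ?F = "\<lambda>X. ennreal (normal_density 0 \<kappa> (p + (\<Sum>a\<in>insert a S. v a * X a))) * h (q + (\<Sum>a\<in>insert a S. w a * X a))"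
  have "(\<integral>\<^sup>+X. ?F X \<partial>(\<Pi>\<^sub>M a\<in>insert a S. nrm (\<sigma> a))) = (\<integral>\<^sup>+x. (\<integral>\<^sup>+X. ?F (X(a := x)) \<partial>(\<Pi>\<^sub>M a\<in>S. nrm (\<sigma> a))) \<partial>nrm ?\<sigma>)"
  proof (rule product_nn_integral_insert_rev[OF insert.hyps])
    have [measurable]: "(\<lambda>X. X b) \<in> (\<Pi>\<^sub>M a\<in>insert a S. nrm (\<sigma> a)) \<rightarrow>\<^sub>M borel" if "b \<in> insert a S" for b
      using measurable_component_singleton[OF that, of "\<lambda>a. nrm (\<sigma> a)"] by (simp cong: measurable_cong_sets)
    show "?F \<in> borel_measurable (\<Pi>\<^sub>M a\<in>insert a S. nrm (\<sigma> a))"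
      by measurable
  qed
  also have "\<dots> = (\<integral>\<^sup>+x. (\<integral>\<^sup>+X. ennreal (normal_density 0 \<kappa> ((p + ?v * x) + (\<Sum>a\<in>S. v a * X a))) * h ((q + ?w * x) + (\<Sum>a\<in>S. w a * X a)) \<partial>(\<Pi>\<^sub>M a\<in>S. nrm (\<sigma> a))) \<partial>nrm ?\<sigma>)"
  proof (intro nn_integral_cong)
    fix x X
    have "(\<Sum>b\<in>insert a S. f b * (X(a := x)) b) = f a * x + (\<Sum>b\<in>S. f b * X b)" for f :: "'i \<Rightarrow> real"
      using insert.hyps by (auto intro!: sum.cong)
    then show "?F (X(a := x)) = ennreal (normal_density 0 \<kappa> ((p + ?v * x) + (\<Sum>a\<in>S. v a * X a))) * h ((q + ?w * x) + (\<Sum>a\<in>S. w a * X a))"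
      by (simp add: add.assoc)
  qed
  also have "\<dots> = (\<integral>\<^sup>+x. ennreal (normal_density 0 k (p + ?v * x)) * (\<integral>\<^sup>+z. h ((q + ?w * x) + b * (p + ?v * x) + s * z) \<partial>nrm 1) \<partial>nrm ?\<sigma>)"
    unfolding insert.IH by (simp add: V_def[symmetric] B_def[symmetric] W_def[symmetric] K2_def[symmetric] s_def[symmetric] k_def[symmetric] b_def)
  also have "\<dots> = (\<integral>\<^sup>+x. ennreal (normal_density 0 ?\<sigma> x) * (ennreal (normal_density 0 k (p + ?v * x)) * (\<integral>\<^sup>+z. h ((q + ?w * x) + b * (p + ?v * x) + s * z) \<partial>nrm 1)) \<partial>lborel)"
    by (rule nn_integral_density) measurable
  also have "\<dots> = (\<integral>\<^sup>+x. ennreal (normal_density 0 (sqrt L2) p) * (ennreal (normal_density \<mu> \<tau> x) * (\<integral>\<^sup>+z. h ((q + ?w * x) + b * (p + ?v * x) + s * z) \<partial>nrm 1)) \<partial>lborel)"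
  proof (rule nn_integral_cong)
    fix x
    have "ennreal (normal_density 0 ?\<sigma> x) * ennreal (normal_density 0 k (p + ?v * x)) = ennreal (normal_density 0 (sqrt L2) p) * ennreal (normal_density \<mu> \<tau> x)"
      using pr[of x] by (simp add: ennreal_mult[symmetric] \<mu>_def \<tau>_def mult.commute)
    then show "ennreal (normal_density 0 ?\<sigma> x) * (ennreal (normal_density 0 k (p + ?v * x)) * (\<integral>\<^sup>+z. h ((q + ?w * x) + b * (p + ?v * x) + s * z) \<partial>nrm 1))
        = ennreal (normal_density 0 (sqrt L2) p) * (ennreal (normal_density \<mu> \<tau> x) * (\<integral>\<^sup>+z. h ((q + ?w * x) + b * (p + ?v * x) + s * z) \<partial>nrm 1))"
      by (simp only: mult.assoc[symmetric])
  qed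
  also have "\<dots> = ennreal (normal_density 0 (sqrt L2) p) * (\<integral>\<^sup>+x. ennreal (normal_density \<mu> \<tau> x) * (\<integral>\<^sup>+z. h ((q + ?w * x) + b * (p + ?v * x) + s * z) \<partial>nrm 1) \<partial>lborel)"
    by (rule nn_integral_cmult) measurable
  also have "(\<integral>\<^sup>+x. ennreal (normal_density \<mu> \<tau> x) * (\<integral>\<^sup>+z. h ((q + ?w * x) + b * (p + ?v * x) + s * z) \<partial>nrm 1) \<partial>lborel)
      = (\<integral>\<^sup>+y. (\<integral>\<^sup>+z. h ((q + ?w * (\<mu> + \<tau> * y)) + b * (p + ?v * (\<mu> + \<tau> * y)) + s * z) \<partial>nrm 1) \<partial>nrm 1)"
    by (rule nn_integral_normal_density[OF \<tau>]) measurable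
  also have "\<dots> = (\<integral>\<^sup>+y. (\<integral>\<^sup>+z. h ((q + b * p + (?w + b * ?v) * \<mu>) + (((?w + b * ?v) * \<tau>) * y + s * z)) \<partial>nrm 1) \<partial>nrm 1)"
    by (simp add: algebra_simps)
  also have "\<dots> = (\<integral>\<^sup>+z. h ((q + b * p + (?w + b * ?v) * \<mu>) + sqrt (((?w + b * ?v) * \<tau>)\<^sup>2 + s\<^sup>2) * z) \<partial>nrm 1)"
    by (rule nn_integral_nrm_add) measurable
  also have "q + b * p + (?w + b * ?v) * \<mu> = q - (B + ?\<sigma>\<^sup>2 * (?v * ?w)) / L2 * p"
    using K2 L2 unfolding b_def \<mu>_def L2_def by (simp add: divide_simps) (simp add: algebra_simps power2_eq_square)
  also have "((?w + b * ?v) * \<tau>)\<^sup>2 + s\<^sup>2 = (W + ?\<sigma>\<^sup>2 * ?w\<^sup>2) - (B + ?\<sigma>\<^sup>2 * (?v * ?w))\<^sup>2 / L2"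
  proof -
    have t2: "\<tau>\<^sup>2 = ?\<sigma>\<^sup>2 * K2 / L2" using L2 by (simp add: \<tau>_def power_divide power_mult_distrib k(2))
    show ?thesis unfolding s2 power_mult_distrib t2 b_def L2_def using K2 L2[unfolded L2_def]
      by (simp add: divide_simps) (simp add: algebra_simps power2_eq_square)
  qed
  finally show ?case using insert.hyps
    by (simp add: V_def[symmetric] B_def[symmetric] W_def[symmetric] L2_def K2_def add_ac)
qed

text \<open>The first absolute moment of the standard normal law, sqrt(2 / pi). It enters E(n,
  \<delta>) and all reduced expectations through the same factor.\<close>

definition m1 :: ennreal where "m1 = (\<integral>\<^sup>+z. ennreal \<bar>z\<bar> \<partial>nrm 1)"

lemma m1_scale: "(\<integral>\<^sup>+z. ennreal \<bar>s * z\<bar> \<partial>nrm 1) = ennreal \<bar>s\<bar> * m1"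
  unfolding m1_def by (subst nn_integral_cmult[symmetric]) (auto simp: abs_mult ennreal_mult)

text \<open>The case of \<open>gauss_two_forms\<close> with vanishing first form: the density factor
  becomes a nonzero finite constant, which cancels.\<close>

lemma gauss_linear_form:
  assumes "finite S" "\<And>a. \<sigma> a > 0" and h[measurable]: "h \<in> borel_measurable borel"
  shows "(\<integral>\<^sup>+X. h (\<Sum>a\<in>S. w a * X a) \<partial>(\<Pi>\<^sub>M a\<in>S. nrm (\<sigma> a))) = (\<integral>\<^sup>+z. h (sqrt (\<Sum>a\<in>S. (\<sigma> a)\<^sup>2 * (w a)\<^sup>2) * z) \<partial>nrm 1)"
proof -
  have [measurable]: "(\<lambda>X. X b) \<in> (\<Pi>\<^sub>M a\<in>S. nrm (\<sigma> a)) \<rightarrow>\<^sub>M borel" if "b \<in> S" for b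
    using measurable_component_singleton[OF that, of "\<lambda>a. nrm (\<sigma> a)"] by (simp cong: measurable_cong_sets)
  let ?c = "ennreal (normal_density 0 1 0)"
  have c: "?c \<noteq> 0" "?c \<noteq> \<top>" using normal_density_pos[of 1 0 0] by auto
  have "?c * (\<integral>\<^sup>+X. h (\<Sum>a\<in>S. w a * X a) \<partial>(\<Pi>\<^sub>M a\<in>S. nrm (\<sigma> a)))
      = ?c * (\<integral>\<^sup>+z. h (sqrt (\<Sum>a\<in>S. (\<sigma> a)\<^sup>2 * (w a)\<^sup>2) * z) \<partial>nrm 1)"
    using gauss_two_forms[where S=S and \<sigma>=\<sigma> and \<kappa>=1 and h=h and v="\<lambda>_. 0" and w=w and p=0 and q=0] assms
    by (subst nn_integral_cmult[symmetric]) auto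
  then show ?thesis using c by (simp add: ennreal_mult_cancel_left)
qed

lemma m1_pos: "m1 > 0" and m1_finite: "m1 < \<top>"
proof -
  have "integrable lborel (\<lambda>x. std_normal_density x * \<bar>x\<bar> ^ (2 * 0 + 1))"
    using std_normal_moment_abs_odd[of 0] by (auto simp: has_bochner_integral_iff)
  then have "integrable lborel (\<lambda>x. std_normal_density x * \<bar>x\<bar>)" by simp
  then have "(\<integral>\<^sup>+x. ennreal (std_normal_density x * \<bar>x\<bar>) \<partial>lborel) < \<top>"
    by (subst nn_integral_eq_integral) auto
  then show "m1 < \<top>" unfolding m1_def by (subst nn_integral_density) (auto simp: ennreal_mult)
  have "m1 \<noteq> 0"
  proof
    assume "m1 = 0"
    then have "(\<integral>\<^sup>+x. ennreal (std_normal_density x * \<bar>x\<bar>) \<partial>lborel) = 0"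
      unfolding m1_def by (subst (asm) nn_integral_density) (auto simp: ennreal_mult)
    then have "AE x in lborel. ennreal (std_normal_density x * \<bar>x\<bar>) = 0"
      by (subst (asm) nn_integral_0_iff_AE) auto
    then have "AE x in lborel. x = (0::real)"
    proof eventually_elim
      case (elim x)
      then show ?case using normal_density_pos[of 1 0 x] by (auto simp: ennreal_eq_0_iff mult_le_0_iff)
    qed
    moreover have "AE x in lborel. x \<noteq> (0::real)" by (rule AE_lborel_singleton)
    ultimately have "AE x in (lborel :: real measure). False" by eventually_elim simp
    then have "(UNIV :: real set) \<in> null_sets lborel" by (subst AE_iff_null_sets) auto
    then show False by (simp add: null_sets_def)
  qed
  then show "m1 > 0" by (simp add: zero_less_iff_neq_zero)
qed

subsection \<open>Determinants with independent Gaussian rows\<close>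

lemma dt_row_expand:
  assumes "i < N"
  shows "dt N (\<lambda>r l. if r = i then \<rho> l else R r l) = (\<Sum>l<N. \<rho> l * cof N R i l)"
  by (subst dt_laplace_row[OF assms]) (auto intro!: sum.cong arg_cong2[where f="(*)"] cof_cong_row)

text \<open>
  The mean absolute determinant depends on the law of a row \<open>\<rho>\<close> only through the numbers
  \<open>E \<bar>\<rho> \<cdot> C\<bar>\<close>, because the determinant is linear in that row.
\<close>

lemma nn_integral_det_rows_cong:
  fixes M :: "nat \<Rightarrow> 'a measure" and M' :: "nat \<Rightarrow> 'b measure"
  assumes fin: "finite I" and I: "I \<subseteq> {..<N}"
    and sf: "\<And>i. sigma_finite_measure (M i)" "\<And>i. sigma_finite_measure (M' i)"
    and meas: "\<And>i l. i \<in> I \<Longrightarrow> l < N \<Longrightarrow> (\<lambda>\<theta>. \<rho> i \<theta> l) \<in> borel_measurable (M i)"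
      "\<And>i l. i \<in> I \<Longrightarrow> l < N \<Longrightarrow> (\<lambda>\<theta>. \<rho>' i \<theta> l) \<in> borel_measurable (M' i)"
    and eq: "\<And>i C. i \<in> I \<Longrightarrow> (\<integral>\<^sup>+\<theta>. ennreal \<bar>\<Sum>l<N. \<rho> i \<theta> l * C l\<bar> \<partial>M i) = (\<integral>\<^sup>+\<theta>. ennreal \<bar>\<Sum>l<N. \<rho>' i \<theta> l * C l\<bar> \<partial>M' i)"
  shows "(\<integral>\<^sup>+\<theta>. ennreal \<bar>dt N (\<lambda>r l. if r \<in> I then \<rho> r (\<theta> r) l else X r l)\<bar> \<partial>PiM I M)
       = (\<integral>\<^sup>+\<theta>. ennreal \<bar>dt N (\<lambda>r l. if r \<in> I then \<rho>' r (\<theta> r) l else X r l)\<bar> \<partial>PiM I M')"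
  using fin I meas eq
\<comment> \<open>\<open>X\<close> also carries the rows that were already switched to the second
  law, so it has to vary: in each step row \<open>i\<close> is switched first and then becomes part
  of \<open>X\<close>.\<close>
proof (induction I arbitrary: X rule: finite_induct)
  case empty
  interpret product_sigma_finite M by (intro product_sigma_finite.intro sf)
  interpret M': product_sigma_finite M' by (intro product_sigma_finite.intro sf)
  show ?case by (simp add: PiM_empty nn_integral_count_space_finite)
next
  case (insert i I)
  interpret product_sigma_finite M by (intro product_sigma_finite.intro sf)
  interpret M': product_sigma_finite M' by (intro product_sigma_finite.intro sf)
  interpret I: finite_product_sigma_finite M I by standard (rule insert.hyps)
  interpret I': finite_product_sigma_finite M' I by standard (rule insert.hyps)
  note [measurable] = insert.prems(2,3)
  have iN: "i < N" using insert.prems(1) by auto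
  have ri: "r \<noteq> i" if "r \<in> I" for r using that insert.hyps by auto
  let ?F1 = "\<lambda>X \<theta>. ennreal \<bar>dt N (\<lambda>r l. if r \<in> insert i I then \<rho> r (\<theta> r) l else X r l)\<bar>"
  let ?F2 = "\<lambda>X \<theta>. ennreal \<bar>dt N (\<lambda>r l. if r \<in> insert i I then \<rho>' r (\<theta> r) l else X r l)\<bar>"
  let ?E1 = "\<lambda>X \<theta>. ennreal \<bar>dt N (\<lambda>r l. if r \<in> I then \<rho> r (\<theta> r) l else X r l)\<bar>"
  let ?E2 = "\<lambda>X \<theta>. ennreal \<bar>dt N (\<lambda>r l. if r \<in> I then \<rho>' r (\<theta> r) l else X r l)\<bar>"
  have m1: "?F1 X \<in> borel_measurable (PiM (insert i I) M)"
  proof (intro measurable_compose[OF _ measurable_ennreal] borel_measurable_abs dt_measurable)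
    fix r l assume "r < N" "l < N"
    then show "(\<lambda>\<theta>. if r \<in> insert i I then \<rho> r (\<theta> r) l else X r l) \<in> borel_measurable (PiM (insert i I) M)"
      by (cases "r \<in> insert i I") (auto intro: measurable_compose[OF measurable_component_singleton] insert.prems)
  qed
  have m2: "?F2 X \<in> borel_measurable (PiM (insert i I) M')"
  proof (intro measurable_compose[OF _ measurable_ennreal] borel_measurable_abs dt_measurable)
    fix r l assume "r < N" "l < N"
    then show "(\<lambda>\<theta>. if r \<in> insert i I then \<rho>' r (\<theta> r) l else X r l) \<in> borel_measurable (PiM (insert i I) M')"
      by (cases "r \<in> insert i I") (auto intro: measurable_compose[OF measurable_component_singleton] insert.prems)
  qed
  have m3: "(\<lambda>p. ?E1 (X(i := \<rho>' i (snd p))) (fst p)) \<in> borel_measurable (PiM I M \<Otimes>\<^sub>M M' i)"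
  proof (intro measurable_compose[OF _ measurable_ennreal] borel_measurable_abs dt_measurable)
    fix r l assume "r < N" and l: "l < N"
    have "(\<lambda>p. \<rho> r (fst p r) l) \<in> borel_measurable (PiM I M \<Otimes>\<^sub>M M' i)" if "r \<in> I"
      using that l by (intro measurable_compose[OF measurable_compose[OF measurable_fst measurable_component_singleton]] insert.prems) auto
    moreover have "(\<lambda>p. \<rho>' i (snd p) l) \<in> borel_measurable (PiM I M \<Otimes>\<^sub>M M' i)"
      using l by (intro measurable_compose[OF measurable_snd] insert.prems) auto
    ultimately show "(\<lambda>p. if r \<in> I then \<rho> r (fst p r) l else (X(i := \<rho>' i (snd p))) r l) \<in> borel_measurable (PiM I M \<Otimes>\<^sub>M M' i)"
      by (cases "r \<in> I"; cases "r = i") auto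
  qed
  have row: "(\<integral>\<^sup>+y. ?F1 X (\<theta>(i := y)) \<partial>M i) = (\<integral>\<^sup>+y. ?E1 (X(i := \<rho>' i y)) \<theta> \<partial>M' i)" for \<theta>
  proof -
    define R where "R = (\<lambda>r l. if r \<in> I then \<rho> r (\<theta> r) l else X r l)"
    have one: "?F1 X (\<theta>(i := y)) = ennreal \<bar>\<Sum>l<N. \<rho> i y l * cof N R i l\<bar>" for y
      unfolding dt_row_expand[OF iN, symmetric] R_def
      by (intro arg_cong[where f=ennreal] arg_cong[where f=abs] dt_cong) (auto simp: ri)
    have two: "?E1 (X(i := \<rho>' i y)) \<theta> = ennreal \<bar>\<Sum>l<N. \<rho>' i y l * cof N R i l\<bar>" for y
      unfolding dt_row_expand[OF iN, symmetric] R_def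
      using insert.hyps by (intro arg_cong[where f=ennreal] arg_cong[where f=abs] dt_cong) auto
    show ?thesis unfolding one two by (rule insert.prems(4)) simp
  qed
  have "(\<integral>\<^sup>+\<theta>. ?F1 X \<theta> \<partial>PiM (insert i I) M) = (\<integral>\<^sup>+\<theta>. (\<integral>\<^sup>+y. ?F1 X (\<theta>(i := y)) \<partial>M i) \<partial>PiM I M)"
    by (rule product_nn_integral_insert[OF insert.hyps m1])
  also have "\<dots> = (\<integral>\<^sup>+\<theta>. (\<integral>\<^sup>+y. ?E1 (X(i := \<rho>' i y)) \<theta> \<partial>M' i) \<partial>PiM I M)"
    unfolding row ..
  also have "\<dots> = (\<integral>\<^sup>+y. (\<integral>\<^sup>+\<theta>. ?E1 (X(i := \<rho>' i y)) \<theta> \<partial>PiM I M) \<partial>M' i)"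
  proof -
    interpret pair_sigma_finite "PiM I M" "M' i"
      by (intro pair_sigma_finite.intro I.sigma_finite_measure_axioms sf)
    show ?thesis
      by (rule Fubini'[symmetric]) (use m3 in \<open>simp add: case_prod_beta'\<close>)
  qed
  also have "\<dots> = (\<integral>\<^sup>+y. (\<integral>\<^sup>+\<theta>. ?E2 (X(i := \<rho>' i y)) \<theta> \<partial>PiM I M') \<partial>M' i)"
    by (intro nn_integral_cong insert.IH) (use insert.prems in auto)
  also have "\<dots> = (\<integral>\<^sup>+y. (\<integral>\<^sup>+\<theta>. ?F2 X (\<theta>(i := y)) \<partial>PiM I M') \<partial>M' i)"
    using insert.hyps
    by (intro nn_integral_cong arg_cong[where f=ennreal] arg_cong[where f=abs] dt_cong) (auto simp: ri)
  also have "\<dots> = (\<integral>\<^sup>+\<theta>. ?F2 X \<theta> \<partial>PiM (insert i I) M')"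
    by (rule M'.product_nn_integral_insert_rev[OF insert.hyps m2, symmetric])
  finally show ?case .
qed

section \<open>Cofactors of matrices with Gaussian entries\<close>

abbreviation Gs :: "'i set \<Rightarrow> ('i \<Rightarrow> real) measure" where
  "Gs L \<equiv> \<Pi>\<^sub>M l\<in>L. nrm 1"

lemma prob_space_Gs: "prob_space (Gs L)"
  by (intro prob_space_PiM prob_space_nrm) simp

lemma measurable_Gs_component: "l \<in> L \<Longrightarrow> (\<lambda>\<theta>. \<theta> l) \<in> borel_measurable (Gs L)"
  using measurable_component_singleton[of l L "\<lambda>_. nrm 1"] by (simp cong: measurable_cong_sets)

definition Jd :: "nat \<Rightarrow> (nat \<Rightarrow> nat \<Rightarrow> real) \<Rightarrow> ennreal" where
  "Jd N c = (\<integral>\<^sup>+z. ennreal \<bar>dt N (\<lambda>i l. c i l * z i l)\<bar> \<partial>(\<Pi>\<^sub>M i\<in>{..<N}. Gs {..<N}))"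

abbreviation GI :: "nat \<Rightarrow> nat \<Rightarrow> (nat \<Rightarrow> nat \<Rightarrow> real) measure" where
  "GI N i \<equiv> \<Pi>\<^sub>M r\<in>{..<N} - {i}. Gs {..<N}"

text \<open>A cofactor of row \<open>i\<close> does not involve that row, so this is a random
  variable on \<open>GI N i\<close>, where row \<open>i\<close> is absent.\<close>

definition Kc :: "nat \<Rightarrow> (nat \<Rightarrow> nat \<Rightarrow> real) \<Rightarrow> nat \<Rightarrow> (nat \<Rightarrow> nat \<Rightarrow> real) \<Rightarrow> nat \<Rightarrow> real" where
  "Kc N c i z l = cof N (\<lambda>r l. c r l * z r l) i l"

lemma skip_less: "i < N \<Longrightarrow> r < N - 1 \<Longrightarrow> skip i r < N" and skip_neq: "skip i r \<noteq> i"
  and inj_skip: "inj_on (skip i) S"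
  by (auto simp: skip_def inj_on_def split: if_splits)

lemma measurable_GI: "r \<in> I \<Longrightarrow> l \<in> L \<Longrightarrow> (\<lambda>z. z r l) \<in> borel_measurable (\<Pi>\<^sub>M r\<in>I. Gs L)"
  using measurable_compose[OF measurable_component_singleton[of r I "\<lambda>_. Gs L"] measurable_Gs_component[of l L]] .

lemma Kc_measurable:
  "i < N \<Longrightarrow> l < N \<Longrightarrow> (\<lambda>z. Kc N c i z l) \<in> borel_measurable (GI N i)"
  unfolding Kc_def cof_def
  by (intro borel_measurable_times borel_measurable_const dt_measurable measurable_GI)
     (auto simp: skip_less skip_neq)

lemma Kc_norm_measurable:
  assumes "i < N" "L \<subseteq> {..<N}"
  shows "(\<lambda>z. ennreal (sqrt (\<Sum>l\<in>L. (w l * Kc N c i z l)\<^sup>2))) \<in> borel_measurable (GI N i)"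
  by (intro measurable_compose[OF _ measurable_ennreal] measurable_compose[OF _ borel_measurable_sqrt]
      borel_measurable_sum borel_measurable_power borel_measurable_times borel_measurable_const Kc_measurable)
     (use assms in auto)

lemma gauss_abs_form:
  assumes "finite L"
  shows "(\<integral>\<^sup>+y. ennreal \<bar>\<Sum>l\<in>L. w l * y l\<bar> \<partial>Gs L) = ennreal (sqrt (\<Sum>l\<in>L. (w l)\<^sup>2)) * m1"
  using gauss_linear_form[OF assms, of "\<lambda>_. 1" "\<lambda>x. ennreal \<bar>x\<bar>" w] m1_scale[of "sqrt (\<Sum>l\<in>L. (w l)\<^sup>2)"]
  by (simp add: sum_nonneg)

text \<open>With the other rows fixed, the determinant is a linear form in the independent normal
  entries of row \<open>i\<close>. Its mean absolute value is \<open>m1\<close> times the Euclidean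
  norm of the coefficients.\<close>

lemma Jd_expand:
  assumes i: "i < N"
  shows "Jd N c = m1 * (\<integral>\<^sup>+z. ennreal (sqrt (\<Sum>l<N. (c i l * Kc N c i z l)\<^sup>2)) \<partial>GI N i)"
proof -
  interpret product_sigma_finite "\<lambda>_::nat. Gs {..<N}"
    by (intro product_sigma_finite.intro prob_space_imp_sigma_finite prob_space_Gs)
  have ins: "{..<N} = insert i ({..<N} - {i})" using i by auto
  let ?F = "\<lambda>z. ennreal \<bar>dt N (\<lambda>i l. c i l * z i l)\<bar>"
  have F: "?F \<in> borel_measurable (\<Pi>\<^sub>M i\<in>{..<N}. Gs {..<N})"
    by (intro measurable_compose[OF _ measurable_ennreal] borel_measurable_abs dt_measurable
        borel_measurable_times borel_measurable_const measurable_GI) auto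
  have F': "?F \<in> borel_measurable (\<Pi>\<^sub>M i\<in>insert i ({..<N} - {i}). Gs {..<N})"
    using F by (simp only: ins[symmetric])
  have "Jd N c = (\<integral>\<^sup>+z. ?F z \<partial>(\<Pi>\<^sub>M i\<in>insert i ({..<N} - {i}). Gs {..<N}))"
    unfolding Jd_def ins[symmetric] by (rule refl)
  also have "\<dots> = (\<integral>\<^sup>+z. (\<integral>\<^sup>+y. ?F (z(i := y)) \<partial>Gs {..<N}) \<partial>GI N i)"
    by (rule product_nn_integral_insert[OF _ _ F']) auto
  also have "\<dots> = (\<integral>\<^sup>+z. m1 * ennreal (sqrt (\<Sum>l<N. (c i l * Kc N c i z l)\<^sup>2)) \<partial>GI N i)"
  proof (rule nn_integral_cong)
    fix z
    have "dt N (\<lambda>r l. c r l * (z(i := y)) r l) = (\<Sum>l<N. (c i l * Kc N c i z l) * y l)" for y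
    proof -
      have "dt N (\<lambda>r l. c r l * (z(i := y)) r l) = dt N (\<lambda>r l. if r = i then c i l * y l else c r l * z r l)"
        by (rule dt_cong) auto
      then show ?thesis unfolding dt_row_expand[OF i] by (simp add: Kc_def mult_ac)
    qed
    then show "(\<integral>\<^sup>+y. ?F (z(i := y)) \<partial>Gs {..<N}) = m1 * ennreal (sqrt (\<Sum>l<N. (c i l * Kc N c i z l)\<^sup>2))"
      using gauss_abs_form[of "{..<N}" "\<lambda>l. c i l * Kc N c i z l"] by (simp add: mult.commute)
  qed
  also have "\<dots> = m1 * (\<integral>\<^sup>+z. ennreal (sqrt (\<Sum>l<N. (c i l * Kc N c i z l)\<^sup>2)) \<partial>GI N i)"
    by (rule nn_integral_cmult[OF Kc_norm_measurable[OF i order.refl]])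
  finally show ?thesis .
qed

text \<open>Up to sign the cofactor is a minor, and only its indices have to be renumbered. For the
  rows this is an identity between product laws; for the columns it goes through
  \<open>nn_integral_det_rows_cong\<close>, since a row with one coordinate dropped is again a
  standard Gaussian vector.\<close>

lemma Kc_minor:
  assumes i: "i < N" and l0: "l0 < N"
  shows "(\<integral>\<^sup>+z. ennreal \<bar>Kc N c i z l0\<bar> \<partial>GI N i) = Jd (N - 1) (\<lambda>r l. c (skip i r) (skip l0 l))"
proof -
  let ?c = "\<lambda>r l. c (skip i r) (skip l0 l)"
  let ?n = "N - 1"
  have "(\<integral>\<^sup>+z. ennreal \<bar>Kc N c i z l0\<bar> \<partial>GI N i)
      = (\<integral>\<^sup>+z. ennreal \<bar>dt ?n (\<lambda>r l. ?c r l * (\<lambda>n\<in>{..<?n}. z (skip i n)) r (skip l0 l))\<bar> \<partial>GI N i)"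
    unfolding Kc_def cof_def abs_mult power_abs
    by (intro nn_integral_cong) (auto intro!: arg_cong[where f=ennreal] arg_cong[where f=abs] dt_cong)
  also have "\<dots> = (\<integral>\<^sup>+z. ennreal \<bar>dt ?n (\<lambda>r l. ?c r l * z r (skip l0 l))\<bar> \<partial>distr (GI N i) (\<Pi>\<^sub>M r\<in>{..<?n}. Gs {..<N}) (\<lambda>z. \<lambda>n\<in>{..<?n}. z (skip i n)))"
  proof (rule nn_integral_distr[symmetric])
    show "(\<lambda>z. \<lambda>n\<in>{..<?n}. z (skip i n)) \<in> GI N i \<rightarrow>\<^sub>M (\<Pi>\<^sub>M r\<in>{..<?n}. Gs {..<N})"
      by (rule measurable_restrict) (rule measurable_component_singleton, use i in \<open>auto simp: skip_less skip_neq\<close>)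
    show "(\<lambda>z. ennreal \<bar>dt ?n (\<lambda>r l. ?c r l * z r (skip l0 l))\<bar>) \<in> borel_measurable (distr (GI N i) (\<Pi>\<^sub>M r\<in>{..<?n}. Gs {..<N}) (\<lambda>z. \<lambda>n\<in>{..<?n}. z (skip i n)))"
      unfolding measurable_distr_eq1
      by (intro measurable_compose[OF _ measurable_ennreal] borel_measurable_abs dt_measurable
        borel_measurable_times borel_measurable_const measurable_GI) (use l0 in \<open>auto simp: skip_less\<close>)
  qed
  also have "distr (GI N i) (\<Pi>\<^sub>M r\<in>{..<?n}. Gs {..<N}) (\<lambda>z. \<lambda>n\<in>{..<?n}. z (skip i n)) = (\<Pi>\<^sub>M r\<in>{..<?n}. Gs {..<N})"
    by (rule distr_PiM_reindex[of _ "\<lambda>_. Gs {..<N}"])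
       (use i in \<open>auto simp: skip_less skip_neq inj_skip intro: prob_space_Gs\<close>)
  also have "(\<integral>\<^sup>+z. ennreal \<bar>dt ?n (\<lambda>r l. ?c r l * z r (skip l0 l))\<bar> \<partial>(\<Pi>\<^sub>M r\<in>{..<?n}. Gs {..<N}))
      = (\<integral>\<^sup>+z. ennreal \<bar>dt ?n (\<lambda>r l. if r \<in> {..<?n} then ?c r l * z r (skip l0 l) else 0)\<bar> \<partial>(\<Pi>\<^sub>M r\<in>{..<?n}. Gs {..<N}))"
    by (intro nn_integral_cong arg_cong[where f=ennreal] arg_cong[where f=abs] dt_cong) auto
  also have "\<dots> = (\<integral>\<^sup>+z. ennreal \<bar>dt ?n (\<lambda>r l. if r \<in> {..<?n} then ?c r l * z r l else 0)\<bar> \<partial>(\<Pi>\<^sub>M r\<in>{..<?n}. Gs {..<?n}))"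
  proof (rule nn_integral_det_rows_cong[where \<rho>="\<lambda>r \<theta> l. ?c r l * \<theta> (skip l0 l)" and \<rho>'="\<lambda>r \<theta> l. ?c r l * \<theta> l" and X="\<lambda>_ _. 0"])
    fix r :: nat and C :: "nat \<Rightarrow> real"
    have "(\<integral>\<^sup>+\<theta>. ennreal \<bar>\<Sum>l<?n. ?c r l * \<theta> l * C l\<bar> \<partial>Gs {..<?n})
        = (\<integral>\<^sup>+\<theta>. ennreal \<bar>\<Sum>l<?n. ?c r l * \<theta> l * C l\<bar> \<partial>distr (Gs {..<N}) (Gs {..<?n}) (\<lambda>\<theta>. \<lambda>n\<in>{..<?n}. \<theta> (skip l0 n)))"
      by (subst distr_PiM_reindex[of _ "\<lambda>_. nrm 1"])
         (use l0 in \<open>auto simp: skip_less inj_skip intro: prob_space_nrm\<close>)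
    also have "\<dots> = (\<integral>\<^sup>+\<theta>. ennreal \<bar>\<Sum>l<?n. ?c r l * (\<lambda>n\<in>{..<?n}. \<theta> (skip l0 n)) l * C l\<bar> \<partial>Gs {..<N})"
      by (rule nn_integral_distr) (use l0 in \<open>auto intro!: measurable_restrict measurable_component_singleton simp: skip_less\<close>)
    also have "\<dots> = (\<integral>\<^sup>+\<theta>. ennreal \<bar>\<Sum>l<?n. ?c r l * \<theta> (skip l0 l) * C l\<bar> \<partial>Gs {..<N})"
      by (intro nn_integral_cong arg_cong[where f=ennreal] arg_cong[where f=abs] sum.cong) auto
    finally show "(\<integral>\<^sup>+\<theta>. ennreal \<bar>\<Sum>l<?n. ?c r l * \<theta> (skip l0 l) * C l\<bar> \<partial>Gs {..<N}) = (\<integral>\<^sup>+\<theta>. ennreal \<bar>\<Sum>l<?n. ?c r l * \<theta> l * C l\<bar> \<partial>Gs {..<?n})" ..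
  qed (use l0 in \<open>auto simp: skip_less intro!: prob_space_imp_sigma_finite prob_space_Gs\<close>)
  also have "\<dots> = Jd ?n ?c"
    unfolding Jd_def by (intro nn_integral_cong arg_cong[where f=ennreal] arg_cong[where f=abs] dt_cong) auto
  finally show ?thesis .
qed

text \<open>The mean of the chi law with \<open>card L\<close> degrees of freedom.\<close>

definition eL :: "nat set \<Rightarrow> ennreal" where
  "eL L = (\<integral>\<^sup>+\<xi>. ennreal (sqrt (\<Sum>l\<in>L. (\<xi> l)\<^sup>2)) \<partial>Gs L)"

text \<open>
  A Householder reflection mixing the columns in \<open>L\<close> maps \<open>\<xi>\<close> to a multiple of a basis vector
  and preserves the covariance of every Gaussian row whose scale is constant on \<open>L\<close>.
\<close>

lemma cofactor_rotation:
  assumes i: "i < N" and L: "L \<subseteq> {..<N}" and l0: "l0 \<in> L"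
    and c: "\<And>r l. l \<in> L \<Longrightarrow> c r l = c r l0"
  shows "(\<integral>\<^sup>+z. ennreal \<bar>\<Sum>l\<in>L. \<xi> l * Kc N c i z l\<bar> \<partial>GI N i)
    = ennreal (sqrt (\<Sum>l\<in>L. (\<xi> l)\<^sup>2)) * (\<integral>\<^sup>+z. ennreal \<bar>Kc N c i z l0\<bar> \<partial>GI N i)"
proof -
  define I where "I = {..<N} - {i}"
  have l0N: "l0 < N" using L l0 by auto
  have finL: "finite L" using L finite_subset by blast
  define n where "n = sqrt (\<Sum>l\<in>L. (\<xi> l)\<^sup>2)"
  have n0: "n \<ge> 0" and n2: "n\<^sup>2 = (\<Sum>l\<in>L. (\<xi> l)\<^sup>2)" by (auto simp: n_def sum_nonneg)
  define \<rho> where "\<rho> l = (if l \<in> L then \<xi> l else 0)" for l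
  define u where "u l = \<rho> l - (if l = l0 then n else 0)" for l
  have u0: "u l = 0" if "l \<notin> L" for l using that l0 by (auto simp: u_def \<rho>_def)
  define U where "U = (\<Sum>l<N. (u l)\<^sup>2)"
  \<comment> \<open>The Householder reflection along \<open>u\<close>. If \<open>U = 0\<close>,
    division by zero makes it the identity, and \<rho> is then already the required multiple of a
    basis vector.\<close>
  define Q where "Q p l = (if p = l then 1 else 0) + u p * (- 2 * u l / U)" for p l
  have sumL: "(\<Sum>l<N. if l \<in> L then f l else 0) = (\<Sum>l\<in>L. f l)" for f :: "nat \<Rightarrow> real"
    using L by (simp add: sum.If_cases Int_absorb1)
  have \<rho>2: "(\<Sum>l<N. (\<rho> l)\<^sup>2) = n\<^sup>2"
    unfolding n2 sumL[symmetric] by (rule sum.cong) (auto simp: \<rho>_def)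
  have \<rho>u: "(\<Sum>l<N. \<rho> l * u l) = n\<^sup>2 - n * \<xi> l0"
  proof -
    have "(\<Sum>l<N. \<rho> l * u l) = (\<Sum>l<N. (\<rho> l)\<^sup>2 - (if l = l0 then n * \<xi> l0 else 0))"
      using l0 by (intro sum.cong) (auto simp: u_def \<rho>_def power2_eq_square algebra_simps)
    then show ?thesis using l0N by (simp add: sum_subtractf \<rho>2)
  qed
  have U: "U = 2 * (n\<^sup>2 - n * \<xi> l0)"
  proof -
    have "U = (\<Sum>l<N. \<rho> l * u l - (if l = l0 then n * u l0 else 0))"
      unfolding U_def using l0 by (intro sum.cong) (auto simp: u_def power2_eq_square algebra_simps)
    also have "\<dots> = n\<^sup>2 - n * \<xi> l0 - n * u l0" using l0N by (simp add: sum_subtractf \<rho>u)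
    also have "n * u l0 = n * \<xi> l0 - n\<^sup>2" using l0 by (simp add: u_def \<rho>_def power2_eq_square algebra_simps)
    finally show ?thesis by simp
  qed
  have U0: "u l = 0" if "U = 0" "l < N" for l
    using that unfolding U_def by (simp add: sum_nonneg_eq_0_iff)
  have detQ: "\<bar>dt N Q\<bar> = 1"
  proof -
    have "dt N Q = 1 + (\<Sum>l<N. u l * (- 2 * u l / U))" unfolding Q_def by (rule dt_rank_one)
    also have "(\<Sum>l<N. u l * (- 2 * u l / U)) = - 2 / U * U"
      unfolding U_def[symmetric] by (subst (2) U_def) (simp add: sum_distrib_left power2_eq_square mult_ac)
    finally show ?thesis by (cases "U = 0") auto
  qed
  have sumQ: "(\<Sum>p<N. f p * Q p l) = f l - 2 * u l / U * (\<Sum>p<N. f p * u p)" if "l < N" for f l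
  proof -
    have "(\<Sum>p<N. f p * Q p l) = (\<Sum>p<N. (if p = l then f l else 0) - 2 * u l / U * (f p * u p))"
      by (intro sum.cong) (auto simp: Q_def algebra_simps)
    then show ?thesis using that by (simp add: sum_subtractf sum_distrib_left)
  qed
  have \<rho>Q: "(\<Sum>p<N. \<rho> p * Q p l) = (if l = l0 then n else 0)" if "l < N" for l
  proof (cases "U = 0")
    case True
    then show ?thesis using U0[OF True that] sumQ[OF that, of \<rho>] by (simp add: u_def)
  next
    case False
    have s: "(\<Sum>p<N. \<rho> p * u p) = U / 2" using \<rho>u U by simp
    have "(\<Sum>p<N. \<rho> p * Q p l) = \<rho> l - u l" unfolding sumQ[OF that] s using False by simp
    then show ?thesis by (simp add: u_def)
  qed
  define \<rho>1 where "\<rho>1 r \<theta> l = (\<Sum>p<N. c r p * \<theta> p * Q p l)" for r and \<theta> :: "nat \<Rightarrow> real" and l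
  define \<rho>2 where "\<rho>2 r \<theta> l = c r l * \<theta> l" for r and \<theta> :: "nat \<Rightarrow> real" and l
  have expand: "\<bar>\<Sum>l\<in>L. \<xi> l * Kc N c i z l\<bar> = \<bar>dt N (\<lambda>r l. if r \<in> I then \<rho>1 r (z r) l else if l = l0 then n else 0)\<bar>" for z
  proof -
    define R where "R = (\<lambda>r l. if r = i then \<rho> l else c r l * z r l)"
    have "(\<Sum>l\<in>L. \<xi> l * Kc N c i z l) = (\<Sum>l<N. \<rho> l * Kc N c i z l)"
      unfolding sumL[symmetric] by (rule sum.cong) (auto simp: \<rho>_def)
    also have "\<dots> = dt N R" unfolding R_def dt_row_expand[OF i] by (simp add: Kc_def)
    finally have "\<bar>\<Sum>l\<in>L. \<xi> l * Kc N c i z l\<bar> = \<bar>dt N R * dt N Q\<bar>" by (simp add: abs_mult detQ)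
    also have "dt N R * dt N Q = dt N (\<lambda>r l. \<Sum>p<N. R r p * Q p l)" by (rule dt_mult[symmetric])
    also have "\<dots> = dt N (\<lambda>r l. if r \<in> I then \<rho>1 r (z r) l else if l = l0 then n else 0)"
      by (rule dt_cong) (auto simp: R_def I_def \<rho>1_def \<rho>Q)
    finally show ?thesis .
  qed
  have "(\<integral>\<^sup>+z. ennreal \<bar>\<Sum>l\<in>L. \<xi> l * Kc N c i z l\<bar> \<partial>GI N i)
      = (\<integral>\<^sup>+z. ennreal \<bar>dt N (\<lambda>r l. if r \<in> I then \<rho>1 r (z r) l else if l = l0 then n else 0)\<bar> \<partial>(\<Pi>\<^sub>M r\<in>I. Gs {..<N}))"
    unfolding expand I_def by (rule refl)
  also have "\<dots> = (\<integral>\<^sup>+z. ennreal \<bar>dt N (\<lambda>r l. if r \<in> I then \<rho>2 r (z r) l else if l = l0 then n else 0)\<bar> \<partial>(\<Pi>\<^sub>M r\<in>I. Gs {..<N}))"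
  proof (rule nn_integral_det_rows_cong)
    fix r :: nat and C :: "nat \<Rightarrow> real"
    define D where "D p = c r p * C p" for p
    define w where "w p = D p - 2 * u p / U * (\<Sum>l<N. D l * u l)" for p
    have "(\<Sum>l<N. \<rho>1 r \<theta> l * C l) = (\<Sum>p<N. w p * \<theta> p)" for \<theta>
    proof -
      have "(\<Sum>l<N. \<rho>1 r \<theta> l * C l) = (\<Sum>p<N. \<theta> p * (c r p * (\<Sum>l<N. C l * Q l p)))"
      proof -
        have "(\<Sum>l<N. \<rho>1 r \<theta> l * C l) = (\<Sum>l<N. \<Sum>p<N. \<theta> p * (c r p * (C l * Q l p)))"
          unfolding \<rho>1_def sum_distrib_right by (intro sum.cong refl) (auto simp: Q_def algebra_simps)
        then show ?thesis by (subst (asm) sum.swap) (simp add: sum_distrib_left)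
      qed
      also have "\<dots> = (\<Sum>p<N. w p * \<theta> p)"
      proof (rule sum.cong[OF refl])
        fix p assume "p \<in> {..<N}"
        then have p: "p < N" by simp
        define s1 s2 where "s1 = (\<Sum>l<N. C l * u l)" and "s2 = (\<Sum>l<N. D l * u l)"
        \<comment> \<open>The scaling of row \<open>r\<close> commutes with the reflection:
          \<open>u\<close> is supported on \<open>L\<close>, where the scale is constant.\<close>
        have key: "c r p * u p * s1 = u p * s2"
        proof (cases "p \<in> L")
          case True
          have "s2 = c r l0 * s1"
            unfolding s1_def s2_def sum_distrib_left
          proof (intro sum.cong refl)
            fix x
            show "D x * u x = c r l0 * (C x * u x)"
              using c[of x r] u0[of x] by (cases "x \<in> L") (auto simp: D_def)
          qed
          then show ?thesis using c[OF True, of r] by simp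
        qed (simp add: u0)
        have "\<theta> p * (c r p * (C p - 2 * u p / U * s1)) = \<theta> p * (c r p * C p) - \<theta> p * (2 / U) * (c r p * u p * s1)"
          by (simp add: algebra_simps)
        also have "\<dots> = w p * \<theta> p" unfolding key by (simp add: w_def D_def s2_def[unfolded D_def] algebra_simps)
        finally show "\<theta> p * (c r p * (\<Sum>l<N. C l * Q l p)) = w p * \<theta> p"
          unfolding sumQ[OF p] s1_def .
      qed
      finally show ?thesis .
    qed
    then have 1: "(\<integral>\<^sup>+\<theta>. ennreal \<bar>\<Sum>l<N. \<rho>1 r \<theta> l * C l\<bar> \<partial>Gs {..<N}) = ennreal (sqrt (\<Sum>l<N. (w l)\<^sup>2)) * m1"
      using gauss_abs_form[of "{..<N}" w] by simp
    have "(\<Sum>l<N. \<rho>2 r \<theta> l * C l) = (\<Sum>l<N. D l * \<theta> l)" for \<theta>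
      by (simp add: \<rho>2_def D_def mult_ac)
    then have 2: "(\<integral>\<^sup>+\<theta>. ennreal \<bar>\<Sum>l<N. \<rho>2 r \<theta> l * C l\<bar> \<partial>Gs {..<N}) = ennreal (sqrt (\<Sum>l<N. (D l)\<^sup>2)) * m1"
      using gauss_abs_form[of "{..<N}" D] by simp
    have "(\<Sum>l<N. (w l)\<^sup>2) = (\<Sum>l<N. (D l)\<^sup>2)"
    proof -
      define s where "s = (\<Sum>l<N. D l * u l)"
      have "(w l)\<^sup>2 = (D l)\<^sup>2 - 4 * s / U * (D l * u l) + 4 * s\<^sup>2 / U\<^sup>2 * (u l)\<^sup>2" for l
        unfolding w_def s_def[symmetric] by (simp add: power2_eq_square algebra_simps)
      then have "(\<Sum>l<N. (w l)\<^sup>2) = (\<Sum>l<N. (D l)\<^sup>2) - 4 * s / U * s + 4 * s\<^sup>2 / U\<^sup>2 * U"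
        unfolding s_def U_def by (simp add: sum.distrib sum_subtractf sum_distrib_left)
      then show ?thesis by (cases "U = 0") (auto simp: power2_eq_square)
    qed
    then show "(\<integral>\<^sup>+\<theta>. ennreal \<bar>\<Sum>l<N. \<rho>1 r \<theta> l * C l\<bar> \<partial>Gs {..<N}) = (\<integral>\<^sup>+\<theta>. ennreal \<bar>\<Sum>l<N. \<rho>2 r \<theta> l * C l\<bar> \<partial>Gs {..<N})"
      using 1 2 by simp
  qed (auto simp: I_def \<rho>1_def \<rho>2_def intro!: prob_space_imp_sigma_finite prob_space_Gs)
  also have "\<dots> = (\<integral>\<^sup>+z. ennreal n * ennreal \<bar>Kc N c i z l0\<bar> \<partial>GI N i)"
    unfolding I_def[symmetric]
  proof (rule nn_integral_cong)
    fix z :: "nat \<Rightarrow> nat \<Rightarrow> real"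
    have "dt N (\<lambda>r l. if r \<in> I then \<rho>2 r (z r) l else if l = l0 then n else 0)
        = dt N (\<lambda>r l. if r = i then if l = l0 then n else 0 else c r l * z r l)"
      by (rule dt_cong) (auto simp: I_def \<rho>2_def)
    also have "\<dots> = (\<Sum>l<N. if l = l0 then n * Kc N c i z l0 else 0)"
      unfolding dt_row_expand[OF i] by (rule sum.cong) (auto simp: Kc_def)
    also have "\<dots> = n * Kc N c i z l0" using l0N by simp
    finally show "ennreal \<bar>dt N (\<lambda>r l. if r \<in> I then \<rho>2 r (z r) l else if l = l0 then n else 0)\<bar> = ennreal n * ennreal \<bar>Kc N c i z l0\<bar>"
      using n0 by (simp add: abs_mult ennreal_mult)
  qed
  also have "\<dots> = ennreal n * (\<integral>\<^sup>+z. ennreal \<bar>Kc N c i z l0\<bar> \<partial>GI N i)"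
    by (rule nn_integral_cmult) (intro measurable_compose[OF _ measurable_ennreal] borel_measurable_abs Kc_measurable i l0N)
  finally show ?thesis unfolding n_def .
qed

text \<open>An auxiliary Gaussian vector \<xi> on \<open>L\<close> is paired with the cofactors, and
  the mean of the absolute pairing is computed in both orders. Averaging over \<xi> first gives
  \<open>m1\<close> times the norm of the cofactors; averaging over the matrix first gives, by
  \<open>cofactor_rotation\<close>, the length of \<xi> times the mean of a single cofactor.\<close>

lemma cofactor_norm:
  assumes i: "i < N" and L: "L \<subseteq> {..<N}" and l0: "l0 \<in> L"
    and c: "\<And>r l. l \<in> L \<Longrightarrow> c r l = c r l0"
  shows "m1 * (\<integral>\<^sup>+z. ennreal (sqrt (\<Sum>l\<in>L. (Kc N c i z l)\<^sup>2)) \<partial>GI N i)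
    = eL L * Jd (N - 1) (\<lambda>r l. c (skip i r) (skip l0 l))"
proof -
  have finL: "finite L" using L finite_subset by blast
  have LN: "l < N" if "l \<in> L" for l using L that by auto
  interpret P: prob_space "Gs L" by (rule prob_space_Gs)
  interpret Q: prob_space "GI N i" by (intro prob_space_PiM prob_space_Gs)
  interpret pair_sigma_finite "GI N i" "Gs L"
    by (intro pair_sigma_finite.intro prob_space_imp_sigma_finite P.prob_space_axioms Q.prob_space_axioms)
  have meas: "(\<lambda>p. ennreal \<bar>\<Sum>l\<in>L. snd p l * Kc N c i (fst p) l\<bar>) \<in> borel_measurable (GI N i \<Otimes>\<^sub>M Gs L)"
    by (intro measurable_compose[OF _ measurable_ennreal] borel_measurable_abs borel_measurable_sum borel_measurable_times
        measurable_compose[OF measurable_snd measurable_Gs_component] measurable_compose[OF measurable_fst Kc_measurable] i LN)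
  have "m1 * (\<integral>\<^sup>+z. ennreal (sqrt (\<Sum>l\<in>L. (Kc N c i z l)\<^sup>2)) \<partial>GI N i)
      = (\<integral>\<^sup>+z. m1 * ennreal (sqrt (\<Sum>l\<in>L. (Kc N c i z l)\<^sup>2)) \<partial>GI N i)"
    using nn_integral_cmult[OF Kc_norm_measurable[OF i L, of "\<lambda>_. 1" c], of m1] by simp
  also have "\<dots> = (\<integral>\<^sup>+z. (\<integral>\<^sup>+\<xi>. ennreal \<bar>\<Sum>l\<in>L. \<xi> l * Kc N c i z l\<bar> \<partial>Gs L) \<partial>GI N i)"
  proof (rule nn_integral_cong)
    fix z
    have e: "(\<Sum>l\<in>L. \<xi> l * Kc N c i z l) = (\<Sum>l\<in>L. Kc N c i z l * \<xi> l)" for \<xi>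
      by (intro sum.cong refl mult.commute)
    show "m1 * ennreal (sqrt (\<Sum>l\<in>L. (Kc N c i z l)\<^sup>2)) = (\<integral>\<^sup>+\<xi>. ennreal \<bar>\<Sum>l\<in>L. \<xi> l * Kc N c i z l\<bar> \<partial>Gs L)"
      unfolding e gauss_abs_form[OF finL] by (rule mult.commute)
  qed
  also have "\<dots> = (\<integral>\<^sup>+\<xi>. (\<integral>\<^sup>+z. ennreal \<bar>\<Sum>l\<in>L. \<xi> l * Kc N c i z l\<bar> \<partial>GI N i) \<partial>Gs L)"
    by (rule Fubini'[where f="\<lambda>z \<xi>. ennreal \<bar>\<Sum>l\<in>L. \<xi> l * Kc N c i z l\<bar>", symmetric])
       (use meas in \<open>simp only: case_prod_beta'\<close>)
  also have "\<dots> = (\<integral>\<^sup>+\<xi>. ennreal (sqrt (\<Sum>l\<in>L. (\<xi> l)\<^sup>2)) * (\<integral>\<^sup>+z. ennreal \<bar>Kc N c i z l0\<bar> \<partial>GI N i) \<partial>Gs L)"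
    by (intro nn_integral_cong) (rule cofactor_rotation[where c=c, OF i L l0 c])
  also have "\<dots> = eL L * (\<integral>\<^sup>+z. ennreal \<bar>Kc N c i z l0\<bar> \<partial>GI N i)"
    unfolding eL_def by (rule nn_integral_multc) measurable
  finally show ?thesis unfolding Kc_minor[OF i LN[OF l0]] .
qed

subsection \<open>Constants\<close>

text \<open>This is Gamma((m + 1)/2) / 2; all dimensional constants below are ratios of such
  values.\<close>

definition Mr :: "nat \<Rightarrow> real" where
  "Mr m = (LINT x|lborel. indicator {0..} x *\<^sub>R (exp (- x\<^sup>2) * x ^ m))"

lemma Mr_even: "Mr (2 * k) = sqrt pi / 2 * (fact (2 * k) / (2 ^ (2 * k) * fact k))"
  and Mr_odd: "Mr (2 * k + 1) = fact k / 2"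
  unfolding Mr_def using gaussian_moment_even_pos[of k] gaussian_moment_odd_pos[of k]
  by (simp_all add: has_bochner_integral_integral_eq)

lemma nn_integral_Mr: "(\<integral>\<^sup>+r. ennreal (indicator {0<..} r * (r ^ m * exp (- r\<^sup>2))) \<partial>lborel) = ennreal (Mr m)"
proof -
  have "has_bochner_integral lborel (\<lambda>x. indicator {0..} x *\<^sub>R (exp (- x\<^sup>2) * x ^ m)) (Mr m)"
  proof (cases "even m")
    case True
    then obtain k where "m = 2 * k" by blast
    then show ?thesis using gaussian_moment_even_pos[of k] by (simp only: Mr_even)
  next
    case False
    then obtain k where "m = 2 * k + 1" by (blast elim: oddE)
    then show ?thesis using gaussian_moment_odd_pos[of k] by (simp only: Mr_odd)
  qed
  then have "(\<integral>\<^sup>+r. ennreal (indicator {0..} r *\<^sub>R (exp (- r\<^sup>2) * r ^ m)) \<partial>lborel) = ennreal (Mr m)"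
    by (intro nn_integral_eq_integral[THEN trans]) (auto simp: has_bochner_integral_iff indicator_def)
  moreover have "(\<integral>\<^sup>+r. ennreal (indicator {0<..} r * (r ^ m * exp (- r\<^sup>2))) \<partial>lborel)
      = (\<integral>\<^sup>+r. ennreal (indicator {0..} r *\<^sub>R (exp (- r\<^sup>2) * r ^ m)) \<partial>lborel)"
    using AE_lborel_singleton[of "0::real"]
    by (intro nn_integral_cong_AE, eventually_elim) (auto simp: indicator_def mult.commute)
  ultimately show ?thesis by simp
qed

lemma Mr_pos: "Mr m > 0"
proof (cases "even m")
  case True
  then obtain k where "m = 2 * k" by blast
  then show ?thesis by (simp add: Mr_even)
next
  case False
  then obtain k where "m = 2 * k + 1" by (blast elim: oddE)
  then show ?thesis by (simp only: Mr_odd) simp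
qed

lemma Mr_rec: "Mr (m + 2) = real (m + 1) / 2 * Mr m"
proof (cases "even m")
  case True
  then obtain k where k: "m = 2 * k" by blast
  have f1: "fact (2 * (k + 1)) = (2 * real k + 2) * (2 * real k + 1) * fact (2 * k)"
    by (simp add: algebra_simps)
  have f2: "fact (k + 1) = (real k + 1) * fact k" by (simp add: algebra_simps)
  have k1: "m + 2 = 2 * (k + 1)" using k by simp
  have "(2 * real k + 2) * (2 * real k + 1) * fact (2 * k) / (2 ^ (2 * (k + 1)) * ((real k + 1) * fact k))
      = (2 * real k + 1) / 2 * (fact (2 * k) / (2 ^ (2 * k) * fact k))"
    by (simp add: divide_simps)
  then show ?thesis unfolding k1 Mr_even f1 f2 unfolding k Mr_even by simp
next
  case False
  then obtain k where k: "m = 2 * k + 1" by (blast elim: oddE)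
  have "m + 2 = 2 * (k + 1) + 1" using k by simp
  then show ?thesis unfolding k by (simp only: Mr_odd) (simp add: algebra_simps)
qed

text \<open>Read from right to left, it represents a negative half-integral power of
  \<open>q\<close> as an integral of exp(-r^2 q). When \<open>q\<close> is a sum of squares, such
  exponentials factor over the coordinates.\<close>

lemma nn_integral_Mr_scale:
  assumes q: "q > 0"
  shows "(\<integral>\<^sup>+r. ennreal (indicator {0<..} r * (r ^ m * exp (- (r\<^sup>2 * q)))) \<partial>lborel) = ennreal (Mr m * q powr (- (real m + 1) / 2))"
proof -
  define c where "c = q powr (- 1 / 2)"
  have c: "c > 0" using q by (simp add: c_def)
  have "c\<^sup>2 = q powr (- 1)" unfolding c_def by (subst powr_power) (use q in auto)
  then have c2: "c\<^sup>2 * q = 1" using q by (simp add: powr_minus_divide)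
  have cm: "c ^ Suc m = q powr (- (real m + 1) / 2)"
  proof -
    have "c ^ Suc m = q powr (real (Suc m) * (- 1 / 2))"
      unfolding c_def by (rule powr_power) (use q in simp)
    also have "real (Suc m) * (- 1 / 2) = - (real m + 1) / 2" by (simp add: field_simps)
    finally show ?thesis .
  qed
  have "(\<integral>\<^sup>+r. ennreal (indicator {0<..} r * (r ^ m * exp (- (r\<^sup>2 * q)))) \<partial>lborel)
      = ennreal \<bar>c\<bar> * (\<integral>\<^sup>+r. ennreal (indicator {0<..} (0 + c * r) * ((0 + c * r) ^ m * exp (- ((0 + c * r)\<^sup>2 * q)))) \<partial>lborel)"
    by (rule nn_integral_real_affine) (use c in auto)
  also have "\<dots> = ennreal c * (\<integral>\<^sup>+r. ennreal (c ^ m) * ennreal (indicator {0<..} r * (r ^ m * exp (- r\<^sup>2))) \<partial>lborel)"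
  proof -
    have "ennreal (indicator {0<..} (0 + c * r) * ((0 + c * r) ^ m * exp (- ((0 + c * r)\<^sup>2 * q))))
        = ennreal (c ^ m) * ennreal (indicator {0<..} r * (r ^ m * exp (- r\<^sup>2)))" for r
    proof -
      have "(c * r)\<^sup>2 * q = r\<^sup>2" using c2 by (simp add: power_mult_distrib mult_ac)
      then show ?thesis using c by (simp add: ennreal_mult'[symmetric] power_mult_distrib indicator_def zero_less_mult_iff mult_ac)
    qed
    then show ?thesis using c by simp
  qed
  also have "\<dots> = ennreal c * (ennreal (c ^ m) * ennreal (Mr m))"
    by (subst nn_integral_cmult) (auto simp: nn_integral_Mr)
  also have "\<dots> = ennreal (c ^ Suc m * Mr m)"
    using c Mr_pos[of m] by (simp add: ennreal_mult[symmetric] mult.assoc less_imp_le)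
  finally show ?thesis unfolding cm by (simp add: mult.commute)
qed

lemma nn_integral_gauss_full:
  assumes r: "r > 0"
  shows "(\<integral>\<^sup>+t. ennreal (exp (- (r\<^sup>2 * t\<^sup>2))) \<partial>lborel) = ennreal (sqrt pi / r)"
proof -
  define \<sigma> where "\<sigma> = 1 / (sqrt 2 * r)"
  have \<sigma>: "\<sigma> > 0" using r by (simp add: \<sigma>_def)
  interpret prob_space "nrm \<sigma>" by (rule prob_space_nrm[OF \<sigma>])
  have s: "sqrt (2 * pi * \<sigma>\<^sup>2) = sqrt pi / r"
    using r by (simp add: \<sigma>_def power_divide power_mult_distrib real_sqrt_divide)
  have e: "- (t - 0)\<^sup>2 / (2 * \<sigma>\<^sup>2) = - (r\<^sup>2 * t\<^sup>2)" for t
    using r by (simp add: \<sigma>_def power_divide power_mult_distrib field_simps)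
  have d: "normal_density 0 \<sigma> t = r / sqrt pi * exp (- (r\<^sup>2 * t\<^sup>2))" for t
    unfolding normal_density_def s e by simp
  let ?I = "\<integral>\<^sup>+t. ennreal (exp (- (r\<^sup>2 * t\<^sup>2))) \<partial>lborel"
  have "1 = (\<integral>\<^sup>+t. ennreal (normal_density 0 \<sigma> t) \<partial>lborel)"
    using emeasure_space_1 by (simp add: emeasure_density)
  also have "\<dots> = (\<integral>\<^sup>+t. ennreal (r / sqrt pi) * ennreal (exp (- (r\<^sup>2 * t\<^sup>2))) \<partial>lborel)"
    unfolding d by (intro nn_integral_cong ennreal_mult) (use r in auto)
  also have "\<dots> = ennreal (r / sqrt pi) * ?I" by (rule nn_integral_cmult) simp
  finally have 1: "ennreal (r / sqrt pi) * ?I = 1" by (rule sym)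
  have "?I = (ennreal (sqrt pi / r) * ennreal (r / sqrt pi)) * ?I"
    using r by (subst ennreal_mult[symmetric]) auto
  also have "\<dots> = ennreal (sqrt pi / r)" unfolding mult.assoc 1 by (rule mult_1_right)
  finally show ?thesis .
qed

text \<open>The weight adds 2 r^2 to the inverse variance 1, so the product is an unnormalised
  normal density with standard deviation (1 + 2 r^2)^(-1/2), the number that also appears as the
  normalising factor.\<close>

lemma nn_integral_nrm_tilt:
  assumes [measurable]: "h \<in> borel_measurable borel"
  shows "(\<integral>\<^sup>+z. h z * ennreal (exp (- (r\<^sup>2 * z\<^sup>2))) \<partial>nrm 1)
    = ennreal ((1 + 2 * r\<^sup>2) powr (- 1 / 2)) * (\<integral>\<^sup>+z. h ((1 + 2 * r\<^sup>2) powr (- 1 / 2) * z) \<partial>nrm 1)"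
proof -
  define \<sigma> where "\<sigma> = (1 + 2 * r\<^sup>2) powr (- 1 / 2)"
  have q: "1 + 2 * r\<^sup>2 > 0" by (simp add: add_pos_nonneg)
  have \<sigma>: "\<sigma> > 0" using q by (simp add: \<sigma>_def)
  have "\<sigma>\<^sup>2 = (1 + 2 * r\<^sup>2) powr (- 1)" unfolding \<sigma>_def by (subst powr_power) (use q in auto)
  then have \<sigma>2: "\<sigma>\<^sup>2 = 1 / (1 + 2 * r\<^sup>2)" using q by (simp add: powr_minus_divide)
  have *: "normal_density 0 1 z * exp (- (r\<^sup>2 * z\<^sup>2)) = \<sigma> * normal_density 0 \<sigma> z" for z
  proof -
    have s: "sqrt (2 * pi * \<sigma>\<^sup>2) = sqrt (2 * pi * 1\<^sup>2) * \<sigma>" using \<sigma> by (simp add: real_sqrt_mult)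
    have e: "- (z - 0)\<^sup>2 / (2 * \<sigma>\<^sup>2) = - (z - 0)\<^sup>2 / (2 * 1\<^sup>2) + - (r\<^sup>2 * z\<^sup>2)"
      using q unfolding \<sigma>2 by (simp add: field_simps)
    have gen: "1 / a * x * y = \<sigma> * (1 / (a * \<sigma>) * (x * y))" for a x y :: real using \<sigma> by simp
    show ?thesis unfolding normal_density_def s e exp_add by (rule gen)
  qed
  have "(\<integral>\<^sup>+z. h z * ennreal (exp (- (r\<^sup>2 * z\<^sup>2))) \<partial>nrm 1) = (\<integral>\<^sup>+z. ennreal (normal_density 0 1 z) * (h z * ennreal (exp (- (r\<^sup>2 * z\<^sup>2)))) \<partial>lborel)"
    by (rule nn_integral_density) measurable
  also have "\<dots> = (\<integral>\<^sup>+z. ennreal \<sigma> * (ennreal (normal_density 0 \<sigma> z) * h z) \<partial>lborel)"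
  proof (rule nn_integral_cong)
    fix z
    have "ennreal (normal_density 0 1 z) * ennreal (exp (- (r\<^sup>2 * z\<^sup>2))) = ennreal \<sigma> * ennreal (normal_density 0 \<sigma> z)"
    proof -
      have "ennreal (normal_density 0 1 z) * ennreal (exp (- (r\<^sup>2 * z\<^sup>2))) = ennreal (normal_density 0 1 z * exp (- (r\<^sup>2 * z\<^sup>2)))"
        by (rule ennreal_mult[symmetric]) auto
      also have "\<dots> = ennreal \<sigma> * ennreal (normal_density 0 \<sigma> z)"
        unfolding * by (rule ennreal_mult) (use \<sigma> in auto)
      finally show ?thesis .
    qed
    then have "(ennreal (normal_density 0 1 z) * ennreal (exp (- (r\<^sup>2 * z\<^sup>2)))) * h z = (ennreal \<sigma> * ennreal (normal_density 0 \<sigma> z)) * h z"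
      by (rule arg_cong)
    then show "ennreal (normal_density 0 1 z) * (h z * ennreal (exp (- (r\<^sup>2 * z\<^sup>2)))) = ennreal \<sigma> * (ennreal (normal_density 0 \<sigma> z) * h z)"
      by (simp only: mult_ac)
  qed
  also have "\<dots> = ennreal \<sigma> * (\<integral>\<^sup>+z. ennreal (normal_density 0 \<sigma> z) * h z \<partial>lborel)"
    by (rule nn_integral_cmult) measurable
  also have "(\<integral>\<^sup>+z. ennreal (normal_density 0 \<sigma> z) * h z \<partial>lborel) = (\<integral>\<^sup>+z. h (\<sigma> * z) \<partial>nrm 1)"
    using nn_integral_normal_density[OF \<sigma>, of h 0] by simp
  finally show ?thesis unfolding \<sigma>_def .
qed

lemma nn_integral_nrm_square: "(\<integral>\<^sup>+z. ennreal (z\<^sup>2) \<partial>nrm 1) = 1"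
proof -
  have "has_bochner_integral lborel (\<lambda>x. std_normal_density x * x\<^sup>2) 1"
    using std_normal_moment_even[of 1] by simp
  then have "(\<integral>\<^sup>+z. ennreal (std_normal_density z * z\<^sup>2) \<partial>lborel) = 1"
    by (subst nn_integral_eq_integral) (auto simp: has_bochner_integral_iff)
  then show ?thesis by (subst nn_integral_density) (auto simp: ennreal_mult)
qed

text \<open>The integral factors over the coordinates. By tilting, every coordinate contributes
  \<sigma> = (1 + 2 r^2)^(-1/2), and the one carrying the square contributes \<sigma>^3.\<close>

lemma gauss_square_exp:
  assumes L: "finite L" "l \<in> L"
  shows "(\<integral>\<^sup>+\<xi>. ennreal ((\<xi> l)\<^sup>2 * exp (- (r\<^sup>2 * (\<Sum>l\<in>L. (\<xi> l)\<^sup>2)))) \<partial>Gs L) = ennreal ((1 + 2 * r\<^sup>2) powr (- (real (card L) + 2) / 2))"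
proof -
  interpret product_sigma_finite "\<lambda>_. nrm 1"
    by (intro product_sigma_finite.intro prob_space_imp_sigma_finite prob_space_nrm) simp
  interpret prob_space "nrm 1" by (rule prob_space_nrm) simp
  define \<sigma> where "\<sigma> = (1 + 2 * r\<^sup>2) powr (- 1 / 2)"
  have q: "1 + 2 * r\<^sup>2 > 0" by (simp add: add_pos_nonneg)
  have \<sigma>: "\<sigma> > 0" using q by (simp add: \<sigma>_def)
  let ?f = "\<lambda>i z. if i = l then ennreal (z\<^sup>2) * ennreal (exp (- (r\<^sup>2 * z\<^sup>2))) else 1 * ennreal (exp (- (r\<^sup>2 * z\<^sup>2)))"
  have "(\<integral>\<^sup>+\<xi>. ennreal ((\<xi> l)\<^sup>2 * exp (- (r\<^sup>2 * (\<Sum>l\<in>L. (\<xi> l)\<^sup>2)))) \<partial>Gs L) = (\<integral>\<^sup>+\<xi>. (\<Prod>i\<in>L. ?f i (\<xi> i)) \<partial>Gs L)"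
  proof (rule nn_integral_cong)
    fix \<xi> :: "'a \<Rightarrow> real"
    have "exp (- (r\<^sup>2 * (\<Sum>l\<in>L. (\<xi> l)\<^sup>2))) = (\<Prod>i\<in>L. exp (- (r\<^sup>2 * (\<xi> i)\<^sup>2)))"
      by (simp add: sum_distrib_left sum_negf[symmetric] exp_sum[OF L(1)])
    also have "(\<xi> l)\<^sup>2 * \<dots> = (\<xi> l)\<^sup>2 * exp (- (r\<^sup>2 * (\<xi> l)\<^sup>2)) * (\<Prod>i\<in>L - {l}. exp (- (r\<^sup>2 * (\<xi> i)\<^sup>2)))"
      by (subst prod.remove[OF L]) simp
    finally have R: "(\<xi> l)\<^sup>2 * exp (- (r\<^sup>2 * (\<Sum>l\<in>L. (\<xi> l)\<^sup>2)))
        = (\<xi> l)\<^sup>2 * exp (- (r\<^sup>2 * (\<xi> l)\<^sup>2)) * (\<Prod>i\<in>L - {l}. exp (- (r\<^sup>2 * (\<xi> i)\<^sup>2)))" .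
    have "ennreal ((\<xi> l)\<^sup>2 * exp (- (r\<^sup>2 * (\<Sum>l\<in>L. (\<xi> l)\<^sup>2))))
        = ennreal ((\<xi> l)\<^sup>2) * ennreal (exp (- (r\<^sup>2 * (\<xi> l)\<^sup>2))) * (\<Prod>i\<in>L - {l}. ennreal (exp (- (r\<^sup>2 * (\<xi> i)\<^sup>2))))"
      unfolding R by (simp add: ennreal_mult prod_nonneg prod_ennreal)
    also have "\<dots> = (\<Prod>i\<in>L. ?f i (\<xi> i))"
      by (subst prod.remove[OF L]) (auto intro!: arg_cong2[where f="(*)"] prod.cong)
    finally show "ennreal ((\<xi> l)\<^sup>2 * exp (- (r\<^sup>2 * (\<Sum>l\<in>L. (\<xi> l)\<^sup>2)))) = (\<Prod>i\<in>L. ?f i (\<xi> i))" .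
  qed
  also have "\<dots> = (\<Prod>i\<in>L. integral\<^sup>N (nrm 1) (?f i))"
    by (rule product_nn_integral_prod[OF L(1)]) auto
  also have "\<dots> = (\<Prod>i\<in>L. if i = l then ennreal (\<sigma> ^ 3) else ennreal \<sigma>)"
  proof (rule prod.cong[OF refl])
    fix i
    have "(\<integral>\<^sup>+z. ennreal (z\<^sup>2) * ennreal (exp (- (r\<^sup>2 * z\<^sup>2))) \<partial>nrm 1) = ennreal \<sigma> * (\<integral>\<^sup>+z. ennreal ((\<sigma> * z)\<^sup>2) \<partial>nrm 1)"
      unfolding \<sigma>_def by (rule nn_integral_nrm_tilt) measurable
    also have "(\<integral>\<^sup>+z. ennreal ((\<sigma> * z)\<^sup>2) \<partial>nrm 1) = ennreal (\<sigma>\<^sup>2) * 1"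
      unfolding nn_integral_nrm_square[symmetric] power_mult_distrib
      by (subst nn_integral_cmult[symmetric]) (auto simp: ennreal_mult)
    also have "ennreal \<sigma> * (ennreal (\<sigma>\<^sup>2) * 1) = ennreal (\<sigma> ^ 3)"
      using \<sigma> by (simp add: ennreal_mult[symmetric] less_imp_le power3_eq_cube power2_eq_square)
    moreover have "(\<integral>\<^sup>+z. 1 * ennreal (exp (- (r\<^sup>2 * z\<^sup>2))) \<partial>nrm 1) = ennreal \<sigma>"
      using nn_integral_nrm_tilt[of "\<lambda>_. 1" r] emeasure_space_1 by (simp add: \<sigma>_def)
    ultimately show "integral\<^sup>N (nrm 1) (?f i) = (if i = l then ennreal (\<sigma> ^ 3) else ennreal \<sigma>)" by simp
  qed
  also have "\<dots> = ennreal (\<sigma> ^ 3) * (\<Prod>i\<in>L - {l}. ennreal \<sigma>)"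
    by (subst prod.remove[OF L]) (auto intro!: arg_cong2[where f="(*)"] prod.cong)
  also have "\<dots> = ennreal (\<sigma> ^ (card L + 2))"
  proof -
    have "card L \<noteq> 0" using L by auto
    then have "3 + (card L - 1) = card L + 2" by simp
    moreover have "\<sigma> ^ 3 * \<sigma> ^ (card L - 1) = \<sigma> ^ (3 + (card L - 1))" by (rule power_add[symmetric])
    ultimately show ?thesis using L \<sigma> by (simp add: ennreal_mult[symmetric] ennreal_power less_imp_le)
  qed
  also have "\<sigma> ^ (card L + 2) = (1 + 2 * r\<^sup>2) powr (- (real (card L) + 2) / 2)"
  proof -
    have "\<sigma> ^ (card L + 2) = (1 + 2 * r\<^sup>2) powr (real (card L + 2) * (- 1 / 2))"
      unfolding \<sigma>_def by (rule powr_power) (use q in simp)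
    also have "real (card L + 2) * (- 1 / 2) = - (real (card L) + 2) / 2" by (simp add: field_simps)
    finally show ?thesis .
  qed
  finally show ?thesis .
qed

text \<open>The root of S = sum of squares is linearised by \<open>Mr 0\<close> sqrt(S) = integral
  of S exp(-r^2 S) over r > 0. The Gaussian mean of the integrand is (m + 1) (1 + 2 r^2)^(-(m+3)/2).
  To integrate this over r, the power is itself written as an integral over \<rho>, at the cost of
  the factor \<open>Mr (m + 2)\<close>, and the order is exchanged; the recursion for
  \<open>Mr\<close> simplifies the result.\<close>

lemma eL_value:
  assumes L: "finite L" "card L = Suc m"
  shows "eL L = ennreal (sqrt 2 * Mr (Suc m) / Mr m)"
proof -
  interpret P: prob_space "Gs L" by (rule prob_space_Gs)
  interpret pair_sigma_finite "Gs L" "lborel :: real measure"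
    by (intro pair_sigma_finite.intro prob_space_imp_sigma_finite P.prob_space_axioms lborel.sigma_finite_measure_axioms)
  define S where "S \<xi> = (\<Sum>l\<in>L. (\<xi> l)\<^sup>2)" for \<xi> :: "nat \<Rightarrow> real"
  have S0: "S \<xi> \<ge> 0" for \<xi> by (simp add: S_def sum_nonneg)
  have S_meas[measurable]: "S \<in> borel_measurable (Gs L)" unfolding S_def by measurable
  have Mr0: "ennreal (Mr 0) * ennreal (sqrt (S \<xi>)) = (\<integral>\<^sup>+r. ennreal (indicator {0<..} r * (S \<xi> * exp (- (r\<^sup>2 * S \<xi>)))) \<partial>lborel)" for \<xi>
  proof (cases "S \<xi> = 0")
    case False
    then have s: "S \<xi> > 0" using S0[of \<xi>] by simp
    have "(\<integral>\<^sup>+r. ennreal (indicator {0<..} r * (S \<xi> * exp (- (r\<^sup>2 * S \<xi>)))) \<partial>lborel)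
        = (\<integral>\<^sup>+r. ennreal (S \<xi>) * ennreal (indicator {0<..} r * (r ^ 0 * exp (- (r\<^sup>2 * S \<xi>)))) \<partial>lborel)"
      using s by (intro nn_integral_cong) (simp add: ennreal_mult'[symmetric] mult_ac)
    also have "\<dots> = ennreal (S \<xi>) * ennreal (Mr 0 * S \<xi> powr (- (real 0 + 1) / 2))"
      by (subst nn_integral_cmult) (simp_all only: nn_integral_Mr_scale[OF s], measurable)
    also have "\<dots> = ennreal (Mr 0 * sqrt (S \<xi>))"
    proof -
      have "S \<xi> * S \<xi> powr (- 1 / 2) = sqrt (S \<xi>)"
        using s by (simp add: powr_half_sqrt[symmetric] powr_minus divide_inverse[symmetric] powr_mult_base[symmetric])
          (simp add: powr_half_sqrt real_div_sqrt)
      then show ?thesis using s Mr_pos[of 0] by (simp add: ennreal_mult[symmetric] less_imp_le mult_ac)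
    qed
    finally show ?thesis using Mr_pos[of 0] S0 by (simp add: ennreal_mult less_imp_le)
  qed simp
  have "ennreal (Mr 0) * eL L = (\<integral>\<^sup>+\<xi>. ennreal (Mr 0) * ennreal (sqrt (S \<xi>)) \<partial>Gs L)"
    unfolding eL_def S_def[symmetric] by (rule nn_integral_cmult[symmetric]) measurable
  also have "\<dots> = (\<integral>\<^sup>+\<xi>. (\<integral>\<^sup>+r. ennreal (indicator {0<..} r * (S \<xi> * exp (- (r\<^sup>2 * S \<xi>)))) \<partial>lborel) \<partial>Gs L)"
    unfolding Mr0 ..
  also have "\<dots> = (\<integral>\<^sup>+r. (\<integral>\<^sup>+\<xi>. ennreal (indicator {0<..} r * (S \<xi> * exp (- (r\<^sup>2 * S \<xi>)))) \<partial>Gs L) \<partial>lborel)"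
    by (rule Fubini'[where f="\<lambda>\<xi> r. ennreal (indicator {0<..} r * (S \<xi> * exp (- (r\<^sup>2 * S \<xi>))))", symmetric]) measurable
  also have "\<dots> = (\<integral>\<^sup>+r. ennreal (indicator {0<..} r) * ennreal (real (Suc m) * (1 + 2 * r\<^sup>2) powr (- (real m + 3) / 2)) \<partial>lborel)"
  proof (rule nn_integral_cong)
    fix r :: real
    have "(\<integral>\<^sup>+\<xi>. ennreal (indicator {0<..} r * (S \<xi> * exp (- (r\<^sup>2 * S \<xi>)))) \<partial>Gs L)
        = ennreal (indicator {0<..} r) * (\<integral>\<^sup>+\<xi>. ennreal (S \<xi> * exp (- (r\<^sup>2 * S \<xi>))) \<partial>Gs L)"
      using S0 by (subst nn_integral_cmult[symmetric]) (auto simp: ennreal_mult)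
    also have "(\<integral>\<^sup>+\<xi>. ennreal (S \<xi> * exp (- (r\<^sup>2 * S \<xi>))) \<partial>Gs L) = (\<integral>\<^sup>+\<xi>. (\<Sum>l\<in>L. ennreal ((\<xi> l)\<^sup>2 * exp (- (r\<^sup>2 * S \<xi>)))) \<partial>Gs L)"
      by (intro nn_integral_cong) (simp add: sum_ennreal sum_distrib_right[symmetric] S_def)
    also have "\<dots> = (\<Sum>l\<in>L. (\<integral>\<^sup>+\<xi>. ennreal ((\<xi> l)\<^sup>2 * exp (- (r\<^sup>2 * S \<xi>))) \<partial>Gs L))"
      by (rule nn_integral_sum) measurable
    also have "\<dots> = (\<Sum>l\<in>L. ennreal ((1 + 2 * r\<^sup>2) powr (- (real m + 3) / 2)))"
      unfolding S_def using gauss_square_exp[OF L(1)] by (intro sum.cong refl) (simp add: L(2) algebra_simps)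
    also have "\<dots> = ennreal (real (Suc m) * (1 + 2 * r\<^sup>2) powr (- (real m + 3) / 2))"
      by (simp add: L(2) ennreal_mult ennreal_of_nat_eq_real_of_nat[symmetric] del: of_nat_Suc)
    finally show "(\<integral>\<^sup>+\<xi>. ennreal (indicator {0<..} r * (S \<xi> * exp (- (r\<^sup>2 * S \<xi>)))) \<partial>Gs L)
        = ennreal (indicator {0<..} r) * ennreal (real (Suc m) * (1 + 2 * r\<^sup>2) powr (- (real m + 3) / 2))" .
  qed
  finally have 1: "ennreal (Mr 0) * eL L = \<dots>" .
  have "ennreal (Mr (m + 2)) * (ennreal (Mr 0) * eL L)
      = (\<integral>\<^sup>+r. (\<integral>\<^sup>+\<rho>. ennreal (indicator {0<..} r * indicator {0<..} \<rho> * real (Suc m) * (\<rho> ^ (m + 2) * exp (- (\<rho>\<^sup>2 * (1 + 2 * r\<^sup>2))))) \<partial>lborel) \<partial>lborel)"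
    unfolding 1
  proof (rule trans[OF nn_integral_cmult[symmetric] nn_integral_cong])
    fix r :: real
    have q: "1 + 2 * r\<^sup>2 > 0" by (simp add: add_pos_nonneg)
    have "(\<integral>\<^sup>+\<rho>. ennreal (indicator {0<..} r * indicator {0<..} \<rho> * real (Suc m) * (\<rho> ^ (m + 2) * exp (- (\<rho>\<^sup>2 * (1 + 2 * r\<^sup>2))))) \<partial>lborel)
        = (\<integral>\<^sup>+\<rho>. ennreal (indicator {0<..} r * real (Suc m)) * ennreal (indicator {0<..} \<rho> * (\<rho> ^ (m + 2) * exp (- (\<rho>\<^sup>2 * (1 + 2 * r\<^sup>2))))) \<partial>lborel)"
      by (intro nn_integral_cong) (simp add: ennreal_mult'[symmetric] mult_ac)
    also have "\<dots> = ennreal (indicator {0<..} r * real (Suc m)) * ennreal (Mr (m + 2) * (1 + 2 * r\<^sup>2) powr (- (real (m + 2) + 1) / 2))"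
      unfolding nn_integral_Mr_scale[OF q, of "m + 2", symmetric] by (rule nn_integral_cmult) measurable
    finally show "ennreal (Mr (m + 2)) * (ennreal (indicator {0<..} r) * ennreal (real (Suc m) * (1 + 2 * r\<^sup>2) powr (- (real m + 3) / 2)))
        = (\<integral>\<^sup>+\<rho>. ennreal (indicator {0<..} r * indicator {0<..} \<rho> * real (Suc m) * (\<rho> ^ (m + 2) * exp (- (\<rho>\<^sup>2 * (1 + 2 * r\<^sup>2))))) \<partial>lborel)"
      using Mr_pos[of "m + 2"] by (simp add: ennreal_mult'[symmetric] less_imp_le mult_ac add_ac)
  qed measurable
  also have "\<dots> = (\<integral>\<^sup>+\<rho>. (\<integral>\<^sup>+r. ennreal (indicator {0<..} r * indicator {0<..} \<rho> * real (Suc m) * (\<rho> ^ (m + 2) * exp (- (\<rho>\<^sup>2 * (1 + 2 * r\<^sup>2))))) \<partial>lborel) \<partial>lborel)"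
    by (rule lborel_pair.Fubini'[where f="\<lambda>r \<rho>. ennreal (indicator {0<..} r * indicator {0<..} \<rho> * real (Suc m) * (\<rho> ^ (m + 2) * exp (- (\<rho>\<^sup>2 * (1 + 2 * r\<^sup>2)))))", symmetric]) measurable
  also have "\<dots> = (\<integral>\<^sup>+\<rho>. ennreal (real (Suc m) * Mr 0 / sqrt 2) * ennreal (indicator {0<..} \<rho> * (\<rho> ^ Suc m * exp (- \<rho>\<^sup>2))) \<partial>lborel)"
  proof (rule nn_integral_cong)
    fix \<rho> :: real
    show "(\<integral>\<^sup>+r. ennreal (indicator {0<..} r * indicator {0<..} \<rho> * real (Suc m) * (\<rho> ^ (m + 2) * exp (- (\<rho>\<^sup>2 * (1 + 2 * r\<^sup>2))))) \<partial>lborel)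
        = ennreal (real (Suc m) * Mr 0 / sqrt 2) * ennreal (indicator {0<..} \<rho> * (\<rho> ^ Suc m * exp (- \<rho>\<^sup>2)))"
    proof (cases "\<rho> > 0")
      case True
      let ?c = "real (Suc m) * (\<rho> ^ (m + 2) * exp (- \<rho>\<^sup>2))"
      have q: "2 * \<rho>\<^sup>2 > 0" using True by simp
      have "(\<integral>\<^sup>+r. ennreal (indicator {0<..} r * indicator {0<..} \<rho> * real (Suc m) * (\<rho> ^ (m + 2) * exp (- (\<rho>\<^sup>2 * (1 + 2 * r\<^sup>2))))) \<partial>lborel)
          = (\<integral>\<^sup>+r. ennreal ?c * ennreal (indicator {0<..} r * (r ^ 0 * exp (- (r\<^sup>2 * (2 * \<rho>\<^sup>2))))) \<partial>lborel)"
      proof (rule nn_integral_cong)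
        fix r :: real
        have "exp (- (\<rho>\<^sup>2 * (1 + 2 * r\<^sup>2))) = exp (- \<rho>\<^sup>2) * exp (- (r\<^sup>2 * (2 * \<rho>\<^sup>2)))"
          by (simp add: exp_add[symmetric] algebra_simps)
        then show "ennreal (indicator {0<..} r * indicator {0<..} \<rho> * real (Suc m) * (\<rho> ^ (m + 2) * exp (- (\<rho>\<^sup>2 * (1 + 2 * r\<^sup>2)))))
            = ennreal ?c * ennreal (indicator {0<..} r * (r ^ 0 * exp (- (r\<^sup>2 * (2 * \<rho>\<^sup>2)))))"
          using True by (simp add: ennreal_mult'[symmetric] mult_ac)
      qed
      also have "\<dots> = ennreal ?c * ennreal (Mr 0 * (2 * \<rho>\<^sup>2) powr (- (real 0 + 1) / 2))"
        unfolding nn_integral_Mr_scale[OF q, of 0, symmetric] by (rule nn_integral_cmult) measurable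
      also have "\<dots> = ennreal (?c * (Mr 0 * (2 * \<rho>\<^sup>2) powr (- (real 0 + 1) / 2)))"
        by (rule ennreal_mult[symmetric]) (use True Mr_pos[of 0] in \<open>auto intro: less_imp_le\<close>)
      also have "(2 * \<rho>\<^sup>2) powr (- (real 0 + 1) / 2) = 1 / (sqrt 2 * \<rho>)"
      proof -
        have "(2 * \<rho>\<^sup>2) powr (- (real 0 + 1) / 2) = (2 * \<rho>\<^sup>2) powr (- (1 / 2))" by simp
        also have "\<dots> = 1 / (2 * \<rho>\<^sup>2) powr (1 / 2)" by (rule powr_minus_divide)
        also have "(2 * \<rho>\<^sup>2) powr (1 / 2) = sqrt (2 * \<rho>\<^sup>2)" using True by (intro powr_half_sqrt) simp
        also have "\<dots> = sqrt 2 * \<rho>" using True by (simp add: real_sqrt_mult)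
        finally show ?thesis .
      qed
      also have "?c * (Mr 0 * (1 / (sqrt 2 * \<rho>))) = (real (Suc m) * Mr 0 / sqrt 2) * (\<rho> ^ Suc m * exp (- \<rho>\<^sup>2))"
        using True by (simp add: divide_simps)
      also have "ennreal \<dots> = ennreal (real (Suc m) * Mr 0 / sqrt 2) * ennreal (\<rho> ^ Suc m * exp (- \<rho>\<^sup>2))"
        by (rule ennreal_mult) (use True Mr_pos[of 0] in \<open>auto intro: less_imp_le\<close>)
      finally show ?thesis using True by simp
    qed simp
  qed
  also have "\<dots> = ennreal (real (Suc m) * Mr 0 / sqrt 2) * ennreal (Mr (Suc m))"
    unfolding nn_integral_Mr[symmetric] by (rule nn_integral_cmult) measurable
  also have "\<dots> = ennreal (real (Suc m) * Mr 0 / sqrt 2 * Mr (Suc m))"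
    by (rule ennreal_mult[symmetric]) (use Mr_pos[of 0] Mr_pos[of "Suc m"] in \<open>auto intro: less_imp_le\<close>)
  finally have "ennreal (Mr (m + 2)) * (ennreal (Mr 0) * eL L) = ennreal (real (Suc m) * Mr 0 / sqrt 2 * Mr (Suc m))" .
  moreover have "ennreal (Mr (m + 2) * Mr 0) = ennreal (Mr (m + 2)) * ennreal (Mr 0)"
    by (rule ennreal_mult) (use Mr_pos[of 0] Mr_pos[of "m + 2"] in auto)
  ultimately have 2: "ennreal (Mr (m + 2) * Mr 0) * eL L = ennreal (real (Suc m) * Mr 0 / sqrt 2 * Mr (Suc m))"
    by (simp only: mult.assoc)
  let ?a = "Mr (m + 2) * Mr 0"
  have a: "?a > 0" by (simp add: Mr_pos)
  have "eL L = (ennreal (1 / ?a) * ennreal ?a) * eL L"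
    using a by (subst ennreal_mult[symmetric]) auto
  also have "\<dots> = ennreal (1 / ?a) * (ennreal ?a * eL L)" by (rule mult.assoc)
  also have "\<dots> = ennreal (1 / ?a * (real (Suc m) * Mr 0 / sqrt 2 * Mr (Suc m)))"
    unfolding 2 using a Mr_pos[of 0] Mr_pos[of "Suc m"] by (subst ennreal_mult[symmetric]) (auto simp: less_imp_le)
  also have "1 / ?a * (real (Suc m) * Mr 0 / sqrt 2 * Mr (Suc m)) = sqrt 2 * Mr (Suc m) / Mr m"
    unfolding Mr_rec using Mr_pos[of 0] Mr_pos[of m] by (simp add: divide_simps)
  finally show ?thesis .
qed

section \<open>Blocks of columns and the total mass of the chart density\<close>

definition bs :: "nat \<Rightarrow> (nat \<Rightarrow> nat) \<Rightarrow> nat \<Rightarrow> nat set" where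
  "bs N blk j = {l. l < N \<and> blk l = j}"

lemma finite_bs: "finite (bs N blk j)" by (simp add: bs_def)

lemma sum_blocks:
  fixes f :: "nat \<Rightarrow> 'a::comm_monoid_add"
  assumes "\<And>l. l < N \<Longrightarrow> blk l < k"
  shows "(\<Sum>j<k. \<Sum>l\<in>bs N blk j. f l) = (\<Sum>l<N. f l)"
  using sum.group[of "{..<N}" "{..<k}" blk f] assms by (auto simp: bs_def)

lemma prod_blocks:
  fixes f :: "nat \<Rightarrow> 'a::comm_monoid_mult"
  assumes "\<And>l. l < N \<Longrightarrow> blk l < k"
  shows "(\<Prod>j<k. \<Prod>l\<in>bs N blk j. f l) = (\<Prod>l<N. f l)"
  using prod.group[of "{..<N}" "{..<k}" blk f] assms by (auto simp: bs_def)

lemma prod_blocks_card: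
  fixes f :: "nat \<Rightarrow> 'a::comm_monoid_mult"
  assumes "\<And>l. l < N \<Longrightarrow> blk l < k"
  shows "(\<Prod>l<N. f (blk l)) = (\<Prod>j<k. f j ^ card (bs N blk j))"
proof -
  have "(\<Prod>l\<in>bs N blk j. f (blk l)) = (\<Prod>l\<in>bs N blk j. f j)" for j
    by (rule prod.cong) (auto simp: bs_def)
  then show ?thesis
    using prod_blocks[of N blk k "\<lambda>l. f (blk l)"] assms by simp
qed

definition qb :: "nat \<Rightarrow> (nat \<Rightarrow> nat) \<Rightarrow> nat \<Rightarrow> (nat \<Rightarrow> real) \<Rightarrow> real" where
  "qb N blk j t = 1 + (\<Sum>l\<in>bs N blk j. (t l)\<^sup>2)"

lemma qb_pos: "qb N blk j t > 0"
  by (simp add: qb_def add_pos_nonneg sum_nonneg)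

text \<open>Up to the power of 2 pi, the Riemannian volume of the product of projective spaces in
  affine coordinates.\<close>

definition chart_dens :: "nat \<Rightarrow> (nat \<Rightarrow> nat) \<Rightarrow> nat \<Rightarrow> (nat \<Rightarrow> real) \<Rightarrow> real" where
  "chart_dens N blk k t = (1 / sqrt (2 * pi)) ^ N * (\<Prod>j<k. qb N blk j t powr (- (real (card (bs N blk j)) + 1) / 2))"

text \<open>The volume of real projective m-space divided by (2 pi)^(m/2), since that volume is
  pi^((m+1)/2) / Gamma((m+1)/2).\<close>

definition cc :: "nat \<Rightarrow> real" where
  "cc m = (1 / sqrt 2) ^ m * Mr 0 / Mr m"

lemma cc_pos: "cc m > 0"
  by (simp add: cc_def Mr_pos)

text \<open>The bracket is the value of \<open>eL\<close> on m + 1 indices. This identity absorbs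
  the change of volume constant when one variable is removed.\<close>

lemma cc_Suc: "cc (Suc m) * (sqrt 2 * Mr (Suc m) / Mr m) = cc m"
  using Mr_pos[of m] Mr_pos[of "Suc m"] by (simp add: cc_def field_simps)

lemma qb_measurable: "qb N blk j \<in> borel_measurable (leb N)"
proof -
  have "(\<lambda>t. t l) \<in> borel_measurable (leb N)" if "l \<in> bs N blk j" for l
    using measurable_component_singleton[of l "{..<N}" "\<lambda>_. lborel"] that by (simp add: bs_def)
  then show ?thesis unfolding qb_def
    by (intro borel_measurable_add borel_measurable_const borel_measurable_sum borel_measurable_power)
qed

lemma chart_dens_measurable: "chart_dens N blk k \<in> borel_measurable (leb N)"
  unfolding chart_dens_def
  by (intro borel_measurable_times borel_measurable_const borel_measurable_prod powr_real_measurable qb_measurable)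

lemma chart_dens_nonneg: "chart_dens N blk k t \<ge> 0"
  unfolding chart_dens_def by (intro mult_nonneg_nonneg prod_nonneg) auto

text \<open>Each power of \<open>qb\<close> is represented by a Gaussian integral over an auxiliary
  variable \<open>r j\<close>. After exchanging the integrations, the integral over \<open>t\<close>
  splits into one-dimensional Gaussians; their factors 1 / r j cancel the powers
  \<open>r j ^ n j\<close>, and each block leaves \<open>Mr 0\<close>.\<close>

lemma chart_integral:
  assumes blk: "\<And>l. l < N \<Longrightarrow> blk l < k"
  shows "(\<integral>\<^sup>+t. ennreal (chart_dens N blk k t) \<partial>leb N) = ennreal (\<Prod>j<k. cc (card (bs N blk j)))"
proof -
  define n where "n j = card (bs N blk j)" for j
  have blocks: "(\<Prod>j<k. \<Prod>l\<in>bs N blk j. f l) = (\<Prod>l<N. f l)" for f :: "nat \<Rightarrow> real"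
    by (rule prod_blocks) (rule blk)
  let ?q = "qb N blk"
  let ?c = "1 / sqrt (2 * pi)"
  interpret LN: finite_product_sigma_finite "\<lambda>_::nat. lborel :: real measure" "{..<N}" by standard simp
  interpret Lk: finite_product_sigma_finite "\<lambda>_::nat. lborel :: real measure" "{..<k}" by standard simp
  interpret pair_sigma_finite "leb N" "leb k"
    by (intro pair_sigma_finite.intro LN.sigma_finite_measure_axioms Lk.sigma_finite_measure_axioms)
  define h where "h t r = (\<Prod>j<k. ennreal (indicator {0<..} (r j) * (r j ^ n j * exp (- ((r j)\<^sup>2 * ?q j t)))))" for t r
  have comp_N: "(\<lambda>t. t l) \<in> borel_measurable (leb N)" if "l < N" for l
    using measurable_component_singleton[of l "{..<N}" "\<lambda>_. lborel"] that by simp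
  have comp_k: "(\<lambda>t. t l) \<in> borel_measurable (leb k)" if "l < k" for l
    using measurable_component_singleton[of l "{..<k}" "\<lambda>_. lborel"] that by simp
  have h_meas: "(\<lambda>p. ennreal (?c ^ N) * h (fst p) (snd p)) \<in> borel_measurable (leb N \<Otimes>\<^sub>M leb k)"
    unfolding h_def
  proof (intro borel_measurable_times_ennreal borel_measurable_const borel_measurable_prod_ennreal measurable_compose[OF _ measurable_ennreal])
    fix j assume "j \<in> {..<k}"
    then have [measurable]: "(\<lambda>p. snd p j) \<in> borel_measurable (leb N \<Otimes>\<^sub>M leb k)"
      by (intro measurable_compose[OF measurable_snd comp_k]) simp
    have [measurable]: "(\<lambda>p. ?q j (fst p)) \<in> borel_measurable (leb N \<Otimes>\<^sub>M leb k)"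
      by (rule measurable_compose[OF measurable_fst qb_measurable])
    show "(\<lambda>p. indicator {0<..} (snd p j) * (snd p j ^ n j * exp (- ((snd p j)\<^sup>2 * ?q j (fst p))))) \<in> borel_measurable (leb N \<Otimes>\<^sub>M leb k)"
      by measurable
  qed
  have h_int: "(\<integral>\<^sup>+r. h t r \<partial>leb k) = ennreal (\<Prod>j<k. Mr (n j) * ?q j t powr (- (real (n j) + 1) / 2))" for t
  proof -
    have "(\<integral>\<^sup>+r. h t r \<partial>leb k) = (\<Prod>j<k. \<integral>\<^sup>+r. ennreal (indicator {0<..} r * (r ^ n j * exp (- (r\<^sup>2 * ?q j t)))) \<partial>lborel)"
      unfolding h_def by (rule lebp.product_nn_integral_prod) auto
    also have "\<dots> = (\<Prod>j<k. ennreal (Mr (n j) * ?q j t powr (- (real (n j) + 1) / 2)))"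
      by (intro prod.cong refl nn_integral_Mr_scale qb_pos)
    also have "\<dots> = ennreal (\<Prod>j<k. Mr (n j) * ?q j t powr (- (real (n j) + 1) / 2))"
      by (rule prod_ennreal) (auto intro!: mult_nonneg_nonneg less_imp_le[OF Mr_pos])
    finally show ?thesis .
  qed
  have inner: "(\<integral>\<^sup>+t. ennreal (?c ^ N) * h t r \<partial>leb N) = (\<Prod>j<k. ennreal ((1 / sqrt 2) ^ n j) * ennreal (indicator {0<..} (r j) * (r j ^ 0 * exp (- (r j)\<^sup>2))))" for r
  proof (cases "\<forall>j<k. r j > 0")
    case False
    then obtain j where j: "j < k" "\<not> r j > 0" by blast
    then have "h t r = 0" for t unfolding h_def by (intro prod_zero) (auto intro!: bexI[of _ j])
    moreover have "(\<Prod>j<k. ennreal ((1 / sqrt 2) ^ n j) * ennreal (indicator {0<..} (r j) * (r j ^ 0 * exp (- (r j)\<^sup>2)))) = 0"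
      using j by (intro prod_zero) (auto intro!: bexI[of _ j])
    ultimately show ?thesis by simp
  next
    case True
    define a where "a = (\<Prod>j<k. r j ^ n j * exp (- (r j)\<^sup>2))"
    have a0: "a \<ge> 0" unfolding a_def using True by (intro prod_nonneg) (auto intro: less_imp_le)
    have ht: "ennreal (?c ^ N) * h t r = ennreal a * (\<Prod>l<N. ennreal ?c * ennreal (exp (- ((r (blk l))\<^sup>2 * (t l)\<^sup>2))))" for t
    proof -
      have "exp (- ((r j)\<^sup>2 * ?q j t)) = exp (- (r j)\<^sup>2) * (\<Prod>l\<in>bs N blk j. exp (- ((r (blk l))\<^sup>2 * (t l)\<^sup>2)))" for j
      proof -
        have "- ((r j)\<^sup>2 * ?q j t) = - (r j)\<^sup>2 + (\<Sum>l\<in>bs N blk j. - ((r (blk l))\<^sup>2 * (t l)\<^sup>2))"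
        proof -
          have "(\<Sum>l\<in>bs N blk j. - ((r (blk l))\<^sup>2 * (t l)\<^sup>2)) = (\<Sum>l\<in>bs N blk j. - ((r j)\<^sup>2 * (t l)\<^sup>2))"
            by (rule sum.cong) (auto simp: bs_def)
          then show ?thesis unfolding qb_def by (simp add: distrib_left sum_distrib_left sum_negf)
        qed
        then show ?thesis by (simp only: exp_add exp_sum[OF finite_bs])
      qed
      then have "(\<Prod>j<k. indicator {0<..} (r j) * (r j ^ n j * exp (- ((r j)\<^sup>2 * ?q j t))))
          = (\<Prod>j<k. (r j ^ n j * exp (- (r j)\<^sup>2)) * (\<Prod>l\<in>bs N blk j. exp (- ((r (blk l))\<^sup>2 * (t l)\<^sup>2))))"
        using True by (intro prod.cong) auto
      also have "\<dots> = a * (\<Prod>l<N. exp (- ((r (blk l))\<^sup>2 * (t l)\<^sup>2)))"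
        unfolding prod.distrib a_def blocks ..
      finally have e: "(\<Prod>j<k. indicator {0<..} (r j) * (r j ^ n j * exp (- ((r j)\<^sup>2 * ?q j t)))) = a * (\<Prod>l<N. exp (- ((r (blk l))\<^sup>2 * (t l)\<^sup>2)))" .
      have "h t r = ennreal (\<Prod>j<k. indicator {0<..} (r j) * (r j ^ n j * exp (- ((r j)\<^sup>2 * ?q j t))))"
        unfolding h_def using True by (intro prod_ennreal) (auto intro: less_imp_le)
      also have "\<dots> = ennreal a * (\<Prod>l<N. ennreal (exp (- ((r (blk l))\<^sup>2 * (t l)\<^sup>2))))"
        unfolding e using a0 by (simp add: ennreal_mult prod_nonneg prod_ennreal)
      finally have 1: "h t r = ennreal a * (\<Prod>l<N. ennreal (exp (- ((r (blk l))\<^sup>2 * (t l)\<^sup>2))))" .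
      have 2: "ennreal (?c ^ N) = (\<Prod>l<N. ennreal ?c)" by (simp add: ennreal_power)
      show ?thesis unfolding 1 2 prod.distrib by (simp only: mult_ac)
    qed
    have "(\<integral>\<^sup>+t. ennreal (?c ^ N) * h t r \<partial>leb N) = (\<integral>\<^sup>+t. ennreal a * (\<Prod>l<N. ennreal ?c * ennreal (exp (- ((r (blk l))\<^sup>2 * (t l)\<^sup>2)))) \<partial>leb N)"
      by (simp only: ht)
    also have "\<dots> = ennreal a * (\<integral>\<^sup>+t. (\<Prod>l<N. ennreal ?c * ennreal (exp (- ((r (blk l))\<^sup>2 * (t l)\<^sup>2)))) \<partial>leb N)"
    proof (rule nn_integral_cmult, rule borel_measurable_prod_ennreal)
      fix l assume "l \<in> {..<N}"
      then have [measurable]: "(\<lambda>t. t l) \<in> borel_measurable (leb N)" by (intro comp_N) simp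
      show "(\<lambda>t. ennreal ?c * ennreal (exp (- ((r (blk l))\<^sup>2 * (t l)\<^sup>2)))) \<in> borel_measurable (leb N)" by measurable
    qed
    also have "(\<integral>\<^sup>+t. (\<Prod>l<N. ennreal ?c * ennreal (exp (- ((r (blk l))\<^sup>2 * (t l)\<^sup>2)))) \<partial>leb N)
        = (\<Prod>l<N. \<integral>\<^sup>+x. ennreal ?c * ennreal (exp (- ((r (blk l))\<^sup>2 * x\<^sup>2))) \<partial>lborel)"
      by (rule lebp.product_nn_integral_prod) auto
    also have "\<dots> = (\<Prod>l<N. ennreal (1 / sqrt 2 / r (blk l)))"
    proof (intro prod.cong refl)
      fix l assume "l \<in> {..<N}"
      then have r: "r (blk l) > 0" using True blk by simp
      have "(\<integral>\<^sup>+x. ennreal ?c * ennreal (exp (- ((r (blk l))\<^sup>2 * x\<^sup>2))) \<partial>lborel) = ennreal ?c * ennreal (sqrt pi / r (blk l))"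
        unfolding nn_integral_gauss_full[OF r, symmetric] by (rule nn_integral_cmult) simp
      also have "\<dots> = ennreal (?c * (sqrt pi / r (blk l)))" by (rule ennreal_mult[symmetric]) (use r in auto)
      also have "?c * (sqrt pi / r (blk l)) = 1 / sqrt 2 / r (blk l)" by (simp add: real_sqrt_mult)
      finally show "(\<integral>\<^sup>+x. ennreal ?c * ennreal (exp (- ((r (blk l))\<^sup>2 * x\<^sup>2))) \<partial>lborel) = ennreal (1 / sqrt 2 / r (blk l))" .
    qed
    also have "\<dots> = ennreal (\<Prod>l<N. 1 / sqrt 2 / r (blk l))"
      using True blk by (intro prod_ennreal) (auto intro!: divide_nonneg_nonneg less_imp_le)
    also have "ennreal a * \<dots> = ennreal (a * (\<Prod>l<N. 1 / sqrt 2 / r (blk l)))"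
      using True blk by (intro ennreal_mult[symmetric] a0 prod_nonneg) (auto intro!: divide_nonneg_nonneg less_imp_le)
    also have "a * (\<Prod>l<N. 1 / sqrt 2 / r (blk l)) = (\<Prod>j<k. (1 / sqrt 2) ^ n j * (indicator {0<..} (r j) * (r j ^ 0 * exp (- (r j)\<^sup>2))))"
    proof -
      have "(\<Prod>l<N. 1 / sqrt 2 / r (blk l)) = (\<Prod>j<k. (1 / sqrt 2 / r j) ^ n j)"
        unfolding n_def by (rule prod_blocks_card) (rule blk)
      then have "a * (\<Prod>l<N. 1 / sqrt 2 / r (blk l)) = (\<Prod>j<k. r j ^ n j * exp (- (r j)\<^sup>2) * (1 / sqrt 2 / r j) ^ n j)"
        by (simp only: a_def prod.distrib)
      also have "\<dots> = (\<Prod>j<k. (1 / sqrt 2) ^ n j * (indicator {0<..} (r j) * (r j ^ 0 * exp (- (r j)\<^sup>2))))"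
      proof (intro prod.cong refl)
        fix j assume "j \<in> {..<k}"
        then have "r j > 0" using True by simp
        then show "r j ^ n j * exp (- (r j)\<^sup>2) * (1 / sqrt 2 / r j) ^ n j
            = (1 / sqrt 2) ^ n j * (indicator {0<..} (r j) * (r j ^ 0 * exp (- (r j)\<^sup>2)))"
          by (simp add: power_divide power_mult_distrib)
      qed
      finally show ?thesis .
    qed
    also have "ennreal \<dots> = (\<Prod>j<k. ennreal ((1 / sqrt 2) ^ n j * (indicator {0<..} (r j) * (r j ^ 0 * exp (- (r j)\<^sup>2)))))"
      by (rule prod_ennreal[symmetric]) auto
    also have "\<dots> = (\<Prod>j<k. ennreal ((1 / sqrt 2) ^ n j) * ennreal (indicator {0<..} (r j) * (r j ^ 0 * exp (- (r j)\<^sup>2))))"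
      by (intro prod.cong refl ennreal_mult) auto
    finally show ?thesis .
  qed
  define P where "P = (\<Prod>j<k. Mr (n j))"
  have P: "P > 0" unfolding P_def by (intro prod_pos) (simp add: Mr_pos)
  have "ennreal P * (\<integral>\<^sup>+t. ennreal (chart_dens N blk k t) \<partial>leb N) = (\<integral>\<^sup>+t. ennreal P * ennreal (chart_dens N blk k t) \<partial>leb N)"
    by (intro nn_integral_cmult[symmetric] measurable_compose[OF chart_dens_measurable measurable_ennreal])
  also have "\<dots> = (\<integral>\<^sup>+t. (\<integral>\<^sup>+r. ennreal (?c ^ N) * h t r \<partial>leb k) \<partial>leb N)"
  proof (rule nn_integral_cong)
    fix t assume t: "t \<in> space (leb N)"
    have "(\<lambda>r. h t r) \<in> borel_measurable (leb k)"
      unfolding h_def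
    proof (intro borel_measurable_prod_ennreal measurable_compose[OF _ measurable_ennreal])
      fix j assume "j \<in> {..<k}"
      then have [measurable]: "(\<lambda>p. p j) \<in> borel_measurable (leb k)" by (intro comp_k) simp
      show "(\<lambda>p. indicator {0<..} (p j) * (p j ^ n j * exp (- ((p j)\<^sup>2 * ?q j t)))) \<in> borel_measurable (leb k)"
        by measurable
    qed
    then have "(\<integral>\<^sup>+r. ennreal (?c ^ N) * h t r \<partial>leb k) = ennreal (?c ^ N) * ennreal (\<Prod>j<k. Mr (n j) * ?q j t powr (- (real (n j) + 1) / 2))"
      unfolding h_int[symmetric] by (rule nn_integral_cmult)
    also have "\<dots> = ennreal (?c ^ N * (\<Prod>j<k. Mr (n j) * ?q j t powr (- (real (n j) + 1) / 2)))"
      by (intro ennreal_mult[symmetric] prod_nonneg) (auto intro!: mult_nonneg_nonneg less_imp_le[OF Mr_pos])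
    also have "?c ^ N * (\<Prod>j<k. Mr (n j) * ?q j t powr (- (real (n j) + 1) / 2)) = P * chart_dens N blk k t"
      unfolding chart_dens_def P_def prod.distrib n_def by (simp only: mult_ac)
    also have "ennreal \<dots> = ennreal P * ennreal (chart_dens N blk k t)"
      by (intro ennreal_mult chart_dens_nonneg) (use P in simp)
    finally show "ennreal P * ennreal (chart_dens N blk k t) = (\<integral>\<^sup>+r. ennreal (?c ^ N) * h t r \<partial>leb k)" by (rule sym)
  qed
  also have "\<dots> = (\<integral>\<^sup>+r. (\<integral>\<^sup>+t. ennreal (?c ^ N) * h t r \<partial>leb N) \<partial>leb k)"
    by (rule Fubini'[where f="\<lambda>t r. ennreal (?c ^ N) * h t r", symmetric]) (use h_meas in \<open>simp only: case_prod_beta'\<close>)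
  also have "\<dots> = (\<integral>\<^sup>+r. (\<Prod>j<k. ennreal ((1 / sqrt 2) ^ n j) * ennreal (indicator {0<..} (r j) * (r j ^ 0 * exp (- (r j)\<^sup>2)))) \<partial>leb k)"
    by (simp only: inner)
  also have "\<dots> = (\<Prod>j<k. \<integral>\<^sup>+x. ennreal ((1 / sqrt 2) ^ n j) * ennreal (indicator {0<..} x * (x ^ 0 * exp (- x\<^sup>2))) \<partial>lborel)"
    by (rule lebp.product_nn_integral_prod) auto
  also have "\<dots> = (\<Prod>j<k. ennreal ((1 / sqrt 2) ^ n j * Mr 0))"
  proof (intro prod.cong refl)
    fix j
    have "(\<integral>\<^sup>+x. ennreal ((1 / sqrt 2) ^ n j) * ennreal (indicator {0<..} x * (x ^ 0 * exp (- x\<^sup>2))) \<partial>lborel) = ennreal ((1 / sqrt 2) ^ n j) * ennreal (Mr 0)"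
      unfolding nn_integral_Mr[of 0, symmetric] by (rule nn_integral_cmult) measurable
    also have "\<dots> = ennreal ((1 / sqrt 2) ^ n j * Mr 0)" by (rule ennreal_mult[symmetric]) (auto intro: less_imp_le[OF Mr_pos])
    finally show "(\<integral>\<^sup>+x. ennreal ((1 / sqrt 2) ^ n j) * ennreal (indicator {0<..} x * (x ^ 0 * exp (- x\<^sup>2))) \<partial>lborel) = ennreal ((1 / sqrt 2) ^ n j * Mr 0)" .
  qed
  also have "\<dots> = ennreal (\<Prod>j<k. (1 / sqrt 2) ^ n j * Mr 0)"
    by (rule prod_ennreal) (auto intro!: mult_nonneg_nonneg less_imp_le[OF Mr_pos])
  finally have fin: "ennreal P * (\<integral>\<^sup>+t. ennreal (chart_dens N blk k t) \<partial>leb N) = ennreal (\<Prod>j<k. (1 / sqrt 2) ^ n j * Mr 0)" .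
  have "(\<integral>\<^sup>+t. ennreal (chart_dens N blk k t) \<partial>leb N) = (ennreal (1 / P) * ennreal P) * (\<integral>\<^sup>+t. ennreal (chart_dens N blk k t) \<partial>leb N)"
    using P by (subst ennreal_mult[symmetric]) auto
  also have "\<dots> = ennreal (1 / P) * ennreal (\<Prod>j<k. (1 / sqrt 2) ^ n j * Mr 0)"
    by (simp only: mult.assoc fin)
  also have "\<dots> = ennreal (1 / P * (\<Prod>j<k. (1 / sqrt 2) ^ n j * Mr 0))"
    by (intro ennreal_mult[symmetric] prod_nonneg) (use P in \<open>auto intro!: mult_nonneg_nonneg less_imp_le[OF Mr_pos]\<close>)
  also have "1 / P * (\<Prod>j<k. (1 / sqrt 2) ^ n j * Mr 0) = (\<Prod>j<k. cc (n j))"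
    unfolding P_def cc_def by (simp add: prod_dividef)
  finally show ?thesis unfolding n_def .
qed

text \<open>In the Leibniz expansion every summand is a product of entries from different, hence
  independent, rows, and each entry has a finite first absolute moment.\<close>

lemma Jd_finite: "Jd N c < \<top>"
proof -
  interpret product_sigma_finite "\<lambda>_::nat. Gs {..<N}"
    by (intro product_sigma_finite.intro prob_space_imp_sigma_finite prob_space_Gs)
  let ?P = "{p. p permutes {..<N}}"
  let ?t = "\<lambda>p z. (\<Prod>i<N. ennreal \<bar>c i (p i) * z i (p i)\<bar>)"
  have pin: "p i < N" if "p \<in> ?P" "i < N" for p i
    using permutes_in_image[of p "{..<N}" i] that by auto
  have meas_row: "(\<lambda>y. ennreal \<bar>c i (p i) * y (p i)\<bar>) \<in> borel_measurable (Gs {..<N})" if "p \<in> ?P" "i < N" for p i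
    by (intro measurable_compose[OF _ measurable_ennreal] borel_measurable_abs borel_measurable_times borel_measurable_const
        measurable_Gs_component) (use pin[OF that] in simp)
  have "Jd N c \<le> (\<integral>\<^sup>+z. (\<Sum>p\<in>?P. ?t p z) \<partial>(\<Pi>\<^sub>M i\<in>{..<N}. Gs {..<N}))"
    unfolding Jd_def
  proof (rule nn_integral_mono)
    fix z
    have "\<bar>dt N (\<lambda>i l. c i l * z i l)\<bar> \<le> (\<Sum>p\<in>?P. \<bar>of_int (sign p) * (\<Prod>i<N. c i (p i) * z i (p i))\<bar>)"
      unfolding dt_leibniz by (rule sum_abs)
    also have "\<dots> = (\<Sum>p\<in>?P. \<Prod>i<N. \<bar>c i (p i) * z i (p i)\<bar>)"
      by (intro sum.cong refl) (simp add: abs_mult abs_prod sign_def)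
    finally have "ennreal \<bar>dt N (\<lambda>i l. c i l * z i l)\<bar> \<le> ennreal (\<Sum>p\<in>?P. \<Prod>i<N. \<bar>c i (p i) * z i (p i)\<bar>)"
      by (rule ennreal_leI)
    also have "\<dots> = (\<Sum>p\<in>?P. ennreal (\<Prod>i<N. \<bar>c i (p i) * z i (p i)\<bar>))"
      by (rule sum_ennreal[symmetric]) (auto intro: prod_nonneg)
    also have "\<dots> = (\<Sum>p\<in>?P. ?t p z)" by (intro sum.cong refl prod_ennreal[symmetric]) auto
    finally show "ennreal \<bar>dt N (\<lambda>i l. c i l * z i l)\<bar> \<le> (\<Sum>p\<in>?P. ?t p z)" .
  qed
  also have "\<dots> = (\<Sum>p\<in>?P. \<integral>\<^sup>+z. ?t p z \<partial>(\<Pi>\<^sub>M i\<in>{..<N}. Gs {..<N}))"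
  proof (rule nn_integral_sum)
    fix p assume p: "p \<in> ?P"
    show "?t p \<in> borel_measurable (\<Pi>\<^sub>M i\<in>{..<N}. Gs {..<N})"
    proof (rule borel_measurable_prod_ennreal)
      fix i assume i: "i \<in> {..<N}"
      then have "i < N" by simp
      from measurable_compose[OF measurable_component_singleton[of i "{..<N}" "\<lambda>_. Gs {..<N}", OF i] meas_row[OF p this]]
      show "(\<lambda>z. ennreal \<bar>c i (p i) * z i (p i)\<bar>) \<in> borel_measurable (\<Pi>\<^sub>M i\<in>{..<N}. Gs {..<N})" .
    qed
  qed
  also have "\<dots> = (\<Sum>p\<in>?P. \<Prod>i<N. \<integral>\<^sup>+y. ennreal \<bar>c i (p i) * y (p i)\<bar> \<partial>Gs {..<N})"
    by (intro sum.cong refl product_nn_integral_prod meas_row) auto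
  also have "\<dots> < \<top>"
  proof -
    have "(\<integral>\<^sup>+y. ennreal \<bar>c i (p i) * y (p i)\<bar> \<partial>Gs {..<N}) < \<top>" if "p \<in> ?P" "i < N" for p i
    proof -
      have "(\<Sum>l<N. (if l = p i then c i (p i) else 0) * y l) = c i (p i) * y (p i)" for y :: "nat \<Rightarrow> real"
      proof -
        have "(\<Sum>l<N. (if l = p i then c i (p i) else 0) * y l) = (\<Sum>l<N. if l = p i then c i (p i) * y (p i) else 0)"
          by (intro sum.cong) auto
        then show ?thesis using pin[OF that] by simp
      qed
      then have "(\<integral>\<^sup>+y. ennreal \<bar>c i (p i) * y (p i)\<bar> \<partial>Gs {..<N}) = ennreal (sqrt (\<Sum>l<N. (if l = p i then c i (p i) else 0)\<^sup>2)) * m1"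
        using gauss_abs_form[of "{..<N}" "\<lambda>l. if l = p i then c i (p i) else 0"] by simp
      then show ?thesis using m1_finite by (simp add: ennreal_mult_less_top)
    qed
    then show ?thesis
      by (auto simp: ennreal_sum_less_top finite_permutations less_top[symmetric] ennreal_prod_eq_top)
  qed
  finally show ?thesis .
qed

subsection \<open>The covariance kernel and its jets\<close>

definition compositions :: "'a set \<Rightarrow> nat \<Rightarrow> ('a \<Rightarrow> nat) set" where
  "compositions H d = {\<alpha> \<in> H \<rightarrow>\<^sub>E UNIV. (\<Sum>h\<in>H. \<alpha> h) = d}"

lemma finite_compositions:
  assumes "finite H"
  shows "finite (compositions H d)"
proof (rule finite_subset)
  show "compositions H d \<subseteq> H \<rightarrow>\<^sub>E {..d}"
  proof
    fix \<alpha> assume "\<alpha> \<in> compositions H d"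
    then have \<alpha>: "\<alpha> \<in> extensional H" "(\<Sum>h\<in>H. \<alpha> h) = d" by (auto simp: compositions_def PiE_iff)
    have "\<alpha> h \<le> d" if "h \<in> H" for h
      unfolding \<alpha>(2)[symmetric] by (rule member_le_sum) (use that assms in auto)
    with \<alpha>(1) show "\<alpha> \<in> H \<rightarrow>\<^sub>E {..d}" by (simp add: PiE_iff)
  qed
  show "finite (H \<rightarrow>\<^sub>E {..d})" using assms by (intro finite_PiE) auto
qed

lemma multinomial:
  fixes z :: "'a \<Rightarrow> real"
  assumes "finite H"
  shows "(\<Sum>\<alpha>\<in>compositions H d. fact d / (\<Prod>h\<in>H. fact (\<alpha> h)) * (\<Prod>h\<in>H. z h ^ \<alpha> h)) = (\<Sum>h\<in>H. z h) ^ d"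
  using assms
proof (induction H arbitrary: d)
  case empty
  have "compositions ({} :: 'a set) d = (if d = 0 then {\<lambda>_. undefined} else {})"
    by (auto simp: compositions_def)
  then show ?case by (cases "d = 0") simp_all
next
  case (insert x H)
  let ?T = "\<lambda>H d \<alpha>. fact d / (\<Prod>h\<in>H. fact (\<alpha> h)) * (\<Prod>h\<in>H. z h ^ \<alpha> h) :: real"
  have "(\<Sum>\<alpha>\<in>compositions (insert x H) d. ?T (insert x H) d \<alpha>)
      = (\<Sum>(m, \<alpha>)\<in>(SIGMA m:{..d}. compositions H (d - m)). real (d choose m) * z x ^ m * ?T H (d - m) \<alpha>)"
  proof (rule sum.reindex_bij_witness[where j="\<lambda>\<alpha>. (\<alpha> x, \<alpha>(x := undefined))" and i="\<lambda>(m, \<alpha>). \<alpha>(x := m)"], goal_cases)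
    case (1 \<alpha>) then show ?case by simp
  next
    case (2 \<alpha>)
    then have s: "\<alpha> x + (\<Sum>h\<in>H. \<alpha> h) = d" and e: "\<alpha> \<in> insert x H \<rightarrow>\<^sub>E UNIV"
      using insert by (auto simp: compositions_def)
    have "(\<Sum>h\<in>H. (\<alpha>(x := undefined)) h) = (\<Sum>h\<in>H. \<alpha> h)"
      using insert by (intro sum.cong) auto
    moreover have "\<alpha>(x := undefined) \<in> H \<rightarrow>\<^sub>E UNIV"
      using e by (auto simp: PiE_iff extensional_def)
    ultimately show ?case using s by (auto simp: compositions_def)
  next
    case (3 p)
    then obtain m \<alpha> where p: "p = (m, \<alpha>)" "m \<le> d" "\<alpha> \<in> compositions H (d - m)" by auto
    then have "\<alpha> x = undefined" using insert by (auto simp: compositions_def PiE_iff extensional_def)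
    then show ?case using p by (auto simp: fun_eq_iff)
  next
    case (4 p)
    then obtain m \<alpha> where p: "p = (m, \<alpha>)" "m \<le> d" "\<alpha> \<in> compositions H (d - m)" by auto
    have "(\<Sum>h\<in>H. (\<alpha>(x := m)) h) = (\<Sum>h\<in>H. \<alpha> h)"
      using insert by (intro sum.cong) auto
    then show ?case using p insert by (auto simp: compositions_def PiE_iff extensional_def)
  next
    case (5 \<alpha>)
    then have s: "\<alpha> x + (\<Sum>h\<in>H. \<alpha> h) = d" using insert by (auto simp: compositions_def)
    have c: "(\<Prod>h\<in>H. fact ((\<alpha>(x := undefined)) h)) = (\<Prod>h\<in>H. fact (\<alpha> h) :: real)"
      "(\<Prod>h\<in>H. z h ^ (\<alpha>(x := undefined)) h) = (\<Prod>h\<in>H. z h ^ \<alpha> h)"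
      using insert by (auto intro!: prod.cong)
    have "real (d choose \<alpha> x) = fact d / (fact (\<alpha> x) * fact (d - \<alpha> x))"
      using s by (intro binomial_fact) simp
    then show ?case using insert by (simp add: c del: fun_upd_apply)
  qed
  also have "\<dots> = (\<Sum>m\<le>d. \<Sum>\<alpha>\<in>compositions H (d - m). real (d choose m) * z x ^ m * ?T H (d - m) \<alpha>)"
    using insert by (subst sum.Sigma) (auto intro: finite_compositions)
  also have "\<dots> = (\<Sum>m\<le>d. real (d choose m) * z x ^ m * (\<Sum>h\<in>H. z h) ^ (d - m))"
    by (simp only: sum_distrib_left[symmetric] insert.IH)
  also have "\<dots> = (z x + (\<Sum>h\<in>H. z h)) ^ d" by (simp add: binomial_ring)
  finally show ?case using insert by simp
qed

definition monom :: "nat \<Rightarrow> (nat \<Rightarrow> nat) \<Rightarrow> (nat \<Rightarrow> nat \<Rightarrow> nat) \<Rightarrow> (nat \<Rightarrow> nat \<Rightarrow> real) \<Rightarrow> real" where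
  "monom k n a x = (\<Prod>j<k. \<Prod>h\<le>n j. x j h ^ a j h)"

lemma exponents_eq: "exponents k n d = (\<Pi>\<^sub>E j\<in>{..<k}. compositions {..n j} (d j))"
  by (simp add: exponents_def compositions_def)

text \<open>\<open>inverse (eta k n a)\<close> is a product of multinomial coefficients, one per
  block, so the sum over exponents is a product of multinomial expansions.\<close>

lemma kernel_monom:
  "(\<Sum>a\<in>exponents k n d. inverse (eta k n a) * (monom k n a x * monom k n a y))
     = (\<Prod>j<k. (\<Sum>h\<le>n j. x j h * y j h) ^ d j)"
proof -
  have "(\<Prod>j<k. (\<Sum>h\<le>n j. x j h * y j h) ^ d j)
      = (\<Prod>j<k. \<Sum>\<alpha>\<in>compositions {..n j} (d j). fact (d j) / (\<Prod>h\<le>n j. fact (\<alpha> h)) * (\<Prod>h\<le>n j. (x j h * y j h) ^ \<alpha> h))"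
    by (intro prod.cong refl multinomial[symmetric]) simp
  also have "\<dots> = (\<Sum>a\<in>exponents k n d. \<Prod>j<k. fact (d j) / (\<Prod>h\<le>n j. fact (a j h)) * (\<Prod>h\<le>n j. (x j h * y j h) ^ a j h))"
    unfolding exponents_eq by (rule prod_sum_PiE) (auto intro: finite_compositions)
  also have "\<dots> = (\<Sum>a\<in>exponents k n d. inverse (eta k n a) * (monom k n a x * monom k n a y))"
  proof (rule sum.cong[OF refl])
    fix a assume "a \<in> exponents k n d"
    then have "(\<Sum>h\<le>n j. a j h) = d j" if "j < k" for j
      using that by (auto simp: exponents_def PiE_iff)
    then show "(\<Prod>j<k. fact (d j) / (\<Prod>h\<le>n j. fact (a j h)) * (\<Prod>h\<le>n j. (x j h * y j h) ^ a j h))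
        = inverse (eta k n a) * (monom k n a x * monom k n a y)"
      by (simp add: eta_def monom_def prod.distrib power_mult_distrib prod_dividef)
  qed
  finally show ?thesis by simp
qed

lemma DERIV_prod_powers:
  fixes g :: "'a \<Rightarrow> real \<Rightarrow> real"
  assumes "finite J" "\<And>j. j \<in> J \<Longrightarrow> (g j has_real_derivative g' j) (at x)" "\<And>j. j \<in> J \<Longrightarrow> g j x \<noteq> 0"
  shows "((\<lambda>s. \<Prod>j\<in>J. g j s ^ d j) has_real_derivative
    (\<Prod>j\<in>J. g j x ^ d j) * (\<Sum>j\<in>J. real (d j) * (g' j / g j x))) (at x)"
  using assms
proof (induction J)
  case (insert i J)
  have 1: "((\<lambda>s. \<Prod>j\<in>J. g j s ^ d j) has_real_derivative
    (\<Prod>j\<in>J. g j x ^ d j) * (\<Sum>j\<in>J. real (d j) * (g' j / g j x))) (at x)"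
    using insert by auto
  have "((\<lambda>s. g i s ^ d i) has_real_derivative real (d i) * (g' i * g i x ^ (d i - Suc 0))) (at x)"
    using insert by (intro DERIV_power) auto
  also have "real (d i) * (g' i * g i x ^ (d i - Suc 0)) = g i x ^ d i * (real (d i) * (g' i / g i x))"
    using insert by (cases "d i") auto
  finally have 2: "((\<lambda>s. g i s ^ d i) has_real_derivative g i x ^ d i * (real (d i) * (g' i / g i x))) (at x)" .
  show ?case using DERIV_mult[OF 2 1] insert by (simp add: algebra_simps)
qed simp

text \<open>Differentiating the kernel identity at 0, first in s and then in u, yields the
  covariances of a value and a directional derivative. The logarithmic form of the first derivative
  needs nonzero bases, which holds for u near 0. \<beta> is the logarithmic derivative of the
  kernel; its square is the part of the variance that conditioning on the value will remove.\<close>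

lemma kernel_jet:
  fixes p :: "'a \<Rightarrow> real \<Rightarrow> real" and q b c :: "'b \<Rightarrow> real"
  assumes J: "finite J" and q: "\<And>j. j \<in> J \<Longrightarrow> q j > 0"
    and p: "\<And>a. a \<in> S \<Longrightarrow> (p a has_real_derivative p' a) (at 0)"
    and ker: "\<And>s u. (\<Sum>a\<in>S. w a * (p a s * p a u)) = (\<Prod>j\<in>J. (q j + (s + u) * b j + s * u * c j) ^ d j)"
  defines "K \<equiv> \<Prod>j\<in>J. q j ^ d j" and "\<beta> \<equiv> \<Sum>j\<in>J. real (d j) * (b j / q j)"
  shows "(\<Sum>a\<in>S. w a * (p a 0)\<^sup>2) = K" "(\<Sum>a\<in>S. w a * (p a 0 * p' a)) = K * \<beta>"
    "(\<Sum>a\<in>S. w a * (p' a)\<^sup>2) = K * (\<beta>\<^sup>2 + (\<Sum>j\<in>J. real (d j) * (c j / q j - (b j / q j)\<^sup>2)))"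
proof -
  show "(\<Sum>a\<in>S. w a * (p a 0)\<^sup>2) = K" using ker[of 0 0] by (simp add: K_def power2_eq_square)
  define R where "R u = (\<Sum>j\<in>J. real (d j) * ((b j + u * c j) / (q j + u * b j)))" for u
  define Q where "Q u = (\<Prod>j\<in>J. (q j + u * b j) ^ d j)" for u
  have first: "(\<Sum>a\<in>S. w a * (p' a * p a u)) = Q u * R u" if u: "\<And>j. j \<in> J \<Longrightarrow> q j + u * b j \<noteq> 0" for u
  proof -
    have "((\<lambda>s. \<Sum>a\<in>S. w a * (p a s * p a u)) has_real_derivative (\<Sum>a\<in>S. w a * (p' a * p a u))) (at 0)"
      by (intro DERIV_sum DERIV_cmult DERIV_cmult_right p)
    moreover have "((\<lambda>s. \<Prod>j\<in>J. (q j + (s + u) * b j + s * u * c j) ^ d j) has_real_derivative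
        (\<Prod>j\<in>J. (q j + (0 + u) * b j + 0 * u * c j) ^ d j)
          * (\<Sum>j\<in>J. real (d j) * ((b j + u * c j) / (q j + (0 + u) * b j + 0 * u * c j)))) (at 0)"
      by (rule DERIV_prod_powers[OF J]) (auto intro!: derivative_eq_intros simp: u)
    ultimately show ?thesis unfolding ker Q_def R_def by (auto dest: DERIV_unique)
  qed
  have "(\<Sum>a\<in>S. w a * (p' a * p a 0)) = Q 0 * R 0" by (rule first) (use q in force)
  then show "(\<Sum>a\<in>S. w a * (p a 0 * p' a)) = K * \<beta>"
    by (simp add: Q_def R_def K_def \<beta>_def mult.commute)
  have "\<forall>\<^sub>F u in nhds 0. \<forall>j\<in>J. q j + u * b j \<noteq> 0"
  proof (subst eventually_ball_finite_distrib[OF J], intro ballI)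
    fix j assume "j \<in> J"
    then have "q j > 0" by (rule q)
    moreover have "((\<lambda>u. q j + u * b j) \<longlongrightarrow> q j + 0 * b j) (nhds 0)"
      by (intro tendsto_add tendsto_mult tendsto_const filterlim_ident)
    ultimately show "\<forall>\<^sub>F u in nhds 0. q j + u * b j \<noteq> 0"
      using tendsto_imp_eventually_ne[of "\<lambda>u. q j + u * b j" "q j" "nhds 0" 0] by simp
  qed
  then have ev: "\<forall>\<^sub>F u in nhds 0. (\<Sum>a\<in>S. w a * (p' a * p a u)) = Q u * R u"
    by eventually_elim (rule first, auto)
  have dQ: "(Q has_real_derivative (\<Prod>j\<in>J. (q j + 0 * b j) ^ d j) * (\<Sum>j\<in>J. real (d j) * (b j / (q j + 0 * b j)))) (at 0)"
    unfolding Q_def by (rule DERIV_prod_powers[OF J]) (auto intro!: derivative_eq_intros dest: q)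
  have dR: "(R has_real_derivative (\<Sum>j\<in>J. real (d j) * (c j / q j - (b j / q j)\<^sup>2))) (at 0)"
    unfolding R_def
  proof (intro DERIV_sum DERIV_cmult)
    fix j assume "j \<in> J"
    then have "q j > 0" by (rule q)
    then show "((\<lambda>u. (b j + u * c j) / (q j + u * b j)) has_real_derivative c j / q j - (b j / q j)\<^sup>2) (at 0)"
      by (auto intro!: derivative_eq_intros simp: field_simps power2_eq_square)
  qed
  have "((\<lambda>u. \<Sum>a\<in>S. w a * (p' a * p a u)) has_real_derivative (\<Sum>a\<in>S. w a * (p' a * p' a))) (at 0)"
    by (intro DERIV_sum DERIV_cmult p)
  then have "((\<lambda>u. Q u * R u) has_real_derivative (\<Sum>a\<in>S. w a * (p' a * p' a))) (at 0)"
    using DERIV_cong_ev[OF refl ev refl] by simp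
  from DERIV_unique[OF this DERIV_mult[OF dQ dR]]
  show "(\<Sum>a\<in>S. w a * (p' a)\<^sup>2) = K * (\<beta>\<^sup>2 + (\<Sum>j\<in>J. real (d j) * (c j / q j - (b j / q j)\<^sup>2)))"
    by (simp add: Q_def R_def K_def \<beta>_def power2_eq_square algebra_simps)
qed

text \<open>
  The factor that turns independent Gaussian entries into a row of the Jacobian at \<open>t\<close>. In each block,
  \<open>I - t t\<^sup>T / (r (r + 1))\<close> is the square root of \<open>I - t t\<^sup>T / r\<^sup>2\<close>, where \<open>r\<^sup>2 = 1 + \<bar>t\<bar>\<^sup>2\<close>.
\<close>

definition Smat :: "nat \<Rightarrow> (nat \<Rightarrow> nat) \<Rightarrow> (nat \<Rightarrow> real) \<Rightarrow> nat \<Rightarrow> nat \<Rightarrow> real" where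
  "Smat N blk t p l = (let q = qb N blk (blk p) t in
     ((if p = l then 1 else 0) - (if blk p = blk l then t p * t l / (sqrt q * (sqrt q + 1)) else 0)) / sqrt q)"

lemma Smat_form:
  assumes p: "p < N" and j_def: "j = blk p"
  shows "(\<Sum>l<N. Smat N blk t p l * C l) =
    (C p - t p * (\<Sum>l\<in>bs N blk j. t l * C l) / (sqrt (qb N blk j t) * (sqrt (qb N blk j t) + 1))) / sqrt (qb N blk j t)"
proof -
  let ?r = "sqrt (qb N blk j t)"
  have "(\<Sum>l<N. Smat N blk t p l * C l) = (\<Sum>l<N. ((if p = l then C l else 0)
      - (if blk l = j then t p / (?r * (?r + 1)) * (t l * C l) else 0)) / ?r)"
    by (rule sum.cong) (auto simp: Smat_def Let_def j_def field_simps)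
  also have "\<dots> = ((\<Sum>l<N. if p = l then C l else 0) - (\<Sum>l<N. if blk l = j then t p / (?r * (?r + 1)) * (t l * C l) else 0)) / ?r"
    by (simp add: sum_divide_distrib[symmetric] sum_subtractf)
  also have "(\<Sum>l<N. if p = l then C l else 0) = C p" using p by simp
  also have "(\<Sum>l<N. if blk l = j then t p / (?r * (?r + 1)) * (t l * C l) else 0) = t p / (?r * (?r + 1)) * (\<Sum>l\<in>bs N blk j. t l * C l)"
    by (simp add: bs_def sum_distrib_left sum.inter_filter[symmetric] Collect_conj_eq lessThan_def)
  finally show ?thesis by simp
qed

text \<open>Makes \<open>Smat\<close> a square root of the conditional covariance: the right-hand
  side has the shape of the term that \<open>kernel_jet\<close> adds to \<beta>^2. The coefficient
  \<beta> = 1/(r (r+1)) fits because \<beta>^2 (r^2 - 1) - 2 \<beta> = -1/r^2.\<close>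

lemma Smat_quadratic:
  assumes blk: "\<And>l. l < N \<Longrightarrow> blk l < k"
  shows "(\<Sum>p<N. e (blk p) * (\<Sum>l<N. Smat N blk t p l * C l)\<^sup>2)
    = (\<Sum>j<k. e j * ((\<Sum>l\<in>bs N blk j. (C l)\<^sup>2) / qb N blk j t - ((\<Sum>l\<in>bs N blk j. t l * C l) / qb N blk j t)\<^sup>2))"
proof -
  have "(\<Sum>p\<in>bs N blk j. e (blk p) * (\<Sum>l<N. Smat N blk t p l * C l)\<^sup>2)
      = e j * ((\<Sum>l\<in>bs N blk j. (C l)\<^sup>2) / qb N blk j t - ((\<Sum>l\<in>bs N blk j. t l * C l) / qb N blk j t)\<^sup>2)" for j
  proof -
    define q where "q = qb N blk j t"
    define r where "r = sqrt q"
    define b where "b = (\<Sum>l\<in>bs N blk j. t l * C l)"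
    define c where "c = (\<Sum>l\<in>bs N blk j. (C l)\<^sup>2)"
    define \<beta> where "\<beta> = 1 / (r * (r + 1))"
    have r: "r > 0" "q = r\<^sup>2" using qb_pos[of N blk j t] by (auto simp: r_def q_def less_imp_le)
    have T: "(\<Sum>l\<in>bs N blk j. (t l)\<^sup>2) = r\<^sup>2 - 1" using r(2) by (simp add: q_def qb_def)
    have "(\<Sum>p\<in>bs N blk j. e (blk p) * (\<Sum>l<N. Smat N blk t p l * C l)\<^sup>2)
        = (\<Sum>p\<in>bs N blk j. e j / r\<^sup>2 * ((C p)\<^sup>2 - 2 * \<beta> * b * (t p * C p) + (\<beta> * b)\<^sup>2 * (t p)\<^sup>2))"
    proof (rule sum.cong[OF refl])
      fix p assume "p \<in> bs N blk j"
      then have p: "p < N" "blk p = j" by (auto simp: bs_def)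
      have "(\<Sum>l<N. Smat N blk t p l * C l) = (C p - t p * b * \<beta>) / r"
        using Smat_form[where blk=blk and t=t and C=C, OF p(1) p(2)[symmetric]] by (simp add: b_def \<beta>_def r_def q_def)
      then show "e (blk p) * (\<Sum>l<N. Smat N blk t p l * C l)\<^sup>2
          = e j / r\<^sup>2 * ((C p)\<^sup>2 - 2 * \<beta> * b * (t p * C p) + (\<beta> * b)\<^sup>2 * (t p)\<^sup>2)"
        using p by (simp add: power_divide power2_diff power_mult_distrib) (simp add: algebra_simps)?
    qed
    also have "\<dots> = e j / r\<^sup>2 * (c - 2 * \<beta> * b * b + (\<beta> * b)\<^sup>2 * (r\<^sup>2 - 1))"
      by (simp only: sum_distrib_left[symmetric] sum.distrib sum_subtractf T c_def b_def)
    also have "c - 2 * \<beta> * b * b + (\<beta> * b)\<^sup>2 * (r\<^sup>2 - 1) = c + b\<^sup>2 * (\<beta>\<^sup>2 * (r\<^sup>2 - 1) - 2 * \<beta>)"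
      by (simp add: algebra_simps power2_eq_square)
    also have "\<beta>\<^sup>2 * (r\<^sup>2 - 1) - 2 * \<beta> = - 1 / r\<^sup>2"
    proof -
      have "\<beta>\<^sup>2 * (r\<^sup>2 - 1) - 2 * \<beta> = (r * r - 1 - 2 * (r * (r + 1))) / (r * (r + 1))\<^sup>2"
        using r(1) by (simp add: \<beta>_def power2_eq_square divide_simps)
      also have "r * r - 1 - 2 * (r * (r + 1)) = - ((r + 1)\<^sup>2)"
        by (simp add: algebra_simps power2_eq_square)
      also have "- ((r + 1)\<^sup>2) / (r * (r + 1))\<^sup>2 = - 1 / r\<^sup>2"
        using r(1) by (simp add: power_mult_distrib)
      finally show ?thesis .
    qed
    also have "e j / r\<^sup>2 * (c + b\<^sup>2 * (- 1 / r\<^sup>2)) = e j * (c / q - (b / q)\<^sup>2)"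
      using r by (simp add: power_divide field_simps power2_eq_square)
    finally show ?thesis unfolding q_def b_def c_def .
  qed
  then show ?thesis
    using sum_blocks[of N blk k "\<lambda>p. e (blk p) * (\<Sum>l<N. Smat N blk t p l * C l)\<^sup>2"] blk by simp
qed

text \<open>Apart from the row scaling, the matrix is a product of rank-one perturbations of the
  identity, one per block: the blocks have disjoint supports, so multiplying by the next factor
  merely adds its perturbation. By \<open>dt_rank_one\<close> each factor has determinant 1 / sqrt(q
  j), and the row scaling contributes one more such factor for every row of the block.\<close>

lemma dt_Smat:
  assumes blk: "\<And>l. l < N \<Longrightarrow> blk l < k"
  shows "dt N (Smat N blk t) = (\<Prod>j<k. qb N blk j t powr (- (real (card (bs N blk j)) + 1) / 2))"
proof -
  define q where "q j = qb N blk j t" for j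
  define \<beta> where "\<beta> j = 1 / (sqrt (q j) * (sqrt (q j) + 1))" for j
  have q: "q j > 0" for j by (simp add: q_def qb_pos)
  have if_mult: "M * u = (if P then u else 0) \<Longrightarrow> M * (u * v) = (if P then u * v else 0)"
    and mult_if: "M * (if P then 1 else 0) = (if P then M else 0)" for M u v :: real and P
    by (auto simp: mult.assoc[symmetric])
  let ?M = "\<lambda>k' p l. (if p = l then 1 else 0) + (if blk p = blk l \<and> blk p < k' then - \<beta> (blk p) * t p * t l else (0::real))"
  have M: "dt N (?M k') = (\<Prod>j<k'. 1 / sqrt (q j))" for k'
  proof (induction k')
    case 0
    have "dt N (?M 0) = dt N (\<lambda>p l. (if p = l then 1 else 0) + 0 * 0)" by (rule dt_cong) simp
    also have "\<dots> = 1 + (\<Sum>l<N. 0 * 0)" by (rule dt_rank_one)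
    finally show ?case by simp
  next
    case (Suc m)
    let ?v = "\<lambda>l. if blk l = m then t l else 0" and ?u = "\<lambda>p. if blk p = m then - \<beta> m * t p else 0"
    have "dt N (?M (Suc m)) = dt N (\<lambda>p l. \<Sum>r<N. ?M m p r * ((if r = l then 1 else 0) + ?u r * ?v l))"
    proof (rule dt_cong)
      fix p l assume p: "p < N" and l: "l < N"
      have "(\<Sum>r<N. ?M m p r * ((if r = l then 1 else 0) + ?u r * ?v l))
          = (\<Sum>r<N. (if r = l then ?M m p r else 0) + (if r = p then ?u r * ?v l else 0))"
      proof (rule sum.cong[OF refl])
        fix r
        have "?M m p r * ?u r = (if r = p then ?u r else 0)"
          by (cases "blk r = m"; cases "r = p"; simp)
        then have "?M m p r * (?u r * ?v l) = (if r = p then ?u r * ?v l else 0)"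
          by (rule if_mult)
        moreover have "?M m p r * (if r = l then 1 else 0) = (if r = l then ?M m p r else 0)"
          by (rule mult_if)
        ultimately show "?M m p r * ((if r = l then 1 else 0) + ?u r * ?v l)
            = (if r = l then ?M m p r else 0) + (if r = p then ?u r * ?v l else 0)"
          by (simp only: distrib_left)
      qed
      also have "\<dots> = ?M m p l + ?u p * ?v l"
        using p l by (simp add: sum.distrib)
      also have "\<dots> = ?M (Suc m) p l" by (auto simp: less_Suc_eq)
      finally show "?M (Suc m) p l = (\<Sum>r<N. ?M m p r * ((if r = l then 1 else 0) + ?u r * ?v l))" by simp
    qed
    also have "\<dots> = dt N (?M m) * dt N (\<lambda>r l. (if r = l then 1 else 0) + ?u r * ?v l)"
      by (rule dt_mult)
    also have "dt N (\<lambda>r l. (if r = l then 1 else 0) + ?u r * ?v l) = 1 + (\<Sum>l<N. ?u l * ?v l)"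
      by (rule dt_rank_one)
    also have "(\<Sum>l<N. ?u l * ?v l) = - \<beta> m * (\<Sum>l\<in>bs N blk m. (t l)\<^sup>2)"
    proof -
      have "(\<Sum>l<N. ?u l * ?v l) = (\<Sum>l<N. if blk l = m then - \<beta> m * (t l)\<^sup>2 else 0)"
        by (rule sum.cong) (auto simp: power2_eq_square)
      then show ?thesis
        by (simp add: bs_def sum_distrib_left sum.inter_filter[symmetric] Collect_conj_eq lessThan_def)
    qed
    also have "(\<Sum>l\<in>bs N blk m. (t l)\<^sup>2) = q m - 1" by (simp add: q_def qb_def)
    also have "1 + - \<beta> m * (q m - 1) = 1 / sqrt (q m)"
    proof -
      have "q m - 1 = (sqrt (q m) + 1) * (sqrt (q m) - 1)"
        using q[of m] by (simp add: algebra_simps)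
      moreover have "sqrt (q m) > 0" using q by simp
      moreover from this have "sqrt (q m) + 1 \<noteq> 0" by linarith
      ultimately have "\<beta> m * (q m - 1) = (sqrt (q m) - 1) / sqrt (q m)"
        by (simp add: \<beta>_def)
      then show ?thesis using q[of m] by (simp add: diff_divide_distrib)
    qed
    finally show ?case using Suc by simp
  qed
  have "dt N (Smat N blk t) = dt N (\<lambda>p l. 1 / sqrt (q (blk p)) * ?M k p l)"
    using blk by (intro dt_cong) (auto simp: Smat_def Let_def q_def \<beta>_def field_simps)
  also have "\<dots> = dt N (\<lambda>l p. ?M k p l * (1 / sqrt (q (blk p))))"
    by (rule trans[OF dt_transpose[symmetric]]) (simp only: mult.commute)
  also have "\<dots> = dt N (\<lambda>l p. ?M k p l) * (\<Prod>p<N. 1 / sqrt (q (blk p)))"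
    by (rule dt_scale_cols)
  also have "dt N (\<lambda>l p. ?M k p l) = (\<Prod>j<k. 1 / sqrt (q j))"
    unfolding M[symmetric] by (rule dt_transpose)
  also have "(\<Prod>p<N. 1 / sqrt (q (blk p))) = (\<Prod>j<k. (1 / sqrt (q j)) ^ card (bs N blk j))"
    by (rule prod_blocks_card) (rule blk)
  also have "(\<Prod>j<k. 1 / sqrt (q j)) * \<dots> = (\<Prod>j<k. q j powr (- (real (card (bs N blk j)) + 1) / 2))"
    unfolding prod.distrib[symmetric]
  proof (rule prod.cong[OF refl])
    fix j
    have "1 / sqrt (q j) = q j powr (- 1 / 2)"
      using q[of j] by (simp add: powr_half_sqrt[symmetric] powr_minus_divide)
    then have "1 / sqrt (q j) * (1 / sqrt (q j)) ^ card (bs N blk j) = (q j powr (- 1 / 2)) ^ Suc (card (bs N blk j))"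
      by simp
    also have "\<dots> = q j powr (real (Suc (card (bs N blk j))) * (- 1 / 2))"
      by (rule powr_power) (use q[of j] in simp)
    also have "real (Suc (card (bs N blk j))) * (- 1 / 2) = - (real (card (bs N blk j)) + 1) / 2"
      by (simp add: field_simps)
    finally show "1 / sqrt (q j) * (1 / sqrt (q j)) ^ card (bs N blk j) = q j powr (- (real (card (bs N blk j)) + 1) / 2)" .
  qed
  finally show ?thesis by (simp add: q_def)
qed

subsection \<open>Affine charts of the root space\<close>

text \<open>\<open>hc\<close> selects in each block the homogeneous coordinate that is set to 1. The
  other coordinates are numbered by l < N; \<open>(blk, pos)\<close> and \<open>idx\<close> are the
  two directions of this numbering.\<close>

locale chart =
  fixes k :: nat and n hc :: "nat \<Rightarrow> nat" and N :: nat and blk pos :: "nat \<Rightarrow> nat" and idx :: "nat \<Rightarrow> nat \<Rightarrow> nat"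
  assumes hc: "j < k \<Longrightarrow> hc j \<le> n j"
    and blk: "l < N \<Longrightarrow> blk l < k"
    and pos: "l < N \<Longrightarrow> pos l \<le> n (blk l)" "l < N \<Longrightarrow> pos l \<noteq> hc (blk l)" "l < N \<Longrightarrow> idx (blk l) (pos l) = l"
    and idx: "j < k \<Longrightarrow> h \<le> n j \<Longrightarrow> h \<noteq> hc j \<Longrightarrow> idx j h < N"
      "j < k \<Longrightarrow> h \<le> n j \<Longrightarrow> h \<noteq> hc j \<Longrightarrow> blk (idx j h) = j"
      "j < k \<Longrightarrow> h \<le> n j \<Longrightarrow> h \<noteq> hc j \<Longrightarrow> pos (idx j h) = h"
begin

lemma sum_chart:
  fixes F :: "nat \<Rightarrow> 'a::comm_monoid_add"
  assumes j: "j < k"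
  shows "(\<Sum>h\<le>n j. F h) = F (hc j) + (\<Sum>l\<in>bs N blk j. F (pos l))"
proof -
  have "(\<Sum>h\<in>{..n j} - {hc j}. F h) = (\<Sum>l\<in>bs N blk j. F (pos l))"
    by (rule sum.reindex_bij_witness[where i=pos and j="idx j"]) (use j pos idx in \<open>auto simp: bs_def\<close>)
  then show ?thesis using hc[OF j] by (subst sum.remove[of _ "hc j"]) auto
qed

lemma card_bs: "j < k \<Longrightarrow> card (bs N blk j) = n j"
  using sum_chart[of j "\<lambda>_. 1::nat"] by simp

lemma N_eq: "N = (\<Sum>j<k. n j)"
  using sum_blocks[of N blk k "\<lambda>_. 1::nat"] blk card_bs by simp

definition chart_point :: "(nat \<Rightarrow> real) \<Rightarrow> nat \<Rightarrow> nat \<Rightarrow> real" where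
  "chart_point t j h = (if h = hc j then 1 else t (idx j h))"

definition chart_monom :: "(nat \<Rightarrow> nat \<Rightarrow> nat) \<Rightarrow> (nat \<Rightarrow> real) \<Rightarrow> real" where
  "chart_monom a t = monom k n a (chart_point t)"

lemma kernel_chart_monom:
  "(\<Sum>a\<in>exponents k n d. inverse (eta k n a) * (chart_monom a t * chart_monom a u))
    = (\<Prod>j<k. (1 + (\<Sum>l\<in>bs N blk j. t l * u l)) ^ d j)"
  unfolding chart_monom_def kernel_monom
proof (rule prod.cong[OF refl])
  fix j assume "j \<in> {..<k}"
  then have j: "j < k" by simp
  have "(\<Sum>l\<in>bs N blk j. chart_point t j (pos l) * chart_point u j (pos l)) = (\<Sum>l\<in>bs N blk j. t l * u l)"
    by (rule sum.cong) (use pos in \<open>auto simp: bs_def chart_point_def\<close>)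
  then show "(\<Sum>h\<le>n j. chart_point t j h * chart_point u j h) ^ d j = (1 + (\<Sum>l\<in>bs N blk j. t l * u l)) ^ d j"
    unfolding sum_chart[OF j] by (simp add: chart_point_def)
qed

text \<open>The exponent of the monomial that is constantly 1 on the chart. Its coefficient has
  variance 1 and acts as an additive constant of the equation.\<close>

definition lead_exponent :: "(nat \<Rightarrow> nat) \<Rightarrow> nat \<Rightarrow> nat \<Rightarrow> nat" where
  "lead_exponent d = (\<lambda>j\<in>{..<k}. \<lambda>h\<in>{..n j}. if h = hc j then d j else 0)"

lemma lead_exponent_exponents: "lead_exponent d \<in> exponents k n d"
  using hc by (auto simp: lead_exponent_def exponents_def intro!: PiE_I)

lemma eta_lead_exponent: "eta k n (lead_exponent d) = 1"
proof -
  have "(\<Prod>h\<le>n j. fact (lead_exponent d j h)) = (fact (d j) :: real)" "(\<Sum>h\<le>n j. lead_exponent d j h) = d j" if j: "j < k" for j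
  proof -
    have "(\<Prod>h\<le>n j. fact (lead_exponent d j h)) = (\<Prod>h\<le>n j. if h = hc j then fact (d j) else 1 :: real)"
      using j by (intro prod.cong) (auto simp: lead_exponent_def)
    then show "(\<Prod>h\<le>n j. fact (lead_exponent d j h)) = (fact (d j) :: real)" using hc[OF j] by simp
    have "(\<Sum>h\<le>n j. lead_exponent d j h) = (\<Sum>h\<le>n j. if h = hc j then d j else 0)"
      using j by (intro sum.cong) (auto simp: lead_exponent_def)
    then show "(\<Sum>h\<le>n j. lead_exponent d j h) = d j" using hc[OF j] by simp
  qed
  then show ?thesis unfolding eta_def by simp
qed

lemma chart_monom_lead_exponent: "chart_monom (lead_exponent d) t = 1"
  unfolding chart_monom_def monom_def by (intro prod.neutral ballI) (auto simp: lead_exponent_def chart_point_def)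

lemma ex_dqf_chart_monom: "\<exists>A. dqf N (chart_monom a) A"
proof -
  have "\<exists>A. dqf N (\<lambda>t. chart_point t j h ^ a j h) A" if "j < k" "h \<le> n j" for j h
  proof -
    have "\<exists>A. dqf N (\<lambda>t. chart_point t j h) A"
    proof (cases "h = hc j")
      case True
      then show ?thesis using dqf_const[of N 1] by (auto simp: chart_point_def)
    next
      case False
      then show ?thesis using dqf_coord[OF idx(1)[OF that False]] by (auto simp: chart_point_def)
    qed
    then show ?thesis using dqf_power by blast
  qed
  then have "\<exists>A. dqf N (\<lambda>t. \<Prod>j<k. \<Prod>h\<le>n j. chart_point t j h ^ a j h) A"
    by (intro dqf_prod) auto
  then show ?thesis by (simp add: chart_monom_def[abs_def] monom_def)
qed

text \<open>An arbitrary choice of quotients; its values on the diagonal are determined by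
  \<open>dqf_deriv\<close>.\<close>

definition chart_monom_dq :: "(nat \<Rightarrow> nat \<Rightarrow> nat) \<Rightarrow> nat \<Rightarrow> (nat \<Rightarrow> real) \<Rightarrow> (nat \<Rightarrow> real) \<Rightarrow> real" where
  "chart_monom_dq a = (SOME A. dqf N (chart_monom a) A)"

lemma dqf_chart_monom: "dqf N (chart_monom a) (chart_monom_dq a)"
  unfolding chart_monom_dq_def by (rule someI_ex[OF ex_dqf_chart_monom])

abbreviation rest_exponents :: "(nat \<Rightarrow> nat) \<Rightarrow> (nat \<Rightarrow> nat \<Rightarrow> nat) set" where
  "rest_exponents d \<equiv> exponents k n d - {lead_exponent d}"

abbreviation coeff_sd :: "(nat \<Rightarrow> nat \<Rightarrow> nat) \<Rightarrow> real" where
  "coeff_sd a \<equiv> sqrt (inverse (eta k n a))"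

abbreviation row_law :: "(nat \<Rightarrow> nat) \<Rightarrow> ((nat \<Rightarrow> nat \<Rightarrow> nat) \<Rightarrow> real) measure" where
  "row_law d \<equiv> \<Pi>\<^sub>M a\<in>rest_exponents d. nrm (coeff_sd a)"

lemma coeff_sd_pos: "coeff_sd a > 0" by (simp add: eta_pos)

lemma coeff_sd_sq: "(coeff_sd a)\<^sup>2 = inverse (eta k n a)" using eta_pos[of k n a] by (simp add: less_imp_le)

lemma finite_rest_exponents: "finite (rest_exponents d)" by (simp add: finite_exponents)

lemma prob_space_row_law: "prob_space (row_law d)"
  by (intro prob_space_PiM prob_space_nrm coeff_sd_pos)

definition chart_value :: "(nat \<Rightarrow> nat) \<Rightarrow> ((nat \<Rightarrow> nat \<Rightarrow> nat) \<Rightarrow> real) \<Rightarrow> (nat \<Rightarrow> real) \<Rightarrow> real" where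
  "chart_value d X t = (\<Sum>a\<in>rest_exponents d. X a * chart_monom a t)"

definition chart_row :: "(nat \<Rightarrow> nat) \<Rightarrow> ((nat \<Rightarrow> nat \<Rightarrow> nat) \<Rightarrow> real) \<Rightarrow> (nat \<Rightarrow> real) \<Rightarrow> nat \<Rightarrow> real" where
  "chart_row d X t l = (\<Sum>a\<in>rest_exponents d. X a * chart_monom_dq a l t t)"

text \<open>Value and derivative in direction \<open>C\<close> are two linear forms in the
  coefficients, so \<open>gauss_two_forms\<close> applies. The density weight produces the factor 1
  / sqrt(2 pi K) and replaces the derivative by a normal variable of conditional variance K Q. The
  kernel value K cancels, and Q is the quadratic form of \<open>Smat\<close>.\<close>

lemma row_integral:
  assumes t: "t \<in> rsp N"
  shows "(\<integral>\<^sup>+X. ennreal \<bar>\<Sum>l<N. normal_density 0 1 (chart_value d X t) * chart_row d X t l * C l\<bar> \<partial>row_law d)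
    = (\<integral>\<^sup>+z. ennreal \<bar>\<Sum>l<N. 1 / sqrt (2 * pi) * (\<Sum>p<N. sqrt (real (d (blk p))) * z p * Smat N blk t p l) * C l\<bar> \<partial>Gs {..<N})"
proof -
  define v where "v a = chart_monom a t" for a
  define w where "w a = (\<Sum>l<N. chart_monom_dq a l t t * C l)" for a
  define q where "q j = qb N blk j t" for j
  define b where "b j = (\<Sum>l\<in>bs N blk j. t l * C l)" for j
  define c where "c j = (\<Sum>l\<in>bs N blk j. (C l)\<^sup>2)" for j
  define K where "K = (\<Prod>j<k. q j ^ d j)"
  define \<beta> where "\<beta> = (\<Sum>j<k. real (d j) * (b j / q j))"
  define Q where "Q = (\<Sum>j<k. real (d j) * (c j / q j - (b j / q j)\<^sup>2))"
  define line where "line s = (\<lambda>l\<in>{..<N}. t l + s * C l)" for s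
  have q: "q j > 0" for j by (simp add: q_def qb_pos)
  have line0: "line 0 = t"
    using t by (intro rsp_eqI[of _ N]) (auto simp: line_def restrict_rsp)
  have ker: "(\<Sum>a\<in>exponents k n d. inverse (eta k n a) * (chart_monom a (line s) * chart_monom a (line u)))
      = (\<Prod>j<k. (q j + (s + u) * b j + s * u * c j) ^ d j)" for s u
    unfolding kernel_chart_monom
  proof (intro prod.cong refl arg_cong[where f="\<lambda>x. x ^ _"])
    fix j
    have "(\<Sum>l\<in>bs N blk j. line s l * line u l)
        = (\<Sum>l\<in>bs N blk j. (t l)\<^sup>2 + (s + u) * (t l * C l) + s * u * (C l)\<^sup>2)"
      by (rule sum.cong) (auto simp: bs_def line_def power2_eq_square algebra_simps)
    then show "1 + (\<Sum>l\<in>bs N blk j. line s l * line u l) = q j + (s + u) * b j + s * u * c j"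
      by (simp add: q_def qb_def b_def c_def sum.distrib sum_distrib_left)
  qed
  have deriv: "((\<lambda>s. chart_monom a (line s)) has_real_derivative w a) (at 0)" for a
    unfolding line_def w_def by (rule dqf_deriv[OF dqf_chart_monom t])
  have jets: "(\<Sum>a\<in>exponents k n d. inverse (eta k n a) * (v a)\<^sup>2) = K"
    "(\<Sum>a\<in>exponents k n d. inverse (eta k n a) * (v a * w a)) = K * \<beta>"
    "(\<Sum>a\<in>exponents k n d. inverse (eta k n a) * (w a)\<^sup>2) = K * (\<beta>\<^sup>2 + Q)"
    using kernel_jet[of "{..<k}" q "exponents k n d" "\<lambda>a s. chart_monom a (line s)" w "\<lambda>a. inverse (eta k n a)" b c d] q deriv ker
    by (simp_all add: line0 v_def K_def \<beta>_def Q_def)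
  have va0: "v (lead_exponent d) = 1" by (simp add: v_def chart_monom_lead_exponent)
  have wa0: "w (lead_exponent d) = 0"
  proof -
    have "((\<lambda>s. 1) has_real_derivative w (lead_exponent d)) (at 0)"
      using deriv[of "lead_exponent d"] by (simp add: chart_monom_lead_exponent)
    then show ?thesis by (rule DERIV_unique) simp
  qed
  have split: "(\<Sum>a\<in>rest_exponents d. inverse (eta k n a) * f a) = (\<Sum>a\<in>exponents k n d. inverse (eta k n a) * f a) - f (lead_exponent d)" for f :: "_ \<Rightarrow> real"
    using sum.remove[OF finite_exponents lead_exponent_exponents, of "\<lambda>a. inverse (eta k n a) * f a" d] by (simp add: eta_lead_exponent)
  have K: "K > 0" unfolding K_def by (intro prod_pos) (simp add: q)
  \<comment> \<open>The leading monomial has value 1 and derivative 0, so leaving it out lowers only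
    this sum, by 1. The variance 1 of the density in the integrand restores K.\<close>
  have V: "(\<Sum>a\<in>rest_exponents d. (coeff_sd a)\<^sup>2 * (v a)\<^sup>2) = K - 1"
    unfolding coeff_sd_sq by (subst split) (simp add: jets va0)
  have B: "(\<Sum>a\<in>rest_exponents d. (coeff_sd a)\<^sup>2 * (v a * w a)) = K * \<beta>"
    unfolding coeff_sd_sq by (subst split) (simp add: jets wa0)
  have W: "(\<Sum>a\<in>rest_exponents d. (coeff_sd a)\<^sup>2 * (w a)\<^sup>2) = K * (\<beta>\<^sup>2 + Q)"
    unfolding coeff_sd_sq by (subst split) (simp add: jets wa0)
  have Q: "(\<Sum>p<N. real (d (blk p)) * (\<Sum>l<N. Smat N blk t p l * C l)\<^sup>2) = Q"
    unfolding Q_def b_def c_def q_def by (rule Smat_quadratic) (rule blk)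
  have Q0: "Q \<ge> 0" unfolding Q[symmetric] by (intro sum_nonneg mult_nonneg_nonneg) auto
  have WB: "K * (\<beta>\<^sup>2 + Q) - (K * \<beta>)\<^sup>2 / K = K * Q"
    using K by (simp add: power2_eq_square field_simps)
  have "(\<integral>\<^sup>+X. ennreal \<bar>\<Sum>l<N. normal_density 0 1 (chart_value d X t) * chart_row d X t l * C l\<bar> \<partial>row_law d)
      = (\<integral>\<^sup>+X. ennreal (normal_density 0 1 (0 + (\<Sum>a\<in>rest_exponents d. v a * X a))) * ennreal \<bar>0 + (\<Sum>a\<in>rest_exponents d. w a * X a)\<bar> \<partial>row_law d)"
  proof (rule nn_integral_cong)
    fix X
    have "(\<Sum>l<N. normal_density 0 1 (chart_value d X t) * chart_row d X t l * C l) = normal_density 0 1 (chart_value d X t) * (\<Sum>l<N. chart_row d X t l * C l)"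
      by (simp add: sum_distrib_left mult.assoc)
    also have "(\<Sum>l<N. chart_row d X t l * C l) = (\<Sum>a\<in>rest_exponents d. w a * X a)"
      unfolding chart_row_def w_def sum_distrib_right by (subst sum.swap) (simp only: mult_ac)
    finally have 1: "(\<Sum>l<N. normal_density 0 1 (chart_value d X t) * chart_row d X t l * C l) = normal_density 0 1 (chart_value d X t) * (\<Sum>a\<in>rest_exponents d. w a * X a)" .
    have 2: "chart_value d X t = (\<Sum>a\<in>rest_exponents d. v a * X a)"
      by (simp add: chart_value_def v_def mult.commute)
    show "ennreal \<bar>\<Sum>l<N. normal_density 0 1 (chart_value d X t) * chart_row d X t l * C l\<bar>
        = ennreal (normal_density 0 1 (0 + (\<Sum>a\<in>rest_exponents d. v a * X a))) * ennreal \<bar>0 + (\<Sum>a\<in>rest_exponents d. w a * X a)\<bar>"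
      unfolding 1 unfolding 2 by (simp add: abs_mult ennreal_mult)
  qed
  also have "\<dots> = ennreal (normal_density 0 (sqrt (1\<^sup>2 + (K - 1))) 0)
      * (\<integral>\<^sup>+z. ennreal \<bar>0 - K * \<beta> / (1\<^sup>2 + (K - 1)) * 0 + sqrt (K * (\<beta>\<^sup>2 + Q) - (K * \<beta>)\<^sup>2 / (1\<^sup>2 + (K - 1))) * z\<bar> \<partial>nrm 1)"
    unfolding V[symmetric] B[symmetric] W[symmetric]
    by (rule gauss_two_forms[where h="\<lambda>x. ennreal \<bar>x\<bar>" and \<sigma>=coeff_sd and \<kappa>=1])
      (rule finite_rest_exponents coeff_sd_pos zero_less_one, measurable)+
  also have "\<dots> = ennreal (1 / sqrt (2 * pi * K)) * (\<integral>\<^sup>+z. ennreal \<bar>sqrt (K * Q) * z\<bar> \<partial>nrm 1)"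
    using K WB by (simp add: normal_density_def)
  also have "\<dots> = ennreal (1 / sqrt (2 * pi * K)) * (ennreal (sqrt (K * Q)) * m1)"
    using K Q0 by (simp add: m1_scale)
  also have "\<dots> = ennreal (sqrt (Q / (2 * pi))) * m1"
  proof -
    have "1 / sqrt (2 * pi * K) * sqrt (K * Q) = sqrt (Q / (2 * pi))"
      using K by (simp add: real_sqrt_mult real_sqrt_divide)
    then show ?thesis using K Q0 by (simp add: mult.assoc[symmetric] ennreal_mult[symmetric])
  qed
  finally have L: "(\<integral>\<^sup>+X. ennreal \<bar>\<Sum>l<N. normal_density 0 1 (chart_value d X t) * chart_row d X t l * C l\<bar> \<partial>row_law d) = ennreal (sqrt (Q / (2 * pi))) * m1" .
  define u where "u p = 1 / sqrt (2 * pi) * (sqrt (real (d (blk p))) * (\<Sum>l<N. Smat N blk t p l * C l))" for p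
  have "(\<Sum>p<N. (u p)\<^sup>2) = Q / (2 * pi)"
  proof -
    have "(u p)\<^sup>2 = 1 / (2 * pi) * (real (d (blk p)) * (\<Sum>l<N. Smat N blk t p l * C l)\<^sup>2)" for p
      by (simp add: u_def power_mult_distrib power_divide)
    then show ?thesis unfolding Q[symmetric] by (simp only: sum_distrib_left[symmetric]) simp
  qed
  then have "(\<integral>\<^sup>+z. ennreal \<bar>\<Sum>p<N. u p * z p\<bar> \<partial>Gs {..<N}) = ennreal (sqrt (Q / (2 * pi))) * m1"
    by (simp add: gauss_abs_form)
  moreover have "(\<Sum>l<N. 1 / sqrt (2 * pi) * (\<Sum>p<N. sqrt (real (d (blk p))) * z p * Smat N blk t p l) * C l) = (\<Sum>p<N. u p * z p)" for z
    unfolding u_def sum_distrib_left sum_distrib_right by (subst sum.swap) (simp only: mult_ac)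
  ultimately show ?thesis using L by simp
qed

lemma chart_monom_continuous: "continuous_on (rsp N) (chart_monom a)"
  by (rule dqf_cont_self[OF dqf_chart_monom])

lemma chart_monom_dq_continuous: "l < N \<Longrightarrow> continuous_on (rsp N) (\<lambda>t. chart_monom_dq a l t t)"
  by (rule dqf_cont_comp[OF dqf_chart_monom, where g="\<lambda>t. t" and h="\<lambda>t. t"]) (auto intro: continuous_on_id)

lemma measurable_row_law: "a \<in> rest_exponents d \<Longrightarrow> (\<lambda>X. X a) \<in> borel_measurable (row_law d)"
  using measurable_component_singleton[of a "rest_exponents d" "\<lambda>a. nrm (coeff_sd a)"] by simp

text \<open>By \<open>row_integral\<close> the rows can be exchanged one at a time.
  \<open>Smat\<close> is the same right factor in all new rows, so its determinant splits off;
  together with N factors 1 / sqrt(2 pi) it is \<open>chart_dens\<close>.\<close>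

lemma chart_det_integral:
  assumes t: "t \<in> rsp N"
  shows "(\<integral>\<^sup>+X. ennreal \<bar>dt N (\<lambda>i l. normal_density 0 1 (chart_value (\<delta> i) (X i) t) * chart_row (\<delta> i) (X i) t l)\<bar> \<partial>(\<Pi>\<^sub>M i\<in>{..<N}. row_law (\<delta> i)))
    = ennreal (chart_dens N blk k t) * Jd N (\<lambda>i l. sqrt (real (\<delta> i (blk l))))"
proof -
  let ?s = "1 / sqrt (2 * pi)"
  let ?\<rho> = "\<lambda>i X l. normal_density 0 1 (chart_value (\<delta> i) X t) * chart_row (\<delta> i) X t l"
  let ?\<rho>' = "\<lambda>i z l. ?s * (\<Sum>p<N. sqrt (real (\<delta> i (blk p))) * z p * Smat N blk t p l)"
  have S: "dt N (Smat N blk t) = (\<Prod>j<k. qb N blk j t powr (- (real (card (bs N blk j)) + 1) / 2))"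
    by (rule dt_Smat) (rule blk)
  have gm: "(\<lambda>X. chart_value d X t) \<in> borel_measurable (row_law d)" for d
    unfolding chart_value_def by (intro borel_measurable_sum borel_measurable_times borel_measurable_const measurable_row_law)
  have rm: "(\<lambda>X. chart_row d X t l) \<in> borel_measurable (row_law d)" for d l
    unfolding chart_row_def by (intro borel_measurable_sum borel_measurable_times borel_measurable_const measurable_row_law)
  have "(\<integral>\<^sup>+X. ennreal \<bar>dt N (\<lambda>r l. if r \<in> {..<N} then ?\<rho> r (X r) l else 0)\<bar> \<partial>(\<Pi>\<^sub>M i\<in>{..<N}. row_law (\<delta> i)))
      = (\<integral>\<^sup>+z. ennreal \<bar>dt N (\<lambda>r l. if r \<in> {..<N} then ?\<rho>' r (z r) l else 0)\<bar> \<partial>(\<Pi>\<^sub>M i\<in>{..<N}. Gs {..<N}))"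
  proof (rule nn_integral_det_rows_cong[where X="\<lambda>_ _. 0"])
    show "sigma_finite_measure (row_law (\<delta> i))" for i by (intro prob_space_imp_sigma_finite prob_space_row_law)
    show "sigma_finite_measure (Gs {..<N})" by (intro prob_space_imp_sigma_finite prob_space_Gs)
    show "(\<lambda>X. ?\<rho> i X l) \<in> borel_measurable (row_law (\<delta> i))" for i l
      by (intro borel_measurable_times rm measurable_compose[OF gm borel_measurable_normal_density])
    show "(\<lambda>z. ?\<rho>' i z l) \<in> borel_measurable (Gs {..<N})" for i l
      by (intro borel_measurable_times borel_measurable_sum borel_measurable_const measurable_Gs_component) auto
    show "(\<integral>\<^sup>+X. ennreal \<bar>\<Sum>l<N. ?\<rho> i X l * C l\<bar> \<partial>row_law (\<delta> i)) = (\<integral>\<^sup>+z. ennreal \<bar>\<Sum>l<N. ?\<rho>' i z l * C l\<bar> \<partial>Gs {..<N})" for i C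
      by (rule row_integral[OF t])
  qed auto
  moreover have "dt N (\<lambda>r l. if r \<in> {..<N} then ?\<rho> r (X r) l else 0) = dt N (\<lambda>r l. ?\<rho> r (X r) l)" for X
    by (rule dt_cong) simp
  moreover have "ennreal \<bar>dt N (\<lambda>r l. if r \<in> {..<N} then ?\<rho>' r (z r) l else 0)\<bar>
      = ennreal (chart_dens N blk k t) * ennreal \<bar>dt N (\<lambda>i l. sqrt (real (\<delta> i (blk l))) * z i l)\<bar>" for z
  proof -
    have "dt N (\<lambda>r l. if r \<in> {..<N} then ?\<rho>' r (z r) l else 0)
        = dt N (\<lambda>r l. ?s * (\<Sum>p<N. sqrt (real (\<delta> r (blk p))) * z r p * Smat N blk t p l))"
      by (rule dt_cong) simp
    also have "\<dots> = ?s ^ N * (dt N (\<lambda>i p. sqrt (real (\<delta> i (blk p))) * z i p) * dt N (Smat N blk t))"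
      unfolding dt_scale by (simp only: dt_mult)
    also have "\<dots> = chart_dens N blk k t * dt N (\<lambda>i p. sqrt (real (\<delta> i (blk p))) * z i p)"
      unfolding chart_dens_def S by (simp only: mult_ac)
    finally show ?thesis
      using chart_dens_nonneg[of N blk k t] by (simp add: abs_mult ennreal_mult)
  qed
  moreover have "(\<integral>\<^sup>+z. ennreal (chart_dens N blk k t) * ennreal \<bar>dt N (\<lambda>i l. sqrt (real (\<delta> i (blk l))) * z i l)\<bar> \<partial>(\<Pi>\<^sub>M i\<in>{..<N}. Gs {..<N}))
      = ennreal (chart_dens N blk k t) * Jd N (\<lambda>i l. sqrt (real (\<delta> i (blk l))))"
    unfolding Jd_def
  proof (rule nn_integral_cmult, intro measurable_compose[OF _ measurable_ennreal] borel_measurable_abs dt_measurable borel_measurable_times borel_measurable_const)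
    fix i l assume "i < N" "l < N"
    then show "(\<lambda>z. z i l) \<in> borel_measurable (\<Pi>\<^sub>M i\<in>{..<N}. Gs {..<N})" by (intro measurable_GI) auto
  qed
  ultimately show ?thesis by simp
qed

end

subsection \<open>Measurability of the number of zeros\<close>

text \<open>On a compact set a continuous nonnegative function has a zero iff its values come
  arbitrarily close to 0, and by continuity this can be tested on a countable dense subset.\<close>

lemma sets_ex_zero_compact:
  fixes F :: "'w \<Rightarrow> (nat \<Rightarrow> real) \<Rightarrow> real"
  assumes K: "compact K" and cont: "\<And>w. w \<in> space M \<Longrightarrow> continuous_on K (F w)"
    and nonneg: "\<And>w t. 0 \<le> F w t" and meas: "\<And>t. t \<in> K \<Longrightarrow> (\<lambda>w. F w t) \<in> borel_measurable M"
  shows "{w \<in> space M. \<exists>t\<in>K. F w t = 0} \<in> sets M"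
proof -
  obtain D where D: "countable D" "D \<subseteq> K" "K \<subseteq> closure D" using separable[of K] by blast
  have "{w \<in> space M. \<exists>t\<in>K. F w t = 0} = (\<Inter>m::nat. \<Union>t\<in>D. {w \<in> space M. F w t < 1 / real (Suc m)})" (is "?L = ?R")
  proof (intro equalityI subsetI)
    fix w assume "w \<in> ?L"
    then obtain t where w: "w \<in> space M" and t: "t \<in> K" "F w t = 0" by auto
    have "\<exists>s\<in>D. F w s < 1 / real (Suc m)" for m
    proof -
      obtain A where A: "open A" "A \<inter> K = F w -` {..<1 / real (Suc m)} \<inter> K"
        using cont[OF w] unfolding continuous_on_open_invariant by (metis open_lessThan)
      have "t \<in> A" using t A(2) by auto
      then have "A \<inter> D \<noteq> {}" using t D(3) open_Int_closure_eq_empty[OF A(1), of D] by auto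
      then show ?thesis using A(2) D(2) by blast
    qed
    then show "w \<in> ?R" using w by auto
  next
    fix w assume w: "w \<in> ?R"
    then have w': "w \<in> space M" and ex: "\<And>m::nat. \<exists>t\<in>D. F w t < 1 / real (Suc m)" by auto
    have "K \<noteq> {}" using ex[of 0] D(2) by auto
    then obtain t where t: "t \<in> K" "\<And>s. s \<in> K \<Longrightarrow> F w t \<le> F w s"
      using continuous_attains_inf[OF K _ cont[OF w']] by blast
    have "F w t < 1 / real (Suc m)" for m using ex[of m] t(2) D(2) by (meson le_less_trans subsetD)
    then have "\<not> F w t > 0" by (metis nat_approx_posE not_less_iff_gr_or_eq)
    then have "F w t = 0" using nonneg[of w t] by linarith
    then show "w \<in> ?L" using w' t(1) by auto
  qed
  also have "\<dots> \<in> sets M"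
  proof (rule sets.countable_INT, intro image_subsetI sets.countable_UN'' D)
    fix m :: nat and t assume "t \<in> D"
    then have [measurable]: "(\<lambda>w. F w t) \<in> borel_measurable M" using D(2) by (intro meas) auto
    show "{w \<in> space M. F w t < 1 / real (Suc m)} \<in> sets M" by measurable
  qed simp
  finally show ?thesis .
qed

lemma sets_ex_zero_closed:
  fixes F :: "'w \<Rightarrow> (nat \<Rightarrow> real) \<Rightarrow> real"
  assumes Z: "closed Z" "Z \<subseteq> rsp N" and cont: "\<And>w. w \<in> space M \<Longrightarrow> continuous_on (rsp N) (F w)"
    and nonneg: "\<And>w t. 0 \<le> F w t" and meas: "\<And>t. t \<in> rsp N \<Longrightarrow> (\<lambda>w. F w t) \<in> borel_measurable M"
  shows "{w \<in> space M. \<exists>t\<in>Z. F w t = 0} \<in> sets M"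
proof -
  have "{w \<in> space M. \<exists>t\<in>Z \<inter> rbox N (real r). F w t = 0} \<in> sets M" for r
  proof (rule sets_ex_zero_compact)
    show "compact (Z \<inter> rbox N (real r))" using Z(1) compact_rbox by (rule closed_Int_compact)
    show "continuous_on (Z \<inter> rbox N (real r)) (F w)" if "w \<in> space M" for w
      using continuous_on_subset[OF cont[OF that]] Z(2) by blast
    show "(\<lambda>w. F w t) \<in> borel_measurable M" if "t \<in> Z \<inter> rbox N (real r)" for t
      using meas Z(2) that by blast
  qed (rule nonneg)
  then have "(\<Union>r. {w \<in> space M. \<exists>t\<in>Z \<inter> rbox N (real r). F w t = 0}) \<in> sets M"
    by (intro sets.countable_UN) auto
  also have "(\<Union>r. {w \<in> space M. \<exists>t\<in>Z \<inter> rbox N (real r). F w t = 0}) = {w \<in> space M. \<exists>t\<in>Z. F w t = 0}"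
    using Z(2) unfolding rsp_eq_UN_rbox by blast
  finally show ?thesis .
qed

text \<open>\<open>\<phi> r t\<close> names the dyadic cell of side 2^-r that contains
  \<open>t\<close>. Finitely many distinct points lie in distinct cells once r is large, so the
  numbers of occupied cells exhaust the cardinality. Finite families of cells keep each of these
  numbers a finite sum of indicators.\<close>

lemma emeasure_count_eq_SUP_cells:
  fixes S :: "(nat \<Rightarrow> real) set" and N :: nat
  defines "\<phi> \<equiv> \<lambda>(r::nat) t. \<lambda>l\<in>{..<N}. \<lfloor>2 ^ r * t l :: real\<rfloor>"
  assumes S: "S \<subseteq> rsp N"
  shows "emeasure (count_space UNIV) S
    = (SUP p\<in>UNIV \<times> {Z. finite Z \<and> Z \<subseteq> {..<N} \<rightarrow>\<^sub>E UNIV}. of_nat (card {z\<in>snd p. \<exists>t\<in>S. \<phi> (fst p) t = z}))"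
    (is "_ = (SUP p\<in>?I. ?c p)")
proof (rule antisym)
  have sep: "of_nat (card T) \<le> (SUP p\<in>?I. ?c p)" if T: "finite T" "T \<subseteq> S" for T
  proof -
    have ev: "\<forall>\<^sub>F r in sequentially. \<phi> r s \<noteq> \<phi> r t" if st: "s \<in> T" "t \<in> T" "s \<noteq> t" for s t
    proof -
      have "\<exists>l<N. s l \<noteq> t l" using st T S rsp_eqI[of s N t] by blast
      then obtain l where l: "l < N" "s l \<noteq> t l" by blast
      obtain r0 where r0: "1 / \<bar>s l - t l\<bar> < 2 ^ r0" using real_arch_pow[of 2] by auto
      have "\<phi> r s \<noteq> \<phi> r t" if "r \<ge> r0" for r
      proof
        assume "\<phi> r s = \<phi> r t"
        then have "\<lfloor>2 ^ r * s l\<rfloor> = \<lfloor>2 ^ r * t l\<rfloor>" using l(1) by (auto simp: \<phi>_def dest!: fun_cong[of _ _ l])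
        then have "\<bar>2 ^ r * s l - 2 ^ r * t l\<bar> < 1" by linarith
        then have "2 ^ r * \<bar>s l - t l\<bar> < 1" by (simp add: right_diff_distrib[symmetric] abs_mult)
        moreover have "(2::real) ^ r0 \<le> 2 ^ r" using that by simp
        then have "1 / \<bar>s l - t l\<bar> < 2 ^ r" using r0 by linarith
        then have "1 < 2 ^ r * \<bar>s l - t l\<bar>" using l(2) by (simp add: field_simps)
        ultimately show False by linarith
      qed
      then show ?thesis unfolding eventually_sequentially by blast
    qed
    have "\<forall>\<^sub>F r in sequentially. \<forall>s\<in>T. \<forall>t\<in>T. s \<noteq> t \<longrightarrow> \<phi> r s \<noteq> \<phi> r t"
    proof (intro eventually_ball_finite[OF T(1)] ballI)
      fix s t assume st: "s \<in> T" "t \<in> T"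
      show "\<forall>\<^sub>F r in sequentially. s \<noteq> t \<longrightarrow> \<phi> r s \<noteq> \<phi> r t"
      proof (cases "s = t")
        case False
        from ev[OF st False] show ?thesis by eventually_elim simp
      qed simp
    qed
    then obtain r where r: "\<forall>s\<in>T. \<forall>t\<in>T. s \<noteq> t \<longrightarrow> \<phi> r s \<noteq> \<phi> r t"
      unfolding eventually_sequentially by blast
    then have "inj_on (\<phi> r) T" by (auto intro: inj_onI)
    then have "card T = card (\<phi> r ` T)" by (simp only: card_image)
    also have "\<phi> r ` T = {z\<in>\<phi> r ` T. \<exists>t\<in>S. \<phi> r t = z}" using T(2) by auto
    finally have 1: "of_nat (card T) = ?c (r, \<phi> r ` T)" by simp
    have "\<phi> r t \<in> {..<N} \<rightarrow>\<^sub>E UNIV" for t by (simp add: \<phi>_def)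
    then have "\<phi> r ` T \<subseteq> {..<N} \<rightarrow>\<^sub>E UNIV" by blast
    with T(1) have mem: "(r, \<phi> r ` T) \<in> ?I" by blast
    show ?thesis unfolding 1 by (rule SUP_upper[OF mem])
  qed
  show "emeasure (count_space UNIV) S \<le> (SUP p\<in>?I. ?c p)"
  proof (cases "finite S")
    case True
    then show ?thesis using sep[of S] by simp
  next
    case False
    have ge: "of_nat n \<le> (SUP p\<in>?I. ?c p)" for n
      using infinite_arbitrarily_large[OF False, of n] sep by blast
    have "(SUP p\<in>?I. ?c p) = \<top>"
    proof (rule ccontr)
      assume "(SUP p\<in>?I. ?c p) \<noteq> \<top>"
      then obtain n where "(SUP p\<in>?I. ?c p) < of_nat n"
        using ennreal_Ex_less_of_nat unfolding less_top by blast
      then show False using ge[of n] by (simp add: not_le[symmetric])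
    qed
    then show ?thesis by (simp only: top_greatest)
  qed
  show "(SUP p\<in>?I. ?c p) \<le> emeasure (count_space UNIV) S"
  proof (rule SUP_least)
    fix p assume p: "p \<in> ?I"
    let ?A = "{z\<in>snd p. \<exists>t\<in>S. \<phi> (fst p) t = z}"
    show "?c p \<le> emeasure (count_space UNIV) S"
    proof (cases "finite S")
      case True
      have "card ?A \<le> card (\<phi> (fst p) ` S)" by (rule card_mono) (use True in auto)
      also have "\<dots> \<le> card S" by (rule card_image_le) fact
      finally show ?thesis using True by simp
    qed simp
  qed
qed

text \<open>The number of roots has to be measurable before laws can be pushed forward or integrals
  exchanged. It is a countable supremum of finite counts of cells that contain a zero.\<close>

lemma measurable_count_zeros:
  fixes F :: "'w \<Rightarrow> (nat \<Rightarrow> real) \<Rightarrow> real"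
  assumes cont: "\<And>w. w \<in> space M \<Longrightarrow> continuous_on (rsp N) (F w)"
    and nonneg: "\<And>w t. 0 \<le> F w t" and meas: "\<And>t. t \<in> rsp N \<Longrightarrow> (\<lambda>w. F w t) \<in> borel_measurable M"
  shows "(\<lambda>w. emeasure (count_space UNIV) {t \<in> rsp N. F w t = 0}) \<in> borel_measurable M"
proof -
  define \<phi> where "\<phi> r t = (\<lambda>l\<in>{..<N}. \<lfloor>2 ^ r * t l :: real\<rfloor>)" for r :: nat and t
  define E where "E r z = {w \<in> space M. \<exists>t\<in>{t \<in> rsp N. F w t = 0}. \<phi> r t = z}" for r z
  have E: "E r z \<in> sets M" if z: "z \<in> {..<N} \<rightarrow>\<^sub>E UNIV" for r z
  proof -
    \<comment> \<open>Dyadic cells are half-open; shrinking the open side by 1/(m+1) exhausts a cell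
      by closed sets, to which the criterion for zeros applies.\<close>
    define C where "C m = {t \<in> rsp N. \<forall>l\<in>{..<N}. real_of_int (z l) \<le> 2 ^ r * t l \<and> 2 ^ r * t l \<le> real_of_int (z l) + 1 - 1 / real (Suc m)}" for m
    have cell: "\<phi> r t = z \<longleftrightarrow> (\<exists>m. t \<in> C m)" if t: "t \<in> rsp N" for t
    proof
      assume "\<phi> r t = z"
      then have fl: "\<lfloor>2 ^ r * t l\<rfloor> = z l" if "l < N" for l using that by (auto simp: \<phi>_def)
      have "\<exists>m::nat. 2 ^ r * t l \<le> real_of_int (z l) + 1 - 1 / real (Suc m)" if "l < N" for l
      proof -
        have "0 < real_of_int (z l) + 1 - 2 ^ r * t l" using fl[OF that] by linarith
        then obtain m where "1 / real (Suc m) < real_of_int (z l) + 1 - 2 ^ r * t l" by (rule nat_approx_posE)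
        then show ?thesis by (intro exI[of _ m]) linarith
      qed
      then obtain f :: "nat \<Rightarrow> nat" where f: "\<And>l. l < N \<Longrightarrow> 2 ^ r * t l \<le> real_of_int (z l) + 1 - 1 / real (Suc (f l))"
        by metis
      have "t \<in> C (\<Sum>l<N. f l)"
        unfolding C_def
      proof (intro CollectI conjI t ballI)
        fix l assume "l \<in> {..<N}"
        then have l: "l < N" by simp
        show "real_of_int (z l) \<le> 2 ^ r * t l" using fl[OF l] by linarith
        have "f l \<le> (\<Sum>l<N. f l)" by (rule member_le_sum) (use l in auto)
        then have "1 / real (Suc (\<Sum>l<N. f l)) \<le> 1 / real (Suc (f l))" by (intro divide_left_mono) (auto simp del: of_nat_sum of_nat_Suc)
        then show "2 ^ r * t l \<le> real_of_int (z l) + 1 - 1 / real (Suc (\<Sum>l<N. f l))" using f[OF l] by linarith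
      qed
      then show "\<exists>m. t \<in> C m" by blast
    next
      assume "\<exists>m. t \<in> C m"
      then obtain m where m: "t \<in> C m" by blast
      have "\<lfloor>2 ^ r * t l\<rfloor> = z l" if "l < N" for l
      proof -
        have "1 / real (Suc m) > 0" by simp
        moreover have "real_of_int (z l) \<le> 2 ^ r * t l" "2 ^ r * t l \<le> real_of_int (z l) + 1 - 1 / real (Suc m)"
          using m that by (auto simp: C_def)
        ultimately show ?thesis by linarith
      qed
      then show "\<phi> r t = z" using z by (auto simp: \<phi>_def PiE_iff extensional_def)
    qed
    have "closed (C m)" for m
    proof -
      have "C m = rsp N \<inter> (\<Inter>l\<in>{..<N}. {t. real_of_int (z l) \<le> 2 ^ r * t l} \<inter> {t. 2 ^ r * t l \<le> real_of_int (z l) + 1 - 1 / real (Suc m)})"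
        by (auto simp: C_def)
      also have "closed \<dots>"
        by (intro closed_Int closed_rsp closed_INT ballI closed_Collect_le continuous_on_mult continuous_on_const continuous_on_product_coordinates)
      finally show ?thesis .
    qed
    then have "{w \<in> space M. \<exists>t\<in>C m. F w t = 0} \<in> sets M" for m
      by (intro sets_ex_zero_closed[where N=N] cont nonneg meas) (auto simp: C_def)
    then have "(\<Union>m. {w \<in> space M. \<exists>t\<in>C m. F w t = 0}) \<in> sets M" by (intro sets.countable_UN) auto
    also have "(\<Union>m. {w \<in> space M. \<exists>t\<in>C m. F w t = 0}) = E r z"
    proof (intro equalityI subsetI)
      fix w assume "w \<in> (\<Union>m. {w \<in> space M. \<exists>t\<in>C m. F w t = 0})"
      then obtain m t where "w \<in> space M" "t \<in> C m" "F w t = 0" by blast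
      moreover from this have "t \<in> rsp N" by (simp add: C_def)
      ultimately show "w \<in> E r z" unfolding E_def using cell by blast
    next
      fix w assume "w \<in> E r z"
      then show "w \<in> (\<Union>m. {w \<in> space M. \<exists>t\<in>C m. F w t = 0})" unfolding E_def using cell by blast
    qed
    finally show ?thesis .
  qed
  let ?I = "(UNIV :: nat set) \<times> {Z. finite Z \<and> Z \<subseteq> {..<N} \<rightarrow>\<^sub>E (UNIV :: int set)}"
  have "(\<lambda>w. SUP p\<in>?I. \<Sum>z\<in>snd p. indicator (E (fst p) z) w :: ennreal) \<in> borel_measurable M"
  proof (rule borel_measurable_SUP[where F="\<lambda>p w. \<Sum>z\<in>snd p. indicator (E (fst p) z) w"])
    have "countable ({..<N} \<rightarrow>\<^sub>E (UNIV :: int set))" by (intro countable_PiE) auto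
    then show "countable ?I" by (intro countable_SIGMA countableI_type countable_Collect_finite_subset)
    fix p assume "p \<in> ?I"
    then show "(\<lambda>w. \<Sum>z\<in>snd p. indicator (E (fst p) z) w :: ennreal) \<in> borel_measurable M"
      by (intro borel_measurable_sum borel_measurable_indicator E) auto
  qed
  also have "?this \<longleftrightarrow> ?thesis"
  proof (rule measurable_cong)
    fix w assume w: "w \<in> space M"
    have "emeasure (count_space UNIV) {t \<in> rsp N. F w t = 0}
      = (SUP p\<in>?I. of_nat (card {z\<in>snd p. \<exists>t\<in>{t \<in> rsp N. F w t = 0}. \<phi> (fst p) t = z}))"
      unfolding \<phi>_def by (rule emeasure_count_eq_SUP_cells) auto
    also have "\<dots> = (SUP p\<in>?I. \<Sum>z\<in>snd p. indicator (E (fst p) z) w)"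
    proof (rule SUP_cong[OF refl])
      fix p assume "p \<in> ?I"
      then have "finite (snd p)" by auto
      then have "(\<Sum>z\<in>snd p. indicator (E (fst p) z) w :: ennreal) = of_nat (card {z \<in> snd p. w \<in> E (fst p) z})"
        by (simp add: indicator_def sum.inter_filter[symmetric] del: mem_Collect_eq) (simp only: Int_def mem_Collect_eq)
      then show "of_nat (card {z\<in>snd p. \<exists>t\<in>{t \<in> rsp N. F w t = 0}. \<phi> (fst p) t = z}) = (\<Sum>z\<in>snd p. indicator (E (fst p) z) w :: ennreal)"
        using w by (simp add: E_def)
    qed
    finally show "(SUP p\<in>?I. \<Sum>z\<in>snd p. indicator (E (fst p) z) w :: ennreal) = emeasure (count_space UNIV) {t \<in> rsp N. F w t = 0}" by simp
  qed
  finally show ?thesis .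
qed

lemma PiM_nrm_density:
  "(\<Pi>\<^sub>M i\<in>{..<N::nat}. nrm 1) = density (leb N) (\<lambda>c. \<Prod>i<N. ennreal (normal_density 0 1 (c i)))"
proof -
  interpret product_prob_space "\<lambda>_::nat. nrm 1" by (intro product_prob_spaceI prob_space_nrm) simp
  have m: "(\<lambda>c. \<Prod>i<N. ennreal (normal_density 0 1 (c i))) \<in> borel_measurable (leb N)"
  proof (intro borel_measurable_prod_ennreal measurable_compose[OF _ measurable_ennreal] measurable_compose[OF _ borel_measurable_normal_density])
    fix i assume "i \<in> {..<N}"
    then show "(\<lambda>c. c i) \<in> borel_measurable (leb N)"
      using measurable_component_singleton[of i "{..<N}" "\<lambda>_. lborel"] by simp
  qed
  have "density (leb N) (\<lambda>c. \<Prod>i<N. ennreal (normal_density 0 1 (c i))) = (\<Pi>\<^sub>M i\<in>{..<N}. nrm 1)"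
  proof (rule PiM_eqI)
    show "sets (density (leb N) (\<lambda>c. \<Prod>i<N. ennreal (normal_density 0 1 (c i)))) = sets (\<Pi>\<^sub>M i\<in>{..<N}. nrm 1)"
      unfolding sets_density by (rule sets_PiM_cong) auto
    fix A assume A: "\<And>i. i \<in> {..<N} \<Longrightarrow> A i \<in> sets (nrm 1)"
    then have A': "\<And>i. i < N \<Longrightarrow> A i \<in> sets borel" by simp
    have "emeasure (density (leb N) (\<lambda>c. \<Prod>i<N. ennreal (normal_density 0 1 (c i)))) (Pi\<^sub>E {..<N} A)
        = (\<integral>\<^sup>+c. (\<Prod>i<N. ennreal (normal_density 0 1 (c i))) * indicator (Pi\<^sub>E {..<N} A) c \<partial>leb N)"
      by (rule emeasure_density[OF m]) (use A' in \<open>auto intro!: sets_PiM_I_finite\<close>)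
    also have "\<dots> = (\<integral>\<^sup>+c. (\<Prod>i<N. ennreal (normal_density 0 1 (c i)) * indicator (A i) (c i)) \<partial>leb N)"
    proof (rule nn_integral_cong)
      fix c assume c: "c \<in> space (leb N)"
      have "(\<Prod>i<N. indicator (A i) (c i) :: ennreal) = indicator (Pi\<^sub>E {..<N} A) c"
      proof (cases "\<forall>i<N. c i \<in> A i")
        case True
        then show ?thesis using c by (simp add: indicator_def PiE_iff space_PiM)
      next
        case False
        then obtain i where "i < N" "c i \<notin> A i" by blast
        then have "(\<Prod>i<N. indicator (A i) (c i) :: ennreal) = 0" "c \<notin> Pi\<^sub>E {..<N} A"
          by (auto intro!: prod_zero bexI[of _ i])
        then show ?thesis by simp
      qed
      then show "(\<Prod>i<N. ennreal (normal_density 0 1 (c i))) * indicator (Pi\<^sub>E {..<N} A) c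
          = (\<Prod>i<N. ennreal (normal_density 0 1 (c i)) * indicator (A i) (c i))"
        by (simp add: prod.distrib)
    qed
    also have "\<dots> = (\<Prod>i<N. \<integral>\<^sup>+x. ennreal (normal_density 0 1 x) * indicator (A i) x \<partial>lborel)"
      by (rule lebp.product_nn_integral_prod) (use A' in auto)
    also have "\<dots> = (\<Prod>i<N. emeasure (nrm 1) (A i))"
      by (intro prod.cong refl emeasure_density[symmetric]) (use A' in auto)
    finally show "emeasure (density (leb N) (\<lambda>c. \<Prod>i<N. ennreal (normal_density 0 1 (c i)))) (Pi\<^sub>E {..<N} A)
        = (\<Prod>i<N. emeasure (nrm 1) (A i))" .
  qed simp
  then show ?thesis by simp
qed

subsection \<open>The expected number of roots in a chart\<close>

context chart
begin

abbreviation coeff_index :: "(nat \<Rightarrow> nat \<Rightarrow> nat) \<Rightarrow> (nat \<times> (nat \<Rightarrow> nat \<Rightarrow> nat)) set" where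
  "coeff_index \<delta> \<equiv> SIGMA i:{..<N}. exponents k n (\<delta> i)"

abbreviation rows_law :: "(nat \<Rightarrow> nat \<Rightarrow> nat) \<Rightarrow> (nat \<Rightarrow> (nat \<Rightarrow> nat \<Rightarrow> nat) \<Rightarrow> real) measure" where
  "rows_law \<delta> \<equiv> \<Pi>\<^sub>M i\<in>{..<N}. row_law (\<delta> i)"

text \<open>Reassembles a system from its leading coefficients and all others. The leading ones
  become the target variable of the area formula, while the others fix the map.\<close>

definition combine_coeffs :: "(nat \<Rightarrow> nat \<Rightarrow> nat) \<Rightarrow> (nat \<Rightarrow> real) \<times> (nat \<Rightarrow> (nat \<Rightarrow> nat \<Rightarrow> nat) \<Rightarrow> real) \<Rightarrow> nat \<times> (nat \<Rightarrow> nat \<Rightarrow> nat) \<Rightarrow> real" where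
  "combine_coeffs \<delta> p = (\<lambda>s\<in>coeff_index \<delta>. if snd s = lead_exponent (\<delta> (fst s)) then fst p (fst s) else snd p (fst s) (snd s))"

lemma random_system_eq: "random_system k n \<delta> = (\<Pi>\<^sub>M s\<in>coeff_index \<delta>. nrm (coeff_sd (snd s)))"
  unfolding random_system_def N_eq[symmetric] by (simp add: case_prod_beta')

lemma finite_coeff_index: "finite (coeff_index \<delta>)" by (simp add: finite_exponents)

lemma prob_space_rows_law: "prob_space (rows_law \<delta>)"
  by (intro prob_space_PiM prob_space_row_law)

lemma measurable_rows_law: "i < N \<Longrightarrow> a \<in> rest_exponents (\<delta> i) \<Longrightarrow> (\<lambda>X. X i a) \<in> borel_measurable (rows_law \<delta>)"
  by (rule measurable_compose[OF measurable_component_singleton[where M="\<lambda>i. row_law (\<delta> i)"] measurable_row_law[where d="\<delta> i"]]) auto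

lemma measurable_combine_coeffs: "combine_coeffs \<delta> \<in> (\<Pi>\<^sub>M i\<in>{..<N}. nrm 1) \<Otimes>\<^sub>M rows_law \<delta> \<rightarrow>\<^sub>M random_system k n \<delta>"
  unfolding random_system_eq combine_coeffs_def
proof (rule measurable_restrict)
  fix s assume s: "s \<in> coeff_index \<delta>"
  then obtain i a where s': "s = (i, a)" "i < N" "a \<in> exponents k n (\<delta> i)" by auto
  show "(\<lambda>p. if snd s = lead_exponent (\<delta> (fst s)) then fst p (fst s) else snd p (fst s) (snd s))
      \<in> (\<Pi>\<^sub>M i\<in>{..<N}. nrm 1) \<Otimes>\<^sub>M rows_law \<delta> \<rightarrow>\<^sub>M nrm (coeff_sd (snd s))"
  proof (cases "a = lead_exponent (\<delta> i)")
    case True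
    have "(\<lambda>c. c i) \<in> borel_measurable (\<Pi>\<^sub>M i\<in>{..<N}. nrm 1)"
      using measurable_component_singleton[of i "{..<N}" "\<lambda>_. nrm 1"] s'(2) by simp
    then have "(\<lambda>p. fst p i) \<in> borel_measurable ((\<Pi>\<^sub>M i\<in>{..<N}. nrm 1) \<Otimes>\<^sub>M rows_law \<delta>)"
      by (rule measurable_compose[OF measurable_fst])
    then show ?thesis using s' True by simp
  next
    case False
    have "(\<lambda>p. snd p i a) \<in> borel_measurable ((\<Pi>\<^sub>M i\<in>{..<N}. nrm 1) \<Otimes>\<^sub>M rows_law \<delta>)"
      by (rule measurable_compose[OF measurable_snd measurable_rows_law]) (use s' False in auto)
    then show ?thesis using s' False by simp
  qed
qed

lemma vimage_combine_coeffs: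
  assumes A: "\<And>s. s \<in> coeff_index \<delta> \<Longrightarrow> A s \<in> sets borel"
  shows "combine_coeffs \<delta> -` Pi\<^sub>E (coeff_index \<delta>) A \<inter> space ((\<Pi>\<^sub>M i\<in>{..<N}. nrm 1) \<Otimes>\<^sub>M rows_law \<delta>)
    = (\<Pi>\<^sub>E i\<in>{..<N}. A (i, lead_exponent (\<delta> i))) \<times> (\<Pi>\<^sub>E i\<in>{..<N}. \<Pi>\<^sub>E a\<in>rest_exponents (\<delta> i). A (i, a))" (is "?L = ?R")
proof (intro equalityI subsetI)
  fix p assume p: "p \<in> ?L"
  obtain c X where cX: "p = (c, X)" by (cases p)
  have ext: "c \<in> extensional {..<N}" "X \<in> extensional {..<N}" "\<And>i. i < N \<Longrightarrow> X i \<in> extensional (rest_exponents (\<delta> i))"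
    using p by (auto simp: cX space_pair_measure space_PiM PiE_iff)
  have mem: "combine_coeffs \<delta> p (i, a) \<in> A (i, a)" if "i < N" "a \<in> exponents k n (\<delta> i)" for i a
    using p that by (auto simp: PiE_iff)
  have "c i \<in> A (i, lead_exponent (\<delta> i))" if "i < N" for i
    using mem[OF that lead_exponent_exponents] that lead_exponent_exponents by (simp add: combine_coeffs_def cX)
  moreover have "X i a \<in> A (i, a)" if "i < N" "a \<in> rest_exponents (\<delta> i)" for i a
    using mem[of i a] that by (auto simp: combine_coeffs_def cX)
  ultimately show "p \<in> ?R" using ext by (simp add: cX PiE_iff)
next
  fix p assume p: "p \<in> ?R"
  obtain c X where cX: "p = (c, X)" by (cases p)
  have c: "c \<in> extensional {..<N}" "\<And>i. i < N \<Longrightarrow> c i \<in> A (i, lead_exponent (\<delta> i))"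
    and X: "X \<in> extensional {..<N}" "\<And>i. i < N \<Longrightarrow> X i \<in> extensional (rest_exponents (\<delta> i))" "\<And>i a. i < N \<Longrightarrow> a \<in> rest_exponents (\<delta> i) \<Longrightarrow> X i a \<in> A (i, a)"
    using p by (auto simp: cX PiE_iff)
  have "combine_coeffs \<delta> p \<in> Pi\<^sub>E (coeff_index \<delta>) A"
  proof (rule PiE_I)
    fix s assume s: "s \<in> coeff_index \<delta>"
    obtain i a where s': "s = (i, a)" by (cases s)
    then show "combine_coeffs \<delta> p s \<in> A s"
      using s c(2)[of i] X(3)[of i a] by (auto simp: combine_coeffs_def cX)
  qed (simp add: combine_coeffs_def)
  moreover have "p \<in> space ((\<Pi>\<^sub>M i\<in>{..<N}. nrm 1) \<Otimes>\<^sub>M rows_law \<delta>)"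
    using c X by (simp add: cX space_pair_measure space_PiM PiE_iff)
  ultimately show "p \<in> ?L" by simp
qed

text \<open>Both laws are determined by their values on boxes, where regrouping the factors by
  equations suffices; leading coefficients are standard normal by
  \<open>eta_lead_exponent\<close>.\<close>

lemma distr_combine_coeffs: "distr ((\<Pi>\<^sub>M i\<in>{..<N}. nrm 1) \<Otimes>\<^sub>M rows_law \<delta>) (random_system k n \<delta>) (combine_coeffs \<delta>) = random_system k n \<delta>"
proof -
  interpret S: product_sigma_finite "\<lambda>s :: nat \<times> (nat \<Rightarrow> nat \<Rightarrow> nat). nrm (coeff_sd (snd s))"
    by (intro product_sigma_finite.intro prob_space_imp_sigma_finite prob_space_nrm coeff_sd_pos)
  interpret P: product_sigma_finite "\<lambda>i :: nat. nrm 1"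
    by (intro product_sigma_finite.intro prob_space_imp_sigma_finite prob_space_nrm) simp
  interpret C: product_sigma_finite "\<lambda>a :: nat \<Rightarrow> nat \<Rightarrow> nat. nrm (coeff_sd a)"
    by (intro product_sigma_finite.intro prob_space_imp_sigma_finite prob_space_nrm coeff_sd_pos)
  interpret Q: product_sigma_finite "\<lambda>i :: nat. row_law (\<delta> i)"
    by (intro product_sigma_finite.intro prob_space_imp_sigma_finite prob_space_row_law)
  interpret rows_law: prob_space "rows_law \<delta>" by (rule prob_space_rows_law)
  have m: "combine_coeffs \<delta> \<in> (\<Pi>\<^sub>M i\<in>{..<N}. nrm 1) \<Otimes>\<^sub>M rows_law \<delta> \<rightarrow>\<^sub>M (\<Pi>\<^sub>M s\<in>coeff_index \<delta>. nrm (coeff_sd (snd s)))"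
    using measurable_combine_coeffs unfolding random_system_eq .
  show ?thesis unfolding random_system_eq
  proof (rule S.PiM_eqI[OF finite_coeff_index])
    fix A assume A: "\<And>s. s \<in> coeff_index \<delta> \<Longrightarrow> A s \<in> sets (nrm (coeff_sd (snd s)))"
    then have A': "\<And>s. s \<in> coeff_index \<delta> \<Longrightarrow> A s \<in> sets borel" by simp
    have A0: "\<And>i. i \<in> {..<N} \<Longrightarrow> A (i, lead_exponent (\<delta> i)) \<in> sets (nrm 1)" using A' lead_exponent_exponents by simp
    have A1: "\<And>i a. i \<in> {..<N} \<Longrightarrow> a \<in> rest_exponents (\<delta> i) \<Longrightarrow> A (i, a) \<in> sets (nrm (coeff_sd a))" using A' by simp
    have A2: "\<And>i. i \<in> {..<N} \<Longrightarrow> (\<Pi>\<^sub>E a\<in>rest_exponents (\<delta> i). A (i, a)) \<in> sets (row_law (\<delta> i))"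
      by (intro sets_PiM_I_finite finite_rest_exponents A1)
    have "emeasure (distr ((\<Pi>\<^sub>M i\<in>{..<N}. nrm 1) \<Otimes>\<^sub>M rows_law \<delta>) (\<Pi>\<^sub>M s\<in>coeff_index \<delta>. nrm (coeff_sd (snd s))) (combine_coeffs \<delta>)) (Pi\<^sub>E (coeff_index \<delta>) A)
        = emeasure ((\<Pi>\<^sub>M i\<in>{..<N}. nrm 1) \<Otimes>\<^sub>M rows_law \<delta>) (combine_coeffs \<delta> -` Pi\<^sub>E (coeff_index \<delta>) A \<inter> space ((\<Pi>\<^sub>M i\<in>{..<N}. nrm 1) \<Otimes>\<^sub>M rows_law \<delta>))"
      by (rule emeasure_distr[OF m]) (intro sets_PiM_I_finite finite_coeff_index A)
    also have "\<dots> = emeasure ((\<Pi>\<^sub>M i\<in>{..<N}. nrm 1) \<Otimes>\<^sub>M rows_law \<delta>)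
        ((\<Pi>\<^sub>E i\<in>{..<N}. A (i, lead_exponent (\<delta> i))) \<times> (\<Pi>\<^sub>E i\<in>{..<N}. \<Pi>\<^sub>E a\<in>rest_exponents (\<delta> i). A (i, a)))"
      by (subst vimage_combine_coeffs) (rule A', assumption, rule refl)
    also have "\<dots> = emeasure (\<Pi>\<^sub>M i\<in>{..<N}. nrm 1) (\<Pi>\<^sub>E i\<in>{..<N}. A (i, lead_exponent (\<delta> i))) * emeasure (rows_law \<delta>) (\<Pi>\<^sub>E i\<in>{..<N}. \<Pi>\<^sub>E a\<in>rest_exponents (\<delta> i). A (i, a))"
      by (intro rows_law.emeasure_pair_measure_Times sets_PiM_I_finite A0 A2 finite_lessThan)
    also have "emeasure (\<Pi>\<^sub>M i\<in>{..<N}. nrm 1) (\<Pi>\<^sub>E i\<in>{..<N}. A (i, lead_exponent (\<delta> i))) = (\<Prod>i<N. emeasure (nrm 1) (A (i, lead_exponent (\<delta> i))))"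
      by (intro P.emeasure_PiM A0 finite_lessThan)
    also have "emeasure (rows_law \<delta>) (\<Pi>\<^sub>E i\<in>{..<N}. \<Pi>\<^sub>E a\<in>rest_exponents (\<delta> i). A (i, a)) = (\<Prod>i<N. emeasure (row_law (\<delta> i)) (\<Pi>\<^sub>E a\<in>rest_exponents (\<delta> i). A (i, a)))"
      by (intro Q.emeasure_PiM A2 finite_lessThan)
    also have "\<dots> = (\<Prod>i<N. \<Prod>a\<in>rest_exponents (\<delta> i). emeasure (nrm (coeff_sd a)) (A (i, a)))"
      by (intro prod.cong refl C.emeasure_PiM A1 finite_rest_exponents)
    also have "(\<Prod>i<N. emeasure (nrm 1) (A (i, lead_exponent (\<delta> i)))) * \<dots> = (\<Prod>i<N. \<Prod>a\<in>exponents k n (\<delta> i). emeasure (nrm (coeff_sd a)) (A (i, a)))"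
      unfolding prod.distrib[symmetric]
      by (intro prod.cong refl) (subst prod.remove[OF finite_exponents lead_exponent_exponents], simp add: eta_lead_exponent)
    also have "\<dots> = (\<Prod>s\<in>coeff_index \<delta>. emeasure (nrm (coeff_sd (snd s))) (A s))"
      by (subst prod.Sigma) (auto simp: finite_exponents case_prod_beta')
    finally show "emeasure (distr ((\<Pi>\<^sub>M i\<in>{..<N}. nrm 1) \<Otimes>\<^sub>M rows_law \<delta>) (\<Pi>\<^sub>M s\<in>coeff_index \<delta>. nrm (coeff_sd (snd s))) (combine_coeffs \<delta>)) (Pi\<^sub>E (coeff_index \<delta>) A)
        = (\<Prod>s\<in>coeff_index \<delta>. emeasure (nrm (coeff_sd (snd s))) (A s))" .
  qed simp
qed

lemma density_measurable: "(\<lambda>c. \<Prod>i<N. ennreal (normal_density 0 1 (c i))) \<in> borel_measurable (leb N)"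
proof (intro borel_measurable_prod_ennreal measurable_compose[OF _ measurable_ennreal] measurable_compose[OF _ borel_measurable_normal_density])
  fix i assume "i \<in> {..<N}"
  then show "(\<lambda>c. c i) \<in> borel_measurable (leb N)"
    using measurable_component_singleton[of i "{..<N}" "\<lambda>_. lborel"] by simp
qed

lemma nn_integral_random_system:
  assumes \<Phi>: "\<Phi> \<in> borel_measurable (random_system k n \<delta>)"
  shows "(\<integral>\<^sup>+f. \<Phi> f \<partial>random_system k n \<delta>)
    = (\<integral>\<^sup>+X. (\<integral>\<^sup>+c. (\<Prod>i<N. ennreal (normal_density 0 1 (c i))) * \<Phi> (combine_coeffs \<delta> (c, X)) \<partial>leb N) \<partial>rows_law \<delta>)"
proof -
  interpret P: prob_space "\<Pi>\<^sub>M i\<in>{..<N}. nrm 1" by (intro prob_space_PiM prob_space_nrm) simp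
  interpret rows_law: prob_space "rows_law \<delta>" by (rule prob_space_rows_law)
  interpret pair_sigma_finite "\<Pi>\<^sub>M i\<in>{..<N}. nrm 1" "rows_law \<delta>"
    by (intro pair_sigma_finite.intro prob_space_imp_sigma_finite P.prob_space_axioms rows_law.prob_space_axioms)
  have m: "(\<lambda>p. \<Phi> (combine_coeffs \<delta> p)) \<in> borel_measurable ((\<Pi>\<^sub>M i\<in>{..<N}. nrm 1) \<Otimes>\<^sub>M rows_law \<delta>)"
    by (rule measurable_compose[OF measurable_combine_coeffs \<Phi>])
  have "(\<integral>\<^sup>+f. \<Phi> f \<partial>random_system k n \<delta>) = (\<integral>\<^sup>+f. \<Phi> f \<partial>distr ((\<Pi>\<^sub>M i\<in>{..<N}. nrm 1) \<Otimes>\<^sub>M rows_law \<delta>) (random_system k n \<delta>) (combine_coeffs \<delta>))"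
    by (simp only: distr_combine_coeffs)
  also have "\<dots> = (\<integral>\<^sup>+p. \<Phi> (combine_coeffs \<delta> p) \<partial>((\<Pi>\<^sub>M i\<in>{..<N}. nrm 1) \<Otimes>\<^sub>M rows_law \<delta>))"
    by (rule nn_integral_distr[OF measurable_combine_coeffs]) (use \<Phi> in \<open>simp only: measurable_distr_eq1\<close>)
  also have "\<dots> = (\<integral>\<^sup>+X. (\<integral>\<^sup>+c. \<Phi> (combine_coeffs \<delta> (c, X)) \<partial>(\<Pi>\<^sub>M i\<in>{..<N}. nrm 1)) \<partial>rows_law \<delta>)"
    by (rule nn_integral_snd[OF m, symmetric])
  also have "\<dots> = (\<integral>\<^sup>+X. (\<integral>\<^sup>+c. (\<Prod>i<N. ennreal (normal_density 0 1 (c i))) * \<Phi> (combine_coeffs \<delta> (c, X)) \<partial>leb N) \<partial>rows_law \<delta>)"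
  proof (rule nn_integral_cong)
    fix X assume X: "X \<in> space (rows_law \<delta>)"
    have "(\<lambda>c. \<Phi> (combine_coeffs \<delta> (c, X))) \<in> borel_measurable (\<Pi>\<^sub>M i\<in>{..<N}. nrm 1)"
      by (rule measurable_compose[OF measurable_Pair2'[OF X] m])
    also have "borel_measurable (\<Pi>\<^sub>M i\<in>{..<N}. nrm 1) = borel_measurable (leb N)"
      by (intro measurable_cong_sets sets_PiM_cong) auto
    finally show "(\<integral>\<^sup>+c. \<Phi> (combine_coeffs \<delta> (c, X)) \<partial>(\<Pi>\<^sub>M i\<in>{..<N}. nrm 1))
        = (\<integral>\<^sup>+c. (\<Prod>i<N. ennreal (normal_density 0 1 (c i))) * \<Phi> (combine_coeffs \<delta> (c, X)) \<partial>leb N)"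
      unfolding PiM_nrm_density by (rule nn_integral_density[OF density_measurable])
  qed
  finally show ?thesis .
qed

definition chart_roots :: "(nat \<Rightarrow> nat \<Rightarrow> nat) \<Rightarrow> (nat \<times> (nat \<Rightarrow> nat \<Rightarrow> nat) \<Rightarrow> real) \<Rightarrow> (nat \<Rightarrow> real) set" where
  "chart_roots \<delta> f = {t \<in> rsp N. \<forall>i<N. mh_eval k n (\<delta> i) (\<lambda>a. f (i, a)) (chart_point t) = 0}"

text \<open>Merges all equations into one continuous nonnegative function, the form in which the
  measurability lemmas speak of zeros.\<close>

definition chart_defect :: "(nat \<Rightarrow> nat \<Rightarrow> nat) \<Rightarrow> (nat \<times> (nat \<Rightarrow> nat \<Rightarrow> nat) \<Rightarrow> real) \<Rightarrow> (nat \<Rightarrow> real) \<Rightarrow> real" where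
  "chart_defect \<delta> f t = (\<Sum>i<N. \<bar>mh_eval k n (\<delta> i) (\<lambda>a. f (i, a)) (chart_point t)\<bar>)"

lemma mh_eval_chart_point: "mh_eval k n d c (chart_point t) = (\<Sum>a\<in>exponents k n d. c a * chart_monom a t)"
  by (simp add: mh_eval_def chart_monom_def monom_def)

lemma chart_defect_nonneg: "chart_defect \<delta> f t \<ge> 0" by (simp add: chart_defect_def sum_nonneg)

lemma chart_defect_zero: "chart_defect \<delta> f t = 0 \<longleftrightarrow> (\<forall>i<N. mh_eval k n (\<delta> i) (\<lambda>a. f (i, a)) (chart_point t) = 0)"
  unfolding chart_defect_def by (subst sum_nonneg_eq_0_iff) auto

lemma chart_roots_eq: "chart_roots \<delta> f = {t \<in> rsp N. chart_defect \<delta> f t = 0}"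
  by (simp add: chart_roots_def chart_defect_zero)

lemma chart_defect_continuous: "continuous_on (rsp N) (chart_defect \<delta> f)"
  unfolding chart_defect_def mh_eval_chart_point
  by (intro continuous_on_sum continuous_on_rabs continuous_on_mult continuous_on_const chart_monom_continuous)

lemma chart_defect_measurable: "(\<lambda>f. chart_defect \<delta> f t) \<in> borel_measurable (random_system k n \<delta>)"
  unfolding chart_defect_def mh_eval_chart_point
proof (intro borel_measurable_sum borel_measurable_abs borel_measurable_times borel_measurable_const)
  fix i a assume "i \<in> {..<N}" "a \<in> exponents k n (\<delta> i)"
  then show "(\<lambda>f. f (i, a)) \<in> borel_measurable (random_system k n \<delta>)"
    using measurable_component_singleton[of "(i, a)" "coeff_index \<delta>" "\<lambda>s. nrm (coeff_sd (snd s))"] by (simp add: random_system_eq)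
qed

text \<open>With the sign moved to the nonleading part, the roots are the preimages of the vector of
  leading coefficients, as in \<open>area_formula\<close>.\<close>

lemma chart_roots_combine_coeffs:
  assumes t: "t \<in> rsp N" and c: "c \<in> rsp N"
  shows "t \<in> chart_roots \<delta> (combine_coeffs \<delta> (c, X)) \<longleftrightarrow> Gm N (\<lambda>i. \<lambda>t. \<Sum>a\<in>rest_exponents (\<delta> i). (- X i a) * chart_monom a t) t = c"
proof -
  have "mh_eval k n (\<delta> i) (\<lambda>a. combine_coeffs \<delta> (c, X) (i, a)) (chart_point t) = c i - (\<Sum>a\<in>rest_exponents (\<delta> i). (- X i a) * chart_monom a t)" if "i < N" for i
  proof -
    have "(\<Sum>a\<in>rest_exponents (\<delta> i). combine_coeffs \<delta> (c, X) (i, a) * chart_monom a t) = (\<Sum>a\<in>rest_exponents (\<delta> i). X i a * chart_monom a t)"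
      using that by (intro sum.cong) (auto simp: combine_coeffs_def)
    moreover have "combine_coeffs \<delta> (c, X) (i, lead_exponent (\<delta> i)) = c i" using that lead_exponent_exponents by (simp add: combine_coeffs_def)
    ultimately show ?thesis
      unfolding mh_eval_chart_point by (subst sum.remove[OF finite_exponents lead_exponent_exponents]) (simp add: chart_monom_lead_exponent sum_negf)
  qed
  then have "t \<in> chart_roots \<delta> (combine_coeffs \<delta> (c, X)) \<longleftrightarrow> (\<forall>i<N. (\<Sum>a\<in>rest_exponents (\<delta> i). (- X i a) * chart_monom a t) = c i)"
    using t by (auto simp: chart_roots_def)
  also have "\<dots> \<longleftrightarrow> Gm N (\<lambda>i. \<lambda>t. \<Sum>a\<in>rest_exponents (\<delta> i). (- X i a) * chart_monom a t) t = c"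
  proof
    assume "\<forall>i<N. (\<Sum>a\<in>rest_exponents (\<delta> i). (- X i a) * chart_monom a t) = c i"
    then show "Gm N (\<lambda>i. \<lambda>t. \<Sum>a\<in>rest_exponents (\<delta> i). (- X i a) * chart_monom a t) t = c"
      by (intro rsp_eqI[OF Gm_rsp c]) (simp only: Gm_apply)
  next
    assume e: "Gm N (\<lambda>i. \<lambda>t. \<Sum>a\<in>rest_exponents (\<delta> i). (- X i a) * chart_monom a t) t = c"
    show "\<forall>i<N. (\<Sum>a\<in>rest_exponents (\<delta> i). (- X i a) * chart_monom a t) = c i"
      by (intro allI impI) (subst e[symmetric], simp only: Gm_apply)
  qed
  finally show ?thesis .
qed

text \<open>For fixed nonleading coefficients, the leading ones that allow a root on the hyperplane
  form its image under the map, a null set by \<open>dqf_hyperplane_null\<close>.\<close>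

lemma AE_no_root_on_hyperplane:
  assumes l: "l < N"
  shows "AE f in random_system k n \<delta>. \<forall>t\<in>chart_roots \<delta> f. t l \<noteq> 0"
proof -
  define B where "B = {f \<in> space (random_system k n \<delta>). \<exists>t\<in>{t \<in> rsp N. t l = 0}. chart_defect \<delta> f t = 0}"
  have "closed {t :: nat \<Rightarrow> real. t l = 0}"
    by (intro closed_Collect_eq continuous_on_product_coordinates continuous_on_const)
  then have "closed ({t. t l = 0} \<inter> rsp N)" by (intro closed_Int closed_rsp)
  also have "{t. t l = 0} \<inter> rsp N = {t \<in> rsp N. t l = 0}" by blast
  finally have B: "B \<in> sets (random_system k n \<delta>)"
    unfolding B_def by (intro sets_ex_zero_closed[where N=N] chart_defect_continuous chart_defect_nonneg chart_defect_measurable) auto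
  have "emeasure (random_system k n \<delta>) B = (\<integral>\<^sup>+f. indicator B f \<partial>random_system k n \<delta>)"
    using B by simp
  also have "\<dots> = (\<integral>\<^sup>+X. (\<integral>\<^sup>+c. (\<Prod>i<N. ennreal (normal_density 0 1 (c i))) * indicator B (combine_coeffs \<delta> (c, X)) \<partial>leb N) \<partial>rows_law \<delta>)"
    by (rule nn_integral_random_system) (use B in simp)
  also have "\<dots> = (\<integral>\<^sup>+X. 0 \<partial>rows_law \<delta>)"
  proof (rule nn_integral_cong)
    fix X
    let ?G = "\<lambda>i t. \<Sum>a\<in>rest_exponents (\<delta> i). (- X i a) * chart_monom a t"
    have null: "Gm N ?G ` {t \<in> rsp N. t l = 0} \<in> null_sets (leb N)"
      by (rule dqf_hyperplane_null[OF dqf_lincomb l]) (rule dqf_chart_monom)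
    have "(\<integral>\<^sup>+c. (\<Prod>i<N. ennreal (normal_density 0 1 (c i))) * indicator B (combine_coeffs \<delta> (c, X)) \<partial>leb N)
        = (\<integral>\<^sup>+c. 0 \<partial>leb N)"
    proof (rule nn_integral_cong_AE, rule AE_mp[OF AE_not_in[OF null]], intro AE_I2 impI)
      fix c assume c: "c \<in> space (leb N)" "c \<notin> Gm N ?G ` {t \<in> rsp N. t l = 0}"
      have "combine_coeffs \<delta> (c, X) \<notin> B"
      proof
        assume "combine_coeffs \<delta> (c, X) \<in> B"
        then obtain t where t: "t \<in> rsp N" "t l = 0" "t \<in> chart_roots \<delta> (combine_coeffs \<delta> (c, X))"
          by (auto simp: B_def chart_roots_eq)
        then have "Gm N ?G t = c" using chart_roots_combine_coeffs[OF t(1)] c(1) by (simp only: space_leb)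
        then show False using c(2) t by blast
      qed
      then show "(\<Prod>i<N. ennreal (normal_density 0 1 (c i))) * indicator B (combine_coeffs \<delta> (c, X)) = 0" by simp
    qed
    then show "(\<integral>\<^sup>+c. (\<Prod>i<N. ennreal (normal_density 0 1 (c i))) * indicator B (combine_coeffs \<delta> (c, X)) \<partial>leb N) = 0" by simp
  qed
  finally have "emeasure (random_system k n \<delta>) B = 0" by simp
  then have "B \<in> null_sets (random_system k n \<delta>)" using B by auto
  from AE_not_in[OF this] show ?thesis
    by (rule AE_mp) (intro AE_I2, auto simp: B_def chart_roots_eq)
qed

text \<open>The area formula is used with the coefficients \<open>X\<close> fixed and the Gaussian
  density of \<open>c\<close> as weight. The order is then exchanged because
  \<open>chart_det_integral\<close> averages over \<open>X\<close> at a fixed point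
  \<open>t\<close>.\<close>

lemma expected_chart_roots:
  "(\<integral>\<^sup>+f. emeasure (count_space UNIV) (chart_roots \<delta> f) \<partial>random_system k n \<delta>)
    = ennreal (\<Prod>j<k. cc (n j)) * Jd N (\<lambda>i l. sqrt (real (\<delta> i (blk l))))"
proof -
  interpret rows_law: prob_space "rows_law \<delta>" by (rule prob_space_rows_law)
  interpret LN: finite_product_sigma_finite "\<lambda>_::nat. lborel :: real measure" "{..<N}" by standard simp
  interpret pair_sigma_finite "rows_law \<delta>" "leb N"
    by (intro pair_sigma_finite.intro prob_space_imp_sigma_finite rows_law.prob_space_axioms LN.sigma_finite_measure_axioms)
  let ?J = "Jd N (\<lambda>i l. sqrt (real (\<delta> i (blk l))))"
  let ?D = "\<lambda>X t. dt N (\<lambda>i l. normal_density 0 1 (chart_value (\<delta> i) (X i) t) * chart_row (\<delta> i) (X i) t l)"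
  have "(\<lambda>f. emeasure (count_space UNIV) (chart_roots \<delta> f)) \<in> borel_measurable (random_system k n \<delta>)"
    unfolding chart_roots_eq by (intro measurable_count_zeros chart_defect_continuous chart_defect_nonneg chart_defect_measurable)
  then have "(\<integral>\<^sup>+f. emeasure (count_space UNIV) (chart_roots \<delta> f) \<partial>random_system k n \<delta>)
      = (\<integral>\<^sup>+X. (\<integral>\<^sup>+c. (\<Prod>i<N. ennreal (normal_density 0 1 (c i))) * emeasure (count_space UNIV) (chart_roots \<delta> (combine_coeffs \<delta> (c, X))) \<partial>leb N) \<partial>rows_law \<delta>)"
    by (rule nn_integral_random_system)
  also have "\<dots> = (\<integral>\<^sup>+X. (\<integral>\<^sup>+t. ennreal \<bar>?D X t\<bar> \<partial>leb N) \<partial>rows_law \<delta>)"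
  proof (rule nn_integral_cong)
    fix X
    let ?G = "\<lambda>i t. \<Sum>a\<in>rest_exponents (\<delta> i). (- X i a) * chart_monom a t"
    let ?A = "\<lambda>i l x y. \<Sum>a\<in>rest_exponents (\<delta> i). (- X i a) * chart_monom_dq a l x y"
    have "(\<integral>\<^sup>+c. (\<Prod>i<N. ennreal (normal_density 0 1 (c i))) * emeasure (count_space UNIV) (chart_roots \<delta> (combine_coeffs \<delta> (c, X))) \<partial>leb N)
        = (\<integral>\<^sup>+c. (\<Prod>i<N. ennreal (normal_density 0 1 (c i))) * emeasure (count_space UNIV) {x \<in> rsp N. Gm N ?G x = c} \<partial>leb N)"
    proof (rule nn_integral_cong)
      fix c assume "c \<in> space (leb N)"
      then have c: "c \<in> rsp N" by (simp only: space_leb)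
      have "chart_roots \<delta> (combine_coeffs \<delta> (c, X)) \<subseteq> rsp N" by (auto simp: chart_roots_def)
      then have "chart_roots \<delta> (combine_coeffs \<delta> (c, X)) = {x \<in> rsp N. Gm N ?G x = c}"
        using chart_roots_combine_coeffs[OF _ c] by blast
      then show "(\<Prod>i<N. ennreal (normal_density 0 1 (c i))) * emeasure (count_space UNIV) (chart_roots \<delta> (combine_coeffs \<delta> (c, X)))
          = (\<Prod>i<N. ennreal (normal_density 0 1 (c i))) * emeasure (count_space UNIV) {x \<in> rsp N. Gm N ?G x = c}" by simp
    qed
    also have "\<dots> = (\<integral>\<^sup>+t. (\<Prod>i<N. ennreal (normal_density 0 1 (Gm N ?G t i))) * ennreal \<bar>dt N (\<lambda>i l. ?A i l t t)\<bar> \<partial>leb N)"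
      by (rule area_formula[OF dqf_lincomb density_measurable]) (rule dqf_chart_monom)
    also have "\<dots> = (\<integral>\<^sup>+t. ennreal \<bar>?D X t\<bar> \<partial>leb N)"
    proof (rule nn_integral_cong)
      fix t
      \<comment> \<open>The sign disappears twice: the normal density is even, and only the absolute
        determinant enters.\<close>
      have "?G i t = - chart_value (\<delta> i) (X i) t" for i by (simp add: chart_value_def sum_negf)
      then have 1: "(\<Prod>i<N. ennreal (normal_density 0 1 (Gm N ?G t i))) = ennreal (\<Prod>i<N. normal_density 0 1 (chart_value (\<delta> i) (X i) t))"
        by (subst prod_ennreal[symmetric]) (auto intro!: prod.cong simp: normal_density_def)
      have "dt N (\<lambda>i l. ?A i l t t) = dt N (\<lambda>i l. (- 1) * chart_row (\<delta> i) (X i) t l)"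
        by (rule dt_cong) (simp add: chart_row_def sum_negf)
      then have 2: "\<bar>dt N (\<lambda>i l. ?A i l t t)\<bar> = \<bar>dt N (\<lambda>i l. chart_row (\<delta> i) (X i) t l)\<bar>"
        unfolding dt_scale by (simp add: abs_mult power_abs)
      have "?D X t = dt N (\<lambda>l i. chart_row (\<delta> i) (X i) t l * normal_density 0 1 (chart_value (\<delta> i) (X i) t))"
        by (rule trans[OF dt_transpose[symmetric]]) (simp only: mult.commute)
      also have "\<dots> = dt N (\<lambda>l i. chart_row (\<delta> i) (X i) t l) * (\<Prod>i<N. normal_density 0 1 (chart_value (\<delta> i) (X i) t))"
        by (rule dt_scale_cols)
      also have "dt N (\<lambda>l i. chart_row (\<delta> i) (X i) t l) = dt N (\<lambda>i l. chart_row (\<delta> i) (X i) t l)"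
        by (rule dt_transpose)
      finally have 3: "\<bar>?D X t\<bar> = (\<Prod>i<N. normal_density 0 1 (chart_value (\<delta> i) (X i) t)) * \<bar>dt N (\<lambda>i l. chart_row (\<delta> i) (X i) t l)\<bar>"
        by (simp add: abs_mult abs_prod)
      show "(\<Prod>i<N. ennreal (normal_density 0 1 (Gm N ?G t i))) * ennreal \<bar>dt N (\<lambda>i l. ?A i l t t)\<bar> = ennreal \<bar>?D X t\<bar>"
        unfolding 1 2 3 by (rule ennreal_mult[symmetric]) (auto intro: prod_nonneg)
    qed
    finally show "(\<integral>\<^sup>+c. (\<Prod>i<N. ennreal (normal_density 0 1 (c i))) * emeasure (count_space UNIV) (chart_roots \<delta> (combine_coeffs \<delta> (c, X))) \<partial>leb N)
        = (\<integral>\<^sup>+t. ennreal \<bar>?D X t\<bar> \<partial>leb N)" .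
  qed
  also have "\<dots> = (\<integral>\<^sup>+t. (\<integral>\<^sup>+X. ennreal \<bar>?D X t\<bar> \<partial>rows_law \<delta>) \<partial>leb N)"
  proof (rule Fubini'[where f="\<lambda>X t. ennreal \<bar>?D X t\<bar>", symmetric])
    have cont_meas: "h \<in> borel_measurable (leb N)" if "continuous_on (rsp N) h" for h :: "(nat \<Rightarrow> real) \<Rightarrow> real"
    proof -
      have "(\<lambda>x. if x \<in> rsp N then h x else 0) \<in> borel_measurable (leb N)"
        by (rule measurable_if_continuous_on[OF that]) (simp add: closed_rsp)
      then show ?thesis by (rule measurable_cong[THEN iffD1, rotated]) (simp add: space_leb)
    qed
    have X: "(\<lambda>p. fst p i a) \<in> borel_measurable (rows_law \<delta> \<Otimes>\<^sub>M leb N)" if "i < N" "a \<in> rest_exponents (\<delta> i)" for i a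
      by (rule measurable_compose[OF measurable_fst measurable_rows_law[where \<delta>=\<delta> and i=i and a=a, OF that]])
    have gm: "(\<lambda>p. chart_value (\<delta> i) (fst p i) (snd p)) \<in> borel_measurable (rows_law \<delta> \<Otimes>\<^sub>M leb N)" if "i < N" for i
      unfolding chart_value_def
      by (intro borel_measurable_sum borel_measurable_times X[OF that] measurable_compose[OF measurable_snd cont_meas] chart_monom_continuous)
    have rm: "(\<lambda>p. chart_row (\<delta> i) (fst p i) (snd p) l) \<in> borel_measurable (rows_law \<delta> \<Otimes>\<^sub>M leb N)" if "i < N" "l < N" for i l
      unfolding chart_row_def
      by (intro borel_measurable_sum borel_measurable_times X[OF that(1)] measurable_compose[OF measurable_snd cont_meas[OF chart_monom_dq_continuous[OF that(2)]]])
    show "(\<lambda>(X, t). ennreal \<bar>?D X t\<bar>) \<in> borel_measurable (rows_law \<delta> \<Otimes>\<^sub>M leb N)"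
      unfolding case_prod_beta'
      by (intro measurable_compose[OF _ measurable_ennreal] borel_measurable_abs dt_measurable borel_measurable_times rm
          measurable_compose[OF gm borel_measurable_normal_density])
  qed
  also have "\<dots> = (\<integral>\<^sup>+t. ennreal (chart_dens N blk k t) * ?J \<partial>leb N)"
    by (rule nn_integral_cong) (rule chart_det_integral, simp only: space_leb)
  also have "\<dots> = (\<integral>\<^sup>+t. ennreal (chart_dens N blk k t) \<partial>leb N) * ?J"
    by (rule nn_integral_multc) (rule measurable_compose[OF chart_dens_measurable measurable_ennreal])
  also have "(\<integral>\<^sup>+t. ennreal (chart_dens N blk k t) \<partial>leb N) = ennreal (\<Prod>j<k. cc (card (bs N blk j)))"
    by (rule chart_integral) (rule blk)
  also have "(\<Prod>j<k. cc (card (bs N blk j))) = (\<Prod>j<k. cc (n j))"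
    by (intro prod.cong refl) (simp add: card_bs)
  finally show ?thesis .
qed

end

subsection \<open>Roots in the product of projective spaces\<close>

lemma proj_class_eq:
  assumes "p \<in> real_proj_space m" "v \<in> p"
  shows "p = proportional m `` {v}"
proof -
  obtain u where u: "u \<in> nonzero_vecs m" "p = proportional m `` {u}"
    using assms(1) unfolding real_proj_space_def by (rule quotientE)
  then have "(u, v) \<in> proportional m" using assms(2) by simp
  then show ?thesis unfolding u(2) by (rule equiv_class_eq[OF equiv_proportional])
qed

lemma proj_class_nonzero: "p \<in> real_proj_space m \<Longrightarrow> v \<in> p \<Longrightarrow> v \<in> nonzero_vecs m"
  using in_quotient_imp_subset[OF equiv_proportional] by (auto simp: real_proj_space_def)

lemma emeasure_count_bij_betw:
  assumes "bij_betw g A B"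
  shows "emeasure (count_space UNIV) B = emeasure (count_space UNIV) A"
  using bij_betw_same_card[OF assms] bij_betw_finite[OF assms] by (cases "finite A") auto

context chart
begin

lemma chart_point_normalized:
  assumes "j < k" "h \<le> n j" "x j (hc j) \<noteq> 0"
  shows "chart_point (\<lambda>l\<in>{..<N}. x (blk l) (pos l) / x (blk l) (hc (blk l))) j h = x j h / x j (hc j)"
  using assms idx[of j h] by (auto simp: chart_point_def)

lemma chart_roots_normalized:
  assumes x: "\<And>j. j < k \<Longrightarrow> x j (hc j) \<noteq> 0"
    and root: "\<And>i. i < N \<Longrightarrow> mh_eval k n (\<delta> i) (\<lambda>a. f (i, a)) x = 0"
  shows "(\<lambda>l\<in>{..<N}. x (blk l) (pos l) / x (blk l) (hc (blk l))) \<in> chart_roots \<delta> f"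
proof -
  let ?t = "\<lambda>l\<in>{..<N}. x (blk l) (pos l) / x (blk l) (hc (blk l))"
  have "mh_eval k n (\<delta> i) (\<lambda>a. f (i, a)) (chart_point ?t) = 0" if "i < N" for i
  proof -
    have "mh_eval k n (\<delta> i) (\<lambda>a. f (i, a)) (chart_point ?t) = (\<Prod>j<k. (1 / x j (hc j)) ^ \<delta> i j) * mh_eval k n (\<delta> i) (\<lambda>a. f (i, a)) x"
      by (rule mh_eval_scale) (subst chart_point_normalized, use x in auto)
    then show ?thesis using root[OF that] by simp
  qed
  then show ?thesis by (simp add: chart_roots_def restrict_rsp)
qed

text \<open>The hypothesis excludes roots at infinity of the chart; dividing by the selected
  coordinates then gives each root exactly one chart representative.\<close>

lemma bij_betw_chart_roots_system_roots:
  assumes nz: "\<And>\<zeta> x j. \<zeta> \<in> system_roots k n \<delta> f \<Longrightarrow> x \<in> (\<Pi>\<^sub>E j\<in>{..<k}. \<zeta> j) \<Longrightarrow> j < k \<Longrightarrow> x j (hc j) \<noteq> 0"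
  shows "bij_betw (\<lambda>t. \<lambda>j\<in>{..<k}. proportional (n j) `` {\<lambda>h\<in>{..n j}. chart_point t j h}) (chart_roots \<delta> f) (system_roots k n \<delta> f)"
    (is "bij_betw ?\<psi> _ _")
proof (rule bij_betw_imageI)
  have v: "(\<lambda>h\<in>{..n j}. chart_point t j h) \<in> nonzero_vecs (n j)" if "j < k" for t j
    using hc[OF that] by (auto simp: nonzero_vecs_def chart_point_def intro!: exI[of _ "hc j"])
  show "inj_on ?\<psi> (chart_roots \<delta> f)"
  proof (rule inj_onI)
    fix t t' assume t: "t \<in> chart_roots \<delta> f" "t' \<in> chart_roots \<delta> f" "?\<psi> t = ?\<psi> t'"
    show "t = t'"
    proof (rule rsp_eqI[of _ N])
      fix l assume l: "l < N"
      let ?j = "blk l"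
      have j: "?j < k" using l by (rule blk)
      have "proportional (n ?j) `` {\<lambda>h\<in>{..n ?j}. chart_point t ?j h} = proportional (n ?j) `` {\<lambda>h\<in>{..n ?j}. chart_point t' ?j h}"
        using fun_cong[OF t(3), of ?j] j by simp
      then have "(\<lambda>h\<in>{..n ?j}. chart_point t ?j h, \<lambda>h\<in>{..n ?j}. chart_point t' ?j h) \<in> proportional (n ?j)"
        using eq_equiv_class[OF _ equiv_proportional v[OF j]] by blast
      then obtain c where c: "\<And>h. h \<le> n ?j \<Longrightarrow> chart_point t' ?j h = c * chart_point t ?j h"
        by (auto simp: proportional_def)
      have "c = 1" using c[OF hc[OF j]] by (simp add: chart_point_def)
      then show "t l = t' l" using c[of "pos l"] pos[OF l] by (simp add: chart_point_def)
    qed (use t in \<open>auto simp: chart_roots_def\<close>)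
  qed
  show "?\<psi> ` chart_roots \<delta> f = system_roots k n \<delta> f"
  proof (intro equalityI subsetI)
    fix \<zeta> assume "\<zeta> \<in> ?\<psi> ` chart_roots \<delta> f"
    then obtain t where t: "t \<in> chart_roots \<delta> f" "\<zeta> = ?\<psi> t" by blast
    have "\<zeta> \<in> root_space k n"
      unfolding root_space_def real_proj_space_def t(2) by (rule restrict_PiE_iff[THEN iffD2]) (auto intro: quotientI v)
    moreover have "mh_eval k n (\<delta> i) (\<lambda>a. f (i, a)) x = 0" if "i < N" "x \<in> (\<Pi>\<^sub>E j\<in>{..<k}. \<zeta> j)" for i x
    proof -
      have "\<exists>s. \<forall>h\<le>n j. x j h = s * chart_point t j h" if j: "j < k" for j
      proof -
        have "x j \<in> \<zeta> j" using \<open>x \<in> _\<close> j by (auto simp: PiE_iff)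
        then have "(\<lambda>h\<in>{..n j}. chart_point t j h, x j) \<in> proportional (n j)" using j t(2) by simp
        then show ?thesis by (auto simp: proportional_def)
      qed
      then obtain s where s: "\<And>j h. j < k \<Longrightarrow> h \<le> n j \<Longrightarrow> x j h = s j * chart_point t j h" by metis
      have "mh_eval k n (\<delta> i) (\<lambda>a. f (i, a)) x = (\<Prod>j<k. s j ^ \<delta> i j) * mh_eval k n (\<delta> i) (\<lambda>a. f (i, a)) (chart_point t)"
        by (rule mh_eval_scale) (rule s)
      then show ?thesis using t(1) that(1) by (simp add: chart_roots_def)
    qed
    ultimately show "\<zeta> \<in> system_roots k n \<delta> f" by (simp add: system_roots_def N_eq[symmetric])
  next
    fix \<zeta> assume \<zeta>: "\<zeta> \<in> system_roots k n \<delta> f"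
    then have rs: "\<zeta> \<in> root_space k n" by (simp add: system_roots_def)
    obtain x where x: "x \<in> (\<Pi>\<^sub>E j\<in>{..<k}. \<zeta> j)" using root_space_representative[OF rs] by blast
    let ?t = "\<lambda>l\<in>{..<N}. x (blk l) (pos l) / x (blk l) (hc (blk l))"
    have nzx: "x j (hc j) \<noteq> 0" if "j < k" for j using nz[OF \<zeta> x that] .
    have t: "?t \<in> chart_roots \<delta> f"
      by (rule chart_roots_normalized) (use nzx x \<zeta> in \<open>auto simp: system_roots_def N_eq[symmetric]\<close>)
    have e: "?\<psi> ?t = \<zeta>"
    proof (rule PiE_ext)
      show "\<zeta> \<in> (\<Pi>\<^sub>E j\<in>{..<k}. UNIV)" using rs by (auto simp: root_space_def PiE_iff)
      show "?\<psi> ?t \<in> (\<Pi>\<^sub>E j\<in>{..<k}. UNIV)" by simp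
      fix j assume "j \<in> {..<k}"
      then have j: "j < k" by simp
      have p: "\<zeta> j \<in> real_proj_space (n j)" using rs j by (auto simp: root_space_def PiE_iff)
      have xj: "x j \<in> \<zeta> j" using x j by (auto simp: PiE_iff)
      have "(x j, \<lambda>h\<in>{..n j}. chart_point ?t j h) \<in> proportional (n j)"
        unfolding proportional_def
      proof (intro CollectI case_prodI conjI exI[of _ "1 / x j (hc j)"] allI impI)
        show "1 / x j (hc j) \<noteq> 0" using nzx[OF j] by simp
        show "(\<lambda>h\<in>{..n j}. chart_point ?t j h) h = 1 / x j (hc j) * x j h" if h: "h \<le> n j" for h
          using chart_point_normalized[OF j h, of x] nzx[OF j] h by simp
      qed (rule proj_class_nonzero[OF p xj] v[OF j])+
      then have "proportional (n j) `` {x j} = proportional (n j) `` {\<lambda>h\<in>{..n j}. chart_point ?t j h}"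
        by (rule equiv_class_eq[OF equiv_proportional])
      then show "?\<psi> ?t j = \<zeta> j" using proj_class_eq[OF p xj] j by simp
    qed
    show "\<zeta> \<in> ?\<psi> ` chart_roots \<delta> f" by (rule image_eqI[where f="?\<psi>" and x="?t", OF e[symmetric] t])
  qed
qed

end

text \<open>Only the positions inside a block depend on \<open>hc\<close>; \<open>blk\<close> is
  prescribed, so all charts share one assignment of columns to blocks.\<close>

lemma ex_chart:
  assumes blk: "\<And>l. l < N \<Longrightarrow> blk l < k" and card: "\<And>j. j < k \<Longrightarrow> card (bs N blk j) = n j"
    and hc: "\<And>j. j < k \<Longrightarrow> hc j \<le> n j"
  shows "\<exists>pos idx. chart k n hc N blk pos idx"
proof -
  have "\<exists>g. bij_betw g (bs N blk j) ({..n j} - {hc j})" if j: "j < k" for j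
    by (rule finite_same_card_bij) (use j card[OF j] hc[OF j] in \<open>auto simp: finite_bs\<close>)
  then obtain g where g: "\<And>j. j < k \<Longrightarrow> bij_betw (g j) (bs N blk j) ({..n j} - {hc j})" by metis
  have mem: "l \<in> bs N blk (blk l)" if "l < N" for l using that by (simp add: bs_def)
  have "chart k n hc N blk (\<lambda>l. g (blk l) l) (\<lambda>j. inv_into (bs N blk j) (g j))"
  proof
    show "hc j \<le> n j" if "j < k" for j using hc that .
    fix l assume l: "l < N"
    show "blk l < k" using blk l .
    note b = g[OF this]
    show "g (blk l) l \<le> n (blk l)" "g (blk l) l \<noteq> hc (blk l)"
      using bij_betwE[OF b] mem[OF l] by auto
    show "inv_into (bs N blk (blk l)) (g (blk l)) (g (blk l) l) = l"
      by (rule bij_betw_inv_into_left[OF b mem[OF l]])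
  next
    fix j h assume j: "j < k" and h: "h \<le> n j" "h \<noteq> hc j"
    then have m: "h \<in> {..n j} - {hc j}" by simp
    have b: "inv_into (bs N blk j) (g j) h \<in> bs N blk j"
      using bij_betwE[OF bij_betw_inv_into[OF g[OF j]]] m by blast
    then show "inv_into (bs N blk j) (g j) h < N" "blk (inv_into (bs N blk j) (g j) h) = j" by (auto simp: bs_def)
    then show "g (blk (inv_into (bs N blk j) (g j) h)) (inv_into (bs N blk j) (g j) h) = h"
      using bij_betw_inv_into_right[OF g[OF j] m] by simp
  qed
  then show ?thesis by blast
qed

text \<open>The finitely many charts cover the root space. A root at infinity of the chart
  \<open>hc0\<close> lies in some other chart, where the coordinate numbered 0 of some block is an
  affine coordinate equal to zero, and almost surely this happens in no chart. So \<open>hc0\<close>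
  alone counts all roots.\<close>

theorem expected_roots_eq:
  assumes blk: "\<And>l. l < N \<Longrightarrow> blk l < k" and card: "\<And>j. j < k \<Longrightarrow> card (bs N blk j) = n j"
  shows "expected_roots k n \<delta> = ennreal (\<Prod>j<k. cc (n j)) * Jd N (\<lambda>i l. sqrt (real (\<delta> i (blk l))))"
proof -
  define H where "H = (\<Pi>\<^sub>E j\<in>{..<k}. {..n j})"
  have "\<forall>hc\<in>H. \<exists>pos idx. chart k n hc N blk pos idx"
    using ex_chart[OF blk card] by (auto simp: H_def PiE_iff)
  then obtain POS IDX where ch: "\<And>hc. hc \<in> H \<Longrightarrow> chart k n hc N blk (POS hc) (IDX hc)" by metis
  have fin: "finite H" unfolding H_def by (intro finite_PiE) auto
  define hc0 where "hc0 = (\<lambda>j\<in>{..<k}. 0 :: nat)"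
  have hc0: "hc0 \<in> H" by (simp add: hc0_def H_def)
  interpret C: chart k n hc0 N blk "POS hc0" "IDX hc0" by (rule ch[OF hc0])
  have "AE f in random_system k n \<delta>. \<forall>hc\<in>H. \<forall>l\<in>{..<N}. \<forall>t\<in>chart.chart_roots k n hc N (IDX hc) \<delta> f. t l \<noteq> 0"
    by (intro AE_finite_allI fin finite_lessThan chart.AE_no_root_on_hyperplane[OF ch]) auto
  then have "AE f in random_system k n \<delta>. emeasure (count_space UNIV) (system_roots k n \<delta> f) = emeasure (count_space UNIV) (C.chart_roots \<delta> f)"
  proof (rule AE_mp, intro AE_I2 impI)
    fix f assume good: "\<forall>hc\<in>H. \<forall>l\<in>{..<N}. \<forall>t\<in>chart.chart_roots k n hc N (IDX hc) \<delta> f. t l \<noteq> 0"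
    show "emeasure (count_space UNIV) (system_roots k n \<delta> f) = emeasure (count_space UNIV) (C.chart_roots \<delta> f)"
    proof (rule emeasure_count_bij_betw, rule C.bij_betw_chart_roots_system_roots)
      fix \<zeta> x j assume \<zeta>: "\<zeta> \<in> system_roots k n \<delta> f" and x: "x \<in> (\<Pi>\<^sub>E j\<in>{..<k}. \<zeta> j)" and j: "j < k"
      have "\<exists>h\<le>n j'. x j' h \<noteq> 0" if "j' < k" for j'
      proof -
        have "\<zeta> j' \<in> real_proj_space (n j')" "x j' \<in> \<zeta> j'"
          using \<zeta> x that by (auto simp: system_roots_def root_space_def PiE_iff)
        then have "x j' \<in> nonzero_vecs (n j')" by (rule proj_class_nonzero)
        then show ?thesis by (simp add: nonzero_vecs_def)
      qed
      \<comment> \<open>Nonzero homogeneous coordinates of a representative, one in every block,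
        select a chart that contains the root.\<close>
      then obtain hc' where hc': "\<And>j. j < k \<Longrightarrow> hc' j \<le> n j \<and> x j (hc' j) \<noteq> 0" by metis
      define hc where "hc = restrict hc' {..<k}"
      have hc: "hc \<in> H" "\<And>j. j < k \<Longrightarrow> x j (hc j) \<noteq> 0" using hc' by (auto simp: hc_def H_def)
      interpret D: chart k n hc N blk "POS hc" "IDX hc" by (rule ch[OF hc(1)])
      let ?t = "\<lambda>l\<in>{..<N}. x (blk l) (POS hc l) / x (blk l) (hc (blk l))"
      have t: "?t \<in> D.chart_roots \<delta> f"
        by (rule D.chart_roots_normalized) (use hc(2) x \<zeta> in \<open>auto simp: system_roots_def D.N_eq[symmetric]\<close>)
      show "x j (hc0 j) \<noteq> 0"
      proof
        assume "x j (hc0 j) = 0"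
        then have x0: "x j 0 = 0" using j by (simp add: hc0_def)
        then have ne: "0 \<noteq> hc j" using hc(2)[OF j] by metis
        note i = D.idx[OF j _ ne]
        have "?t (IDX hc j 0) = 0" using i x0 by simp
        moreover have "IDX hc j 0 \<in> {..<N}" using i by simp
        ultimately show False using good hc(1) t by blast
      qed
    qed
  qed
  then have "expected_roots k n \<delta> = (\<integral>\<^sup>+f. emeasure (count_space UNIV) (C.chart_roots \<delta> f) \<partial>random_system k n \<delta>)"
    unfolding expected_roots_def by (rule nn_integral_cong_AE)
  then show ?thesis unfolding C.expected_chart_roots .
qed

subsection \<open>Means of weighted norms\<close>

text \<open>In the application \<open>Y j\<close> is the norm of the cofactors in block
  \<open>j\<close> and \<open>w j\<close> is the square root of \<open>\<delta> i j\<close>.\<close>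

locale mean_norm =
  fixes M :: "'w measure" and J :: "'j set" and w :: "'j \<Rightarrow> real" and Y :: "'j \<Rightarrow> 'w \<Rightarrow> real"
  assumes fin: "finite J" and w: "\<And>j. j \<in> J \<Longrightarrow> w j \<ge> 0" and Y: "\<And>j x. j \<in> J \<Longrightarrow> Y j x \<ge> 0"
    and int: "\<And>j. j \<in> J \<Longrightarrow> integrable M (Y j)"
begin

definition wY :: "'j \<Rightarrow> 'w \<Rightarrow> real" where "wY j x = w j * Y j x"
definition mean_wY :: "'j \<Rightarrow> real" where "mean_wY j = w j * integral\<^sup>L M (Y j)"
definition norm_wY :: "'w \<Rightarrow> real" where "norm_wY x = sqrt (\<Sum>j\<in>J. (wY j x)\<^sup>2)"
definition norm_means :: real where "norm_means = sqrt (\<Sum>j\<in>J. (mean_wY j)\<^sup>2)"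

lemma wY_nonneg: "j \<in> J \<Longrightarrow> wY j x \<ge> 0" by (simp add: wY_def w Y)

lemma mean_wY_nonneg: "j \<in> J \<Longrightarrow> mean_wY j \<ge> 0" by (simp add: mean_wY_def w Y integral_nonneg_AE)

lemma integrable_wY: "j \<in> J \<Longrightarrow> integrable M (wY j)" by (simp add: wY_def[abs_def] int)

lemma integral_wY: "integral\<^sup>L M (wY j) = mean_wY j" by (simp add: wY_def[abs_def] mean_wY_def)

lemma norm_wY_nonneg: "norm_wY x \<ge> 0" by (simp add: norm_wY_def sum_nonneg)

lemma norm_wY_le: "norm_wY x \<le> (\<Sum>j\<in>J. wY j x)"
proof -
  have "norm_wY x \<le> (\<Sum>j\<in>J. \<bar>wY j x\<bar>)" using L2_set_le_sum_abs[of "\<lambda>j. wY j x" J] by (simp add: norm_wY_def L2_set_def)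
  also have "\<dots> = (\<Sum>j\<in>J. wY j x)" by (intro sum.cong refl) (simp add: wY_nonneg)
  finally show ?thesis .
qed

lemma integrable_norm_wY: "integrable M norm_wY"
proof (rule Bochner_Integration.integrable_bound)
  show "integrable M (\<lambda>x. \<Sum>j\<in>J. wY j x)" by (intro Bochner_Integration.integrable_sum integrable_wY)
  have "\<And>j. j \<in> J \<Longrightarrow> wY j \<in> borel_measurable M" using integrable_wY by (rule borel_measurable_integrable)
  then show "norm_wY \<in> borel_measurable M" unfolding norm_wY_def[abs_def] by measurable
  show "AE x in M. norm (norm_wY x) \<le> norm (\<Sum>j\<in>J. wY j x)"
    using norm_wY_le norm_wY_nonneg by (intro AE_I2) (auto intro: order_trans[OF _ abs_ge_self])
qed

lemma cauchy_schwarz: "(\<Sum>j\<in>J. mean_wY j * wY j x) \<le> norm_means * norm_wY x"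
proof -
  have "(\<Sum>j\<in>J. mean_wY j * wY j x) = (\<Sum>j\<in>J. \<bar>mean_wY j\<bar> * \<bar>wY j x\<bar>)"
    by (intro sum.cong refl) (simp add: wY_nonneg mean_wY_nonneg)
  also have "\<dots> \<le> norm_means * norm_wY x"
    using L2_set_mult_ineq[of mean_wY "\<lambda>j. wY j x" J] by (simp add: norm_means_def norm_wY_def L2_set_def)
  finally show ?thesis .
qed

lemma norm_means_sq: "norm_means\<^sup>2 = (\<Sum>j\<in>J. (mean_wY j)\<^sup>2)" and norm_means_nonneg: "norm_means \<ge> 0"
  by (simp_all add: norm_means_def sum_nonneg)

lemma norm_wY_sq: "(norm_wY x)\<^sup>2 = (\<Sum>j\<in>J. (wY j x)\<^sup>2)" by (simp add: norm_wY_def sum_nonneg)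

text \<open>The integrand is the pointwise defect in the Cauchy-Schwarz inequality with the vector
  of means. It is nonnegative, so its integral yields both the lower bound and the case of
  equality.\<close>

lemma integral_gap: "integral\<^sup>L M (\<lambda>x. norm_means * norm_wY x - (\<Sum>j\<in>J. mean_wY j * wY j x)) = norm_means * (integral\<^sup>L M norm_wY - norm_means)"
proof -
  have "integral\<^sup>L M (\<lambda>x. norm_means * norm_wY x - (\<Sum>j\<in>J. mean_wY j * wY j x)) = norm_means * integral\<^sup>L M norm_wY - (\<Sum>j\<in>J. mean_wY j * mean_wY j)"
    by (simp add: Bochner_Integration.integral_diff Bochner_Integration.integral_sum integrable_norm_wY integrable_wY integral_wY)
  then show ?thesis using norm_means_sq by (simp add: power2_eq_square algebra_simps)
qed

lemma lower: "norm_means \<le> integral\<^sup>L M norm_wY"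
proof (cases "norm_means = 0")
  case True
  then show ?thesis by (simp add: integral_nonneg_AE norm_wY_nonneg)
next
  case False
  have "0 \<le> integral\<^sup>L M (\<lambda>x. norm_means * norm_wY x - (\<Sum>j\<in>J. mean_wY j * wY j x))"
    by (intro integral_nonneg_AE AE_I2) (use cauchy_schwarz in simp)
  then have "0 \<le> norm_means * (integral\<^sup>L M norm_wY - norm_means)" by (simp only: integral_gap)
  then show ?thesis using False norm_means_nonneg by (simp add: zero_le_mult_iff)
qed

lemma upper: "integral\<^sup>L M norm_wY \<le> (\<Sum>j\<in>J. mean_wY j)"
proof -
  have "integral\<^sup>L M norm_wY \<le> integral\<^sup>L M (\<lambda>x. \<Sum>j\<in>J. wY j x)"
    by (intro integral_mono integrable_norm_wY Bochner_Integration.integrable_sum integrable_wY norm_wY_le)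
  also have "\<dots> = (\<Sum>j\<in>J. mean_wY j)"
    by (simp add: Bochner_Integration.integral_sum integrable_wY integral_wY)
  finally show ?thesis .
qed

lemma sum_eq_norm:
  assumes "\<And>j j'. j \<in> J \<Longrightarrow> j' \<in> J \<Longrightarrow> mean_wY j > 0 \<Longrightarrow> mean_wY j' > 0 \<Longrightarrow> j = j'"
  shows "(\<Sum>j\<in>J. mean_wY j) = norm_means"
proof (cases "\<exists>j\<in>J. mean_wY j > 0")
  case True
  then obtain j where j: "j \<in> J" "mean_wY j > 0" by blast
  then have 0: "mean_wY j' = 0" if "j' \<in> J - {j}" for j'
    using assms[of j' j] that mean_wY_nonneg[of j'] by force
  have "(\<Sum>j\<in>J. mean_wY j) = mean_wY j" "(\<Sum>j\<in>J. (mean_wY j)\<^sup>2) = (mean_wY j)\<^sup>2"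
    by (subst sum.remove[OF fin j(1)], simp add: 0)+
  then show ?thesis using j by (simp add: norm_means_def)
next
  case False
  then have "mean_wY j = 0" if "j \<in> J" for j using mean_wY_nonneg[OF that] that by force
  then show ?thesis by (simp add: norm_means_def)
qed

text \<open>Equality of the integrals forces the norm to equal the sum s of the entries almost
  everywhere. Then the sum of the nonnegative terms a_j (s - a_j) is s^2 minus the sum of squares,
  that is 0, and s - a_j is at least any other entry.\<close>

lemma upper_eq:
  assumes eq: "integral\<^sup>L M norm_wY = (\<Sum>j\<in>J. mean_wY j)" and j: "j1 \<in> J" "j2 \<in> J" "j1 \<noteq> j2"
  shows "AE x in M. wY j1 x * wY j2 x = 0"
proof -
  have i: "integrable M (\<lambda>x. (\<Sum>j\<in>J. wY j x) - norm_wY x)"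
    by (intro Bochner_Integration.integrable_diff integrable_norm_wY Bochner_Integration.integrable_sum integrable_wY)
  have "integral\<^sup>L M (\<lambda>x. (\<Sum>j\<in>J. wY j x) - norm_wY x) = 0"
    by (simp add: Bochner_Integration.integral_diff Bochner_Integration.integral_sum integrable_norm_wY integrable_wY integral_wY eq)
  then have "AE x in M. (\<Sum>j\<in>J. wY j x) - norm_wY x = 0"
    using integral_nonneg_eq_0_iff_AE[OF i] norm_wY_le by simp
  then show ?thesis
  proof (rule AE_mp, intro AE_I2 impI)
    fix x assume e: "(\<Sum>j\<in>J. wY j x) - norm_wY x = 0"
    define s where "s = (\<Sum>j\<in>J. wY j x)"
    have le: "wY j x \<le> s" if "j \<in> J" for j
      unfolding s_def by (rule member_le_sum) (use that fin wY_nonneg in auto)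
    have "(\<Sum>j\<in>J. wY j x * (s - wY j x)) = s * s - (\<Sum>j\<in>J. (wY j x)\<^sup>2)"
      by (simp add: right_diff_distrib sum_subtractf sum_distrib_right[symmetric] s_def[symmetric] power2_eq_square)
    also have "\<dots> = 0" using e norm_wY_sq[of x] by (simp add: s_def[symmetric] power2_eq_square)
    finally have "wY j1 x * (s - wY j1 x) = 0"
      using j(1) fin by (subst (asm) sum_nonneg_eq_0_iff) (auto simp: wY_nonneg le)
    moreover have "wY j1 x + wY j2 x \<le> s"
    proof -
      have "(\<Sum>j\<in>{j1, j2}. wY j x) \<le> s" unfolding s_def by (rule sum_mono2) (use j fin wY_nonneg in auto)
      then show ?thesis using j by simp
    qed
    ultimately show "wY j1 x * wY j2 x = 0"
      using wY_nonneg[OF j(2), of x] by auto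
  qed
qed

text \<open>The sum of squared differences between R times the vector and its norm times the vector
  of means, R being \<open>norm_means\<close>, is a multiple of the Cauchy-Schwarz defect. Where the
  defect vanishes, the vector is proportional to the means.\<close>

lemma lower_eq:
  assumes eq: "integral\<^sup>L M norm_wY = norm_means" and R: "norm_means > 0" and j: "j1 \<in> J" "j2 \<in> J"
  shows "AE x in M. wY j1 x * mean_wY j2 - wY j2 x * mean_wY j1 = 0"
proof -
  have i: "integrable M (\<lambda>x. norm_means * norm_wY x - (\<Sum>j\<in>J. mean_wY j * wY j x))"
    by (intro Bochner_Integration.integrable_diff Bochner_Integration.integrable_sum Bochner_Integration.integrable_mult_right integrable_norm_wY integrable_wY impI)
  have "integral\<^sup>L M (\<lambda>x. norm_means * norm_wY x - (\<Sum>j\<in>J. mean_wY j * wY j x)) = 0"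
    unfolding integral_gap eq by simp
  then have "AE x in M. norm_means * norm_wY x - (\<Sum>j\<in>J. mean_wY j * wY j x) = 0"
    using integral_nonneg_eq_0_iff_AE[OF i] cauchy_schwarz by simp
  then show ?thesis
  proof (rule AE_mp, intro AE_I2 impI)
    fix x assume e: "norm_means * norm_wY x - (\<Sum>j\<in>J. mean_wY j * wY j x) = 0"
    have "(\<Sum>j\<in>J. (norm_means * wY j x - norm_wY x * mean_wY j)\<^sup>2)
        = (\<Sum>j\<in>J. norm_means\<^sup>2 * (wY j x)\<^sup>2 - 2 * norm_means * norm_wY x * (mean_wY j * wY j x) + (norm_wY x)\<^sup>2 * (mean_wY j)\<^sup>2)"
      by (intro sum.cong refl) (simp add: power2_diff power_mult_distrib algebra_simps)
    also have "\<dots> = norm_means\<^sup>2 * (norm_wY x)\<^sup>2 - 2 * norm_means * norm_wY x * (\<Sum>j\<in>J. mean_wY j * wY j x) + (norm_wY x)\<^sup>2 * norm_means\<^sup>2"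
      by (simp only: sum.distrib sum_subtractf sum_distrib_left[symmetric] norm_means_sq norm_wY_sq)
    also have "\<dots> = 2 * norm_means * norm_wY x * (norm_means * norm_wY x - (\<Sum>j\<in>J. mean_wY j * wY j x))"
      by (simp add: power2_eq_square algebra_simps)
    also have "\<dots> = 0" using e by simp
    finally have z: "norm_means * wY j x = norm_wY x * mean_wY j" if "j \<in> J" for j
      using that fin by (subst (asm) sum_nonneg_eq_0_iff) auto
    have "norm_means * (wY j1 x * mean_wY j2 - wY j2 x * mean_wY j1) = (norm_means * wY j1 x) * mean_wY j2 - (norm_means * wY j2 x) * mean_wY j1"
      by (simp add: algebra_simps)
    also have "\<dots> = 0" unfolding z[OF j(1)] z[OF j(2)] by (simp add: algebra_simps)
    finally show "wY j1 x * mean_wY j2 - wY j2 x * mean_wY j1 = 0" using R by simp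
  qed
qed

end

section \<open>Full support of the Gaussian law and zeros of cofactors\<close>

lemma emeasure_nrm_Ioo_pos:
  assumes "e > 0"
  shows "emeasure (nrm 1) {x - e<..<x + e} > 0"
proof (rule ccontr)
  assume "\<not> ?thesis"
  then have "{x - e<..<x + e} \<in> null_sets (nrm 1)" by (intro null_setsI) auto
  then have "AE y in lborel. y \<in> {x - e<..<x + e} \<longrightarrow> ennreal (normal_density 0 1 y) = 0"
    by (subst (asm) null_sets_density_iff) auto
  then have "AE y in lborel. y \<notin> {x - e<..<x + e}"
    by (rule AE_mp) (intro AE_I2, auto simp: normal_density_pos less_imp_neq[symmetric] not_le)
  then have "{x - e<..<x + e} \<in> null_sets lborel" by (subst (asm) AE_iff_null_sets[symmetric]) auto
  then have "ennreal (x + e - (x - e)) = 0"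
    using assms by (simp only: null_sets_def mem_Collect_eq emeasure_lborel_Ioo)
  then show False using assms by simp
qed

lemma ennreal_prod_pos:
  fixes f :: "'a \<Rightarrow> ennreal"
  assumes "finite A" "\<And>a. a \<in> A \<Longrightarrow> f a > 0"
  shows "prod f A > 0"
  using assms by (induction A) (auto simp: ennreal_zero_less_mult_iff)

text \<open>Every open box around \<open>z\<close> has positive Gaussian measure and so contains a
  zero of \<open>g\<close>. Shrinking boxes give zeros that converge to \<open>z\<close> in all
  entries the law involves, and continuity finishes the argument.\<close>

lemma AE_zero_imp_zero:
  fixes g :: "(nat \<Rightarrow> nat \<Rightarrow> real) \<Rightarrow> real"
  assumes ae: "AE z in GI N i. g z = 0"
    and cont: "\<And>y z. (\<And>r l. r \<in> {..<N} - {i} \<Longrightarrow> l < N \<Longrightarrow> (\<lambda>m. y m r l) \<longlonglongrightarrow> z r l) \<Longrightarrow> (\<lambda>m::nat. g (y m)) \<longlonglongrightarrow> g z"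
  shows "g z = 0"
proof -
  interpret S: product_sigma_finite "\<lambda>_::nat. nrm 1"
    by (intro product_sigma_finite.intro prob_space_imp_sigma_finite prob_space_nrm) simp
  interpret G: product_sigma_finite "\<lambda>_::nat. Gs {..<N}"
    by (intro product_sigma_finite.intro prob_space_imp_sigma_finite prob_space_Gs)
  let ?I = "{..<N} - {i}"
  define B where "B m = (\<Pi>\<^sub>E r\<in>?I. \<Pi>\<^sub>E l\<in>{..<N}. {z r l - 1 / real (Suc m)<..<z r l + 1 / real (Suc m)})" for m :: nat
  have "\<exists>y\<in>B m. g y = 0" for m
  proof (rule ccontr)
    assume no: "\<not> ?thesis"
    have s1: "(\<Pi>\<^sub>E l\<in>{..<N}. {z r l - 1 / real (Suc m)<..<z r l + 1 / real (Suc m)}) \<in> sets (Gs {..<N})" for r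
      by (intro sets_PiM_I_finite) auto
    then have s: "B m \<in> sets (GI N i)" unfolding B_def by (intro sets_PiM_I_finite) auto
    have "AE z in GI N i. z \<notin> B m" using ae by (rule AE_mp) (use no in \<open>intro AE_I2, auto\<close>)
    then have "B m \<in> null_sets (GI N i)" using s by (subst (asm) AE_iff_null_sets[symmetric]) auto
    then have "0 = emeasure (GI N i) (B m)" by auto
    also have "emeasure (GI N i) (B m) = (\<Prod>r\<in>?I. emeasure (Gs {..<N}) (\<Pi>\<^sub>E l\<in>{..<N}. {z r l - 1 / real (Suc m)<..<z r l + 1 / real (Suc m)}))"
      unfolding B_def by (rule G.emeasure_PiM) (simp, rule s1)
    also have "\<dots> = (\<Prod>r\<in>?I. \<Prod>l<N. emeasure (nrm 1) {z r l - 1 / real (Suc m)<..<z r l + 1 / real (Suc m)})"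
      by (intro prod.cong refl S.emeasure_PiM) auto
    also have "\<dots> > 0" by (intro ennreal_prod_pos emeasure_nrm_Ioo_pos) auto
    finally show False by simp
  qed
  then obtain y where y: "\<And>m. y m \<in> B m" "\<And>m. g (y m) = 0" by metis
  have "(\<lambda>m. g (y m)) \<longlonglongrightarrow> g z"
  proof (rule cont)
    fix r l assume rl: "r \<in> ?I" "l < N"
    have "\<bar>y m r l - z r l\<bar> \<le> 1 / real (Suc m)" for m
    proof -
      have "y m r \<in> (\<Pi>\<^sub>E l\<in>{..<N}. {z r l - 1 / real (Suc m)<..<z r l + 1 / real (Suc m)})"
        using y(1)[of m] rl(1) unfolding B_def by (rule PiE_mem)
      then have "y m r l \<in> {z r l - 1 / real (Suc m)<..<z r l + 1 / real (Suc m)}"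
        by (rule PiE_mem) (use rl in simp)
      then show ?thesis by (simp add: abs_le_iff)
    qed
    then have "(\<lambda>m. y m r l - z r l) \<longlonglongrightarrow> 0"
      by (intro tendsto_0_le[OF LIMSEQ_inverse_real_of_nat, where K=1]) (auto simp: inverse_eq_divide)
    then show "(\<lambda>m. y m r l) \<longlonglongrightarrow> z r l" by (simp add: LIM_zero_iff)
  qed
  then show ?thesis by (simp add: y(2) LIMSEQ_const_iff)
qed

lemma Kc_tendsto:
  assumes i: "i < N" and l: "l < N"
    and y: "\<And>r l. r \<in> {..<N} - {i} \<Longrightarrow> l < N \<Longrightarrow> (\<lambda>m. y m r l) \<longlonglongrightarrow> z r l"
  shows "(\<lambda>m::nat. Kc N c i (y m) l) \<longlonglongrightarrow> Kc N c i z l"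
  unfolding Kc_def cof_def
proof (intro tendsto_mult tendsto_const tendsto_dt)
  fix r l' assume "r < N - 1" "l' < N - 1"
  then show "(\<lambda>m. y m (skip i r) (skip l l')) \<longlonglongrightarrow> z (skip i r) (skip l l')"
    using skip_less[OF i] skip_less[OF l] skip_neq by (intro y) auto
qed

text \<open>The cofactor at column \<open>l\<close> ignores that column, while every other cofactor
  of the row contains it. Zeroing it therefore isolates one cofactor.\<close>

lemma Kc_zero_col:
  assumes l: "l < N" and l': "l' < N"
  shows "Kc N c i (\<lambda>r m. if m = l then 0 else z r m) l' = (if l' = l then Kc N c i z l else 0)"
proof (cases "l' = l")
  case True
  have "dt (N - 1) (\<lambda>r m. c (skip i r) (skip l m) * (if skip l m = l then 0 else z (skip i r) (skip l m)))
      = dt (N - 1) (\<lambda>r m. c (skip i r) (skip l m) * z (skip i r) (skip l m))"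
    by (rule dt_cong) (simp add: skip_neq)
  then show ?thesis using True by (simp add: Kc_def cof_def)
next
  case False
  obtain m where m: "m < N - 1" "skip l' m = l"
  proof (cases "l < l'")
    case True
    then show ?thesis using that[of l] l' by (simp add: skip_def)
  next
    case f: False
    then show ?thesis using that[of "l - 1"] False l by (simp add: skip_def)
  qed
  have "dt (N - 1) (\<lambda>r m. c (skip i r) (skip l' m) * (if skip l' m = l then 0 else z (skip i r) (skip l' m))) = 0"
    by (rule dt_zero_col[OF m(1)]) (simp add: m(2))
  then show ?thesis using False by (simp add: Kc_def cof_def)
qed

lemma dt_line_poly: "\<exists>p. \<forall>s. dt m (\<lambda>i l. A i l + s * B i l) = poly p s"
proof (intro exI allI)
  fix s
  show "dt m (\<lambda>i l. A i l + s * B i l)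
    = poly (\<Sum>p | p permutes {..<m}. [:of_int (sign p):] * (\<Prod>i<m. [:A i (p i), B i (p i):])) s"
    by (simp add: dt_leibniz poly_sum poly_prod)
qed

lemma Kc_line_poly: "\<exists>p. \<forall>s. Kc N c i (\<lambda>r l. z r l + s * (z' r l - z r l)) l = poly p s"
proof -
  obtain p where p: "\<And>s. dt (N - 1) (\<lambda>r m. c (skip i r) (skip l m) * z (skip i r) (skip l m)
      + s * (c (skip i r) (skip l m) * (z' (skip i r) (skip l m) - z (skip i r) (skip l m)))) = poly p s"
    using dt_line_poly by metis
  have "Kc N c i (\<lambda>r l. z r l + s * (z' r l - z r l)) l = poly ([:(- 1) ^ (i + l):] * p) s" for s
    unfolding Kc_def cof_def poly_mult p[symmetric]
    by (simp add: distrib_left mult_ac)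
  then show ?thesis by blast
qed

text \<open>On the line joining a point where the first cofactor is nonzero to one where the second
  is, both are univariate polynomials. Neither is the zero polynomial, yet their product vanishes at
  every point.\<close>

lemma Kc_product_zero:
  assumes "\<And>z. Kc N c i z l * Kc N c i z l' = 0"
  shows "(\<forall>z. Kc N c i z l = 0) \<or> (\<forall>z. Kc N c i z l' = 0)"
proof (rule ccontr)
  assume "\<not> ?thesis"
  then obtain z z' where z: "Kc N c i z l \<noteq> 0" "Kc N c i z' l' \<noteq> 0" by blast
  obtain p where p: "\<And>s. Kc N c i (\<lambda>r l. z r l + s * (z' r l - z r l)) l = poly p s" using Kc_line_poly by metis
  obtain p' where p': "\<And>s. Kc N c i (\<lambda>r l. z r l + s * (z' r l - z r l)) l' = poly p' s" using Kc_line_poly by metis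
  have "poly (p * p') s = 0" for s unfolding poly_mult p[symmetric] p'[symmetric] by (rule assms)
  then have "p * p' = 0" by (simp add: poly_all_0_iff_0[symmetric])
  then have "p = 0 \<or> p' = 0" by simp
  then show False using z p[of 0] p'[of 1] by auto
qed

subsection \<open>Removing an equation and a variable\<close>

lemma skip_surj:
  assumes "l0 < N" "l < N" "l \<noteq> l0"
  obtains m where "m < N - 1" "skip l0 m = l"
proof (cases "l < l0")
  case True
  then show ?thesis using that[of l] assms by (simp add: skip_def)
next
  case False
  then show ?thesis using that[of "l - 1"] assms by (simp add: skip_def)
qed

lemma ex_block_map:
  "\<exists>blk. (\<forall>l<\<Sum>j<k. n j. blk l < k) \<and> (\<forall>j<k. card (bs (\<Sum>j<k. n j) blk j) = n j)"
proof -
  let ?S = "SIGMA j:{..<k}. {..<n j}"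
  let ?N = "\<Sum>j<k. n j"
  have "card ?S = ?N" by simp
  then obtain h where h: "bij_betw h {0..<?N} ?S"
    using ex_bij_betw_nat_finite[of ?S] by auto
  have "fst (h l) < k" if "l < ?N" for l
  proof -
    have "h l \<in> ?S" using bij_betwE[OF h] that by simp
    then show ?thesis by (cases "h l") auto
  qed
  moreover have "card (bs ?N (\<lambda>l. fst (h l)) j) = n j" if "j < k" for j
  proof -
    have sub: "bs ?N (\<lambda>l. fst (h l)) j \<subseteq> {0..<?N}" by (auto simp: bs_def)
    have "h ` bs ?N (\<lambda>l. fst (h l)) j = {j} \<times> {..<n j}"
    proof (intro equalityI subsetI)
      fix p assume "p \<in> h ` bs ?N (\<lambda>l. fst (h l)) j"
      then obtain l where l: "l < ?N" "p = h l" "fst (h l) = j" by (auto simp: bs_def)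
      then have "h l \<in> ?S" using bij_betwE[OF h] by simp
      then show "p \<in> {j} \<times> {..<n j}" using l by (cases "h l") auto
    next
      fix p assume p: "p \<in> {j} \<times> {..<n j}"
      then have "p \<in> ?S" using that by auto
      then obtain l where "l \<in> {0..<?N}" "p = h l" using h unfolding bij_betw_def by blast
      then show "p \<in> h ` bs ?N (\<lambda>l. fst (h l)) j" using p by (intro image_eqI[of _ _ l]) (auto simp: bs_def)
    qed
    then have "card ({j} \<times> {..<n j}) = card (bs ?N (\<lambda>l. fst (h l)) j)"
      using card_image[OF inj_on_subset[OF bij_betw_imp_inj_on[OF h] sub]] by simp
    then show ?thesis by simp
  qed
  ultimately show ?thesis by (intro exI[of _ "\<lambda>l. fst (h l)"]) blast
qed

lemma card_bs_skip:
  assumes l0: "l0 < N"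
  shows "card (bs (N - 1) (\<lambda>l. blk (skip l0 l)) j) = card (bs N blk j) - (if blk l0 = j then 1 else 0)"
proof -
  have "skip l0 ` bs (N - 1) (\<lambda>l. blk (skip l0 l)) j = bs N blk j - {l0}"
  proof (intro equalityI subsetI)
    fix l assume "l \<in> bs N blk j - {l0}"
    then have l: "l < N" "l \<noteq> l0" "blk l = j" by (auto simp: bs_def)
    then obtain m where "m < N - 1" "skip l0 m = l" using skip_surj[OF l0] by blast
    then show "l \<in> skip l0 ` bs (N - 1) (\<lambda>l. blk (skip l0 l)) j"
      using l by (intro image_eqI[of _ _ m]) (auto simp: bs_def)
  qed (auto simp: bs_def skip_less[OF l0] skip_neq)
  then have "card (bs (N - 1) (\<lambda>l. blk (skip l0 l)) j) = card (bs N blk j - {l0})"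
    using card_image[OF inj_skip, of l0 "bs (N - 1) (\<lambda>l. blk (skip l0 l)) j"] by simp
  then show ?thesis using l0 by (auto simp: bs_def card_Diff_singleton_if)
qed

theorem theorem4:
  fixes k i :: nat and n :: "nat \<Rightarrow> nat" and \<delta> :: "nat \<Rightarrow> nat \<Rightarrow> nat"
  assumes "k \<ge> 1"
    and "(\<Sum>j<k. n j) \<ge> 1"
    and "i < (\<Sum>j<k. n j)"
  shows
    "let E = expected_roots k n \<delta>;
         E' = (\<lambda>j. expected_roots k (n(j := n j - 1)) (remove_row i \<delta>));
         upper = (\<Sum>j | j < k \<and> n j > 0. ennreal (sqrt (real (\<delta> i j))) * E' j);
         lower = ennsqrt (\<Sum>j | j < k \<and> n j > 0. of_nat (\<delta> i j) * (E' j)\<^sup>2);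
         at_most_one = (\<exists>\<^sub>\<le>\<^sub>1 j. j < k \<and> n j > 0 \<and> \<delta> i j > 0 \<and> E' j > 0)
     in upper \<ge> E \<and> E \<ge> lower \<and>
        (upper = E \<longleftrightarrow> at_most_one) \<and>
        (E = lower \<longleftrightarrow> at_most_one)"
proof -
  define N where "N = (\<Sum>j<k. n j)"
  have i: "i < N" using assms(3) by (simp add: N_def)
  obtain blk where blk: "\<And>l. l < N \<Longrightarrow> blk l < k" and card: "\<And>j. j < k \<Longrightarrow> card (bs N blk j) = n j"
    using ex_block_map[of n k] unfolding N_def by blast
  define c where "c = (\<lambda>r l. sqrt (real (\<delta> r (blk l))))"
  define J where "J = {j. j < k \<and> n j > 0}"
  define w where "w j = sqrt (real (\<delta> i j))" for j
  define Y where "Y j z = sqrt (\<Sum>l\<in>bs N blk j. (Kc N c i z l)\<^sup>2)" for j z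
  define P where "P = (\<Prod>j<k. cc (n j))"
  \<comment> \<open>The constant K of the overview: \<open>P\<close> collects the volume constants
    and \<open>m1\<close> arises from averaging over the Gaussian row \<open>i\<close>.\<close>
  define \<kappa> where "\<kappa> = P * enn2real m1"
  define E where "E = expected_roots k n \<delta>"
  define E' where "E' j = expected_roots k (n(j := n j - 1)) (remove_row i \<delta>)" for j
  have P: "P > 0" unfolding P_def by (intro prod_pos) (simp add: cc_pos)
  have \<kappa>: "\<kappa> > 0" "ennreal \<kappa> = ennreal P * m1"
    using P m1_pos m1_finite by (simp_all add: \<kappa>_def enn2real_positive_iff ennreal_mult)
  have Y0: "Y j z \<ge> 0" for j z by (simp add: Y_def sum_nonneg)
  have Y_meas: "(\<lambda>z. ennreal (Y j z)) \<in> borel_measurable (GI N i)" for j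
    using Kc_norm_measurable[OF i, of "bs N blk j" "\<lambda>_. 1" c] by (auto simp: Y_def bs_def)
  have Y_meas': "Y j \<in> borel_measurable (GI N i)" for j
    using measurable_compose[OF Y_meas borel_measurable_enn2real[OF measurable_ident], of j] Y0 by simp
  have finJ: "finite J" by (simp add: J_def)
  have E_eq: "E = ennreal \<kappa> * (\<integral>\<^sup>+z. ennreal (sqrt (\<Sum>j\<in>J. (w j * Y j z)\<^sup>2)) \<partial>GI N i)"
  proof -
    have "(\<Sum>l<N. (c i l * Kc N c i z l)\<^sup>2) = (\<Sum>j\<in>J. (w j * Y j z)\<^sup>2)" for z
    proof -
      have "(\<Sum>l<N. (c i l * Kc N c i z l)\<^sup>2) = (\<Sum>j<k. \<Sum>l\<in>bs N blk j. (c i l * Kc N c i z l)\<^sup>2)"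
        by (rule sum_blocks[symmetric]) (rule blk)
      also have "\<dots> = (\<Sum>j<k. (w j * Y j z)\<^sup>2)"
      proof (rule sum.cong[OF refl])
        fix j
        have "(\<Sum>l\<in>bs N blk j. (c i l * Kc N c i z l)\<^sup>2) = (\<Sum>l\<in>bs N blk j. (w j)\<^sup>2 * (Kc N c i z l)\<^sup>2)"
          by (rule sum.cong) (auto simp: bs_def c_def w_def power_mult_distrib)
        then show "(\<Sum>l\<in>bs N blk j. (c i l * Kc N c i z l)\<^sup>2) = (w j * Y j z)\<^sup>2"
          by (simp add: sum_distrib_left[symmetric] power_mult_distrib Y_def sum_nonneg)
      qed
      also have "\<dots> = (\<Sum>j\<in>J. (w j * Y j z)\<^sup>2)"
      proof (rule sum.mono_neutral_right)
        show "\<forall>j\<in>{..<k} - J. (w j * Y j z)\<^sup>2 = 0"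
        proof
          fix j assume "j \<in> {..<k} - J"
          then have "card (bs N blk j) = 0" using card by (auto simp: J_def)
          then have "bs N blk j = {}" using finite_bs by simp
          then show "(w j * Y j z)\<^sup>2 = 0" by (simp add: Y_def)
        qed
      qed (auto simp: J_def)
      finally show ?thesis .
    qed
    moreover have "E = ennreal P * Jd N c"
      unfolding E_def P_def c_def by (rule expected_roots_eq) (rule blk card, assumption)+
    ultimately show ?thesis
      unfolding \<kappa>(2) by (simp add: Jd_expand[OF i] mult.assoc)
  qed
  have E'_eq: "E' j = ennreal \<kappa> * (\<integral>\<^sup>+z. ennreal (Y j z) \<partial>GI N i)" and E'_fin: "E' j < \<top>" if j: "j \<in> J" for j
  proof -
    have jk: "j < k" "n j > 0" using j by (auto simp: J_def)
    then have "bs N blk j \<noteq> {}" using card[OF jk(1)] by auto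
    \<comment> \<open>Deleting row \<open>i\<close> and any column of block \<open>j\<close> leaves
      the scales of the reduced system, because they are constant on a block.\<close>
    then obtain l0 where l0: "l0 \<in> bs N blk j" by blast
    then have l0': "l0 < N" "blk l0 = j" by (auto simp: bs_def)
    obtain m where m: "n j = Suc m" using jk(2) by (cases "n j") auto
    let ?n' = "n(j := n j - 1)"
    let ?D = "Jd (N - 1) (\<lambda>r l. c (skip i r) (skip l0 l))"
    have "E' j = ennreal (\<Prod>j'<k. cc (?n' j')) * Jd (N - 1) (\<lambda>r l. sqrt (real (remove_row i \<delta> r (blk (skip l0 l)))))"
      unfolding E'_def
    proof (rule expected_roots_eq)
      show "blk (skip l0 l) < k" if "l < N - 1" for l
        using blk[OF skip_less[OF l0'(1) that]] .
      show "card (bs (N - 1) (\<lambda>l. blk (skip l0 l)) j') = ?n' j'" if "j' < k" for j'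
        using card_bs_skip[OF l0'(1), of blk j'] card[OF that] l0'(2) by auto
    qed
    also have "(\<lambda>r l. sqrt (real (remove_row i \<delta> r (blk (skip l0 l))))) = (\<lambda>r l. c (skip i r) (skip l0 l))"
      by (auto simp: fun_eq_iff c_def remove_row_def skip_def)
    finally have 1: "E' j = ennreal (\<Prod>j'<k. cc (?n' j')) * ?D" .
    then show "E' j < \<top>" using Jd_finite by (simp add: ennreal_mult_less_top)
    have "(\<Prod>j'<k. cc (?n' j')) = cc m * (\<Prod>j'\<in>{..<k} - {j}. cc (n j'))"
      using jk(1) by (subst prod.remove[of _ j]) (auto simp: m)
    \<comment> \<open>Lowering the dimension of block \<open>j\<close> multiplies the constant by
      the mean chi length of that block. \<open>cofactor_norm\<close> supplies the same factor, and
      so \<kappa> appears again.\<close>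
    also have "cc m = cc (n j) * (sqrt 2 * Mr (Suc m) / Mr m)" by (simp only: m cc_Suc)
    also have "\<dots> * (\<Prod>j'\<in>{..<k} - {j}. cc (n j')) = P * (sqrt 2 * Mr (Suc m) / Mr m)"
      unfolding P_def using jk(1) by (subst prod.remove[of "{..<k}" j]) auto
    also have "ennreal \<dots> = ennreal P * ennreal (sqrt 2 * Mr (Suc m) / Mr m)"
      by (rule ennreal_mult) (use P Mr_pos[of m] Mr_pos[of "Suc m"] in auto)
    also have "ennreal (sqrt 2 * Mr (Suc m) / Mr m) = eL (bs N blk j)"
      by (rule eL_value[symmetric]) (use card[OF jk(1)] m finite_bs in auto)
    finally have 2: "E' j = ennreal P * eL (bs N blk j) * ?D" unfolding 1 by (rule arg_cong)
    have "eL (bs N blk j) * ?D = m1 * (\<integral>\<^sup>+z. ennreal (Y j z) \<partial>GI N i)"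
      unfolding Y_def by (rule cofactor_norm[symmetric, OF i _ l0]) (use l0' in \<open>auto simp: bs_def c_def\<close>)
    then show "E' j = ennreal \<kappa> * (\<integral>\<^sup>+z. ennreal (Y j z) \<partial>GI N i)"
      unfolding 2 \<kappa>(2) by (simp only: mult.assoc)
  qed
  interpret mean_norm "GI N i" J w Y
  proof
    fix j assume j: "j \<in> J"
    \<comment> \<open>Finiteness of \<open>E' j\<close> is read back as integrability of the block
      norm.\<close>
    have "ennreal \<kappa> * (\<integral>\<^sup>+z. ennreal (Y j z) \<partial>GI N i) < \<top>" using E'_fin[OF j] by (simp only: E'_eq[OF j])
    then have "(\<integral>\<^sup>+z. ennreal (Y j z) \<partial>GI N i) < \<top>" using \<kappa>(1) by (auto simp: ennreal_mult_less_top)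
    then show "integrable (GI N i) (Y j)"
      by (intro integrableI_nonneg Y_meas') (simp_all add: Y0)
  qed (simp_all add: finJ w_def Y0)
  let ?s = "integral\<^sup>L (GI N i) norm_wY"
  have s0: "?s \<ge> 0" by (simp add: integral_nonneg_AE norm_wY_nonneg)
  have E: "E = ennreal (\<kappa> * ?s)"
  proof -
    have "(\<integral>\<^sup>+z. ennreal (norm_wY z) \<partial>GI N i) = ennreal ?s"
      by (rule nn_integral_eq_integral[OF integrable_norm_wY]) (simp add: norm_wY_nonneg)
    then show ?thesis
      unfolding E_eq wY_def[symmetric] norm_wY_def[symmetric] using \<kappa>(1) s0 by (simp add: ennreal_mult)
  qed
  define y where "y j = integral\<^sup>L (GI N i) (Y j)" for j
  have y0: "y j \<ge> 0" for j unfolding y_def by (intro integral_nonneg_AE AE_I2 Y0)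
  have E': "E' j = ennreal (\<kappa> * y j)" if "j \<in> J" for j
  proof -
    have "(\<integral>\<^sup>+z. ennreal (Y j z) \<partial>GI N i) = ennreal (y j)"
      unfolding y_def by (rule nn_integral_eq_integral[OF int[OF that]]) (simp add: Y0)
    then show ?thesis unfolding E'_eq[OF that] using \<kappa>(1) y0 by (simp add: ennreal_mult)
  qed
  have mean_wY: "mean_wY j = w j * y j" for j by (simp add: mean_wY_def y_def)
  have w0: "w j \<ge> 0" for j by (simp add: w_def)
  have upper_eq': "(\<Sum>j\<in>J. ennreal (sqrt (real (\<delta> i j))) * E' j) = ennreal (\<kappa> * (\<Sum>j\<in>J. mean_wY j))"
  proof -
    have "(\<Sum>j\<in>J. ennreal (sqrt (real (\<delta> i j))) * E' j) = (\<Sum>j\<in>J. ennreal (\<kappa> * mean_wY j))"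
      by (intro sum.cong refl) (use \<kappa>(1) y0 in \<open>simp add: E' mean_wY w_def[symmetric] w0 ennreal_mult[symmetric] mult_ac\<close>)
    also have "\<dots> = ennreal (\<Sum>j\<in>J. \<kappa> * mean_wY j)" using \<kappa>(1) mean_wY_nonneg by (intro sum_ennreal) auto
    finally show ?thesis by (simp only: sum_distrib_left)
  qed
  have lower_eq': "ennsqrt (\<Sum>j\<in>J. of_nat (\<delta> i j) * (E' j)\<^sup>2) = ennreal (\<kappa> * norm_means)"
  proof -
    have "(\<Sum>j\<in>J. of_nat (\<delta> i j) * (E' j)\<^sup>2) = (\<Sum>j\<in>J. ennreal (\<kappa>\<^sup>2 * (mean_wY j)\<^sup>2))"
    proof (intro sum.cong refl)
      fix j assume j: "j \<in> J"
      have "of_nat (\<delta> i j) = ennreal ((w j)\<^sup>2)" by (simp add: w_def ennreal_of_nat_eq_real_of_nat)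
      moreover have "(E' j)\<^sup>2 = ennreal ((\<kappa> * y j)\<^sup>2)"
        unfolding E'[OF j] by (rule ennreal_power) (use \<kappa>(1) y0 in simp)
      ultimately have "of_nat (\<delta> i j) * (E' j)\<^sup>2 = ennreal ((w j)\<^sup>2 * (\<kappa> * y j)\<^sup>2)"
        by (simp add: ennreal_mult)
      then show "of_nat (\<delta> i j) * (E' j)\<^sup>2 = ennreal (\<kappa>\<^sup>2 * (mean_wY j)\<^sup>2)"
        by (simp add: mean_wY power_mult_distrib mult_ac)
    qed
    also have "\<dots> = ennreal (\<Sum>j\<in>J. \<kappa>\<^sup>2 * (mean_wY j)\<^sup>2)" by (intro sum_ennreal) auto
    also have "(\<Sum>j\<in>J. \<kappa>\<^sup>2 * (mean_wY j)\<^sup>2) = (\<kappa> * norm_means)\<^sup>2"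
      by (simp only: sum_distrib_left[symmetric] power_mult_distrib norm_means_sq)
    also have "ennsqrt (ennreal ((\<kappa> * norm_means)\<^sup>2)) = ennreal (\<kappa> * norm_means)"
      using \<kappa>(1) norm_means_nonneg by (simp add: ennsqrt_def)
    finally show ?thesis .
  qed
  define amo where "amo = (\<exists>\<^sub>\<le>\<^sub>1 j. j < k \<and> n j > 0 \<and> \<delta> i j > 0 \<and> E' j > 0)"
  \<comment> \<open>The condition on \<open>j\<close> in the statement says that the mean of the
    weighted block norm is positive, so equality can be discussed in terms of these means.\<close>
  have act: "j < k \<and> n j > 0 \<and> \<delta> i j > 0 \<and> E' j > 0 \<longleftrightarrow> j \<in> J \<and> mean_wY j > 0" for j
  proof (cases "j \<in> J")
    case True
    then have "E' j > 0 \<longleftrightarrow> y j > 0" using \<kappa>(1) by (simp add: E' zero_less_mult_iff)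
    moreover have "\<delta> i j > 0 \<longleftrightarrow> w j > 0" by (simp add: w_def)
    ultimately show ?thesis using True w0[of j] y0[of j] by (auto simp: J_def mean_wY zero_less_mult_iff)
  qed (auto simp: J_def)
  have amo_iff: "amo \<longleftrightarrow> (\<forall>j j'. j \<in> J \<and> mean_wY j > 0 \<longrightarrow> j' \<in> J \<and> mean_wY j' > 0 \<longrightarrow> j = j')"
    unfolding amo_def Uniq_def act by blast
  have equal: "?s = (\<Sum>j\<in>J. mean_wY j)" "?s = norm_means" if amo
  proof -
    have "(\<Sum>j\<in>J. mean_wY j) = norm_means" by (rule sum_eq_norm) (use that amo_iff in blast)
    then show "?s = (\<Sum>j\<in>J. mean_wY j)" "?s = norm_means" using lower upper by auto
  qed
  have strict: "?s \<noteq> (\<Sum>j\<in>J. mean_wY j)" "?s \<noteq> norm_means" if not: "\<not> amo"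
  proof -
    obtain j1 j2 where j: "j1 \<in> J" "j2 \<in> J" "mean_wY j1 > 0" "mean_wY j2 > 0" "j1 \<noteq> j2"
      using not amo_iff by blast
    \<comment> \<open>A positive mean provides a cofactor in the block that is not identically
      zero.\<close>
    have ex: "\<exists>l\<in>bs N blk j. \<exists>z. Kc N c i z l \<noteq> 0" if "mean_wY j > 0" for j
    proof (rule ccontr)
      assume "\<not> ?thesis"
      then have "Y j = (\<lambda>_. 0)" by (simp add: Y_def fun_eq_iff)
      then show False using that by (simp add: mean_wY y_def)
    qed
    obtain l1 z1 where l1: "l1 \<in> bs N blk j1" "Kc N c i z1 l1 \<noteq> 0" using ex[OF j(3)] by blast
    obtain l2 z2 where l2: "l2 \<in> bs N blk j2" "Kc N c i z2 l2 \<noteq> 0" using ex[OF j(4)] by blast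
    have l: "l1 < N" "l2 < N" using l1(1) l2(1) by (auto simp: bs_def)
    show "?s \<noteq> (\<Sum>j\<in>J. mean_wY j)"
    proof
      assume "?s = (\<Sum>j\<in>J. mean_wY j)"
      from upper_eq[OF this j(1,2,5)] have ae: "AE z in GI N i. wY j1 z * wY j2 z = 0" .
      have "Kc N c i z l1 * Kc N c i z l2 = 0" for z
      proof (rule AE_zero_imp_zero[where N=N and i=i and z=z and g="\<lambda>z. Kc N c i z l1 * Kc N c i z l2"])
        show "AE z in GI N i. Kc N c i z l1 * Kc N c i z l2 = 0"
        proof (rule AE_mp[OF ae], intro AE_I2 impI)
          fix z assume "wY j1 z * wY j2 z = 0"
          then have "Y j1 z = 0 \<or> Y j2 z = 0" using j by (auto simp: wY_def mean_wY)
          then show "Kc N c i z l1 * Kc N c i z l2 = 0"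
            using l1(1) l2(1) by (auto simp: Y_def sum_nonneg_eq_0_iff finite_bs)
        qed
        fix y :: "nat \<Rightarrow> nat \<Rightarrow> nat \<Rightarrow> real" and z
        assume y: "\<And>r l. r \<in> {..<N} - {i} \<Longrightarrow> l < N \<Longrightarrow> (\<lambda>m. y m r l) \<longlonglongrightarrow> z r l"
        show "(\<lambda>m. Kc N c i (y m) l1 * Kc N c i (y m) l2) \<longlonglongrightarrow> Kc N c i z l1 * Kc N c i z l2"
          by (intro tendsto_mult Kc_tendsto i l y)
      qed
      then show False using Kc_product_zero[of N c i l1 l2] l1(2) l2(2) by blast
    qed
    show "?s \<noteq> norm_means"
    proof
      assume eq: "?s = norm_means"
      have "(mean_wY j1)\<^sup>2 \<le> norm_means\<^sup>2" unfolding norm_means_sq by (rule member_le_sum) (use j finJ in auto)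
      then have R: "norm_means > 0" using j(3) norm_means_nonneg by (auto simp: less_le)
      \<comment> \<open>At this matrix only the cofactor at \<open>l1\<close> survives, so the norm
        of block \<open>j1\<close> is positive and that of \<open>j2\<close> is 0. Proportionality
        to the two positive means fails.\<close>
      define z where "z = (\<lambda>r m. if m = l1 then 0 else z1 r m)"
      have "wY j1 z * mean_wY j2 - wY j2 z * mean_wY j1 = 0"
      proof (rule AE_zero_imp_zero[where N=N and i=i and z=z and g="\<lambda>z. wY j1 z * mean_wY j2 - wY j2 z * mean_wY j1"])
        show "AE z in GI N i. wY j1 z * mean_wY j2 - wY j2 z * mean_wY j1 = 0" by (rule lower_eq[OF eq R j(1,2)])
        fix y :: "nat \<Rightarrow> nat \<Rightarrow> nat \<Rightarrow> real" and z
        assume y: "\<And>r l. r \<in> {..<N} - {i} \<Longrightarrow> l < N \<Longrightarrow> (\<lambda>m. y m r l) \<longlonglongrightarrow> z r l"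
        have "(\<lambda>m. wY j (y m)) \<longlonglongrightarrow> wY j z" for j
          unfolding wY_def Y_def
        proof (intro tendsto_mult tendsto_const tendsto_real_sqrt tendsto_sum tendsto_power)
          fix l assume "l \<in> bs N blk j"
          then have "l < N" by (simp add: bs_def)
          then show "(\<lambda>m. Kc N c i (y m) l) \<longlonglongrightarrow> Kc N c i z l" by (intro Kc_tendsto i y)
        qed
        then show "(\<lambda>m. wY j1 (y m) * mean_wY j2 - wY j2 (y m) * mean_wY j1) \<longlonglongrightarrow> wY j1 z * mean_wY j2 - wY j2 z * mean_wY j1"
          by (intro tendsto_diff tendsto_mult tendsto_const)
      qed
      moreover have K: "Kc N c i z l = (if l = l1 then Kc N c i z1 l1 else 0)" if "l < N" for l
        unfolding z_def by (rule Kc_zero_col[OF \<open>l1 < N\<close> that])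
      have "Y j2 z = 0"
        unfolding Y_def using l1(1) j(5) K by (auto simp: bs_def intro!: sum.neutral)
      moreover have "Y j1 z \<noteq> 0"
      proof
        assume "Y j1 z = 0"
        then have "Kc N c i z l1 = 0" using l1(1) by (auto simp: Y_def sum_nonneg_eq_0_iff finite_bs)
        then show False using K[OF l(1)] l1(2) by simp
      qed
      ultimately show False using j by (auto simp: wY_def mean_wY)
    qed
  qed
  have main: "(\<Sum>j\<in>J. ennreal (sqrt (real (\<delta> i j))) * E' j) \<ge> E"
    "E \<ge> ennsqrt (\<Sum>j\<in>J. of_nat (\<delta> i j) * (E' j)\<^sup>2)"
    "(\<Sum>j\<in>J. ennreal (sqrt (real (\<delta> i j))) * E' j) = E \<longleftrightarrow> amo"
    "E = ennsqrt (\<Sum>j\<in>J. of_nat (\<delta> i j) * (E' j)\<^sup>2) \<longleftrightarrow> amo"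
  proof -
    have A: "(\<Sum>j\<in>J. mean_wY j) \<ge> 0" by (intro sum_nonneg mean_wY_nonneg)
    show "(\<Sum>j\<in>J. ennreal (sqrt (real (\<delta> i j))) * E' j) \<ge> E"
      unfolding upper_eq' E using upper \<kappa>(1) by (intro ennreal_leI mult_left_mono) auto
    show "E \<ge> ennsqrt (\<Sum>j\<in>J. of_nat (\<delta> i j) * (E' j)\<^sup>2)"
      unfolding lower_eq' E using lower \<kappa>(1) by (intro ennreal_leI mult_left_mono) auto
    show "(\<Sum>j\<in>J. ennreal (sqrt (real (\<delta> i j))) * E' j) = E \<longleftrightarrow> amo"
      unfolding upper_eq' E using equal(1) strict(1)[THEN not_sym] \<kappa>(1) A s0 by (subst ennreal_inj) auto
    show "E = ennsqrt (\<Sum>j\<in>J. of_nat (\<delta> i j) * (E' j)\<^sup>2) \<longleftrightarrow> amo"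
      unfolding lower_eq' E using equal(2) strict(2) \<kappa>(1) norm_means_nonneg s0 by (subst ennreal_inj) auto
  qed
  then show ?thesis
    unfolding Let_def E_def[symmetric] E'_def[symmetric] J_def[symmetric] amo_def[symmetric] by blast
qed

end
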